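(* Let $M$ be a (not necessarily oriented or compact) $2$-dimensional smooth manifold equipped with a conformal structure. Then the assignment $f\mapsto L_f$, which sends a smooth immersion $f\colon M\to\mathbb{R}^3$ to its induced spin bundle $L_f\to M$, induces a bijection between regular homotopy classes of immersions $f\colon M\to\mathbb{R}^3$ and isomorphism classes of spin bundles $L\to M$ (inducing the given conformal structure on $M$).
   Context: All objects are smooth. $\mathbb{H}$ denotes the quaternions and $\mathbb{R}^3=\operatorname{Im}\mathbb{H}$. Regular homotopy. Two immersions $f,\tilde f\colon M\to\mathbb{R}^3$ are regularly homotopic if there is a smooth homotopy $f_t\colon M\to\mathbb{R}^3$ through immersions with $f_0=f$, $f_1=\tilde f$. Spin bundle. A spin bundle over $M$ is a right quaternionic line bundle $L\to M$ together with a non-degenerate quaternionic skew-Hermitian pairing (spin pairing) $(\cdot,\cdot)\colon L\times L\to \operatorname{Hom}(TM,\mathbb{H})$, i.e. the pairing is real bilinear with $(\psi\lambda,\varphi\mu)=\bar\lambda(\psi,\varphi)\mu$ for $\lambda,\mu\in\mathbb{H}$ and $\overline{(\psi,\varphi)}=-(\varphi,\psi)$, and for every non-zero tangent vector $X$ and non-zero $\psi\in L$ one has $(\psi,\psi)_X\neq 0$. Hence $(\psi,\psi)$ is an injective $\operatorname{Im}\mathbb{H}=\mathbb{R}^3$-valued $1$-form for $\psi\ne 0$, and the Riemannian metrics $|(\psi,\psi)|^2$, for $\psi$ nowhere vanishing, all lie in one conformal class, the conformal structure on $M$ induced by $L$. Two spin bundles $L,\tilde L\to M$ are isomorphic if there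 is a quaternionic linear bundle isomorphism $T\colon L\to\tilde L$ (covering the identity of $M$) intertwining their spin pairings. Induced spin bundle. Let $\operatorname{Conf}(TM,\mathbb{R}^3)$ be the bundle of injective conformal linear maps $T_xM\to\mathbb{R}^3$ with respect to the given conformal structure. For an immersion $f\colon M\to\mathbb{R}^3$ the derivative decomposes uniquely as $df=\omega\circ B$ with $\omega\in\Gamma(\operatorname{Conf}(TM,\mathbb{R}^3))$ and $B\in\Gamma(\operatorname{End}(TM))$ positive and self-adjoint (with respect to any metric in the conformal class) with $\det B=1$. The induced spin bundle is $L_f:=M\times\mathbb{H}$ with spin pairing $(\psi,\varphi)=\bar\psi\,\omega\,\varphi$. *)

theory Defs
  imports "HOL-Analysis.Analysis"
begin

section \<open>Quaternions\<close>

text \<open>A quaternion is a pair of a real part and an imaginary part in \<open>\<real>\<^sup>3 = Im \<H>\<close>; the Euclidean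
  structure is the one of the product type.\<close>

type_synonym quat = "real \<times> (real^3)"

definition qmult :: "quat \<Rightarrow> quat \<Rightarrow> quat"  (infixl \<open>*\<^sub>q\<close> 70) where
  "x *\<^sub>q y = (fst x * fst y - snd x \<bullet> snd y,
             fst x *\<^sub>R snd y + fst y *\<^sub>R snd x + cross3 (snd x) (snd y))"

definition qone :: quat where
  "qone = (1, 0)"

definition qconj :: "quat \<Rightarrow> quat" where
  "qconj x = (fst x, - snd x)"

definition qim :: "real^3 \<Rightarrow> quat" where
  "qim v = (0, v)"


section \<open>Smooth maps between Euclidean spaces\<close>

text \<open>\<open>Ck_on k f S\<close> is meant for open \<open>S\<close> in a finite-dimensional space.  Smoothness on an
  arbitrary set means that smooth extensions exist locally; this covers the closed time interval
  of a homotopy.\<close>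

primrec Ck_on ::
    "nat \<Rightarrow> ('a::real_normed_vector \<Rightarrow> 'b::real_normed_vector) \<Rightarrow> 'a set \<Rightarrow> bool" where
  "Ck_on 0 f S \<longleftrightarrow> continuous_on S f"
| "Ck_on (Suc k) f S \<longleftrightarrow>
     f differentiable_on S \<and> (\<forall>v. Ck_on k (\<lambda>x. frechet_derivative f (at x) v) S)"

definition smooth_on ::
    "'a set \<Rightarrow> ('a::euclidean_space \<Rightarrow> 'b::euclidean_space) \<Rightarrow> bool" where
  "smooth_on S f \<longleftrightarrow>
     (\<forall>x\<in>S. \<exists>U g. open U \<and> x \<in> U \<and> (\<forall>k. Ck_on k g U) \<and> (\<forall>y\<in>S \<inter> U. g y = f y))"


section \<open>Smooth surfaces\<close>

text \<open>The underlying topological space is a type; a chart is a domain together with a map whose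
  values outside the domain are irrelevant.  Atlases need not be maximal.\<close>

type_synonym 'm chart = "'m set \<times> ('m \<Rightarrow> real^2)"

definition smooth_atlas :: "('m::topological_space) chart set \<Rightarrow> bool" where
  "smooth_atlas A \<longleftrightarrow>
     (\<forall>(U, x)\<in>A. open U \<and> open (x ` U) \<and> homeomorphism U (x ` U) x (inv_into U x)) \<and>
     (\<Union>(U, x)\<in>A. U) = UNIV \<and>
     (\<forall>(U, x)\<in>A. \<forall>(V, y)\<in>A. smooth_on (x ` (U \<inter> V)) (y \<circ> inv_into U x))"

definition smooth_fun_on ::
    "'m chart set \<Rightarrow> 'm set \<Rightarrow> ('m \<Rightarrow> 'b::euclidean_space) \<Rightarrow> bool" where
  "smooth_fun_on A W h \<longleftrightarrow> (\<forall>(U, x)\<in>A. smooth_on (x ` (U \<inter> W)) (h \<circ> inv_into U x))"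

text \<open>Tangent vectors are derivations on globally smooth functions, normalised to be zero on
  functions that are not smooth.\<close>

type_synonym 'm tangent = "('m \<Rightarrow> real) \<Rightarrow> real"

definition tangent_space :: "'m chart set \<Rightarrow> 'm \<Rightarrow> 'm tangent set" where
  "tangent_space A p =
     {X. (\<forall>h. \<not> smooth_fun_on A UNIV h \<longrightarrow> X h = 0) \<and>
         (\<forall>h k. smooth_fun_on A UNIV h \<longrightarrow> smooth_fun_on A UNIV k \<longrightarrow>
            (\<forall>a b. X (\<lambda>q. a * h q + b * k q) = a * X h + b * X k) \<and>
            X (\<lambda>q. h q * k q) = X h * k p + h p * X k)}"

definition tcomb :: "real \<Rightarrow> 'm tangent \<Rightarrow> real \<Rightarrow> 'm tangent \<Rightarrow> 'm tangent" where
  "tcomb a X b Y = (\<lambda>h. a * X h + b * Y h)"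

definition tzero :: "'m tangent" where
  "tzero = (\<lambda>h. 0)"

definition tangent_linear ::
    "'m chart set \<Rightarrow> 'm \<Rightarrow> ('m tangent \<Rightarrow> 'b::real_vector) \<Rightarrow> bool" where
  "tangent_linear A p \<alpha> \<longleftrightarrow>
     (\<forall>X\<in>tangent_space A p. \<forall>Y\<in>tangent_space A p. \<forall>a b.
        \<alpha> (tcomb a X b Y) = a *\<^sub>R \<alpha> X + b *\<^sub>R \<alpha> Y)"

definition tangent_endo :: "'m chart set \<Rightarrow> 'm \<Rightarrow> ('m tangent \<Rightarrow> 'm tangent) \<Rightarrow> bool" where
  "tangent_endo A p B \<longleftrightarrow>
     (\<forall>X\<in>tangent_space A p. B X \<in> tangent_space A p) \<and>
     (\<forall>X\<in>tangent_space A p. \<forall>Y\<in>tangent_space A p. \<forall>a b.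
        B (tcomb a X b Y) = tcomb a (B X) b (B Y))"

definition tangent_basis :: "'m chart set \<Rightarrow> 'm \<Rightarrow> (2 \<Rightarrow> 'm tangent) \<Rightarrow> bool" where
  "tangent_basis A p e \<longleftrightarrow>
     (\<forall>i. e i \<in> tangent_space A p) \<and>
     (\<forall>X\<in>tangent_space A p. \<exists>!c::real^2. X = (\<lambda>h. \<Sum>i\<in>UNIV. c $ i * e i h))"

definition tangent_det ::
    "'m chart set \<Rightarrow> 'm \<Rightarrow> ('m tangent \<Rightarrow> 'm tangent) \<Rightarrow> real \<Rightarrow> bool" where
  "tangent_det A p B d \<longleftrightarrow>
     (\<exists>e (a::real^2^2). tangent_basis A p e \<and>
        (\<forall>j. B (e j) = (\<lambda>h. \<Sum>i\<in>UNIV. a $ i $ j * e i h)) \<and> det a = d)"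

text \<open>The tangent vector at \<open>p\<close> represented by \<open>v\<close> in the chart \<open>(U, x)\<close>.\<close>

definition coord_vector :: "'m chart set \<Rightarrow> 'm chart \<Rightarrow> real^2 \<Rightarrow> 'm \<Rightarrow> 'm tangent" where
  "coord_vector A c v p =
     (\<lambda>h. if smooth_fun_on A UNIV h
           then frechet_derivative (h \<circ> inv_into (fst c) (snd c)) (at (snd c p)) v else 0)"

definition smooth_form_on ::
    "'m chart set \<Rightarrow> 'm set \<Rightarrow> ('m \<Rightarrow> 'm tangent \<Rightarrow> 'b::euclidean_space) \<Rightarrow> bool" where
  "smooth_form_on A W \<alpha> \<longleftrightarrow>
     (\<forall>c\<in>A. \<forall>v. smooth_fun_on A (fst c \<inter> W) (\<lambda>p. \<alpha> p (coord_vector A c v p)))"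

definition smooth_endo_field ::
    "'m chart set \<Rightarrow> ('m \<Rightarrow> 'm tangent \<Rightarrow> 'm tangent) \<Rightarrow> bool" where
  "smooth_endo_field A B \<longleftrightarrow>
     (\<forall>p. tangent_endo A p (B p)) \<and>
     (\<forall>c\<in>A. \<forall>v h. smooth_fun_on A UNIV h \<longrightarrow>
        smooth_fun_on A (fst c) (\<lambda>p. B p (coord_vector A c v p) h))"


section \<open>Immersions into three-space and regular homotopy\<close>

definition differential :: "('m \<Rightarrow> real^3) \<Rightarrow> 'm tangent \<Rightarrow> real^3" where
  "differential f X = (\<chi> i. X (\<lambda>q. f q $ i))"

definition immersions :: "'m chart set \<Rightarrow> ('m \<Rightarrow> real^3) set" where
  "immersions A =
     {f. smooth_fun_on A UNIV f \<and> (\<forall>p. inj_on (differential f) (tangent_space A p))}"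

definition regularly_homotopic ::
    "'m chart set \<Rightarrow> ('m \<Rightarrow> real^3) \<Rightarrow> ('m \<Rightarrow> real^3) \<Rightarrow> bool" where
  "regularly_homotopic A f f' \<longleftrightarrow>
     (\<exists>F::real \<Rightarrow> 'm \<Rightarrow> real^3.
        (\<forall>(U, x)\<in>A. smooth_on ({0..1} \<times> x ` U) (\<lambda>(t, y). F t (inv_into U x y))) \<and>
        (\<forall>t\<in>{0..1}. F t \<in> immersions A) \<and> F 0 = f \<and> F 1 = f')"

definition reg_homotopy_rel :: "'m chart set \<Rightarrow> (('m \<Rightarrow> real^3) \<times> ('m \<Rightarrow> real^3)) set" where
  "reg_homotopy_rel A =
     {(f, f'). f \<in> immersions A \<and> f' \<in> immersions A \<and> regularly_homotopic A f f'}"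


section \<open>Conformal structures\<close>

text \<open>Metrics, forms and endomorphism fields are total functions; only their values on
  tangent vectors at the given point are constrained.\<close>

type_synonym 'm metric = "'m \<Rightarrow> 'm tangent \<Rightarrow> 'm tangent \<Rightarrow> real"

definition riemannian_metric :: "'m chart set \<Rightarrow> 'm metric \<Rightarrow> bool" where
  "riemannian_metric A g \<longleftrightarrow>
     (\<forall>p. \<forall>X\<in>tangent_space A p.
        tangent_linear A p (g p X) \<and>
        (\<forall>Y\<in>tangent_space A p. g p X Y = g p Y X) \<and>
        (X \<noteq> tzero \<longrightarrow> g p X X > 0)) \<and>
     (\<forall>c\<in>A. \<forall>v w. smooth_fun_on A (fst c)
        (\<lambda>p. g p (coord_vector A c v p) (coord_vector A c w p)))"

definition conformally_equivalent :: "'m chart set \<Rightarrow> 'm metric \<Rightarrow> 'm metric \<Rightarrow> bool" where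
  "conformally_equivalent A g g' \<longleftrightarrow>
     (\<exists>\<rho>::'m \<Rightarrow> real. smooth_fun_on A UNIV \<rho> \<and>
        (\<forall>p. \<rho> p > 0 \<and>
          (\<forall>X\<in>tangent_space A p. \<forall>Y\<in>tangent_space A p. g' p X Y = \<rho> p * g p X Y)))"

definition conformal_structure :: "'m chart set \<Rightarrow> 'm metric set \<Rightarrow> bool" where
  "conformal_structure A C \<longleftrightarrow>
     (\<exists>g. riemannian_metric A g \<and>
        C = {g'. riemannian_metric A g' \<and> conformally_equivalent A g g'})"

definition conf_maps ::
    "'m chart set \<Rightarrow> 'm metric set \<Rightarrow> 'm \<Rightarrow> ('m tangent \<Rightarrow> real^3) set" where
  "conf_maps A C p =
     {\<omega>. tangent_linear A p \<omega> \<and> inj_on \<omega> (tangent_space A p) \<and>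
         (\<forall>g\<in>C. \<exists>r>0. \<forall>X\<in>tangent_space A p. \<forall>Y\<in>tangent_space A p.
            \<omega> X \<bullet> \<omega> Y = r * g p X Y)}"


section \<open>Spin bundles\<close>

text \<open>A bundle is given by its total space, fibrewise operations and an atlas of local
  trivialisations.  A trivialisation \<open>(U, \<Phi>)\<close> is represented by its fibre coordinate \<open>\<Phi>\<close>, that
  is, \<open>\<psi> \<mapsto> (\<pi> \<psi>, \<Phi> \<psi>)\<close> maps the part of the bundle over \<open>U\<close> onto \<open>U \<times> \<H>\<close>.\<close>

record ('m, 'e) qbundle =
  tot :: "'e set"
  bproj :: "'e \<Rightarrow> 'm"
  bzero :: "'m \<Rightarrow> 'e"
  badd :: "'e \<Rightarrow> 'e \<Rightarrow> 'e"
  bscale :: "'e \<Rightarrow> quat \<Rightarrow> 'e"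
  btrivs :: "('m set \<times> ('e \<Rightarrow> quat)) set"

record ('m, 'e) spin = "('m, 'e) qbundle" +
  pairing :: "'e \<Rightarrow> 'e \<Rightarrow> 'm tangent \<Rightarrow> quat"

definition fibre :: "('m, 'e, 'x) qbundle_scheme \<Rightarrow> 'm \<Rightarrow> 'e set" where
  "fibre L p = {\<psi> \<in> tot L. bproj L \<psi> = p}"

definition right_quaternionic_space ::
    "'e set \<Rightarrow> 'e \<Rightarrow> ('e \<Rightarrow> 'e \<Rightarrow> 'e) \<Rightarrow> ('e \<Rightarrow> quat \<Rightarrow> 'e) \<Rightarrow> bool" where
  "right_quaternionic_space V z pl sc \<longleftrightarrow>
     z \<in> V \<and>
     (\<forall>u\<in>V. \<forall>v\<in>V. pl u v \<in> V \<and> pl u v = pl v u) \<and>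
     (\<forall>u\<in>V. \<forall>v\<in>V. \<forall>w\<in>V. pl (pl u v) w = pl u (pl v w)) \<and>
     (\<forall>u\<in>V. pl z u = u \<and> (\<exists>v\<in>V. pl u v = z)) \<and>
     (\<forall>u\<in>V. \<forall>a. sc u a \<in> V) \<and>
     (\<forall>u\<in>V. sc u qone = u) \<and>
     (\<forall>u\<in>V. \<forall>a b. sc u (a *\<^sub>q b) = sc (sc u a) b) \<and>
     (\<forall>u\<in>V. \<forall>a b. sc u (a + b) = pl (sc u a) (sc u b)) \<and>
     (\<forall>u\<in>V. \<forall>v\<in>V. \<forall>a. sc (pl u v) a = pl (sc u a) (sc v a))"

text \<open>A right-linear transition function between trivialisations is left multiplication by a
  quaternion-valued function.\<close>

definition quaternionic_line_bundle ::
    "('m::topological_space) chart set \<Rightarrow> ('m, 'e, 'x) qbundle_scheme \<Rightarrow> bool" where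
  "quaternionic_line_bundle A L \<longleftrightarrow>
     (\<forall>p. right_quaternionic_space (fibre L p) (bzero L p) (badd L) (bscale L)) \<and>
     (\<Union>(U, \<Phi>)\<in>btrivs L. U) = UNIV \<and>
     (\<forall>(U, \<Phi>)\<in>btrivs L. open U \<and>
        (\<forall>p\<in>U. bij_betw \<Phi> (fibre L p) UNIV \<and>
          (\<forall>\<psi>\<in>fibre L p. \<forall>\<phi>\<in>fibre L p. \<Phi> (badd L \<psi> \<phi>) = \<Phi> \<psi> + \<Phi> \<phi>) \<and>
          (\<forall>\<psi>\<in>fibre L p. \<forall>a. \<Phi> (bscale L \<psi> a) = \<Phi> \<psi> *\<^sub>q a))) \<and>
     (\<forall>(U, \<Phi>)\<in>btrivs L. \<forall>(V, \<Psi>)\<in>btrivs L.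
        \<exists>\<tau>::'m \<Rightarrow> quat. smooth_fun_on A (U \<inter> V) \<tau> \<and>
          (\<forall>p\<in>U \<inter> V. \<forall>\<psi>\<in>fibre L p. \<Psi> \<psi> = \<tau> p *\<^sub>q \<Phi> \<psi>))"

definition smooth_section ::
    "'m chart set \<Rightarrow> ('m, 'e, 'x) qbundle_scheme \<Rightarrow> 'm set \<Rightarrow> ('m \<Rightarrow> 'e) \<Rightarrow> bool" where
  "smooth_section A L W s \<longleftrightarrow>
     (\<forall>p\<in>W. s p \<in> fibre L p) \<and>
     (\<forall>(U, \<Phi>)\<in>btrivs L. smooth_fun_on A (U \<inter> W) (\<lambda>p. \<Phi> (s p)))"

definition spin_bundle ::
    "('m::topological_space) chart set \<Rightarrow> ('m, 'e) spin \<Rightarrow> bool" where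
  "spin_bundle A L \<longleftrightarrow>
     quaternionic_line_bundle A L \<and>
     (\<forall>p. \<forall>\<psi>\<in>fibre L p. \<forall>\<phi>\<in>fibre L p.
        tangent_linear A p (pairing L \<psi> \<phi>) \<and>
        (\<forall>X\<in>tangent_space A p.
          (\<forall>\<xi>\<in>fibre L p.
             pairing L (badd L \<psi> \<xi>) \<phi> X = pairing L \<psi> \<phi> X + pairing L \<xi> \<phi> X \<and>
             pairing L \<psi> (badd L \<phi> \<xi>) X = pairing L \<psi> \<phi> X + pairing L \<psi> \<xi> X) \<and>
          (\<forall>a b. pairing L (bscale L \<psi> a) (bscale L \<phi> b) X
                   = qconj a *\<^sub>q pairing L \<psi> \<phi> X *\<^sub>q b) \<and>
          qconj (pairing L \<psi> \<phi> X) = - pairing L \<phi> \<psi> X \<and>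
          (X \<noteq> tzero \<longrightarrow> \<psi> \<noteq> bzero L p \<longrightarrow> pairing L \<psi> \<psi> X \<noteq> 0))) \<and>
     (\<forall>W s t. open W \<longrightarrow> smooth_section A L W s \<longrightarrow> smooth_section A L W t \<longrightarrow>
        smooth_form_on A W (\<lambda>p. pairing L (s p) (t p)))"

text \<open>The metric \<open>|(\<psi>,\<psi>)|\<^sup>2\<close> as a symmetric bilinear form.\<close>

definition section_metric :: "('m, 'e) spin \<Rightarrow> ('m \<Rightarrow> 'e) \<Rightarrow> 'm metric" where
  "section_metric L s = (\<lambda>p X Y. pairing L (s p) (s p) X \<bullet> pairing L (s p) (s p) Y)"

definition induced_conformal_structure ::
    "'m chart set \<Rightarrow> ('m, 'e) spin \<Rightarrow> 'm metric set" where
  "induced_conformal_structure A L =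
     {g. riemannian_metric A g \<and>
         (\<exists>s. smooth_section A L UNIV s \<and> (\<forall>p. s p \<noteq> bzero L p) \<and>
            conformally_equivalent A (section_metric L s) g)}"

definition spin_bundles ::
    "('m::topological_space) chart set \<Rightarrow> 'm metric set \<Rightarrow> ('m, 'e) spin set" where
  "spin_bundles A C = {L. spin_bundle A L \<and> induced_conformal_structure A L = C}"

definition spin_isomorphic ::
    "('m::topological_space) chart set \<Rightarrow> ('m, 'e) spin \<Rightarrow> ('m, 'd) spin \<Rightarrow> bool" where
  "spin_isomorphic A L L' \<longleftrightarrow>
     (\<exists>T::'e \<Rightarrow> 'd.
        (\<forall>p. bij_betw T (fibre L p) (fibre L' p) \<and>
          (\<forall>\<psi>\<in>fibre L p. \<forall>\<phi>\<in>fibre L p.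
             T (badd L \<psi> \<phi>) = badd L' (T \<psi>) (T \<phi>) \<and>
             (\<forall>a. T (bscale L \<psi> a) = bscale L' (T \<psi>) a) \<and>
             (\<forall>X\<in>tangent_space A p. pairing L' (T \<psi>) (T \<phi>) X = pairing L \<psi> \<phi> X))) \<and>
        (\<forall>W s. open W \<longrightarrow> smooth_section A L W s \<longrightarrow> smooth_section A L' W (\<lambda>p. T (s p))))"

definition spin_iso_rel ::
    "('m::topological_space) chart set \<Rightarrow> 'm metric set \<Rightarrow>
     (('m, 'e) spin \<times> ('m, 'e) spin) set" where
  "spin_iso_rel A C =
     {(L, L'). L \<in> spin_bundles A C \<and> L' \<in> spin_bundles A C \<and> spin_isomorphic A L L'}"


section \<open>The induced spin bundle of an immersion\<close>

definition conformal_decomposition ::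
    "'m chart set \<Rightarrow> 'm metric set \<Rightarrow> ('m \<Rightarrow> real^3) \<Rightarrow>
     ('m \<Rightarrow> 'm tangent \<Rightarrow> real^3) \<Rightarrow> ('m \<Rightarrow> 'm tangent \<Rightarrow> 'm tangent) \<Rightarrow> bool" where
  "conformal_decomposition A C f \<omega> B \<longleftrightarrow>
     smooth_form_on A UNIV \<omega> \<and> smooth_endo_field A B \<and>
     (\<forall>p. \<omega> p \<in> conf_maps A C p \<and>
        tangent_det A p (B p) 1 \<and>
        (\<forall>X\<in>tangent_space A p.
          differential f X = \<omega> p (B p X) \<and>
          (\<forall>g\<in>C. (X \<noteq> tzero \<longrightarrow> g p (B p X) X > 0) \<and>
             (\<forall>Y\<in>tangent_space A p. g p (B p X) Y = g p X (B p Y)))))"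

text \<open>Since \<open>\<omega>\<close> is unique only on tangent vectors, it is normalised to be extensional.\<close>

definition conformal_part ::
    "'m chart set \<Rightarrow> 'm metric set \<Rightarrow> ('m \<Rightarrow> real^3) \<Rightarrow> 'm \<Rightarrow> 'm tangent \<Rightarrow> real^3" where
  "conformal_part A C f =
     (THE \<omega>. (\<forall>p. \<omega> p \<in> extensional (tangent_space A p)) \<and>
             (\<exists>B. conformal_decomposition A C f \<omega> B))"

definition induced_spin_bundle ::
    "'m chart set \<Rightarrow> 'm metric set \<Rightarrow> ('m \<Rightarrow> real^3) \<Rightarrow> ('m, 'm \<times> quat) spin" where
  "induced_spin_bundle A C f =
     \<lparr> tot = UNIV,
       bproj = fst,
       bzero = (\<lambda>p. (p, 0)),
       badd = (\<lambda>\<psi> \<phi>. (fst \<psi>, snd \<psi> + snd \<phi>)),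
       bscale = (\<lambda>\<psi> a. (fst \<psi>, snd \<psi> *\<^sub>q a)),
       btrivs = {(UNIV, snd)},
       pairing = (\<lambda>\<psi> \<phi> X. qconj (snd \<psi>) *\<^sub>q qim (conformal_part A C f (fst \<psi>) X) *\<^sub>q snd \<phi>) \<rparr>"

end

theory Submission
  imports Defs
begin

text \<open>
  Call a smooth family of injective linear maps \<open>T\<^sub>pM \<rightarrow> \<real>\<^sup>3\<close> a formal immersion.  The heart of the matter is
  a corrugation: if \<open>u\<close>, \<open>w\<close> are everywhere independent and \<open>a\<close> has compact support, then adding the
  derivative of \<open>N\<^sup>-\<^sup>1 \<eta> (Y/2 sin(2 N x) u - Y cos(N x) w \<times> u)\<close> for large \<open>Y\<close> and then large \<open>N\<close> allows one to replace
  \<open>(u, w)\<close> by \<open>(u - a, w)\<close> and to stay independent.  Doing this in charts, one after the other, removes any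
  compactly (in time) supported term from a path of formal immersions at the cost of an exact term.  Applied to
  a constant path this makes a conformal form \<open>\<omega>\<close> homotopic to the differential of an immersion; applied to a
  path from \<open>df\<close> to \<open>df'\<close> it yields a regular homotopy.

  A spin bundle inducing the given conformal structure has a nowhere vanishing section \<open>\<psi>\<close>, hence is described by
  the conformal form \<open>\<omega> = (\<psi>, \<psi>)\<close>, and two of them are isomorphic iff \<open>\<omega> = \<mu>\<^sup>* \<omega>' \<mu>\<close> for a smooth
  nowhere vanishing quaternion valued \<open>\<mu>\<close>.  Such a \<open>\<mu>\<close> is obtained from a homotopy by lifting a path of rotations
  to the unit quaternions.  Conversely the image of \<open>\<mu>\<close> misses an open half line by dimension, so \<open>\<mu>\<close> is
  homotopic to 1 among nowhere vanishing functions and \<open>\<omega>\<close> to \<open>\<omega>'\<close> among formal immersions.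
\<close>

section \<open>Smooth maps between Euclidean spaces\<close>

text \<open>The oscillation runs along the space coordinates only and time is a passive parameter.
  One construction therefore serves single immersions and homotopies alike, and no time derivative
  of a correction ever has to be controlled.

  Since the surface may be non-orientable, non-compact and not simply connected, rotations over it
  need not lift to unit quaternions. The lift is taken along the time interval instead: a short step
  in time has exactly one lift with real part near 1, and uniqueness makes these lifts depend
  smoothly on the point, so no monodromy can arise.

  Non-compactness also forbids a single frequency for the whole surface. The frequency is chosen
  anew at each step, and the corrections become stationary on every compact set of a countable
  cover, so that no convergence estimate is needed.

  Polar decomposition has a closed formula in dimension two. This yields the smoothness of the
  conformal part and lets it be computed in any convenient frame.\<close>

lemma frechet_derivative_cong_open:
  assumes "open S" "x \<in> S" "\<And>y. y \<in> S \<Longrightarrow> f y = g y"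
  shows "frechet_derivative f (at x) = frechet_derivative g (at x)"
proof -
  have "(f has_derivative D) (at x) \<longleftrightarrow> (g has_derivative D) (at x)" for D
    using has_derivative_transform_within_open[of f D x UNIV S g]
      has_derivative_transform_within_open[of g D x UNIV S f] assms by auto
  then show ?thesis by (simp add: frechet_derivative_def)
qed

lemma Ck_on_cong:
  assumes "open S" "\<And>y. y \<in> S \<Longrightarrow> f y = g y"
  shows "Ck_on k f S \<longleftrightarrow> Ck_on k g S"
  using assms(2)
proof (induction k arbitrary: f g)
  case 0
  then show ?case by (auto intro: continuous_on_eq)
next
  case (Suc k)
  have "f differentiable_on S \<longleftrightarrow> g differentiable_on S"
    using Suc.prems by (auto simp: differentiable_on_def differentiable_def
        dest: has_derivative_transform[rotated 2])
      (metis has_derivative_transform)+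
  moreover have "Ck_on k (\<lambda>x. frechet_derivative f (at x) v) S
      \<longleftrightarrow> Ck_on k (\<lambda>x. frechet_derivative g (at x) v) S" for v
    by (rule Suc.IH) (use frechet_derivative_cong_open[OF assms(1)] Suc.prems in metis)
  ultimately show ?case by simp
qed

lemma Ck_on_subset: "Ck_on k f S \<Longrightarrow> T \<subseteq> S \<Longrightarrow> Ck_on k f T"
  by (induction k arbitrary: f) (auto intro: continuous_on_subset differentiable_on_subset)

lemma Ck_on_Suc_imp: "Ck_on (Suc k) f S \<Longrightarrow> Ck_on k f S"
  by (induction k arbitrary: f) (auto intro: differentiable_imp_continuous_on)

text \<open>\<open>frechet_derivative\<close> is a choice. Uniqueness of derivatives on an open set
  allows any explicit formula in its place, and every smoothness proof below by induction on the
  order relies on this.\<close>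

lemma Ck_on_SucI:
  assumes "open S" "\<And>x. x \<in> S \<Longrightarrow> (f has_derivative f' x) (at x)"
    "\<And>v. Ck_on k (\<lambda>x. f' x v) S"
  shows "Ck_on (Suc k) f S"
proof -
  have "f differentiable_on S"
    using assms(1,2) by (meson differentiable_def differentiable_at_imp_differentiable_on)
  moreover have "Ck_on k (\<lambda>x. frechet_derivative f (at x) v) S" for v
    using assms(3)[of v] Ck_on_cong[OF assms(1), of "\<lambda>x. f' x v" "\<lambda>x. frechet_derivative f (at x) v" k]
      frechet_derivative_at[OF assms(2)] by metis
  ultimately show ?thesis by simp
qed

lemma differentiable_on_has_frechet_derivative:
  assumes "open S" "f differentiable_on S" "x \<in> S"
  shows "(f has_derivative frechet_derivative f (at x)) (at x)"
  using assms by (simp add: frechet_derivative_works[symmetric] differentiable_on_eq_differentiable_at)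

lemma Ck_on_has_derivative:
  assumes "open S" "Ck_on (Suc k) f S" "x \<in> S"
  shows "(f has_derivative frechet_derivative f (at x)) (at x)"
  using assms by (auto intro: differentiable_on_has_frechet_derivative)

lemma Ck_on_const: "open S \<Longrightarrow> Ck_on k (\<lambda>x. c) S"
proof (induction k arbitrary: c)
  case (Suc k)
  show ?case by (rule Ck_on_SucI[where f' = "\<lambda>_ _. 0"]) (use Suc in auto)
qed auto

lemma Ck_on_add: "open S \<Longrightarrow> Ck_on k f S \<Longrightarrow> Ck_on k g S \<Longrightarrow> Ck_on k (\<lambda>x. f x + g x) S"
proof (induction k arbitrary: f g)
  case (Suc k)
  show ?case
    by (rule Ck_on_SucI[where f' = "\<lambda>x v. frechet_derivative f (at x) v + frechet_derivative g (at x) v"])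
      (use Suc in \<open>auto intro!: has_derivative_add intro: differentiable_on_has_frechet_derivative\<close>)
qed (auto intro: continuous_on_add)

lemma Ck_on_sum:
  "open S \<Longrightarrow> (\<And>i. i \<in> I \<Longrightarrow> Ck_on k (f i) S) \<Longrightarrow> Ck_on k (\<lambda>x. \<Sum>i\<in>I. f i x) S"
  by (induction I rule: infinite_finite_induct) (auto simp: Ck_on_const Ck_on_add)

lemma Ck_on_linear:
  assumes "bounded_linear h"
  shows "open S \<Longrightarrow> Ck_on k f S \<Longrightarrow> Ck_on k (\<lambda>x. h (f x)) S"
proof (induction k arbitrary: f)
  case 0
  then show ?case using assms by (auto intro: bounded_linear.continuous_on)
next
  case (Suc k)
  show ?case
    by (rule Ck_on_SucI[where f' = "\<lambda>x v. h (frechet_derivative f (at x) v)"])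
      (use Suc in \<open>auto intro!: bounded_linear.has_derivative[OF assms] intro: differentiable_on_has_frechet_derivative\<close>)
qed

lemma Ck_on_bilinear:
  assumes "bounded_bilinear b"
  shows "open S \<Longrightarrow> Ck_on k f S \<Longrightarrow> Ck_on k g S \<Longrightarrow> Ck_on k (\<lambda>x. b (f x) (g x)) S"
proof (induction k arbitrary: f g)
  case 0
  then show ?case using assms by (auto intro: bounded_bilinear.continuous_on)
next
  case (Suc k)
  have k: "Ck_on k f S" "Ck_on k g S" using Suc.prems Ck_on_Suc_imp by blast+
  show ?case
    by (rule Ck_on_SucI[where f' = "\<lambda>x v. b (f x) (frechet_derivative g (at x) v)
          + b (frechet_derivative f (at x) v) (g x)"])
      (use Suc k in \<open>auto intro!: bounded_bilinear.FDERIV[OF assms] Ck_on_add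
        intro: differentiable_on_has_frechet_derivative\<close>)
qed

lemma Ck_on_id: "open S \<Longrightarrow> Ck_on k (\<lambda>x. x) S"
proof (cases k)
  case (Suc n)
  assume "open S"
  then show ?thesis unfolding Suc
    by (intro Ck_on_SucI[where f' = "\<lambda>_ v. v"]) (auto intro: Ck_on_const)
qed auto

lemma Ck_on_compose:
  fixes f :: "'a::real_normed_vector \<Rightarrow> 'b::euclidean_space"
  shows "\<lbrakk>open S; open T; f ` S \<subseteq> T; Ck_on k f S; Ck_on k g T\<rbrakk> \<Longrightarrow> Ck_on k (\<lambda>x. g (f x)) S"
proof (induction k arbitrary: g)
  case 0
  then show ?case by (auto intro: continuous_on_compose2)
next
  case (Suc k)
  \<comment> \<open>The chain rule evaluates the derivative of \<open>g\<close> in the moving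
    direction \<open>f'(x) v\<close>, whereas \<open>Ck_on\<close> speaks of fixed directions only.
    Expanding that direction over the basis leaves a finite sum of products to which the induction
    hypothesis applies.\<close>
  let ?D = "\<lambda>x v. \<Sum>b\<in>Basis. (frechet_derivative f (at x) v \<bullet> b) *\<^sub>R frechet_derivative g (at (f x)) b"
  show ?case
  proof (rule Ck_on_SucI[where f' = ?D])
    fix x assume x: "x \<in> S"
    have f: "(f has_derivative frechet_derivative f (at x)) (at x)"
      using Suc.prems x Ck_on_has_derivative by blast
    have g: "(g has_derivative frechet_derivative g (at (f x))) (at (f x))"
      using Suc.prems x Ck_on_has_derivative by blast
    interpret lin: bounded_linear "frechet_derivative g (at (f x))"
      using g has_derivative_bounded_linear by blast
    have "frechet_derivative g (at (f x)) w = (\<Sum>b\<in>Basis. (w \<bullet> b) *\<^sub>R frechet_derivative g (at (f x)) b)" for w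
      by (subst euclidean_representation[symmetric, of w]) (simp add: lin.sum lin.scaleR del: euclidean_representation)
    then have "(\<lambda>v. frechet_derivative g (at (f x)) (frechet_derivative f (at x) v)) = ?D x"
      by blast
    then show "((\<lambda>x. g (f x)) has_derivative ?D x) (at x)"
      using has_derivative_compose[OF f g] by metis
  next
    fix v
    have "Ck_on k f S" using Suc.prems Ck_on_Suc_imp by blast
    then have "Ck_on k (\<lambda>x. frechet_derivative g (at (f x)) b) S" for b
      using Suc.IH[of "\<lambda>y. frechet_derivative g (at y) b"] Suc.prems by auto
    moreover have "Ck_on k (\<lambda>x. frechet_derivative f (at x) v \<bullet> b) S" for b
      using Suc.prems by (auto intro: Ck_on_linear[OF bounded_linear_inner_left])
    ultimately show "Ck_on k (\<lambda>x. ?D x v) S"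
      using Suc.prems(1) by (intro Ck_on_sum Ck_on_bilinear[OF bounded_bilinear_scaleR]) auto
  qed (use Suc in auto)
qed

text \<open>A notion for germs: one neighbourhood serves all orders at once, so closure properties
  become pointwise rules without side conditions on domains.\<close>

definition smooth_at :: "('a::real_normed_vector \<Rightarrow> 'b::real_normed_vector) \<Rightarrow> 'a \<Rightarrow> bool" where
  "smooth_at f z \<longleftrightarrow> (\<exists>U. open U \<and> z \<in> U \<and> (\<forall>k. Ck_on k f U))"

lemma smooth_on_open_iff:
  assumes "open S"
  shows "smooth_on S f \<longleftrightarrow> (\<forall>z\<in>S. smooth_at f z)"
proof
  assume s: "smooth_on S f"
  show "\<forall>z\<in>S. smooth_at f z"
  proof
    fix z assume z: "z \<in> S"
    then obtain U g where U: "open U" "z \<in> U" "\<forall>k. Ck_on k g U" "\<forall>y\<in>S \<inter> U. g y = f y"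
      using s unfolding smooth_on_def by blast
    then have "Ck_on k f (S \<inter> U)" for k
      using Ck_on_subset[of k g U "S \<inter> U"] Ck_on_cong[of "S \<inter> U" g f k] assms by blast
    then show "smooth_at f z" unfolding smooth_at_def using U assms z by blast
  qed
next
  assume "\<forall>z\<in>S. smooth_at f z"
  then show "smooth_on S f" unfolding smooth_at_def smooth_on_def by metis
qed

lemma smooth_at_cong:
  assumes "smooth_at f z" "eventually (\<lambda>x. f x = g x) (nhds z)"
  shows "smooth_at g z"
proof -
  obtain U V where "open U" "z \<in> U" "\<And>k. Ck_on k f U" "open V" "z \<in> V" "\<And>x. x \<in> V \<Longrightarrow> f x = g x"
    using assms unfolding smooth_at_def eventually_nhds by blast
  moreover from this have "Ck_on k g (U \<inter> V)" for k
    using Ck_on_cong[of "U \<inter> V" f g k] Ck_on_subset[of k f U "U \<inter> V"] by auto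
  ultimately show ?thesis unfolding smooth_at_def by (intro exI[of _ "U \<inter> V"]) auto
qed

lemma smooth_at_differentiable: "smooth_at f z \<Longrightarrow> f differentiable (at z)"
  unfolding smooth_at_def using Ck_on_has_derivative differentiableI by blast

lemma smooth_at_isCont: "smooth_at f z \<Longrightarrow> isCont f z"
  using smooth_at_differentiable differentiable_imp_continuous_within by blast

lemma smooth_at_has_derivative:
  "smooth_at f z \<Longrightarrow> (f has_derivative frechet_derivative f (at z)) (at z)"
  using smooth_at_differentiable frechet_derivative_works by blast

lemma smooth_at_frechet_derivative:
  "smooth_at f z \<Longrightarrow> smooth_at (\<lambda>x. frechet_derivative f (at x) v) z"
  unfolding smooth_at_def using Ck_on.simps(2) by blast

lemma smooth_at_const [simp, intro]: "smooth_at (\<lambda>x. c) z"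
  unfolding smooth_at_def by (intro exI[of _ UNIV]) (auto simp: Ck_on_const)

lemma smooth_at_id [simp, intro]: "smooth_at (\<lambda>x. x) z"
  unfolding smooth_at_def by (intro exI[of _ UNIV]) (auto simp: Ck_on_id)

lemma smooth_at_bilinear:
  assumes "bounded_bilinear b" "smooth_at f z" "smooth_at g z"
  shows "smooth_at (\<lambda>x. b (f x) (g x)) z"
proof -
  obtain U V where "open U" "z \<in> U" "\<And>k. Ck_on k f U" "open V" "z \<in> V" "\<And>k. Ck_on k g V"
    using assms unfolding smooth_at_def by blast
  moreover from this have "Ck_on k (\<lambda>x. b (f x) (g x)) (U \<inter> V)" for k
    using Ck_on_bilinear[OF assms(1), of "U \<inter> V" k f g] Ck_on_subset[of k f U "U \<inter> V"]
      Ck_on_subset[of k g V "U \<inter> V"] by auto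
  ultimately show ?thesis unfolding smooth_at_def by (intro exI[of _ "U \<inter> V"]) auto
qed

lemma smooth_at_add [intro]:
  assumes "smooth_at f z" "smooth_at g z"
  shows "smooth_at (\<lambda>x. f x + g x) z"
proof -
  obtain U V where "open U" "z \<in> U" "\<And>k. Ck_on k f U" "open V" "z \<in> V" "\<And>k. Ck_on k g V"
    using assms unfolding smooth_at_def by blast
  moreover from this have "Ck_on k (\<lambda>x. f x + g x) (U \<inter> V)" for k
    using Ck_on_add[of "U \<inter> V" k f g] Ck_on_subset[of k f U "U \<inter> V"]
      Ck_on_subset[of k g V "U \<inter> V"] by auto
  ultimately show ?thesis unfolding smooth_at_def by (intro exI[of _ "U \<inter> V"]) auto
qed

lemma smooth_at_linear: "bounded_linear h \<Longrightarrow> smooth_at f z \<Longrightarrow> smooth_at (\<lambda>x. h (f x)) z"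
  unfolding smooth_at_def using Ck_on_linear by blast

lemmas smooth_at_inner [intro] = smooth_at_bilinear[OF bounded_bilinear_inner]
lemmas smooth_at_scaleR [intro] = smooth_at_bilinear[OF bounded_bilinear_scaleR]
lemmas smooth_at_mult [intro] = smooth_at_bilinear[OF bounded_bilinear_mult]
lemmas smooth_at_minus [intro] = smooth_at_linear[OF bounded_linear_minus[OF bounded_linear_ident]]
lemmas smooth_at_fst [intro] = smooth_at_linear[OF bounded_linear_fst]
lemmas smooth_at_snd [intro] = smooth_at_linear[OF bounded_linear_snd]
lemmas smooth_at_nth [intro] = smooth_at_linear[OF bounded_linear_vec_nth]

lemma smooth_at_diff [intro]: "smooth_at f z \<Longrightarrow> smooth_at g z \<Longrightarrow> smooth_at (\<lambda>x. f x - g x) z"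
  using smooth_at_add[of f z "\<lambda>x. - g x"] smooth_at_minus[of g z] by simp

lemma smooth_at_sum [intro]:
  "(\<And>i. i \<in> I \<Longrightarrow> smooth_at (f i) z) \<Longrightarrow> smooth_at (\<lambda>x. \<Sum>i\<in>I. f i x) z"
  by (induction I rule: infinite_finite_induct) auto

lemma smooth_at_prod [intro]:
  fixes f :: "'i \<Rightarrow> 'a::real_normed_vector \<Rightarrow> real"
  shows "(\<And>i. i \<in> I \<Longrightarrow> smooth_at (f i) z) \<Longrightarrow> smooth_at (\<lambda>x. \<Prod>i\<in>I. f i x) z"
  by (induction I rule: infinite_finite_induct) auto

lemma smooth_at_Pair [intro]:
  assumes "smooth_at f z" "smooth_at g z"
  shows "smooth_at (\<lambda>x. (f x, g x)) z"
proof -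
  have "bounded_linear (\<lambda>y. (y, 0))" "bounded_linear (\<lambda>y. (0, y))"
    by (auto intro!: bounded_linear_Pair bounded_linear_ident bounded_linear_zero)
  from smooth_at_linear[OF this(1) assms(1)] smooth_at_linear[OF this(2) assms(2)]
  have "smooth_at (\<lambda>x. (f x, 0) + (0, g x)) z" by (rule smooth_at_add)
  then show ?thesis by simp
qed

lemma smooth_at_compose:
  fixes f :: "'a::real_normed_vector \<Rightarrow> 'b::euclidean_space"
  assumes "smooth_at f z" "smooth_at g (f z)"
  shows "smooth_at (\<lambda>x. g (f x)) z"
proof -
  obtain U V where UV: "open U" "z \<in> U" "\<And>k. Ck_on k f U" "open V" "f z \<in> V" "\<And>k. Ck_on k g V"
    using assms unfolding smooth_at_def by blast
  have "continuous_on U f" using UV(3)[of 0] by simp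
  then have op: "open (U \<inter> f -` V)" using UV by (simp add: continuous_open_preimage)
  have "Ck_on k (\<lambda>x. g (f x)) (U \<inter> f -` V)" for k
    by (rule Ck_on_compose[OF op UV(4) _ Ck_on_subset[OF UV(3)] UV(6)]) auto
  then show ?thesis unfolding smooth_at_def using op UV by (intro exI[of _ "U \<inter> f -` V"]) auto
qed

section \<open>Elementary real functions\<close>

lemma Ck_on_real_SucI:
  fixes f :: "real \<Rightarrow> real"
  assumes "open S" "\<And>x. x \<in> S \<Longrightarrow> (f has_real_derivative f' x) (at x)" "Ck_on k f' S"
  shows "Ck_on (Suc k) f S"
  by (rule Ck_on_SucI[where f' = "\<lambda>x v. f' x * v"])
    (use assms in \<open>auto simp: has_field_derivative_def
      intro!: Ck_on_bilinear[OF bounded_bilinear_mult] Ck_on_const\<close>)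

lemma Ck_on_mult_real:
  fixes f g :: "'a::real_normed_vector \<Rightarrow> real"
  shows "open S \<Longrightarrow> Ck_on k f S \<Longrightarrow> Ck_on k g S \<Longrightarrow> Ck_on k (\<lambda>x. f x * g x) S"
  by (rule Ck_on_bilinear[OF bounded_bilinear_mult])

lemma Ck_on_minus: "open S \<Longrightarrow> Ck_on k f S \<Longrightarrow> Ck_on k (\<lambda>x. - f x) S"
  by (rule Ck_on_linear[OF bounded_linear_minus[OF bounded_linear_ident]])

lemma smooth_at_sin_cos:
  fixes z :: real shows "smooth_at sin z" "smooth_at cos z"
proof -
  have "Ck_on k (sin::real \<Rightarrow> real) UNIV \<and> Ck_on k (cos::real \<Rightarrow> real) UNIV" for k
  proof (induction k)
    case (Suc k)
    then show ?case
      by (intro conjI Ck_on_real_SucI[where f' = cos] Ck_on_real_SucI[where f' = "\<lambda>x. - sin x"] Ck_on_minus)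
        (auto intro!: derivative_eq_intros)
  qed (auto intro: continuous_intros)
  then show "smooth_at sin z" "smooth_at cos z" unfolding smooth_at_def by blast+
qed

lemma Ck_on_inverse_real: "Ck_on k (inverse::real \<Rightarrow> real) (- {0})"
proof (induction k)
  case (Suc k)
  then show ?case
    by (intro Ck_on_real_SucI[where f' = "\<lambda>x. - (inverse x * inverse x)"] Ck_on_minus Ck_on_mult_real)
      (auto intro!: derivative_eq_intros)
qed (auto intro!: continuous_intros)

lemma smooth_at_inverse_real:
  fixes z :: real assumes "z \<noteq> 0" shows "smooth_at inverse z"
  unfolding smooth_at_def using assms Ck_on_inverse_real by (metis ComplI open_Compl closed_singleton singletonD)

lemma smooth_at_sqrt_real:
  fixes z :: real assumes "z > 0" shows "smooth_at sqrt z"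
proof -
  have "Ck_on k sqrt {0<..}" for k
  proof (induction k)
    case (Suc k)
    \<comment> \<open>The derivative of \<open>sqrt\<close> contains \<open>sqrt\<close> again, one
      order lower, so the induction hypothesis feeds itself.\<close>
    from Ck_on_compose[OF _ _ _ Suc Ck_on_inverse_real, unfolded image_subset_iff]
    have "Ck_on k (\<lambda>x. inverse (sqrt x)) {0<..}" by (auto simp: open_Compl)
    then show ?case
      by (intro Ck_on_real_SucI[where f' = "\<lambda>x. inverse (sqrt x) * (1/2)"] Ck_on_mult_real Ck_on_const)
        (auto intro!: derivative_eq_intros simp: field_simps)
  qed (auto intro!: continuous_intros)
  then show ?thesis unfolding smooth_at_def using assms by (metis greaterThan_iff open_greaterThan)
qed

lemma smooth_at_sin [intro]: "smooth_at f z \<Longrightarrow> smooth_at (\<lambda>x. sin (f x :: real)) z"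
  and smooth_at_cos [intro]: "smooth_at f z \<Longrightarrow> smooth_at (\<lambda>x. cos (f x :: real)) z"
  and smooth_at_inverse [intro]: "smooth_at f z \<Longrightarrow> f z \<noteq> 0 \<Longrightarrow> smooth_at (\<lambda>x. inverse (f x :: real)) z"
  and smooth_at_sqrt [intro]: "smooth_at f z \<Longrightarrow> f z > 0 \<Longrightarrow> smooth_at (\<lambda>x. sqrt (f x)) z"
  using smooth_at_compose smooth_at_sin_cos smooth_at_inverse_real smooth_at_sqrt_real by blast+

lemma smooth_at_divide [intro]:
  fixes f g :: "'a::real_normed_vector \<Rightarrow> real"
  shows "smooth_at f z \<Longrightarrow> smooth_at g z \<Longrightarrow> g z \<noteq> 0 \<Longrightarrow> smooth_at (\<lambda>x. f x / g x) z"
  by (simp only: divide_inverse) (intro smooth_at_mult smooth_at_inverse)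

lemma smooth_at_power [intro]:
  fixes f :: "'a::real_normed_vector \<Rightarrow> real"
  shows "smooth_at f z \<Longrightarrow> smooth_at (\<lambda>x. f x ^ n) z"
  by (induction n) auto

lemma smooth_at_norm [intro]:
  fixes f :: "'a::real_normed_vector \<Rightarrow> 'b::euclidean_space"
  assumes "smooth_at f z" "f z \<noteq> 0" shows "smooth_at (\<lambda>x. norm (f x)) z"
proof -
  have "smooth_at (\<lambda>x. sqrt (f x \<bullet> f x)) z" using assms by (intro smooth_at_sqrt smooth_at_inner) auto
  then show ?thesis by (simp add: norm_eq_sqrt_inner)
qed

lemma bounded_bilinear_cross3: "bounded_bilinear cross3"
  using bilinear_cross bilinear_conv_bounded_bilinear by blast

lemmas smooth_at_cross3 [intro] = smooth_at_bilinear[OF bounded_bilinear_cross3]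

section \<open>Bump functions\<close>

text \<open>The functions \<open>exp(-1/x) / x^n\<close>, continued by 0, for all \<open>n\<close>
  at once: differentiation leads from index \<open>n\<close> to \<open>n+1\<close> and
  \<open>n+2\<close>, so the family is closed under it while the single function
  \<open>exp(-1/x)\<close> is not.\<close>

definition flat_exp :: "nat \<Rightarrow> real \<Rightarrow> real" where
  "flat_exp n x = (if x \<le> 0 then 0 else exp (- inverse x) * inverse x ^ n)"

lemma flat_exp_tendsto_0: "(flat_exp n \<longlongrightarrow> 0) (at 0)"
proof -
  have "((\<lambda>y::real. y ^ n / exp y) \<longlongrightarrow> 0) at_top" by (rule tendsto_power_div_exp_0)
  then have "((\<lambda>x::real. inverse x ^ n / exp (inverse x)) \<longlongrightarrow> 0) (at_right 0)"
    using filterlim_compose filterlim_inverse_at_top_right by blast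
  then have "(flat_exp n \<longlongrightarrow> 0) (at_right 0)"
    by (rule Lim_transform_eventually)
      (auto simp: eventually_at_right_field flat_exp_def exp_minus divide_inverse intro!: exI[of _ 1])
  moreover have "(flat_exp n \<longlongrightarrow> 0) (at_left 0)"
    by (rule tendsto_eventually) (auto simp: eventually_at_left_field flat_exp_def intro!: exI[of _ "-1"])
  ultimately show ?thesis by (simp add: filterlim_split_at)
qed

lemma flat_exp_has_derivative:
  "(flat_exp n has_real_derivative (flat_exp (n+2) x - n * flat_exp (n+1) x)) (at x)"
proof (cases x "0::real" rule: linorder_cases)
  case less
  have "((\<lambda>_. 0) has_real_derivative 0) (at x)" by simp
  then have "(flat_exp n has_real_derivative 0) (at x)"
    by (rule has_field_derivative_transform_within_open[where S = "{..<0}"]) (use less in \<open>auto simp: flat_exp_def\<close>)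
  then show ?thesis using less by (simp add: flat_exp_def)
next
  case equal
  \<comment> \<open>The difference quotient at 0 is \<open>flat_exp (n+1)\<close> itself, which
    tends to 0.\<close>
  have "(\<lambda>h. (flat_exp n (0 + h) - flat_exp n 0) / h) \<midarrow>0\<rightarrow> 0"
    by (rule Lim_transform_eventually[OF flat_exp_tendsto_0[of "n+1"]])
      (auto simp: eventually_at flat_exp_def divide_inverse intro!: exI[of _ 1])
  then show ?thesis using equal by (simp add: DERIV_def flat_exp_def)
next
  case greater
  have "((\<lambda>x. exp (- inverse x) * inverse x ^ n) has_real_derivative
      (flat_exp (n+2) x - n * flat_exp (n+1) x)) (at x)"
  proof (cases n)
    case (Suc m)
    have "x ^ n = x * x ^ m" using Suc by simp
    then show ?thesis
      using greater by (auto simp: flat_exp_def Suc field_simps power2_eq_square intro!: derivative_eq_intros)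
        (cases m; simp)
  qed (use greater in \<open>auto simp: flat_exp_def field_simps power2_eq_square intro!: derivative_eq_intros\<close>)
  then show ?thesis
    by (rule has_field_derivative_transform_within_open[where S = "{0<..}"]) (use greater in \<open>auto simp: flat_exp_def\<close>)
qed

lemma smooth_at_flat_exp_real: "smooth_at (flat_exp n) z"
proof -
  have "Ck_on k (flat_exp n) UNIV" for k
  proof (induction k arbitrary: n)
    case 0
    show ?case using DERIV_isCont flat_exp_has_derivative continuous_at_imp_continuous_on by (metis Ck_on.simps(1))
  next
    case (Suc k)
    have "Ck_on k (\<lambda>x. flat_exp (n+2) x + - (n * flat_exp (n+1) x)) UNIV"
      by (intro Ck_on_add Ck_on_minus Ck_on_mult_real Ck_on_const Suc) auto
    then show ?case
      by (intro Ck_on_real_SucI[OF _ flat_exp_has_derivative]) auto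
  qed
  then show ?thesis unfolding smooth_at_def by blast
qed

definition smooth_step :: "real \<Rightarrow> real" where
  "smooth_step x = flat_exp 0 x / (flat_exp 0 x + flat_exp 0 (1 - x))"

lemma flat_exp_nonneg: "flat_exp n x \<ge> 0" and flat_exp_pos_iff: "flat_exp n x > 0 \<longleftrightarrow> x > 0"
  by (auto simp: flat_exp_def)

lemma smooth_step_denominator_pos: "flat_exp 0 x + flat_exp 0 (1 - x) > 0"
proof (cases "x > 0")
  case True
  then show ?thesis using flat_exp_pos_iff[of 0 x] flat_exp_nonneg[of 0 "1 - x"] by linarith
next
  case False
  then show ?thesis using flat_exp_pos_iff[of 0 "1 - x"] flat_exp_nonneg[of 0 x] by linarith
qed

lemma smooth_at_smooth_step [intro]:
  fixes f :: "'a::real_normed_vector \<Rightarrow> real"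
  assumes "smooth_at f z" shows "smooth_at (\<lambda>x. smooth_step (f x)) z"
  unfolding smooth_step_def
  using smooth_step_denominator_pos[of "f z"] assms
  by (intro smooth_at_divide smooth_at_add smooth_at_compose[OF _ smooth_at_flat_exp_real] smooth_at_diff) auto

lemma smooth_step_0: "x \<le> 0 \<Longrightarrow> smooth_step x = 0"
  and smooth_step_1: "x \<ge> 1 \<Longrightarrow> smooth_step x = 1"
  and smooth_step_nonneg: "smooth_step x \<ge> 0"
  and smooth_step_le_1: "smooth_step x \<le> 1"
  using smooth_step_denominator_pos[of x] flat_exp_nonneg[of 0 x] flat_exp_nonneg[of 0 "1 - x"]
  by (auto simp: smooth_step_def flat_exp_def divide_simps split: if_splits)

text \<open>A sum of flat bumps over a finite ball cover is positive on \<open>K\<close> and zero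
  outside the balls. Dividing by half of its minimum on \<open>K\<close> before applying
  \<open>smooth_step\<close> makes the result 1 wherever the sum exceeds half the minimum, that is,
  on an open set around \<open>K\<close> and not merely on \<open>K\<close>.\<close>

lemma smooth_cutoff:
  fixes K :: "'a::euclidean_space set"
  assumes "compact K" "open S" "K \<subseteq> S"
  obtains \<eta> :: "'a \<Rightarrow> real" and K' V where "\<And>x. smooth_at \<eta> x" "compact K'" "K' \<subseteq> S"
    "\<And>x. x \<notin> K' \<Longrightarrow> \<eta> x = 0" "open V" "K \<subseteq> V" "V \<subseteq> S" "\<And>x. x \<in> V \<Longrightarrow> \<eta> x = 1" "\<And>x. 0 \<le> \<eta> x \<and> \<eta> x \<le> 1"
proof (cases "K = {}")
  case True
  show ?thesis by (rule that[of "\<lambda>_. 0" "{}" "{}"]) (use True in auto)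
next
  case False
  have "\<exists>r>0. cball x r \<subseteq> S" if "x \<in> K" for x using assms that open_contains_cball by blast
  then obtain r where r: "\<And>x. x \<in> K \<Longrightarrow> r x > 0 \<and> cball x (r x) \<subseteq> S" by metis
  obtain D where D: "D \<subseteq> K" "finite D" "K \<subseteq> (\<Union>x\<in>D. ball x (r x))"
    using compactE_image[OF assms(1), of K "\<lambda>x. ball x (r x)"] r by force
  define F where "F y = (\<Sum>x\<in>D. flat_exp 0 ((r x)\<^sup>2 - (y - x) \<bullet> (y - x)))" for y
  have Fs: "smooth_at F y" for y unfolding F_def
    by (intro smooth_at_sum smooth_at_compose[OF _ smooth_at_flat_exp_real] smooth_at_diff smooth_at_inner) auto
  have dist2: "(y - x) \<bullet> (y - x) < (r x)\<^sup>2 \<longleftrightarrow> y \<in> ball x (r x)" if "x \<in> D" for x y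
  proof -
    have "r x > 0" using r that D(1) by blast
    then show ?thesis
      by (simp add: dist_norm norm_minus_commute dot_square_norm power_mono_iff flip: not_le)
  qed
  have Fpos: "F y > 0" if yK: "y \<in> K" for y
  proof -
    obtain x where x: "x \<in> D" "y \<in> ball x (r x)" using yK D(3) by fast
    then show ?thesis unfolding F_def
      by (intro sum_pos2[OF D(2) x(1)]) (use dist2 in \<open>auto simp: flat_exp_pos_iff flat_exp_nonneg\<close>)
  qed
  have Fc: "continuous_on UNIV F" using Fs smooth_at_isCont continuous_at_imp_continuous_on by blast
  then obtain y0 where y0: "y0 \<in> K" "\<And>y. y \<in> K \<Longrightarrow> F y0 \<le> F y"
    using continuous_attains_inf[OF assms(1) False, of F] continuous_on_subset by blast
  define \<eta> where "\<eta> y = smooth_step (2 * F y / F y0)" for y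
  let ?K' = "\<Union>x\<in>D. cball x (r x)"
  let ?V = "{y. F y > F y0 / 2}"
  have out: "F y = 0" if "y \<notin> (\<Union>x\<in>D. ball x (r x))" for y unfolding F_def
    by (rule sum.neutral) (use that dist2 in \<open>force simp: flat_exp_def not_less simp del: mem_ball\<close>)
  show ?thesis
  proof (rule that[of \<eta> ?K' ?V])
    show "smooth_at \<eta> x" for x unfolding \<eta>_def using Fpos[OF y0(1)] Fs
      by (intro smooth_at_smooth_step smooth_at_divide smooth_at_mult) auto
    show "compact ?K'" using D by auto
    show "?K' \<subseteq> S" using r D by blast
    show "\<eta> x = 0" if "x \<notin> ?K'" for x
      using out[of x] that by (force simp: \<eta>_def smooth_step_0)
    show "open ?V" by (intro open_Collect_less continuous_on_const Fc)
    show "K \<subseteq> ?V" using y0 Fpos by fastforce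
    show "?V \<subseteq> S" using out Fpos[OF y0(1)] r D(1) ball_subset_cball by fastforce
    show "\<eta> x = 1" if "x \<in> ?V" for x
      unfolding \<eta>_def using that Fpos[OF y0(1)] by (intro smooth_step_1) (auto simp: field_simps)
    show "0 \<le> \<eta> x \<and> \<eta> x \<le> 1" for x by (simp add: \<eta>_def smooth_step_nonneg smooth_step_le_1)
  qed
qed

section \<open>Corrugation\<close>

lemma frechet_derivative_add_smooth:
  assumes "smooth_at f z" "smooth_at g z"
  shows "frechet_derivative (\<lambda>x. f x + g x) (at z) v
    = frechet_derivative f (at z) v + frechet_derivative g (at z) v"
  using frechet_derivative_at[OF has_derivative_add[OF smooth_at_has_derivative[OF assms(1)]
      smooth_at_has_derivative[OF assms(2)]]] by metis

lemma frechet_derivative_zero_near: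
  assumes "open S" "z \<in> S" "\<And>y. y \<in> S \<Longrightarrow> f y = 0"
  shows "frechet_derivative f (at z) v = 0"
  using frechet_derivative_cong_open[of S z f "\<lambda>_. 0"] assms by simp

lemma smooth_at_extend_zero:
  fixes \<eta> :: "'a::euclidean_space \<Rightarrow> real" and f :: "'a \<Rightarrow> 'b::real_normed_vector"
  assumes "\<And>x. smooth_at \<eta> x" "compact K" "K \<subseteq> S" "\<And>x. x \<notin> K \<Longrightarrow> \<eta> x = 0" "\<And>x. x \<in> S \<Longrightarrow> smooth_at f x"
  shows "smooth_at (\<lambda>x. \<eta> x *\<^sub>R f x) z"
proof (cases "z \<in> S")
  case False
  show ?thesis
  proof (rule smooth_at_cong[of "\<lambda>_. 0"])
    show "\<forall>\<^sub>F x in nhds z. 0 = \<eta> x *\<^sub>R f x"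
      unfolding eventually_nhds
      by (rule exI[of _ "- K"]) (use assms False in \<open>auto simp: compact_imp_closed open_Compl\<close>)
  qed auto
qed (use assms in auto)

lemmas cross3_diff_left = bounded_bilinear.diff_left[OF bounded_bilinear_cross3]
lemmas cross3_diff_right = bounded_bilinear.diff_right[OF bounded_bilinear_cross3]

lemma norm_cross3_le: "norm (cross3 x y) \<le> norm x * norm y"
proof (rule power2_le_imp_le)
  show "(norm (cross3 x y))\<^sup>2 \<le> (norm x * norm y)\<^sup>2"
    using norm_cross_dot[of x y] zero_le_power2[of "x \<bullet> y"] by linarith
qed auto

lemma cross3_nonzero_commute: "cross3 x y \<noteq> 0 \<longleftrightarrow> cross3 y x \<noteq> 0"
  using cross_skew[of x y] by auto

lemma smooth_continuous_on: "(\<And>z. z \<in> S \<Longrightarrow> smooth_at f z) \<Longrightarrow> continuous_on S f"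
  by (intro continuous_at_imp_continuous_on ballI smooth_at_isCont)

text \<open>Here \<open>S\<close> stands for the sine of the phase and \<open>1 - 2 S^2\<close> for
  the cosine of the doubled phase. Taking the product with \<open>w\<close> sends \<open>u\<close>
  to \<open>n = u x w\<close> and \<open>w x u\<close> to \<open>- n x w\<close>, and these two
  vectors are orthogonal. If \<open>a = 0\<close>, a vanishing second coordinate forces
  \<open>S = 0\<close> or \<open>\<eta> = 0\<close>, and then the first coordinate is positive. If
  \<open>a\<close> is not 0, then for \<open>S^2 \<le> 1/4\<close> the first coefficient is at least
  \<open>Y/2\<close>, and otherwise the second exceeds \<open>Y/2\<close> in absolute value; either
  one outweighs \<open>a x w\<close> by the bound on \<open>Y\<close>.\<close>

lemma cross3_corrugated_nonzero:
  fixes u w a :: "real^3"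
  assumes n: "cross3 u w \<noteq> 0"
    and a: "a \<noteq> 0 \<Longrightarrow> \<eta> = 1 \<and> Y * norm (cross3 u w) > 2 * norm a * (1 + norm w)"
    and \<eta>: "0 \<le> \<eta>" and Y: "0 < Y"
  shows "cross3 (u - a + ((Y * (1 - 2 * S\<^sup>2)) *\<^sub>R (\<eta> *\<^sub>R u) + (Y * S) *\<^sub>R (\<eta> *\<^sub>R cross3 w u))) w \<noteq> 0"
    (is "cross3 ?A w \<noteq> 0")
proof
  assume z: "cross3 ?A w = 0"
  define n where "n = cross3 u w"
  have nw: "n \<bullet> w = 0" "n \<bullet> n > 0" "norm n > 0" "w \<bullet> n = 0"
    using assms(1) by (auto simp: n_def dot_cross_self)
  have A: "cross3 ?A w = (1 + Y * (1 - 2 * S\<^sup>2) * \<eta>) *\<^sub>R n - cross3 a w - (Y * S * \<eta>) *\<^sub>R cross3 n w"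
    unfolding n_def cross_skew[of w u]
    by (simp add: cross_mult_left cross3_diff_left cross_add_left algebra_simps)
  have "cross3 ?A w \<bullet> n = 0" "cross3 ?A w \<bullet> cross3 n w = 0" using z by auto
  moreover have "cross3 n w \<bullet> n = 0" "n \<bullet> cross3 n w = 0" by (auto simp: dot_cross_self)
  moreover have nn: "cross3 n w \<bullet> cross3 n w = (n \<bullet> n) * (w \<bullet> w)" using nw by (simp add: dot_cross)
  ultimately have e1: "(1 + Y * (1 - 2 * S\<^sup>2) * \<eta>) * (n \<bullet> n) = cross3 a w \<bullet> n"
    and e2: "- (Y * S * \<eta>) * ((n \<bullet> n) * (w \<bullet> w)) = cross3 a w \<bullet> cross3 n w"
    unfolding A by (simp_all add: inner_diff_left)
  have w0: "w \<bullet> w > 0" "norm w > 0" using n by auto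
  show False
  proof (cases "a = 0")
    case True
    with e2 nw w0 Y have "S = 0 \<or> \<eta> = 0" by auto
    with e1 True nw \<eta> Y show False
      by (auto simp: add_nonneg_eq_0_iff mult_nonneg_nonneg)
  next
    case False
    have caw: "norm (cross3 a w) \<le> norm a * norm w" by (rule norm_cross3_le)
    have nY: "norm a * norm w < Y / 2 * norm n" "norm a < Y / 2 * norm n" and \<eta>1: "\<eta> = 1"
    proof -
      have "0 < norm a" "0 \<le> norm a * norm w" using False by auto
      moreover have "\<eta> = 1" "2 * norm a + 2 * (norm a * norm w) < Y * norm n"
        using a[OF False] by (auto simp: n_def distrib_left)
      ultimately show "norm a * norm w < Y / 2 * norm n" "norm a < Y / 2 * norm n" "\<eta> = 1"
by linarith+
    qed
    show False
    proof (cases "S\<^sup>2 \<le> 1/4")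
      case True
      have "Y * (2 * S\<^sup>2) \<le> Y * (1/2)" using True Y by (intro mult_left_mono) auto
      then have "Y / 2 * (n \<bullet> n) \<le> (1 + Y * (1 - 2 * S\<^sup>2) * \<eta>) * (n \<bullet> n)"
        using \<eta>1 nw by (intro mult_right_mono) (auto simp: algebra_simps)
      also have "\<dots> \<le> norm (cross3 a w) * norm n" unfolding e1 by (rule norm_cauchy_schwarz)
      also have "\<dots> \<le> norm a * norm w * norm n" using caw by (simp add: mult_right_mono)
      also have "\<dots> < Y / 2 * norm n * norm n" using nY nw by (simp add: mult_strict_right_mono)
      finally show False by (simp add: dot_square_norm power2_eq_square)
    next
      case False
      then have "\<bar>S\<bar> > 1/2" using abs_le_square_iff[of S "1/2"] by (auto simp: power2_eq_square)
      then have "Y / 2 * (norm n * norm n * (norm w * norm w)) \<le> Y * \<bar>S\<bar> * (norm n * norm n * (norm w * norm w))"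
        using Y by (intro mult_right_mono) auto
      also have "\<dots> = \<bar>- (Y * S * \<eta>) * ((n \<bullet> n) * (w \<bullet> w))\<bar>"
        using \<eta>1 Y by (simp add: abs_mult dot_square_norm power2_eq_square)
      also have "\<dots> \<le> norm (cross3 a w) * norm (cross3 n w)" unfolding e2 by (rule Cauchy_Schwarz_ineq2)
      also have "\<dots> \<le> (norm a * norm w) * (norm n * norm w)"
        by (intro mult_mono caw norm_cross3_le) auto
      also have "\<dots> = norm a * (norm w * norm n * norm w)" by simp
      also have "\<dots> < (Y / 2 * norm n) * (norm w * norm n * norm w)"
        using nY nw w0 by (intro mult_strict_right_mono) auto
      finally show False by (simp add: algebra_simps)
    qed
  qed
qed

lemma compact_norm_bound:
  assumes "compact K" "continuous_on K f"
  obtains M :: real where "M > 0" "\<And>z. z \<in> K \<Longrightarrow> norm (f z) \<le> M"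
  using compact_imp_bounded[OF compact_continuous_image[OF assms(2,1)]] bounded_pos
  by (metis image_eqI)

text \<open>The oscillating part of the derivative runs through the curve
  \<open>1 + Y cos 2s + i Y sin s\<close>, whose mean is 1, which stays at distance of order \<open>Y\<close> from 0 and which
  avoids the negative real axis.  Hence the correction can be cut off where \<open>a = 0\<close>, and where
  \<open>a \<noteq> 0\<close> the term \<open>a\<close> becomes negligible.\<close>

lemma corrugation_one_direction:
  fixes \<Omega> :: "'a::euclidean_space set" and u w a :: "'a \<Rightarrow> real^3"
  assumes \<Omega>: "open \<Omega>" and u: "\<And>z. z \<in> \<Omega> \<Longrightarrow> smooth_at u z" and w: "\<And>z. z \<in> \<Omega> \<Longrightarrow> smooth_at w z"
    and indep: "\<And>z. z \<in> \<Omega> \<Longrightarrow> cross3 (u z) (w z) \<noteq> 0"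
    and a: "\<And>z. smooth_at a z" and Ka: "compact Ka" "Ka \<subseteq> \<Omega>" "\<And>z. z \<notin> Ka \<Longrightarrow> a z = 0"
    and d: "d1 \<bullet> d1 = 1" "d1 \<bullet> d2 = 0"
  obtains g K where "\<And>z. smooth_at g z" "compact K" "K \<subseteq> \<Omega>" "\<And>z. z \<notin> K \<Longrightarrow> g z = 0"
    "\<And>z. z \<in> \<Omega> \<Longrightarrow> cross3 (u z - a z + frechet_derivative g (at z) d1)
                          (w z + frechet_derivative g (at z) d2) \<noteq> 0"
proof -
  obtain \<eta> K V where \<eta>: "\<And>x. smooth_at \<eta> x" and K: "compact K" "K \<subseteq> \<Omega>" "\<And>x. x \<notin> K \<Longrightarrow> \<eta> x = 0"
    and V: "Ka \<subseteq> V" "\<And>x. x \<in> V \<Longrightarrow> \<eta> x = (1::real)" and \<eta>01: "\<And>x. 0 \<le> \<eta> x \<and> \<eta> x \<le> 1"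
    by (rule smooth_cutoff[OF Ka(1) \<Omega> Ka(2)]) (metis (no_types))
  have contu: "continuous_on \<Omega> u" and contw: "continuous_on \<Omega> w" and conta: "continuous_on UNIV a"
    using u w a by (auto intro!: smooth_continuous_on)
  have "continuous_on Ka (\<lambda>z. 2 * norm (a z) * (1 + norm (w z)) / norm (cross3 (u z) (w z)))"
    using indep Ka(2)
    by (intro continuous_intros continuous_on_cross continuous_on_subset[OF conta]
        continuous_on_subset[OF contu] continuous_on_subset[OF contw]) auto
  from compact_norm_bound[OF Ka(1) this] obtain Y0 where Y0: "Y0 > 0"
    "\<And>z. z \<in> Ka \<Longrightarrow> norm (2 * norm (a z) * (1 + norm (w z)) / norm (cross3 (u z) (w z))) \<le> Y0"
    by metis
  \<comment> \<open>Strictly above the maximum over \<open>Ka\<close> of the quotient that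
    \<open>cross3_corrugated_nonzero\<close> wants to be exceeded.\<close>
  define Y where "Y = Y0 + 1"
  have Y: "Y > 0" using Y0 by (simp add: Y_def)
  have Yb: "Y * norm (cross3 (u z) (w z)) > 2 * norm (a z) * (1 + norm (w z))" if "z \<in> Ka" for z
  proof -
    have n: "norm (cross3 (u z) (w z)) > 0" using indep that Ka by auto
    have "2 * norm (a z) * (1 + norm (w z)) / norm (cross3 (u z) (w z)) < Y"
      using abs_le_D1[OF Y0(2)[OF that, unfolded real_norm_def]] by (simp add: Y_def)
    then show ?thesis using n by (simp add: pos_divide_less_eq)
  qed
  define P where "P z = \<eta> z *\<^sub>R u z" for z
  define Q where "Q z = \<eta> z *\<^sub>R cross3 (w z) (u z)" for z
  have P: "smooth_at P z" and Q: "smooth_at Q z" for z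
    unfolding P_def Q_def
    by (rule smooth_at_extend_zero[OF \<eta> K(1,2,3)]; use u w in auto)+
  have contPQ: "continuous_on UNIV P" "continuous_on UNIV Q"
    "continuous_on UNIV (\<lambda>z. frechet_derivative P (at z) v)" "continuous_on UNIV (\<lambda>z. frechet_derivative Q (at z) v)" for v
    by (intro smooth_continuous_on smooth_at_frechet_derivative P Q)+
  \<comment> \<open>The new first vector without its terms of order \<open>1/N\<close>, and with the
    sine of the phase freed to a parameter \<open>S\<close>. Bounds over the compact set of all
    \<open>(z, S)\<close> therefore do not depend on the frequency, which is chosen last.\<close>
  define B where "B z S = u z - a z + ((Y * (1 - 2 * S\<^sup>2)) *\<^sub>R P z + (Y * S) *\<^sub>R Q z)" for z S
  have B0: "cross3 (B z S) (w z) \<noteq> 0" if "z \<in> \<Omega>" for z S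
    unfolding B_def P_def Q_def
  proof (rule cross3_corrugated_nonzero)
    assume "a z \<noteq> 0"
    then have "z \<in> Ka" using Ka(3) by blast
    then show "\<eta> z = 1 \<and> Y * norm (cross3 (u z) (w z)) > 2 * norm (a z) * (1 + norm (w z))"
      using V Yb by blast
  qed (use indep that \<eta>01 Y in auto)
  let ?KS = "K \<times> {-1..1::real}"
  have KS: "compact ?KS" using K by (intro compact_Times) auto
  have contB: "continuous_on ?KS (\<lambda>(z, S). B z S)" "continuous_on ?KS (\<lambda>(z, S). w z)"
    unfolding B_def case_prod_beta using K(2)
    by (intro continuous_intros continuous_on_compose2[OF contu] continuous_on_compose2[OF contw]
        continuous_on_compose2[OF conta] continuous_on_compose2[OF contPQ(1)]
        continuous_on_compose2[OF contPQ(2)]; auto)+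
  obtain M where M: "M > 0" "\<And>z S. z \<in> K \<Longrightarrow> \<bar>S\<bar> \<le> 1 \<Longrightarrow> norm (B z S) \<le> M"
    by (rule compact_norm_bound[OF KS contB(1)]) (force simp: abs_le_iff)
  obtain M' where M': "M' > 0" "\<And>z S::real. z \<in> K \<Longrightarrow> \<bar>S\<bar> \<le> 1 \<Longrightarrow> norm (w z) \<le> M'"
    by (rule compact_norm_bound[OF KS contB(2)]) (force simp: abs_le_iff)
  have "continuous_on ?KS (\<lambda>(z, S). cross3 (B z S) (w z))"
    using continuous_on_cross[OF contB] by (simp add: case_prod_beta)
  \<comment> \<open>A lower bound for the norm is obtained as an upper bound for its reciprocal,
    which also covers an empty \<open>K\<close>.\<close>
  define R where "R q = inverse (norm (case q of (z, S) \<Rightarrow> cross3 (B z S) (w z)))" for q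
  have "continuous_on ?KS R"
    unfolding R_def using \<open>continuous_on ?KS (\<lambda>(z, S). cross3 (B z S) (w z))\<close> B0 K(2)
    by (intro continuous_on_inverse continuous_on_norm) auto
  from compact_norm_bound[OF KS this] obtain m0 where m0: "m0 > 0"
    "\<And>q. q \<in> ?KS \<Longrightarrow> norm (R q) \<le> m0"
    by metis
  define m where "m = inverse m0"
  have m: "m > 0" "m \<le> norm (cross3 (B z S) (w z))" if "z \<in> K" "\<bar>S\<bar> \<le> 1" for z S
  proof -
    have "norm (cross3 (B z S) (w z)) > 0" using B0[of z S] that K(2) by auto
    moreover have "inverse (norm (cross3 (B z S) (w z))) \<le> m0"
      using m0(2)[of "(z, S)"] that by (simp add: R_def abs_le_iff)
    ultimately show "m \<le> norm (cross3 (B z S) (w z))" "m > 0"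
      using m0(1) by (auto simp: m_def field_simps)
  qed
  have mpos: "m > 0" using m0 by (simp add: m_def)
  define E where "E v = (\<lambda>z. Y / 2 * norm (frechet_derivative P (at z) v) + Y * norm (frechet_derivative Q (at z) v))" for v
  have contE: "continuous_on K (E v)" for v
    unfolding E_def using contPQ by (intro continuous_intros) (auto intro: continuous_on_subset)
  obtain M1 where M1: "M1 > 0" "\<And>z. z \<in> K \<Longrightarrow> norm (E d1 z) \<le> M1" using compact_norm_bound[OF K(1) contE[of d1]] by metis
  obtain M2 where M2: "M2 > 0" "\<And>z. z \<in> K \<Longrightarrow> norm (E d2 z) \<le> M2" using compact_norm_bound[OF K(1) contE[of d2]] by metis
  \<comment> \<open>The sum of the bounds of the three products that contain an error term, after
    one factor \<open>1/N\<close> is taken out. In the product of two errors the second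
    \<open>1/N\<close> is simply estimated by 1, whence the condition
    \<open>N \<ge> 1\<close>.\<close>
  define T where "T = M * M2 + M1 * M' + M1 * M2"
  obtain N :: nat where N: "real N > T / m" "real N \<ge> 1"
    using reals_Archimedean2[of "max (T / m) 1"] by (metis max_less_iff_conj less_imp_le)
  define g where "g z = (1 / N) *\<^sub>R ((Y / 2 * sin (2 * N * (z \<bullet> d1))) *\<^sub>R P z - (Y * cos (N * (z \<bullet> d1))) *\<^sub>R Q z)" for z
  have gs: "smooth_at g z" for z
    unfolding g_def by (intro smooth_at_scaleR smooth_at_diff smooth_at_mult smooth_at_sin smooth_at_cos
        smooth_at_inner smooth_at_const smooth_at_id P Q)
  \<comment> \<open>The part in which \<open>P\<close> and \<open>Q\<close> are differentiated; it
    keeps the factor \<open>1/N\<close>. Differentiating the phases produces a factor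
    \<open>N (v . d1)\<close>, which cancels \<open>1/N\<close> but vanishes for
    \<open>v = d2\<close>. Hence the second vector of the pair changes only by a small
    error.\<close>
  define err where "err z v = (1 / N) *\<^sub>R ((Y / 2 * sin (2 * N * (z \<bullet> d1))) *\<^sub>R frechet_derivative P (at z) v
      - (Y * cos (N * (z \<bullet> d1))) *\<^sub>R frechet_derivative Q (at z) v)" for z v
  have Dg: "frechet_derivative g (at z) v = err z v + (v \<bullet> d1) *\<^sub>R ((Y * (1 - 2 * (sin (N * (z \<bullet> d1)))\<^sup>2)) *\<^sub>R P z
      + (Y * sin (N * (z \<bullet> d1))) *\<^sub>R Q z)" for z v
  proof -
    have "(g has_derivative (\<lambda>v. (1 / N) *\<^sub>R
       (((Y / 2 * sin (2 * N * (z \<bullet> d1))) *\<^sub>R frechet_derivative P (at z) v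
         + (Y / 2 * (cos (2 * N * (z \<bullet> d1)) * (2 * N * (v \<bullet> d1)))) *\<^sub>R P z)
       - ((Y * cos (N * (z \<bullet> d1))) *\<^sub>R frechet_derivative Q (at z) v
         + (Y * (- sin (N * (z \<bullet> d1)) * (N * (v \<bullet> d1)))) *\<^sub>R Q z)))) (at z)"
      unfolding g_def
      by (rule derivative_eq_intros smooth_at_has_derivative P Q refl | simp add: algebra_simps)+
    from fun_cong[OF frechet_derivative_at[OF this, symmetric], of v]
    have "frechet_derivative g (at z) v = (1 / N) *\<^sub>R
       (((Y / 2 * sin (2 * N * (z \<bullet> d1))) *\<^sub>R frechet_derivative P (at z) v
         + (Y / 2 * (cos (2 * N * (z \<bullet> d1)) * (2 * N * (v \<bullet> d1)))) *\<^sub>R P z)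
       - ((Y * cos (N * (z \<bullet> d1))) *\<^sub>R frechet_derivative Q (at z) v
         + (Y * (- sin (N * (z \<bullet> d1)) * (N * (v \<bullet> d1)))) *\<^sub>R Q z))" .
    moreover have "cos (2 * N * (z \<bullet> d1)) = 1 - 2 * (sin (N * (z \<bullet> d1)))\<^sup>2"
      using cos_double_sin[of "N * (z \<bullet> d1)"] by (simp add: mult.assoc)
    ultimately show ?thesis
      using N(2) by (simp add: err_def scaleR_add_right scaleR_diff_right mult.assoc mult.left_commute mult.commute[of _ "v \<bullet> d1"])
  qed
  have err: "norm (err z v) \<le> E v z / N" for z v
  proof -
    have "norm ((Y / 2 * sin (2 * N * (z \<bullet> d1))) *\<^sub>R frechet_derivative P (at z) v
      - (Y * cos (N * (z \<bullet> d1))) *\<^sub>R frechet_derivative Q (at z) v) \<le>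
      Y / 2 * \<bar>sin (2 * N * (z \<bullet> d1))\<bar> * norm (frechet_derivative P (at z) v)
      + Y * \<bar>cos (N * (z \<bullet> d1))\<bar> * norm (frechet_derivative Q (at z) v)"
      using Y by (intro order_trans[OF norm_triangle_ineq4]) (simp add: abs_mult)
    also have "\<dots> \<le> Y / 2 * 1 * norm (frechet_derivative P (at z) v) + Y * 1 * norm (frechet_derivative Q (at z) v)"
      using Y by (intro add_mono mult_right_mono mult_left_mono abs_sin_le_one abs_cos_le_one) auto
    finally show ?thesis unfolding err_def E_def using N(2) by (simp add: divide_simps)
  qed
  show ?thesis
  proof (rule that[of g K])
    show "smooth_at g z" for z by (rule gs)
    show "compact K" "K \<subseteq> \<Omega>" by (fact K)+
    show g0: "g z = 0" if "z \<notin> K" for z using K(3)[OF that] by (simp add: g_def P_def Q_def)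
    fix z assume z: "z \<in> \<Omega>"
    show "cross3 (u z - a z + frechet_derivative g (at z) d1) (w z + frechet_derivative g (at z) d2) \<noteq> 0"
    proof (cases "z \<in> K")
      case False
      have "frechet_derivative g (at z) v = 0" for v
        by (rule frechet_derivative_zero_near[of "- K"]) (use K(1) False g0 in \<open>auto simp: compact_imp_closed open_Compl\<close>)
      moreover have "a z = 0" using False V Ka(3) K(3) by (metis in_mono zero_neq_one)
      ultimately show ?thesis using indep[OF z] by simp
    next
      case True
      define S where "S = sin (N * (z \<bullet> d1))"
      have S: "\<bar>S\<bar> \<le> 1" by (simp add: S_def)
      have e1: "norm (err z d1) \<le> M1 / N" and e2: "norm (err z d2) \<le> M2 / N"
        using err[of z d1] err[of z d2] M1(2)[OF True] M2(2)[OF True] N(2)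
        by (auto intro!: order_trans[OF err] divide_right_mono dest: abs_le_D1)
      have "cross3 (u z - a z + frechet_derivative g (at z) d1) (w z + frechet_derivative g (at z) d2)
        = cross3 (B z S + err z d1) (w z + err z d2)"
        using d by (simp add: Dg B_def S_def inner_commute algebra_simps)
      also have "\<dots> = cross3 (B z S) (w z) - (- (cross3 (B z S) (err z d2) + cross3 (err z d1) (w z) + cross3 (err z d1) (err z d2)))"
        by (simp add: cross_add_left cross_add_right)
      finally have eq: "cross3 (u z - a z + frechet_derivative g (at z) d1) (w z + frechet_derivative g (at z) d2) = \<dots>" .
      have "norm (cross3 (B z S) (err z d2) + cross3 (err z d1) (w z) + cross3 (err z d1) (err z d2))
        \<le> norm (cross3 (B z S) (err z d2)) + norm (cross3 (err z d1) (w z)) + norm (cross3 (err z d1) (err z d2))"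
        by (intro order_trans[OF norm_triangle_ineq] add_mono order_refl norm_triangle_ineq)
      also have "\<dots> \<le> M * (M2 / N) + (M1 / N) * M' + (M1 / N) * (M2 / 1)"
        by (intro add_mono order_trans[OF norm_cross3_le] mult_mono M(2) M'(2)[OF _ S] True S e1 e2 order_trans[OF e2])
          (use M1 M2 M M' N in \<open>auto simp: field_simps\<close>)
      also have "\<dots> = T / N" by (simp add: T_def add_divide_distrib)
      also have "\<dots> < m" using N mpos by (simp add: field_simps)
      also have "\<dots> \<le> norm (cross3 (B z S) (w z))" using m[OF True S] by simp
      finally show ?thesis unfolding eq by (metis norm_minus_cancel order_less_irrefl right_minus_eq)
    qed
  qed
qed

text \<open>Two oscillations, the second along \<open>d2\<close> with the roles of the vectors
  exchanged. What the first one adds to both vectors is absorbed into the independent pair from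
  which the second one starts.\<close>

lemma corrugation:
  fixes \<Omega> :: "'a::euclidean_space set" and u1 u2 a1 a2 :: "'a \<Rightarrow> real^3"
  assumes \<Omega>: "open \<Omega>" and u: "\<And>z. z \<in> \<Omega> \<Longrightarrow> smooth_at u1 z" "\<And>z. z \<in> \<Omega> \<Longrightarrow> smooth_at u2 z"
    and indep: "\<And>z. z \<in> \<Omega> \<Longrightarrow> cross3 (u1 z) (u2 z) \<noteq> 0"
    and a: "\<And>z. smooth_at a1 z" "\<And>z. smooth_at a2 z"
    and Ka: "compact Ka" "Ka \<subseteq> \<Omega>" "\<And>z. z \<notin> Ka \<Longrightarrow> a1 z = 0" "\<And>z. z \<notin> Ka \<Longrightarrow> a2 z = 0"
    and d: "d1 \<bullet> d1 = 1" "d1 \<bullet> d2 = 0" "d2 \<bullet> d2 = 1"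
  obtains g K where "\<And>z. smooth_at g z" "compact K" "K \<subseteq> \<Omega>" "\<And>z. z \<notin> K \<Longrightarrow> g z = 0"
    "\<And>z. z \<in> \<Omega> \<Longrightarrow> cross3 (u1 z - a1 z + frechet_derivative g (at z) d1)
                          (u2 z - a2 z + frechet_derivative g (at z) d2) \<noteq> 0"
proof -
  obtain g K where g: "\<And>z. smooth_at g z" "compact K" "K \<subseteq> \<Omega>" "\<And>z. z \<notin> K \<Longrightarrow> g z = 0"
    "\<And>z. z \<in> \<Omega> \<Longrightarrow> cross3 (u1 z - a1 z + frechet_derivative g (at z) d1)
                          (u2 z + frechet_derivative g (at z) d2) \<noteq> 0"
    using corrugation_one_direction[OF \<Omega> u indep a(1) Ka(1-3) d(1,2)] by (metis (no_types, lifting))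
  let ?u1 = "\<lambda>z. u1 z - a1 z + frechet_derivative g (at z) d1"
  let ?u2 = "\<lambda>z. u2 z + frechet_derivative g (at z) d2"
  have s: "smooth_at ?u1 z" "smooth_at ?u2 z" if "z \<in> \<Omega>" for z
    using that u a g(1) by (auto intro!: smooth_at_add smooth_at_diff smooth_at_frechet_derivative)
  have indep': "cross3 (?u2 z) (?u1 z) \<noteq> 0" if "z \<in> \<Omega>" for z
    using g(5)[OF that] cross3_nonzero_commute by blast
  have d': "d2 \<bullet> d1 = 0" using d by (simp add: inner_commute)
  obtain h K' where h: "\<And>z. smooth_at h z" "compact K'" "K' \<subseteq> \<Omega>" "\<And>z. z \<notin> K' \<Longrightarrow> h z = 0"
    "\<And>z. z \<in> \<Omega> \<Longrightarrow> cross3 (?u2 z - a2 z + frechet_derivative h (at z) d2)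
                          (?u1 z + frechet_derivative h (at z) d1) \<noteq> 0"
    using corrugation_one_direction[OF \<Omega> s(2,1) indep' a(2) Ka(1,2,4) d(3) d'] by (metis (no_types, lifting))
  show ?thesis
  proof (rule that[of "\<lambda>z. g z + h z" "K \<union> K'"])
    show "smooth_at (\<lambda>z. g z + h z) z" for z using g(1) h(1) by auto
    fix z assume z: "z \<in> \<Omega>"
    have eqs: "u1 z - a1 z + frechet_derivative (\<lambda>z. g z + h z) (at z) d1 = ?u1 z + frechet_derivative h (at z) d1"
      "u2 z - a2 z + frechet_derivative (\<lambda>z. g z + h z) (at z) d2 = ?u2 z - a2 z + frechet_derivative h (at z) d2"
      using frechet_derivative_add_smooth[OF g(1) h(1)] by (simp_all add: algebra_simps)
    show "cross3 (u1 z - a1 z + frechet_derivative (\<lambda>z. g z + h z) (at z) d1)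
      (u2 z - a2 z + frechet_derivative (\<lambda>z. g z + h z) (at z) d2) \<noteq> 0"
      unfolding eqs using h(5)[OF z] cross3_nonzero_commute by blast
  qed (use g h in auto)
qed

lemmas smooth_intros = smooth_at_add smooth_at_diff smooth_at_minus smooth_at_scaleR smooth_at_mult
  smooth_at_inner smooth_at_cross3 smooth_at_fst smooth_at_snd smooth_at_nth smooth_at_Pair smooth_at_const
  smooth_at_id smooth_at_divide smooth_at_inverse smooth_at_sqrt smooth_at_norm smooth_at_power smooth_at_sum
  smooth_at_prod smooth_at_smooth_step smooth_at_sin smooth_at_cos

declare smooth_intros [rule del]

section \<open>Hadamard's lemma\<close>

text \<open>Differentiation under the integral sign gives an integral of the same kind with a
  differentiated integrand; hence the induction over all \<open>F\<close>.\<close>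

lemma Ck_on_integral:
  fixes F :: "'a::euclidean_space \<times> real \<Rightarrow> 'b::euclidean_space"
  assumes "\<And>z. smooth_at F z"
  shows "Ck_on k (\<lambda>y. integral {0..1} (\<lambda>s. F (y, s))) UNIV"
  using assms
proof (induction k arbitrary: F)
  case 0
  have "continuous_on (UNIV \<times> cbox 0 1) (\<lambda>(y, s). F (y, s))"
    using 0 by (auto simp: case_prod_beta intro!: smooth_continuous_on)
  then show ?case using integral_continuous_on_param[of UNIV 0 1 "\<lambda>y s. F (y, s)"] by simp
next
  case (Suc k)
  \<comment> \<open>The Leibniz rule wants the partial derivative to be continuous as an operator.
    In finite dimension this follows from continuity in each fixed direction.\<close>
  define D where "D y s = Blinfun (\<lambda>v. frechet_derivative F (at (y, s)) (v, 0))" for y s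
  have lin: "bounded_linear (\<lambda>v. frechet_derivative F (at z) (v, 0))" for z
    using bounded_linear_compose[OF has_derivative_bounded_linear[OF smooth_at_has_derivative[OF Suc.prems]]
        bounded_linear_Pair[OF bounded_linear_ident bounded_linear_zero]] by simp
  have D: "blinfun_apply (D y s) v = frechet_derivative F (at (y, s)) (v, 0)" for y s v
    unfolding D_def using lin by (simp add: bounded_linear_Blinfun_apply)
  have cD: "continuous_on UNIV (\<lambda>z. frechet_derivative F (at z) v)" for v
    by (intro smooth_continuous_on smooth_at_frechet_derivative Suc.prems)
  have cF: "continuous_on UNIV F" by (intro smooth_continuous_on Suc.prems)
  have contD: "continuous_on (UNIV \<times> cbox 0 1) (\<lambda>(y, s). D y s)"
    unfolding case_prod_beta
    by (rule continuous_on_blinfun_componentwise) (auto simp: D intro: continuous_on_subset[OF cD])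
  have der: "((\<lambda>y. integral (cbox 0 1) (\<lambda>s. F (y, s))) has_derivative integral (cbox 0 1) (D y)) (at y within UNIV)" for y
  proof (rule leibniz_rule[OF _ _ contD])
    fix x :: 'a and t :: real
    have "((\<lambda>x. (x, t)) has_derivative (\<lambda>v. (v, 0))) (at x within UNIV)"
      by (auto intro!: derivative_eq_intros)
    from has_derivative_compose[OF this smooth_at_has_derivative[OF Suc.prems]]
    show "((\<lambda>x. F (x, t)) has_derivative blinfun_apply (D x t)) (at x within UNIV)"
      by (simp add: D[abs_def])
    show "(\<lambda>s. F (x, s)) integrable_on cbox 0 1"
      by (intro integrable_continuous continuous_on_compose2[OF cF] continuous_intros) auto
  qed auto
  have int: "blinfun_apply (integral (cbox 0 1) (D y)) v = integral {0..1} (\<lambda>s. frechet_derivative F (at (y, s)) (v, 0))" for y v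
  proof -
    have "D y integrable_on cbox 0 1"
      by (intro integrable_continuous continuous_on_compose2[OF contD, of _ "\<lambda>s. (y, s)", simplified])
        (auto intro!: continuous_intros)
    from blinfun_apply_integral[OF this] show ?thesis by (simp add: D)
  qed
  show ?case
    by (rule Ck_on_SucI[OF _ der[unfolded cbox_interval]])
      (auto simp: int[unfolded cbox_interval] intro!: Suc.IH smooth_at_frechet_derivative Suc.prems)
qed

text \<open>The fundamental theorem of calculus along the segment from \<open>y0\<close> to
  \<open>y\<close>. It serves to show that a derivation at a point sees only first
  derivatives.\<close>

lemma hadamard:
  fixes k :: "real^2 \<Rightarrow> real"
  assumes "\<And>y. smooth_at k y"
  obtains H where "\<And>i y. smooth_at (H i) y" "\<And>i. H i y0 = frechet_derivative k (at y0) (axis i 1)"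
    "\<And>y. k y = k y0 + (\<Sum>i\<in>UNIV. (y $ i - y0 $ i) * H i y)"
proof -
  define F where "F i z = frechet_derivative k (at (y0 + snd z *\<^sub>R (fst z - y0))) (axis i 1)" for i and z :: "(real^2) \<times> real"
  define H where "H i y = integral {0..1} (\<lambda>s. F i (y, s))" for i y
  have F: "smooth_at (F i) z" for i z
    unfolding F_def
    by (intro smooth_at_compose[of "\<lambda>z. y0 + snd z *\<^sub>R (fst z - y0)" z "\<lambda>y. frechet_derivative k (at y) (axis i 1)"]
        smooth_at_frechet_derivative assms smooth_at_add smooth_at_const smooth_at_scaleR smooth_at_diff
        smooth_at_fst smooth_at_snd smooth_at_id)
  have FD: "frechet_derivative k (at y) v = (\<Sum>i\<in>UNIV. v $ i * frechet_derivative k (at y) (axis i 1))" for y v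
  proof -
    interpret bounded_linear "frechet_derivative k (at y)"
      using has_derivative_bounded_linear[OF smooth_at_has_derivative[OF assms]] .
    have "v = (\<Sum>i\<in>UNIV. v $ i *\<^sub>R axis i 1)" by (simp add: vec_eq_iff axis_def if_distrib cong: if_cong)
    from arg_cong[OF this, of "frechet_derivative k (at y)"] show ?thesis by (simp add: sum scaleR)
  qed
  show ?thesis
  proof (rule that[of H])
    show "smooth_at (H i) y" for i y
      unfolding smooth_at_def H_def using Ck_on_integral[OF F] by blast
    show "H i y0 = frechet_derivative k (at y0) (axis i 1)" for i by (simp add: H_def F_def)
    fix y
    have "((\<lambda>s. frechet_derivative k (at (y0 + s *\<^sub>R (y - y0))) (y - y0)) has_integral
        (k (y0 + 1 *\<^sub>R (y - y0)) - k (y0 + 0 *\<^sub>R (y - y0)))) {0..1}"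
    proof (rule fundamental_theorem_of_calculus)
      fix s :: real
      have lin: "linear (frechet_derivative k (at (y0 + s *\<^sub>R (y - y0))))"
        using has_derivative_linear[OF smooth_at_has_derivative[OF assms]] .
      have "((\<lambda>s. y0 + s *\<^sub>R (y - y0)) has_derivative (\<lambda>r. r *\<^sub>R (y - y0))) (at s within {0..1})"
        by (auto intro!: derivative_eq_intros)
      from has_derivative_compose[OF this smooth_at_has_derivative[OF assms]]
      show "((\<lambda>s. k (y0 + s *\<^sub>R (y - y0))) has_vector_derivative
          frechet_derivative k (at (y0 + s *\<^sub>R (y - y0))) (y - y0)) (at s within {0..1})"
        unfolding has_vector_derivative_def by (simp only: linear_cmul[OF lin] real_scaleR_def)
    qed simp
    then have "k y - k y0 = integral {0..1} (\<lambda>s. frechet_derivative k (at (y0 + s *\<^sub>R (y - y0))) (y - y0))"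
      by (simp add: integral_unique)
    also have "\<dots> = integral {0..1} (\<lambda>s. \<Sum>i\<in>UNIV. (y $ i - y0 $ i) * F i (y, s))"
      by (subst FD) (simp add: F_def)
    also have "\<dots> = (\<Sum>i\<in>UNIV. (y $ i - y0 $ i) * H i y)"
    proof -
      have "(\<lambda>s. F i (y, s)) integrable_on {0..1}" for i
      proof (rule integrable_continuous_interval)
        have "continuous_on UNIV (F i)" by (intro smooth_continuous_on F)
        then show "continuous_on {0..1} (\<lambda>s. F i (y, s))"
          by (rule continuous_on_compose2) (auto intro!: continuous_intros)
      qed
      then show ?thesis unfolding H_def
        by (subst integral_sum) (auto intro!: integrable_on_mult_right)
    qed
    finally show "k y = k y0 + (\<Sum>i\<in>UNIV. (y $ i - y0 $ i) * H i y)" by simp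
  qed
qed

lemma smooth_on_subset:
  assumes "smooth_on S f" "T \<subseteq> S" shows "smooth_on T f"
  unfolding smooth_on_def
proof
  fix x assume "x \<in> T"
  then obtain U g where "open U" "x \<in> U" "\<forall>k. Ck_on k g U" "\<forall>y\<in>S \<inter> U. g y = f y"
    using assms unfolding smooth_on_def by (meson subsetD)
  then show "\<exists>U g. open U \<and> x \<in> U \<and> (\<forall>k. Ck_on k g U) \<and> (\<forall>y\<in>T \<inter> U. g y = f y)"
    using assms(2) by (intro exI[of _ U] exI[of _ g]) auto
qed

lemma smooth_at_compose_fst:
  fixes \<phi> :: "'a::euclidean_space \<Rightarrow> 'c::real_normed_vector" and z :: "'a \<times> 'b::euclidean_space"
  shows "smooth_at \<phi> (fst z) \<Longrightarrow> smooth_at (\<lambda>z. \<phi> (fst z)) z"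
  by (rule smooth_at_compose) (auto intro: smooth_intros)

lemma smooth_at_compose_snd:
  fixes \<phi> :: "'b::euclidean_space \<Rightarrow> 'c::real_normed_vector" and z :: "'a::euclidean_space \<times> 'b"
  shows "smooth_at \<phi> (snd z) \<Longrightarrow> smooth_at (\<lambda>z. \<phi> (snd z)) z"
  by (rule smooth_at_compose) (auto intro: smooth_intros)

section \<open>Smooth functions on a surface\<close>

abbreviation cinv :: "'m chart \<Rightarrow> real^2 \<Rightarrow> 'm" where
  "cinv c \<equiv> inv_into (fst c) (snd c)"

definition pull :: "'m chart \<Rightarrow> (real \<Rightarrow> 'm \<Rightarrow> 'b) \<Rightarrow> real \<times> (real^2) \<Rightarrow> 'b" where
  "pull c F = (\<lambda>z. F (fst z) (cinv c (snd z)))"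

text \<open>Functions on a surface come with a real parameter, so that homotopies and single functions
  are treated alike.\<close>

definition msmooth :: "'m chart set \<Rightarrow> (real \<Rightarrow> 'm \<Rightarrow> 'b::euclidean_space) \<Rightarrow> real \<Rightarrow> 'm \<Rightarrow> bool" where
  "msmooth A F t p \<longleftrightarrow> (\<exists>c\<in>A. p \<in> fst c \<and> smooth_at (pull c F) (t, snd c p))"

locale surface =
  fixes A :: "('m::{t2_space, second_countable_topology}) chart set"
  assumes atlas: "smooth_atlas A"
begin

section \<open>Charts and their inverses\<close>

lemma chart_open: "c \<in> A \<Longrightarrow> open (fst c)"
  and chart_image_open: "c \<in> A \<Longrightarrow> open (snd c ` fst c)"
  and chart_homeomorphism: "c \<in> A \<Longrightarrow> homeomorphism (fst c) (snd c ` fst c) (snd c) (cinv c)"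
  using atlas unfolding smooth_atlas_def by (auto simp: case_prod_beta)

lemma chart_exists: obtains c where "c \<in> A" "p \<in> fst c"
proof -
  have "\<Union> (fst ` A) = UNIV" using atlas unfolding smooth_atlas_def by (auto simp: case_prod_beta)
  then show ?thesis using that by (metis UNIV_I UN_E)
qed

lemma chart_continuous: "c \<in> A \<Longrightarrow> continuous_on (fst c) (snd c)"
  and cinv_continuous: "c \<in> A \<Longrightarrow> continuous_on (snd c ` fst c) (cinv c)"
  and cinv_chart: "c \<in> A \<Longrightarrow> p \<in> fst c \<Longrightarrow> cinv c (snd c p) = p"
  using chart_homeomorphism unfolding homeomorphism_def by blast+

lemma chart_cinv: "y \<in> snd c ` fst c \<Longrightarrow> snd c (cinv c y) = y"
  and cinv_in: "y \<in> snd c ` fst c \<Longrightarrow> cinv c y \<in> fst c"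
  by (simp_all add: f_inv_into_f inv_into_into)

lemma chart_image_subset_open:
  assumes "c \<in> A" "open W" shows "open (snd c ` (fst c \<inter> W))"
proof -
  have "open (snd c ` fst c \<inter> cinv c -` W)"
    using continuous_open_preimage[OF cinv_continuous chart_image_open] assms by blast
  moreover have "snd c ` fst c \<inter> cinv c -` W = snd c ` (fst c \<inter> W)"
    using assms(1) by (auto simp: cinv_chart)
  ultimately show ?thesis by simp
qed

lemma cinv_image_compact:
  assumes "c \<in> A" "compact K" "K \<subseteq> snd c ` fst c" shows "compact (cinv c ` K)" "closed (cinv c ` K)"
  using compact_continuous_image[OF continuous_on_subset[OF cinv_continuous]] assms compact_imp_closed by blast+

lemma transition_smooth:
  assumes "c \<in> A" "d \<in> A" "p \<in> fst c" "p \<in> fst d"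
  shows "smooth_at (\<lambda>y. snd d (cinv c y)) (snd c p)"
proof -
  have "smooth_on (snd c ` (fst c \<inter> fst d)) (snd d \<circ> cinv c)"
    using atlas assms unfolding smooth_atlas_def by (auto simp: case_prod_beta)
  then show ?thesis
    using smooth_on_open_iff[OF chart_image_subset_open[OF assms(1) chart_open[OF assms(2)]]] assms
    by (auto simp: o_def)
qed

lemma eventually_chart:
  assumes "c \<in> A" "p \<in> fst c" "open W" "p \<in> W"
  shows "\<forall>\<^sub>F z in nhds (t, snd c p). snd z \<in> snd c ` (fst c \<inter> W)"
  unfolding eventually_nhds
  by (rule exI[of _ "UNIV \<times> snd c ` (fst c \<inter> W)"]) (use assms chart_image_subset_open in \<open>auto intro: open_Times\<close>)

text \<open>The change of charts acts on the space coordinate only and time passes through. So the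
  existential over charts in \<open>msmooth\<close> may be read as a universal one.\<close>

lemma smooth_at_pull_transfer:
  fixes F :: "real \<Rightarrow> 'm \<Rightarrow> 'b::real_normed_vector"
  assumes "c \<in> A" "d \<in> A" "p \<in> fst c" "p \<in> fst d" "smooth_at (pull d F) (t, snd d p)"
  shows "smooth_at (pull c F) (t, snd c p)"
proof (rule smooth_at_cong)
  have "smooth_at (\<lambda>z. (fst z, snd d (cinv c (snd z)))) (t, snd c p)"
    using transition_smooth[OF assms(1-4)]
    by (intro smooth_intros smooth_at_compose_snd[where \<phi> = "\<lambda>y. snd d (cinv c y)"]) simp
  then show "smooth_at (\<lambda>z. pull d F (fst z, snd d (cinv c (snd z)))) (t, snd c p)"
    by (rule smooth_at_compose) (use assms in \<open>simp add: cinv_chart\<close>)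
  show "\<forall>\<^sub>F z in nhds (t, snd c p). pull d F (fst z, snd d (cinv c (snd z))) = pull c F z"
    using eventually_chart[OF assms(1,3) chart_open[OF assms(2)] assms(4), of t]
    by eventually_elim (auto simp: pull_def cinv_chart assms)
qed

lemma msmooth_chart:
  assumes "c \<in> A" "p \<in> fst c"
  shows "msmooth A F t p \<longleftrightarrow> smooth_at (pull c F) (t, snd c p)"
  using assms smooth_at_pull_transfer unfolding msmooth_def by blast

lemma msmooth_cong:
  assumes "msmooth A F t p" "open I" "open W" "t \<in> I" "p \<in> W" "\<And>s q. s \<in> I \<Longrightarrow> q \<in> W \<Longrightarrow> F s q = G s q"
  shows "msmooth A G t p"
proof -
  obtain c where c: "c \<in> A" "p \<in> fst c" by (rule chart_exists)
  have "\<forall>\<^sub>F z in nhds (t, snd c p). fst z \<in> I"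
    unfolding eventually_nhds by (rule exI[of _ "I \<times> UNIV"]) (use assms in \<open>auto intro: open_Times\<close>)
  with eventually_chart[OF c assms(3,5), of t]
  have "\<forall>\<^sub>F z in nhds (t, snd c p). pull c F z = pull c G z"
    by eventually_elim (use assms(6) c in \<open>auto simp: pull_def cinv_chart\<close>)
  then show ?thesis using assms(1) smooth_at_cong msmooth_chart[OF c] by blast
qed

section \<open>Closure properties of smooth families\<close>

lemma msmooth_const: "msmooth A (\<lambda>t p. c) t p"
  unfolding msmooth_def pull_def case_prod_beta using chart_exists[of p] smooth_at_const by metis

lemma msmooth_time: "smooth_at \<phi> t \<Longrightarrow> msmooth A (\<lambda>t p. \<phi> t) t p"
  unfolding msmooth_def pull_def case_prod_beta
  using chart_exists[of p] smooth_at_compose_fst[of \<phi>] by (metis fst_conv)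

lemma msmooth_compose:
  assumes "msmooth A F t p" "smooth_at \<phi> (F t p)"
  shows "msmooth A (\<lambda>t p. \<phi> (F t p)) t p"
proof -
  obtain c where c: "c \<in> A" "p \<in> fst c" by (rule chart_exists)
  have "smooth_at (\<lambda>z. \<phi> (pull c F z)) (t, snd c p)"
    by (rule smooth_at_compose) (use assms c in \<open>simp_all add: msmooth_chart, simp add: pull_def cinv_chart\<close>)
  then show ?thesis unfolding msmooth_chart[OF c] by (simp add: pull_def)
qed

lemma msmooth_Pair:
  assumes "msmooth A F t p" "msmooth A G t p"
  shows "msmooth A (\<lambda>t p. (F t p, G t p)) t p"
proof -
  obtain c where c: "c \<in> A" "p \<in> fst c" by (rule chart_exists)
  show ?thesis using assms unfolding msmooth_chart[OF c] by (simp add: pull_def smooth_at_Pair)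
qed

lemma msmooth_compose2:
  assumes "msmooth A F t p" "msmooth A G t p" "smooth_at (\<lambda>z. \<phi> (fst z) (snd z)) (F t p, G t p)"
  shows "msmooth A (\<lambda>t p. \<phi> (F t p) (G t p)) t p"
  using msmooth_compose[OF msmooth_Pair[OF assms(1,2)], of "\<lambda>z. \<phi> (fst z) (snd z)"] assms(3) by simp

lemma msmooth_linear: "bounded_linear h \<Longrightarrow> msmooth A F t p \<Longrightarrow> msmooth A (\<lambda>t p. h (F t p)) t p"
  by (rule msmooth_compose) (assumption | intro smooth_at_linear[of h] smooth_intros)+

lemma msmooth_bilinear:
  "bounded_bilinear b \<Longrightarrow> msmooth A F t p \<Longrightarrow> msmooth A G t p \<Longrightarrow> msmooth A (\<lambda>t p. b (F t p) (G t p)) t p"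
  by (rule msmooth_compose2[where \<phi> = b]) (assumption | intro smooth_at_bilinear[of b] smooth_intros)+

lemma msmooth_add: "msmooth A F t p \<Longrightarrow> msmooth A G t p \<Longrightarrow> msmooth A (\<lambda>t p. F t p + G t p) t p"
  and msmooth_diff: "msmooth A F t p \<Longrightarrow> msmooth A G t p \<Longrightarrow> msmooth A (\<lambda>t p. F t p - G t p) t p"
  by (rule msmooth_compose2[where \<phi> = "(+)"], assumption+, intro smooth_intros,
      rule msmooth_compose2[where \<phi> = "(-)"], assumption+, intro smooth_intros)

lemmas msmooth_scaleR = msmooth_bilinear[OF bounded_bilinear_scaleR]
lemmas msmooth_mult = msmooth_bilinear[OF bounded_bilinear_mult]
lemmas msmooth_inner = msmooth_bilinear[OF bounded_bilinear_inner]
lemmas msmooth_cross3 = msmooth_bilinear[OF bounded_bilinear_cross3]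
lemmas msmooth_nth = msmooth_linear[OF bounded_linear_vec_nth]

lemma msmooth_divide:
  "msmooth A F t p \<Longrightarrow> msmooth A G t p \<Longrightarrow> G t p \<noteq> 0 \<Longrightarrow> msmooth A (\<lambda>t p. F t p / G t p :: real) t p"
  by (rule msmooth_compose2[where \<phi> = "(/)"]) (assumption | intro smooth_intros | simp)+

lemma msmooth_sqrt: "msmooth A F t p \<Longrightarrow> F t p > 0 \<Longrightarrow> msmooth A (\<lambda>t p. sqrt (F t p)) t p"
  by (rule msmooth_compose) (assumption | intro smooth_intros)+

lemma msmooth_norm: "msmooth A F t p \<Longrightarrow> F t p \<noteq> 0 \<Longrightarrow> msmooth A (\<lambda>t p. norm (F t p)) t p"
  by (rule msmooth_compose) (assumption | intro smooth_intros)+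

lemma msmooth_prod:
  fixes F :: "'i \<Rightarrow> real \<Rightarrow> 'm \<Rightarrow> real"
  shows "(\<And>i. i \<in> I \<Longrightarrow> msmooth A (F i) t p) \<Longrightarrow> msmooth A (\<lambda>t p. \<Prod>i\<in>I. F i t p) t p"
  by (induction I rule: infinite_finite_induct) (auto intro: msmooth_const msmooth_mult)

lemma msmooth_reparam:
  assumes "msmooth A F (\<phi> t) p" "smooth_at \<phi> t"
  shows "msmooth A (\<lambda>t p. F (\<phi> t) p) t p"
proof -
  obtain c where c: "c \<in> A" "p \<in> fst c" by (rule chart_exists)
  have "smooth_at (\<lambda>z. (\<phi> (fst z), snd z)) (t, snd c p)"
    using assms(2) by (intro smooth_intros smooth_at_compose_fst) simp
  then have "smooth_at (\<lambda>z. pull c F (\<phi> (fst z), snd z)) (t, snd c p)"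
    by (rule smooth_at_compose) (use assms msmooth_chart[OF c] in auto)
  then show ?thesis unfolding msmooth_chart[OF c] by (simp add: pull_def)
qed

section \<open>Single functions as families constant in time\<close>

lemma msmooth_slice: "msmooth A F s p \<Longrightarrow> msmooth A (\<lambda>_. F s) t p"
  using msmooth_reparam[of F "\<lambda>_. s" t p] by simp

lemma msmooth_slice_iff:
  assumes "c \<in> A" "p \<in> fst c"
  shows "msmooth A (\<lambda>_. h) t p \<longleftrightarrow> smooth_at (h \<circ> cinv c) (snd c p)"
proof
  assume "msmooth A (\<lambda>_. h) t p"
  then have "smooth_at (pull c (\<lambda>_. h)) (t, snd c p)" using msmooth_chart[OF assms] by blast
  from smooth_at_compose[of "\<lambda>y. (t, y)" "snd c p", OF _ this]
  show "smooth_at (h \<circ> cinv c) (snd c p)" by (simp add: pull_def o_def smooth_at_Pair)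
next
  assume "smooth_at (h \<circ> cinv c) (snd c p)"
  then have "smooth_at (\<lambda>z. (h \<circ> cinv c) (snd z)) (t, snd c p)"
    by (intro smooth_at_compose_snd[where \<phi> = "h \<circ> cinv c"]) simp
  then show "msmooth A (\<lambda>_. h) t p" unfolding msmooth_chart[OF assms] by (simp add: pull_def o_def)
qed

lemma smooth_fun_on_iff:
  assumes "open W"
  shows "smooth_fun_on A W h \<longleftrightarrow> (\<forall>p\<in>W. msmooth A (\<lambda>_. h) t p)"
proof
  assume s: "smooth_fun_on A W h"
  show "\<forall>p\<in>W. msmooth A (\<lambda>_. h) t p"
  proof
    fix p assume p: "p \<in> W"
    obtain c where c: "c \<in> A" "p \<in> fst c" by (rule chart_exists)
    have "smooth_on (snd c ` (fst c \<inter> W)) (h \<circ> cinv c)"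
      using s c unfolding smooth_fun_on_def by (auto simp: case_prod_beta)
    then show "msmooth A (\<lambda>_. h) t p"
      using smooth_on_open_iff[OF chart_image_subset_open[OF c(1) assms]] c p msmooth_slice_iff[OF c] by blast
  qed
next
  assume s: "\<forall>p\<in>W. msmooth A (\<lambda>_. h) t p"
  show "smooth_fun_on A W h"
    unfolding smooth_fun_on_def case_prod_beta
  proof
    fix c assume c: "c \<in> A"
    show "smooth_on (snd c ` (fst c \<inter> W)) (h \<circ> cinv c)"
      unfolding smooth_on_open_iff[OF chart_image_subset_open[OF c assms]]
      using s c msmooth_slice_iff by blast
  qed
qed

lemmas smooth_fun_iff = smooth_fun_on_iff[OF open_UNIV, where t = 0, simplified]

lemma smooth_on_of_msmooth:
  assumes "\<And>t p. msmooth A F t p" "(U, x) \<in> A"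
  shows "smooth_on (I \<times> x ` U) (\<lambda>(t, y). F t (inv_into U x y))"
proof -
  have "open (UNIV \<times> x ` U :: (real \<times> _) set)" using chart_image_open[OF assms(2)] by (auto intro: open_Times)
  moreover have "smooth_at (\<lambda>(t, y). F t (inv_into U x y)) z" if "z \<in> UNIV \<times> x ` U" for z
  proof -
    obtain q where q: "q \<in> U" "snd z = x q" using \<open>z \<in> UNIV \<times> x ` U\<close> by (auto simp: mem_Times_iff)
    have "smooth_at (pull (U, x) F) (fst z, x q)"
      using msmooth_chart[OF assms(2), of q F "fst z"] assms(1) q by simp
    moreover have "(\<lambda>(t, y). F t (inv_into U x y)) = pull (U, x) F" by (simp add: pull_def case_prod_beta')
    moreover have "(fst z, x q) = z" using q(2) by (simp add: prod_eq_iff)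
    ultimately show ?thesis by metis
  qed
  ultimately have "smooth_on (UNIV \<times> x ` U) (\<lambda>(t, y). F t (inv_into U x y))"
    using smooth_on_open_iff by blast
  then show ?thesis by (rule smooth_on_subset) auto
qed

text \<open>At a point outside the chart domain the function vanishes nearby, because the image of
  \<open>K\<close> in the surface is compact and hence closed. This is where the Hausdorff property
  enters.\<close>

lemma msmooth_extend_zero:
  fixes k :: "real \<times> (real^2) \<Rightarrow> 'b::euclidean_space"
  assumes c: "c \<in> A" and k: "\<And>z. smooth_at k z" and K: "compact K" "K \<subseteq> snd c ` fst c"
    and k0: "\<And>t y. y \<notin> K \<Longrightarrow> k (t, y) = 0"
  shows "msmooth A (\<lambda>t p. if p \<in> fst c then k (t, snd c p) else 0) t p"
proof (cases "p \<in> fst c")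
  case True
  have "\<forall>\<^sub>F z in nhds (t, snd c p). k z = pull c (\<lambda>t p. if p \<in> fst c then k (t, snd c p) else 0) z"
    using eventually_chart[OF c True chart_open[OF c] True, of t]
  proof eventually_elim
    case (elim z)
    then have "snd z \<in> snd c ` fst c" by simp
    then have "cinv c (snd z) \<in> fst c" "snd c (cinv c (snd z)) = snd z" by (auto intro: cinv_in chart_cinv)
    then show ?case by (simp add: pull_def)
  qed
  then show ?thesis unfolding msmooth_chart[OF c True] by (rule smooth_at_cong[OF k])
next
  case False
  show ?thesis
  proof (rule msmooth_cong[OF msmooth_const[of 0], of UNIV "- cinv c ` K"])
    show "open (- cinv c ` K)" using cinv_image_compact(2)[OF c K] by (simp add: open_Compl)
    show "p \<in> - cinv c ` K" using False K(2) cinv_in[of _ c] by (auto simp: subset_iff)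
    fix q assume q: "q \<in> - cinv c ` K"
    then have "snd c q \<notin> K" if "q \<in> fst c" using cinv_chart[OF c that] by (metis ComplD imageI)
    then show "0 = (if q \<in> fst c then k (t, snd c q) else 0)" for t using k0 by auto
  qed auto
qed

lemma surface_cutoff:
  assumes c: "c \<in> A" and K: "compact K" "K \<subseteq> W" "open W" "W \<subseteq> fst c"
  obtains \<eta> :: "'m \<Rightarrow> real" and K' V where "\<And>t p. msmooth A (\<lambda>_. \<eta>) t p" "compact K'" "K' \<subseteq> W"
    "\<And>p. p \<notin> K' \<Longrightarrow> \<eta> p = 0" "open V" "K \<subseteq> V" "\<And>p. p \<in> V \<Longrightarrow> \<eta> p = 1"
proof -
  have W: "fst c \<inter> W = W" using K by auto
  have 1: "compact (snd c ` K)"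
    using compact_continuous_image[OF continuous_on_subset[OF chart_continuous[OF c]]] K by blast
  have 2: "open (snd c ` W)" using chart_image_subset_open[OF c K(3)] W by simp
  obtain \<phi> :: "real^2 \<Rightarrow> real" and K' V where \<phi>: "\<And>x. smooth_at \<phi> x" "compact K'" "K' \<subseteq> snd c ` W"
    "\<And>x. x \<notin> K' \<Longrightarrow> \<phi> x = 0" "open V" "snd c ` K \<subseteq> V" "V \<subseteq> snd c ` W" "\<And>x. x \<in> V \<Longrightarrow> \<phi> x = 1"
    by (rule smooth_cutoff[OF 1 2 image_mono[OF K(2)]]) metis
  have K'W: "K' \<subseteq> snd c ` fst c" using \<phi>(3) K(4) by blast
  define \<eta> where "\<eta> p = (if p \<in> fst c then \<phi> (snd c p) else 0)" for p
  show ?thesis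
  proof (rule that[of \<eta> "cinv c ` K'" "fst c \<inter> snd c -` V"])
    show "msmooth A (\<lambda>_. \<eta>) t p" for t p
      unfolding \<eta>_def
      by (rule msmooth_extend_zero[OF c smooth_at_compose_snd[OF \<phi>(1)] \<phi>(2) K'W, of t p, unfolded snd_conv])
        (rule \<phi>(4))
    show "compact (cinv c ` K')" by (rule cinv_image_compact[OF c \<phi>(2) K'W])
    show "cinv c ` K' \<subseteq> W" using \<phi>(3) K(4) cinv_chart[OF c] by fastforce
    show "\<eta> p = 0" if "p \<notin> cinv c ` K'" for p
      using that \<phi>(4) cinv_chart[OF c] unfolding \<eta>_def by (metis imageI)
    show "open (fst c \<inter> snd c -` V)"
      by (rule continuous_open_preimage[OF chart_continuous[OF c] chart_open[OF c] \<phi>(5)])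
  qed (use \<phi> K in \<open>auto simp: \<eta>_def\<close>)
qed

section \<open>Tangent vectors in coordinates\<close>

lemma coord_vector_apply:
  "smooth_fun_on A UNIV h \<Longrightarrow> coord_vector A c v p h = frechet_derivative (h \<circ> cinv c) (at (snd c p)) v"
  by (simp add: coord_vector_def)

lemma smooth_fun_cinv: "smooth_fun_on A UNIV h \<Longrightarrow> c \<in> A \<Longrightarrow> p \<in> fst c \<Longrightarrow> smooth_at (h \<circ> cinv c) (snd c p)"
  using smooth_fun_iff msmooth_slice_iff by blast

lemma smooth_fun_comb:
  fixes h k :: "'m \<Rightarrow> real"
  assumes "smooth_fun_on A UNIV h" "smooth_fun_on A UNIV k"
  shows "smooth_fun_on A UNIV (\<lambda>q. a * h q + b * k q)" "smooth_fun_on A UNIV (\<lambda>q. h q * k q)"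
  using assms unfolding smooth_fun_iff by (auto intro!: msmooth_add msmooth_mult msmooth_const)

lemma coord_vector_tangent:
  assumes c: "c \<in> A" "p \<in> fst c"
  shows "coord_vector A c v p \<in> tangent_space A p"
  unfolding tangent_space_def
proof (intro CollectI conjI allI impI)
  fix h k :: "'m \<Rightarrow> real" assume hk: "smooth_fun_on A UNIV h" "smooth_fun_on A UNIV k"
  note d = smooth_at_has_derivative[OF smooth_fun_cinv[OF hk(1) c]]
    smooth_at_has_derivative[OF smooth_fun_cinv[OF hk(2) c]]
  show "coord_vector A c v p (\<lambda>q. a * h q + b * k q) = a * coord_vector A c v p h + b * coord_vector A c v p k" for a b
  proof -
    have "(((\<lambda>q. a * h q + b * k q) \<circ> cinv c) has_derivative (\<lambda>v. a * frechet_derivative (h \<circ> cinv c) (at (snd c p)) v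
        + b * frechet_derivative (k \<circ> cinv c) (at (snd c p)) v)) (at (snd c p))"
      using has_derivative_add[OF has_derivative_mult_right[OF d(1), of a] has_derivative_mult_right[OF d(2), of b]]
      by (simp add: o_def)
    from fun_cong[OF frechet_derivative_at[OF this]] show ?thesis
      using hk by (simp add: coord_vector_apply smooth_fun_comb)
  qed
  have "(((\<lambda>q. h q * k q) \<circ> cinv c) has_derivative (\<lambda>v. h p * frechet_derivative (k \<circ> cinv c) (at (snd c p)) v
      + frechet_derivative (h \<circ> cinv c) (at (snd c p)) v * k p)) (at (snd c p))"
    using has_derivative_mult[OF d] c by (simp add: o_def cinv_chart)
  from fun_cong[OF frechet_derivative_at[OF this], of v]
  show "coord_vector A c v p (\<lambda>q. h q * k q) = coord_vector A c v p h * k p + h p * coord_vector A c v p k"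
    using hk by (simp add: coord_vector_apply smooth_fun_comb)
qed (simp add: coord_vector_def)

lemma coord_vector_comb:
  assumes c: "c \<in> A" "p \<in> fst c"
  shows "coord_vector A c (a *\<^sub>R v + b *\<^sub>R w) p = tcomb a (coord_vector A c v p) b (coord_vector A c w p)"
proof
  fix h :: "'m \<Rightarrow> real"
  show "coord_vector A c (a *\<^sub>R v + b *\<^sub>R w) p h = tcomb a (coord_vector A c v p) b (coord_vector A c w p) h"
  proof (cases "smooth_fun_on A UNIV h")
    case True
    interpret bounded_linear "frechet_derivative (h \<circ> cinv c) (at (snd c p))"
      using has_derivative_bounded_linear[OF smooth_at_has_derivative[OF smooth_fun_cinv[OF True c]]] .
    show ?thesis using True by (simp add: tcomb_def coord_vector_apply add scaleR)
  qed (simp add: tcomb_def coord_vector_def)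
qed

text \<open>Tangent vectors act on global functions only. With a cutoff \<open>\<eta>\<close> that
  is 1 near \<open>p\<close> and supported in \<open>V\<close> one has
  \<open>h = h (1 - \<eta>)\<close>; both factors vanish at \<open>p\<close>, so the product rule
  gives 0.\<close>

lemma tangent_space_local:
  assumes X: "X \<in> tangent_space A p" and h: "smooth_fun_on A UNIV h" and V: "open V" "p \<in> V" "\<And>q. q \<in> V \<Longrightarrow> h q = 0"
  shows "X h = 0"
proof -
  obtain c where c: "c \<in> A" "p \<in> fst c" by (rule chart_exists)
  obtain \<eta> :: "'m \<Rightarrow> real" and K' V' where \<eta>: "\<And>t p. msmooth A (\<lambda>_. \<eta>) t p" "K' \<subseteq> fst c \<inter> V"
    "\<And>p. p \<notin> K' \<Longrightarrow> \<eta> p = 0" "{p} \<subseteq> V'" "\<And>p. p \<in> V' \<Longrightarrow> \<eta> p = 1"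
  proof (rule surface_cutoff[OF c(1), of "{p}" "fst c \<inter> V"])
    show "compact {p}" "{p} \<subseteq> fst c \<inter> V" "open (fst c \<inter> V)" "fst c \<inter> V \<subseteq> fst c"
      using c V chart_open[OF c(1)] by auto
  qed (rule that; assumption)
  have s: "smooth_fun_on A UNIV (\<lambda>q. 1 - \<eta> q)"
    using \<eta>(1) unfolding smooth_fun_iff by (auto intro!: msmooth_diff msmooth_const)
  have eq: "h = (\<lambda>q. h q * (1 - \<eta> q))"
  proof
    show "h q = h q * (1 - \<eta> q)" for q using \<eta>(2) \<eta>(3)[of q] V(3)[of q] by (cases "q \<in> K'") auto
  qed
  have "X (\<lambda>q. h q * (1 - \<eta> q)) = X h * (1 - \<eta> p) + h p * X (\<lambda>q. 1 - \<eta> q)"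
    using X h s unfolding tangent_space_def by blast
  also have "\<dots> = 0" using \<eta>(4,5) V by auto
  finally show ?thesis using eq by simp
qed

text \<open>Every derivation is a coordinate vector: Hadamard's formula writes
  \<open>h - h p\<close> near \<open>p\<close> as a sum of coordinates times smooth functions, and
  the product rule at \<open>p\<close>, where the coordinates \<open>\<xi> i\<close> vanish, leaves
  first derivatives times the values \<open>X (\<xi> i)\<close>. Cutoffs make all functions involved
  global.\<close>

lemma chart_coordinates:
  assumes c: "c \<in> A" "p \<in> fst c"
  obtains \<xi> :: "2 \<Rightarrow> 'm \<Rightarrow> real" and V where "\<And>i. smooth_fun_on A UNIV (\<xi> i)" "open V" "p \<in> V" "V \<subseteq> fst c"
    "\<And>i q. q \<in> V \<Longrightarrow> \<xi> i q = snd c q $ i - snd c p $ i"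
    "\<And>X. X \<in> tangent_space A p \<Longrightarrow> X = coord_vector A c (vec_lambda (\<lambda>i. X (\<xi> i))) p"
proof -
  obtain \<eta> :: "'m \<Rightarrow> real" and K' V0 where \<eta>: "\<And>t p. msmooth A (\<lambda>_. \<eta>) t p" "compact K'" "K' \<subseteq> fst c"
    "\<And>p. p \<notin> K' \<Longrightarrow> \<eta> p = 0" "open V0" "{p} \<subseteq> V0" "\<And>p. p \<in> V0 \<Longrightarrow> \<eta> p = 1"
    by (rule surface_cutoff[OF c(1), of "{p}" "fst c"]) (use c chart_open in auto)
  define V where "V = fst c \<inter> V0"
  have V: "open V" "p \<in> V" "V \<subseteq> fst c" "\<And>q. q \<in> V \<Longrightarrow> \<eta> q = 1"
    using \<eta> c chart_open[OF c(1)] by (auto simp: V_def)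
  have ext: "smooth_fun_on A UNIV (\<lambda>q. \<eta> q * k (snd c q))" if k: "\<And>y. smooth_at k y" for k :: "real^2 \<Rightarrow> real"
    unfolding smooth_fun_iff
  proof
    fix q
    show "msmooth A (\<lambda>_ q. \<eta> q * k (snd c q)) 0 q"
    proof (cases "q \<in> fst c")
      case True
      have "smooth_at (\<lambda>z. k (snd z)) (0::real, snd c q)" by (rule smooth_at_compose_snd) (rule k)
      then have "smooth_at (pull c (\<lambda>_ q. k (snd c q))) (0::real, snd c q)"
        by (rule smooth_at_cong)
          (use eventually_chart[OF c(1) True chart_open[OF c(1)] True, of 0] in
            \<open>eventually_elim, auto simp: pull_def cinv_chart c\<close>)
      then show ?thesis using \<eta>(1) True c by (intro msmooth_mult) (auto simp: msmooth_chart)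
    next
      case False
      show ?thesis
        by (rule msmooth_cong[OF msmooth_const[of 0], of UNIV "- K'"])
          (use \<eta> False in \<open>auto simp: compact_imp_closed open_Compl\<close>)
    qed
  qed
  define y0 where "y0 = snd c p"
  define \<xi> where "\<xi> i q = \<eta> q * (snd c q $ i - y0 $ i)" for i q
  have \<xi>s: "smooth_fun_on A UNIV (\<xi> i)" for i
    unfolding \<xi>_def by (intro ext smooth_at_diff smooth_at_nth smooth_at_id smooth_at_const)
  show ?thesis
  proof (rule that[of \<xi> V])
    show "\<xi> i q = snd c q $ i - snd c p $ i" if "q \<in> V" for i q using V that by (simp add: \<xi>_def y0_def)
    fix X assume X: "X \<in> tangent_space A p"
    have Xlin: "X (\<lambda>q. a * h q + b * k q) = a * X h + b * X k"
      if "smooth_fun_on A UNIV h" "smooth_fun_on A UNIV k" for a b h k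
      using X that unfolding tangent_space_def by blast
    have Xprod: "X (\<lambda>q. h q * k q) = X h * k p + h p * X k"
      if "smooth_fun_on A UNIV h" "smooth_fun_on A UNIV k" for h k
      using X that unfolding tangent_space_def by blast
    have one: "smooth_fun_on A UNIV (\<lambda>_. a :: real)" for a unfolding smooth_fun_iff by (intro allI msmooth_const)
    have X1: "X (\<lambda>_. 1) = 0" using Xprod[OF one one, of 1 1] by simp
    have Xloc: "X h = X k" if h: "smooth_fun_on A UNIV h" "smooth_fun_on A UNIV k" and e: "\<And>q. q \<in> V \<Longrightarrow> h q = k q" for h k
    proof -
      have "X (\<lambda>q. 1 * h q + (-1) * k q) = 0"
        by (rule tangent_space_local[OF X _ V(1,2)]) (use smooth_fun_comb(1)[OF h, of 1 "-1"] e in auto)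
      then show ?thesis using Xlin[OF h, of 1 "-1"] by simp
    qed
    show "X = coord_vector A c (vec_lambda (\<lambda>i. X (\<xi> i))) p"
    proof
      fix h :: "'m \<Rightarrow> real"
      show "X h = coord_vector A c (vec_lambda (\<lambda>i. X (\<xi> i))) p h"
      proof (cases "smooth_fun_on A UNIV h")
        case False
        then show ?thesis using X by (simp add: tangent_space_def coord_vector_def)
      next
        case True
        \<comment> \<open>The coordinate expression of \<open>h\<close>, cut off so that Hadamard's
          lemma applies on the whole plane.\<close>
        define k where "k y = (if y \<in> snd c ` fst c then \<eta> (cinv c y) * h (cinv c y) else 0)" for y
        have ks: "smooth_at k y" for y
        proof (cases "y \<in> snd c ` fst c")
          case True
          then obtain q where q: "q \<in> fst c" "y = snd c q" by blast
          have "smooth_fun_on A UNIV (\<lambda>q. \<eta> q * h q)"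
            using \<eta>(1) \<open>smooth_fun_on A UNIV h\<close> unfolding smooth_fun_iff by (auto intro: msmooth_mult)
          from smooth_fun_cinv[OF this c(1) q(1)] show ?thesis unfolding q(2)
          proof (rule smooth_at_cong)
            show "\<forall>\<^sub>F x in nhds (snd c q). ((\<lambda>q. \<eta> q * h q) \<circ> cinv c) x = k x"
              unfolding eventually_nhds
              by (rule exI[of _ "snd c ` fst c"]) (use chart_image_open[OF c(1)] q in \<open>simp add: k_def\<close>)
          qed
        next
          case False
          have cl: "closed (snd c ` K')"
            using compact_continuous_image[OF continuous_on_subset[OF chart_continuous[OF c(1)] \<eta>(3)] \<eta>(2)] compact_imp_closed by blast
          have "k z = 0" if "z \<notin> snd c ` K'" for z
            using that \<eta>(4)[of "cinv c z"] chart_cinv[of z c] by (cases "cinv c z \<in> K'") (auto simp: k_def cinv_chart c)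
          then show ?thesis
            unfolding smooth_at_def
            using Ck_on_cong[of "- snd c ` K'" k "\<lambda>_. 0"] Ck_on_const[of "- snd c ` K'"] cl False image_mono[OF \<eta>(3), of "snd c"]
            by (intro exI[of _ "- snd c ` K'"]) (auto simp: open_Compl)
        qed
        obtain H where H: "\<And>i y. smooth_at (H i) y" "\<And>i. H i y0 = frechet_derivative k (at y0) (axis i 1)"
          "\<And>y. k y = k y0 + (\<Sum>i\<in>UNIV. (y $ i - y0 $ i) * H i y)"
          by (rule hadamard[OF ks, of y0]) (rule that; assumption)
        have kh: "k (snd c q) = h q" if "q \<in> V" for q
          using that V(3,4) c(1) by (auto simp: k_def cinv_chart subset_iff)
        \<comment> \<open>The Hadamard sum as a global function. The second factors need an
          \<open>\<eta>\<close> of their own, since the product rule asks both factors to be smooth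
          on the whole surface; on \<open>V\<close> it equals 1.\<close>
        define R where "R q = \<xi> 1 q * (\<eta> q * H 1 (snd c q)) + \<xi> 2 q * (\<eta> q * H 2 (snd c q))" for q
        have Hs: "smooth_fun_on A UNIV (\<lambda>q. \<eta> q * H i (snd c q))" for i by (rule ext) (rule H)
        have s1: "smooth_fun_on A UNIV (\<lambda>q. \<xi> i q * (\<eta> q * H i (snd c q)))" for i
          by (rule smooth_fun_comb[OF \<xi>s Hs])
        have Rs: "smooth_fun_on A UNIV R"
          using smooth_fun_comb(1)[OF s1[of 1] s1[of 2], of 1 1] by (simp add: R_def[abs_def])
        have hs: "smooth_fun_on A UNIV (\<lambda>q. 1 * h q + (- h p) * 1)" by (rule smooth_fun_comb[OF True one])
        have "X h = X (\<lambda>q. 1 * h q + (- h p) * 1)" using Xlin[OF True one, of 1 "- h p" 1] X1 by simp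
        also have "\<dots> = X R"
        proof (rule Xloc[OF hs Rs])
          fix q assume q: "q \<in> V"
          have "h q - h p = (\<Sum>i\<in>UNIV. (snd c q $ i - y0 $ i) * H i (snd c q))"
            using H(3)[of "snd c q"] kh[OF q] kh[OF V(2)] by (simp add: y0_def)
          then show "1 * h q + (- h p) * 1 = R q"
            using V(4)[OF q] by (simp add: R_def \<xi>_def sum_2)
        qed
        also have "\<dots> = X (\<lambda>q. \<xi> 1 q * (\<eta> q * H 1 (snd c q))) + X (\<lambda>q. \<xi> 2 q * (\<eta> q * H 2 (snd c q)))"
          using Xlin[OF s1[of 1] s1[of 2], of 1 1] by (simp add: R_def[abs_def])
        also have "\<dots> = X (\<xi> 1) * H 1 y0 + X (\<xi> 2) * H 2 y0"
          using Xprod[OF \<xi>s Hs] V by (simp add: \<xi>_def y0_def)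
        also have "\<dots> = frechet_derivative k (at y0) (vec_lambda (\<lambda>i. X (\<xi> i)))"
        proof -
          interpret bounded_linear "frechet_derivative k (at y0)"
            using has_derivative_bounded_linear[OF smooth_at_has_derivative[OF ks]] .
          have "vec_lambda (\<lambda>i. X (\<xi> i)) = X (\<xi> 1) *\<^sub>R axis 1 1 + X (\<xi> 2) *\<^sub>R (axis 2 1 :: real^2)"
            by (auto simp: vec_eq_iff axis_def forall_2)
          then show ?thesis by (simp add: add scaleR H(2))
        qed
        also have "frechet_derivative k (at y0) = frechet_derivative (h \<circ> cinv c) (at y0)"
        proof (rule frechet_derivative_cong_open)
          show "open (snd c ` (fst c \<inter> V))" using chart_image_subset_open[OF c(1) V(1)] .
          show "y0 \<in> snd c ` (fst c \<inter> V)" using c V by (auto simp: y0_def)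
          show "k y = (h \<circ> cinv c) y" if "y \<in> snd c ` (fst c \<inter> V)" for y
            using that kh cinv_chart[OF c(1)] by auto
        qed
        finally show ?thesis using True by (simp add: coord_vector_apply y0_def)
      qed
    qed
  qed (use V \<xi>s in auto)
qed

lemma coord_vector_coordinate:
  assumes c: "c \<in> A" "p \<in> fst c" and \<xi>: "smooth_fun_on A UNIV \<xi>" "open V" "p \<in> V" "V \<subseteq> fst c"
    "\<And>q. q \<in> V \<Longrightarrow> \<xi> q = snd c q $ i - a"
  shows "coord_vector A c v p \<xi> = v $ i"
proof -
  have "frechet_derivative (\<xi> \<circ> cinv c) (at (snd c p)) = frechet_derivative (\<lambda>y. y $ i - a) (at (snd c p))"
  proof (rule frechet_derivative_cong_open)
    show "open (snd c ` (fst c \<inter> V))" using chart_image_subset_open[OF c(1) \<xi>(2)] .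
  qed (use c \<xi> cinv_chart in auto)
  also have "\<dots> = (\<lambda>v. v $ i)"
    by (rule frechet_derivative_at[symmetric])
      (auto intro!: derivative_eq_intros bounded_linear_imp_has_derivative)
  finally show ?thesis using \<xi>(1) by (simp add: coord_vector_apply)
qed

lemma tangent_space_eq:
  assumes "c \<in> A" "p \<in> fst c"
  shows "tangent_space A p = range (\<lambda>v. coord_vector A c v p)"
  using chart_coordinates[OF assms] coord_vector_tangent[OF assms] by (metis (no_types, lifting) image_subset_iff rangeI subsetI subset_antisym)

lemma coord_vector_inj:
  assumes "c \<in> A" "p \<in> fst c" "coord_vector A c v p = coord_vector A c w p"
  shows "v = w"
proof -
  obtain \<xi> :: "2 \<Rightarrow> 'm \<Rightarrow> real" and V where \<xi>: "\<And>i. smooth_fun_on A UNIV (\<xi> i)" "open V" "p \<in> V" "V \<subseteq> fst c"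
    "\<And>i q. q \<in> V \<Longrightarrow> \<xi> i q = snd c q $ i - snd c p $ i"
    using chart_coordinates[OF assms(1,2)] by (metis (no_types, lifting))
  have "v $ i = w $ i" for i
    using coord_vector_coordinate[OF assms(1,2) \<xi>(1-5)] assms(3) by metis
  then show ?thesis by (simp add: vec_eq_iff)
qed

lemma differential_coord_vector:
  assumes "smooth_fun_on A UNIV f" "c \<in> A" "p \<in> fst c"
  shows "differential f (coord_vector A c v p) = frechet_derivative (f \<circ> cinv c) (at (snd c p)) v"
proof -
  have d: "((f \<circ> cinv c) has_derivative frechet_derivative (f \<circ> cinv c) (at (snd c p))) (at (snd c p))"
    using smooth_at_has_derivative[OF smooth_fun_cinv[OF assms]] .
  have "smooth_fun_on A UNIV (\<lambda>q. f q $ i)" for i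
    using assms(1) unfolding smooth_fun_iff by (auto intro: msmooth_nth)
  moreover have "frechet_derivative ((\<lambda>q. f q $ i) \<circ> cinv c) (at (snd c p)) v
      = frechet_derivative (f \<circ> cinv c) (at (snd c p)) v $ i" for i
    using fun_cong[OF frechet_derivative_at[OF bounded_linear.has_derivative[OF bounded_linear_vec_nth d]], of v]
    by (simp add: o_def)
  ultimately show ?thesis
    by (simp add: differential_def vec_eq_iff coord_vector_apply)
qed

end

section \<open>Forms in coordinates\<close>

text \<open>The relation is read off from the triple product identity for
  \<open>b x (a x b)\<close>.\<close>

lemma cross3_zero_imp_dependent:
  fixes a b :: "real^3"
  assumes "cross3 a b = 0"
  obtains s t where "(s, t) \<noteq> (0, 0)" "s *\<^sub>R a + t *\<^sub>R b = 0"
proof (cases "b = 0")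
  case True
  show ?thesis by (rule that[of 0 1]) (use True in auto)
next
  case False
  have "(b \<bullet> b) *\<^sub>R a + (- (a \<bullet> b)) *\<^sub>R b = cross3 b (cross3 a b)"
    by (simp add: cross3_simps forall_3)
  then show ?thesis using that[of "b \<bullet> b" "- (a \<bullet> b)"] False assms by auto
qed

lemma cross3_nonzero_independent:
  fixes a b :: "real^3"
  assumes "cross3 a b \<noteq> 0" "s *\<^sub>R a + t *\<^sub>R b = 0"
  shows "s = 0" "t = 0"
proof -
  have "cross3 (s *\<^sub>R a + t *\<^sub>R b) b = s *\<^sub>R cross3 a b" "cross3 a (s *\<^sub>R a + t *\<^sub>R b) = t *\<^sub>R cross3 a b"
    by (simp_all add: cross_add_left cross_add_right cross_mult_left cross_mult_right)
  then show "s = 0" "t = 0" using assms by auto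
qed

lemma vec2_eq_axis: "v = v $ 1 *\<^sub>R axis 1 1 + v $ 2 *\<^sub>R (axis 2 1 :: real^2)"
  by (auto simp: vec_eq_iff axis_def forall_2)

context surface begin

lemma tangent_linear_coord:
  assumes "tangent_linear A p \<alpha>" "c \<in> A" "p \<in> fst c"
  shows "\<alpha> (coord_vector A c v p)
    = v $ 1 *\<^sub>R \<alpha> (coord_vector A c (axis 1 1) p) + v $ 2 *\<^sub>R \<alpha> (coord_vector A c (axis 2 1) p)"
  using assms(1) coord_vector_tangent[OF assms(2,3)]
  by (subst vec2_eq_axis[of v]) (simp only: coord_vector_comb[OF assms(2,3)] tangent_linear_def)

text \<open>Turns injectivity on a tangent plane into the non-vanishing of one cross product, the
  condition under which the corrugation operates.\<close>

lemma inj_form_iff: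
  fixes \<alpha> :: "'m tangent \<Rightarrow> real^3"
  assumes lin: "tangent_linear A p \<alpha>" and c: "c \<in> A" "p \<in> fst c"
  shows "inj_on \<alpha> (tangent_space A p)
    \<longleftrightarrow> cross3 (\<alpha> (coord_vector A c (axis 1 1) p)) (\<alpha> (coord_vector A c (axis 2 1) p)) \<noteq> 0"
proof
  assume inj: "inj_on \<alpha> (tangent_space A p)"
  show "cross3 (\<alpha> (coord_vector A c (axis 1 1) p)) (\<alpha> (coord_vector A c (axis 2 1) p)) \<noteq> 0"
  proof
    assume "cross3 (\<alpha> (coord_vector A c (axis 1 1) p)) (\<alpha> (coord_vector A c (axis 2 1) p)) = 0"
    then obtain s t where st: "(s, t) \<noteq> (0, 0)"
      "s *\<^sub>R \<alpha> (coord_vector A c (axis 1 1) p) + t *\<^sub>R \<alpha> (coord_vector A c (axis 2 1) p) = 0"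
      by (rule cross3_zero_imp_dependent)
    define v :: "real^2" where "v = vector [s, t]"
    have "\<alpha> (coord_vector A c v p) = 0" "\<alpha> (coord_vector A c 0 p) = 0"
      using st(2) tangent_linear_coord[OF lin c, of v] tangent_linear_coord[OF lin c, of 0] by (simp_all add: v_def vector_2)
    then have "coord_vector A c v p = coord_vector A c 0 p"
      using inj coord_vector_tangent[OF c] unfolding inj_on_def by metis
    then have "v = 0" using coord_vector_inj[OF c] by blast
    then show False using st(1) by (auto simp: v_def vec_eq_iff forall_2 vector_2)
  qed
next
  assume cr: "cross3 (\<alpha> (coord_vector A c (axis 1 1) p)) (\<alpha> (coord_vector A c (axis 2 1) p)) \<noteq> 0"
  show "inj_on \<alpha> (tangent_space A p)"
    unfolding tangent_space_eq[OF c]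
  proof (rule inj_onI, elim rangeE, hypsubst)
    fix v w assume "\<alpha> (coord_vector A c v p) = \<alpha> (coord_vector A c w p)"
    then have "(v $ 1 - w $ 1) *\<^sub>R \<alpha> (coord_vector A c (axis 1 1) p)
        + (v $ 2 - w $ 2) *\<^sub>R \<alpha> (coord_vector A c (axis 2 1) p) = 0"
      using tangent_linear_coord[OF lin c, of v] tangent_linear_coord[OF lin c, of w] by (simp add: algebra_simps)
    from cross3_nonzero_independent[OF cr this]
    show "coord_vector A c v p = coord_vector A c w p"
      by (metis (no_types) right_minus_eq vec2_eq_axis)
  qed
qed

text \<open>Jointly smooth in time and space, for all real times and not just for
  \<open>[0, 1]\<close>, so that the coordinate domain is open. The homotopies built below are
  constant near their ends and extend by themselves.\<close>

definition form_smooth :: "(real \<Rightarrow> 'm \<Rightarrow> 'm tangent \<Rightarrow> 'b::euclidean_space) \<Rightarrow> bool" where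
  "form_smooth \<Phi> \<longleftrightarrow> (\<forall>t p. \<forall>c\<in>A. p \<in> fst c \<longrightarrow> (\<forall>v. msmooth A (\<lambda>t q. \<Phi> t q (coord_vector A c v q)) t p))"

lemma form_smoothD:
  "form_smooth \<Phi> \<Longrightarrow> c \<in> A \<Longrightarrow> p \<in> fst c \<Longrightarrow> msmooth A (\<lambda>t q. \<Phi> t q (coord_vector A c v q)) t p"
  unfolding form_smooth_def by blast

lemma smooth_form_on_iff: "smooth_form_on A UNIV \<alpha> \<longleftrightarrow> form_smooth (\<lambda>_. \<alpha>)"
proof -
  have "smooth_form_on A UNIV \<alpha> \<longleftrightarrow> (\<forall>t. \<forall>c\<in>A. \<forall>v. \<forall>p\<in>fst c. msmooth A (\<lambda>_ q. \<alpha> q (coord_vector A c v q)) t p)"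
    unfolding smooth_form_on_def Int_UNIV_right using smooth_fun_on_iff[OF chart_open] by blast
  then show ?thesis unfolding form_smooth_def by blast
qed

lemma form_smooth_slice: "form_smooth \<Phi> \<Longrightarrow> form_smooth (\<lambda>_. \<Phi> s)"
  unfolding form_smooth_def using msmooth_slice[where s = s] by blast

lemma form_smooth_add: "form_smooth \<Phi> \<Longrightarrow> form_smooth \<Psi> \<Longrightarrow> form_smooth (\<lambda>t p X. \<Phi> t p X + \<Psi> t p X)"
  and form_smooth_diff: "form_smooth \<Phi> \<Longrightarrow> form_smooth \<Psi> \<Longrightarrow> form_smooth (\<lambda>t p X. \<Phi> t p X - \<Psi> t p X)"
  unfolding form_smooth_def by (auto intro: msmooth_add msmooth_diff)

lemma form_smooth_scaleR:
  "(\<And>t p. msmooth A r t p) \<Longrightarrow> form_smooth \<Phi> \<Longrightarrow> form_smooth (\<lambda>t p X. r t p *\<^sub>R \<Phi> t p X)"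
  unfolding form_smooth_def by (auto intro: msmooth_scaleR)

lemma tangent_linear_add:
    "tangent_linear A p \<alpha> \<Longrightarrow> tangent_linear A p \<beta> \<Longrightarrow> tangent_linear A p (\<lambda>X. \<alpha> X + \<beta> X)"
  and tangent_linear_diff:
    "tangent_linear A p \<alpha> \<Longrightarrow> tangent_linear A p \<beta> \<Longrightarrow> tangent_linear A p (\<lambda>X. \<alpha> X - \<beta> X)"
  and tangent_linear_scaleR: "tangent_linear A p \<alpha> \<Longrightarrow> tangent_linear A p (\<lambda>X. r *\<^sub>R \<alpha> X)"
  unfolding tangent_linear_def by (simp_all add: algebra_simps)

lemma tangent_linear_linear:
  "linear h \<Longrightarrow> tangent_linear A p \<alpha> \<Longrightarrow> tangent_linear A p (\<lambda>X. h (\<alpha> X))"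
  unfolding tangent_linear_def by (simp add: linear_add linear_cmul)

lemma tangent_linear_differential: "tangent_linear A p (differential f)"
  unfolding tangent_linear_def differential_def tcomb_def by (simp add: vec_eq_iff)

section \<open>Differentials of smooth families of maps\<close>

lemma slice_derivative:
  fixes k :: "real \<times> (real^2) \<Rightarrow> 'b::euclidean_space"
  assumes "smooth_at k (s, y)"
  shows "frechet_derivative (\<lambda>y. k (s, y)) (at y) v = frechet_derivative k (at (s, y)) (0, v)"
proof -
  have "((\<lambda>y. (s, y)) has_derivative (\<lambda>v. (0, v))) (at y)" by (auto intro!: derivative_eq_intros)
  from has_derivative_compose[OF this smooth_at_has_derivative[OF assms]]
  show ?thesis using frechet_derivative_at by metis
qed

lemma msmooth_imp_smooth_fun: "(\<And>t p. msmooth A G t p) \<Longrightarrow> smooth_fun_on A UNIV (G t)"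
  unfolding smooth_fun_iff using msmooth_slice by blast

lemma differential_pull:
  assumes "\<And>t p. msmooth A G t p" "c \<in> A" "y \<in> snd c ` fst c"
  shows "differential (G t) (coord_vector A c v (cinv c y)) = frechet_derivative (pull c G) (at (t, y)) (0, v)"
proof -
  have "smooth_at (pull c G) (t, y)"
    using msmooth_chart[OF assms(2) cinv_in[OF assms(3)], of G t] assms(1) chart_cinv[OF assms(3)] by simp
  from slice_derivative[OF this] show ?thesis
    using differential_coord_vector[OF msmooth_imp_smooth_fun[OF assms(1)] assms(2) cinv_in[OF assms(3)], of t v]
      chart_cinv[OF assms(3)] by (simp add: pull_def o_def)
qed

lemma form_smooth_differential:
  assumes "\<And>t p. msmooth A G t p" shows "form_smooth (\<lambda>t p. differential (G t))"
  unfolding form_smooth_def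
proof (intro allI ballI impI)
  fix t p c v assume c: "c \<in> A" "p \<in> fst c"
  have "smooth_at (\<lambda>z. frechet_derivative (pull c G) (at z) (0, v)) (t, snd c p)"
    by (rule smooth_at_frechet_derivative) (use assms msmooth_chart[OF c] in blast)
  then have "smooth_at (pull c (\<lambda>t q. differential (G t) (coord_vector A c v q))) (t, snd c p)"
  proof (rule smooth_at_cong)
    show "\<forall>\<^sub>F z in nhds (t, snd c p). frechet_derivative (pull c G) (at z) (0, v)
        = pull c (\<lambda>t q. differential (G t) (coord_vector A c v q)) z"
      using eventually_chart[OF c chart_open[OF c(1)] c(2), of t]
      by eventually_elim (use differential_pull[OF assms c(1)] in \<open>simp add: pull_def\<close>)
  qed
  then show "msmooth A (\<lambda>t q. differential (G t) (coord_vector A c v q)) t p" unfolding msmooth_chart[OF c] .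
qed

lemma differential_local:
  assumes X: "X \<in> tangent_space A p" and f: "smooth_fun_on A UNIV f" "smooth_fun_on A UNIV g"
    and V: "open V" "p \<in> V" "\<And>q. q \<in> V \<Longrightarrow> f q = g q"
  shows "differential f X = differential g X"
proof -
  have s: "smooth_fun_on A UNIV (\<lambda>q. f q $ i)" "smooth_fun_on A UNIV (\<lambda>q. g q $ i)" for i
    using f unfolding smooth_fun_iff by (auto intro: msmooth_nth)
  have "X (\<lambda>q. f q $ i) = X (\<lambda>q. g q $ i)" for i
  proof -
    have "X (\<lambda>q. 1 * f q $ i + (-1) * g q $ i) = 0"
      by (rule tangent_space_local[OF X smooth_fun_comb(1)[OF s] V(1,2)]) (use V(3) in auto)
    moreover have "X (\<lambda>q. 1 * f q $ i + (-1) * g q $ i) = 1 * X (\<lambda>q. f q $ i) + (-1) * X (\<lambda>q. g q $ i)"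
      using X s unfolding tangent_space_def by blast
    ultimately show ?thesis by simp
  qed
  then show ?thesis by (simp add: differential_def)
qed

lemma differential_comb:
  assumes X: "X \<in> tangent_space A p" and f: "smooth_fun_on A UNIV f" "smooth_fun_on A UNIV g"
  shows "differential (\<lambda>q. a *\<^sub>R f q + b *\<^sub>R g q) X = a *\<^sub>R differential f X + b *\<^sub>R differential g X"
proof -
  have s: "smooth_fun_on A UNIV (\<lambda>q. f q $ i)" "smooth_fun_on A UNIV (\<lambda>q. g q $ i)" for i
    using f unfolding smooth_fun_iff by (auto intro: msmooth_nth)
  have "X (\<lambda>q. a * f q $ i + b * g q $ i) = a * X (\<lambda>q. f q $ i) + b * X (\<lambda>q. g q $ i)" for i
    using X s unfolding tangent_space_def by blast
  then show ?thesis by (simp add: differential_def vec_eq_iff)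
qed

lemma differential_add:
  assumes "X \<in> tangent_space A p" "smooth_fun_on A UNIV f" "smooth_fun_on A UNIV g"
  shows "differential (\<lambda>q. f q + g q) X = differential f X + differential g X"
  using differential_comb[OF assms, of 1 1] by simp

section \<open>The h-principle\<close>

text \<open>The corrugation takes place in the coordinate domain \<open>(0, 1) x W\<close>. Compact
  support there makes the correction vanish off the open time interval and lets it be continued by 0
  beyond the chart. The set \<open>W\<close> may be smaller than the chart domain, which later
  protects the regions already finished.\<close>

lemma h_principle_step:
  fixes \<Psi> \<beta> :: "real \<Rightarrow> 'm \<Rightarrow> 'm tangent \<Rightarrow> real^3"
  assumes c: "c \<in> A" and W: "open W" "W \<subseteq> fst c" and K: "compact K" "K \<subseteq> W"
    and \<Psi>: "form_smooth \<Psi>" "\<And>t p. tangent_linear A p (\<Psi> t p)" "\<And>t p. inj_on (\<Psi> t p) (tangent_space A p)"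
    and \<beta>: "form_smooth \<beta>" "\<And>t p. tangent_linear A p (\<beta> t p)"
    and \<delta>: "\<delta> > 0" and \<beta>0: "\<And>t p X. X \<in> tangent_space A p \<Longrightarrow> t \<notin> {\<delta>..1 - \<delta>} \<or> p \<notin> K \<Longrightarrow> \<beta> t p X = 0"
  obtains g where "\<And>t p. msmooth A g t p" "\<And>t p. t \<notin> {0<..<1} \<or> p \<notin> W \<Longrightarrow> g t p = 0"
    "\<And>t p. inj_on (\<lambda>X. \<Psi> t p X - \<beta> t p X + differential (g t) X) (tangent_space A p)"
proof -
  define \<Omega> where "\<Omega> = {0<..<1::real} \<times> snd c ` W"
  define u where "u i = pull c (\<lambda>t q. \<Psi> t q (coord_vector A c (axis i 1) q))" for i
  define a where "a i z = (if snd z \<in> snd c ` fst c then pull c (\<lambda>t q. \<beta> t q (coord_vector A c (axis i 1) q)) z else 0)" for i z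
  have Wc: "fst c \<inter> W = W" using W by auto
  have opW: "open (snd c ` W)" using chart_image_subset_open[OF c W(1)] Wc by simp
  then have op: "open \<Omega>" unfolding \<Omega>_def by (intro open_Times) auto
  have xK: "compact (snd c ` K)"
    using compact_continuous_image[OF continuous_on_subset[OF chart_continuous[OF c]]] K W by blast
  have KW: "snd c ` K \<subseteq> snd c ` W" "snd c ` W \<subseteq> snd c ` fst c" using K W by auto
  have a0: "a i z = 0" if "z \<notin> {\<delta>..1 - \<delta>} \<times> snd c ` K" for i z
  proof (cases "snd z \<in> snd c ` fst c")
    case True
    have "fst z \<notin> {\<delta>..1 - \<delta>} \<or> cinv c (snd z) \<notin> K"
      using that chart_cinv[OF True] by (metis SigmaI imageI prod.collapse)
    then show ?thesis using \<beta>0[OF coord_vector_tangent[OF c cinv_in[OF True]]] by (simp add: a_def pull_def)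
  qed (simp add: a_def)
  have as: "smooth_at (a i) z" for i z
  proof (cases "snd z \<in> snd c ` fst c")
    case True
    then obtain q where q: "q \<in> fst c" "snd z = snd c q" by blast
    have "smooth_at (pull c (\<lambda>t q. \<beta> t q (coord_vector A c (axis i 1) q))) (fst z, snd c q)"
      using form_smoothD[OF \<beta>(1) c q(1)] msmooth_chart[OF c q(1)] by blast
    then have "smooth_at (pull c (\<lambda>t q. \<beta> t q (coord_vector A c (axis i 1) q))) z" using q(2) by (metis prod.collapse)
    then show ?thesis
    proof (rule smooth_at_cong)
      have "\<forall>\<^sub>F w in nhds z. snd w \<in> snd c ` fst c"
        unfolding eventually_nhds
        by (rule exI[of _ "UNIV \<times> snd c ` fst c"])
          (use True chart_image_open[OF c] in \<open>auto intro!: open_Times simp: mem_Times_iff\<close>)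
      then show "\<forall>\<^sub>F w in nhds z. pull c (\<lambda>t q. \<beta> t q (coord_vector A c (axis i 1) q)) w = a i w"
        by eventually_elim (simp add: a_def)
    qed
  next
    case False
    have "\<forall>\<^sub>F w in nhds z. 0 = a i w"
      unfolding eventually_nhds
    proof (rule exI[of _ "- ({\<delta>..1 - \<delta>} \<times> snd c ` K)"], intro conjI ballI)
      show "open (- ({\<delta>..1 - \<delta>} \<times> snd c ` K))"
        using xK by (intro open_Compl closed_Times) (auto simp: compact_imp_closed)
      show "z \<in> - ({\<delta>..1 - \<delta>} \<times> snd c ` K)" using False KW by (auto simp: mem_Times_iff)
    qed (use a0 in auto)
    then show ?thesis by (rule smooth_at_cong[OF smooth_at_const])
  qed
  have us: "smooth_at (u i) z" if z: "z \<in> \<Omega>" for i z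
  proof -
    obtain q where q: "q \<in> fst c" "snd z = snd c q" using z W by (auto simp: \<Omega>_def)
    have "smooth_at (u i) (fst z, snd c q)"
      using form_smoothD[OF \<Psi>(1) c q(1)] msmooth_chart[OF c q(1)] unfolding u_def by blast
    then show ?thesis using q(2) by (metis prod.collapse)
  qed
  have indep: "cross3 (u 1 z) (u 2 z) \<noteq> 0" if z: "z \<in> \<Omega>" for z
  proof -
    have "cinv c (snd z) \<in> fst c" using z KW(2) by (intro cinv_in) (auto simp: \<Omega>_def)
    from inj_form_iff[OF \<Psi>(2) c this] \<Psi>(3) show ?thesis by (simp add: u_def pull_def)
  qed
  have Ka: "compact ({\<delta>..1 - \<delta>} \<times> snd c ` K)" "{\<delta>..1 - \<delta>} \<times> snd c ` K \<subseteq> \<Omega>"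
    using xK KW(1) \<delta> by (auto intro!: compact_Times simp: \<Omega>_def)
  \<comment> \<open>Both directions have time component 0, so only spatial derivatives of the
    correction occur.\<close>
  let ?d1 = "(0::real, axis 1 1 :: real^2)" and ?d2 = "(0::real, axis 2 1 :: real^2)"
  have d: "?d1 \<bullet> ?d1 = 1" "?d1 \<bullet> ?d2 = 0" "?d2 \<bullet> ?d2 = 1" by (auto simp: inner_axis_axis)
  obtain g0 K0 where g0: "\<And>z. smooth_at g0 z" "compact K0" "K0 \<subseteq> \<Omega>" "\<And>z. z \<notin> K0 \<Longrightarrow> g0 z = 0"
    "\<And>z. z \<in> \<Omega> \<Longrightarrow> cross3 (u 1 z - a 1 z + frechet_derivative g0 (at z) ?d1)
                          (u 2 z - a 2 z + frechet_derivative g0 (at z) ?d2) \<noteq> 0"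
    by (rule corrugation[OF op us[of _ 1] us[of _ 2] indep as[of 1] as[of 2] Ka a0[of _ 1] a0[of _ 2] d])
      (assumption | rule that)+
  define g where "g t p = (if p \<in> fst c then g0 (t, snd c p) else 0)" for t p
  have K0s: "compact (snd ` K0)" "snd ` K0 \<subseteq> snd c ` fst c"
    using g0(2,3) KW(2) by (auto intro!: compact_continuous_image continuous_intros simp: \<Omega>_def) blast
  have gs: "msmooth A g t p" for t p
    unfolding g_def
    by (rule msmooth_extend_zero[OF c g0(1) K0s]) (use g0(4) in \<open>force simp: image_iff\<close>)
  show ?thesis
  proof (rule that[of g])
    show "msmooth A g t p" for t p by (rule gs)
    show "g t p = 0" if "t \<notin> {0<..<1} \<or> p \<notin> W" for t p
    proof (cases "p \<in> fst c")
      case True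
      have "(t, snd c p) \<notin> \<Omega>"
      proof
        assume "(t, snd c p) \<in> \<Omega>"
        then obtain q where "q \<in> W" "snd c p = snd c q" "t \<in> {0<..<1}" by (auto simp: \<Omega>_def)
        then show False using that cinv_chart[OF c] True W(2) by (metis in_mono)
      qed
      then show ?thesis using g0(3,4) True by (auto simp: g_def)
    qed (simp add: g_def)
    fix t p
    show "inj_on (\<lambda>X. \<Psi> t p X - \<beta> t p X + differential (g t) X) (tangent_space A p)"
    proof (cases "p \<in> fst c \<and> (t, snd c p) \<in> \<Omega>")
      case True
      then have p: "p \<in> fst c" "cinv c (snd c p) = p" "snd c p \<in> snd c ` fst c" using cinv_chart[OF c] by auto
      have "frechet_derivative (pull c g) (at (t, snd c p)) = frechet_derivative g0 (at (t, snd c p))"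
        by (rule frechet_derivative_cong_open[of "UNIV \<times> snd c ` fst c"])
          (use p chart_image_open[OF c] in \<open>auto intro!: open_Times simp: pull_def g_def cinv_chart[OF c]\<close>)
      with differential_pull[OF gs c p(3)] p
      have "differential (g t) (coord_vector A c v p) = frechet_derivative g0 (at (t, snd c p)) (0, v)" for v
        by simp
      moreover have "u i (t, snd c p) = \<Psi> t p (coord_vector A c (axis i 1) p)"
        "a i (t, snd c p) = \<beta> t p (coord_vector A c (axis i 1) p)" for i
        using p by (auto simp: u_def a_def pull_def)
      ultimately show ?thesis
        using g0(5)[of "(t, snd c p)"] True
          inj_form_iff[OF tangent_linear_add[OF tangent_linear_diff[OF \<Psi>(2) \<beta>(2)] tangent_linear_differential] c p(1)]
        by simp
    next
      case False
      \<comment> \<open>The support at the fixed time \<open>t\<close>. Its image in the surface is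
        closed, so \<open>g t\<close> vanishes on a whole neighbourhood of \<open>p\<close>, and
        with it the differential there.\<close>
      let ?Kt = "{y. (t, y) \<in> K0}"
      have "compact (snd ` (K0 \<inter> {t} \<times> UNIV))"
        using g0(2) by (intro compact_continuous_image compact_Int_closed continuous_intros closed_Times) auto
      moreover have Kt: "snd ` (K0 \<inter> {t} \<times> UNIV) = ?Kt" by force
      ultimately have "compact ?Kt" by simp
      moreover have "?Kt \<subseteq> snd c ` fst c" using K0s(2) by force
      ultimately have cl: "closed (cinv c ` ?Kt)" using cinv_image_compact[OF c] by blast
      have V: "open (- cinv c ` ?Kt)" "p \<in> - cinv c ` ?Kt"
      proof -
        show "open (- cinv c ` ?Kt)" using cl by auto
        show "p \<in> - cinv c ` ?Kt"
        proof
          assume "p \<in> cinv c ` ?Kt"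
          then obtain y where y: "p = cinv c y" "(t, y) \<in> K0" by blast
          then have "y \<in> snd c ` fst c" "(t, y) \<in> \<Omega>" using K0s(2) g0(3) by force+
          then show False using False y cinv_in chart_cinv by metis
        qed
      qed
      have z: "g t q = 0" if "q \<in> - cinv c ` ?Kt" for q
      proof (cases "q \<in> fst c")
        case True
        then have "(t, snd c q) \<notin> K0" using that cinv_chart[OF c True] by (metis ComplD imageI mem_Collect_eq)
        then show ?thesis using g0(4) by (simp add: g_def)
      qed (simp add: g_def)
      have "differential (g t) X = 0" if "X \<in> tangent_space A p" for X
      proof -
        have "differential (g t) X = differential (\<lambda>_. 0) X"
          by (rule differential_local[OF that msmooth_imp_smooth_fun[OF gs] _ V z])
            (unfold smooth_fun_iff, intro allI msmooth_const)
        also have "\<dots> = 0"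
        proof -
          have "smooth_fun_on A UNIV (\<lambda>_. 0::real^3)" unfolding smooth_fun_iff by (intro allI msmooth_const)
          from differential_comb[OF that this this, of 0 0] show ?thesis by simp
        qed
        finally show ?thesis .
      qed
      moreover have "\<beta> t p X = 0" if "X \<in> tangent_space A p" for X
      proof (rule \<beta>0[OF that])
        show "t \<notin> {\<delta>..1 - \<delta>} \<or> p \<notin> K" using False \<delta> K(2) W(2) by (force simp: \<Omega>_def)
      qed
      ultimately show ?thesis using \<Psi>(3)[of t p] by (simp add: inj_on_def)
    qed
  qed
qed

text \<open>Second countability enters here, through the Lindelof property. A finite cover is
  enumerated with repetitions, which do no harm.\<close>

lemma countable_compact_chart_cover:
  obtains c :: "nat \<Rightarrow> 'm chart" and K :: "nat \<Rightarrow> 'm set"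
  where "\<And>j. c j \<in> A" "\<And>j. compact (K j)" "\<And>j. K j \<subseteq> fst (c j)" "\<And>p. \<exists>j. p \<in> interior (K j)"
proof -
  have "\<exists>c K V. c \<in> A \<and> compact K \<and> K \<subseteq> fst c \<and> open V \<and> V \<subseteq> K \<and> p \<in> V" for p
  proof -
    obtain c where c: "c \<in> A" "p \<in> fst c" by (rule chart_exists)
    then obtain e where e: "e > 0" "cball (snd c p) e \<subseteq> snd c ` fst c"
      using chart_image_open[OF c(1)] open_contains_cball by blast
    let ?K = "cinv c ` cball (snd c p) e" and ?V = "fst c \<inter> snd c -` ball (snd c p) e"
    have "compact ?K" using cinv_image_compact[OF c(1) _ e(2)] by simp
    moreover have "?K \<subseteq> fst c" using e(2) cinv_in[of _ c] by (auto simp: subset_iff)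
    moreover have "open ?V" by (rule continuous_open_preimage[OF chart_continuous[OF c(1)] chart_open[OF c(1)]]) simp
    moreover have "?V \<subseteq> ?K"
    proof
      fix q assume "q \<in> ?V"
      then show "q \<in> ?K" using cinv_chart[OF c(1), of q] by (intro image_eqI[of _ _ "snd c q"]) auto
    qed
    ultimately show ?thesis using c e by (intro exI[of _ c] exI[of _ ?K] exI[of _ ?V]) auto
  qed
  then obtain C K V where CKV: "\<And>p. C p \<in> A" "\<And>p. compact (K p)" "\<And>p. K p \<subseteq> fst (C p)"
    "\<And>p. open (V p)" "\<And>p. V p \<subseteq> K p" "\<And>p. p \<in> V p" by metis
  obtain F where F: "F \<subseteq> range V" "countable F" "\<Union>F = \<Union>(range V)"
    using Lindelof[of "range V"] CKV(4) by auto
  have ne: "F \<noteq> {}" using F(3) CKV(6) by auto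
  have "\<exists>P. \<forall>j. from_nat_into F j = V (P j)"
    using from_nat_into[OF ne] F(1) by (intro choice) blast
  then obtain P where P: "\<And>j. from_nat_into F j = V (P j)" by blast
  show ?thesis
  proof (rule that[of "\<lambda>j. C (P j)" "\<lambda>j. K (P j)"])
    fix p
    have "p \<in> \<Union>F" unfolding F(3) using CKV(6)[of p] by auto
    then obtain S where "S \<in> F" "p \<in> S" by blast
    then obtain j where "p \<in> V (P j)" using from_nat_into_surj[OF F(2)] P by metis
    then show "\<exists>j. p \<in> interior (K (P j))" using CKV(4,5) interior_maximal by (metis in_mono)
  qed (use CKV in auto)
qed

text \<open>The cutoffs \<open>\<eta> j\<close> equal 1 near \<open>K j\<close>, so the \<open>j\<close>-th correction can be kept away from
  \<open>K i\<close> for all \<open>i < j\<close>: on \<open>K i\<close> the iteration stops after step \<open>i\<close>, and no further local finiteness is needed.\<close>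

theorem h_principle:
  fixes \<Phi> \<alpha> :: "real \<Rightarrow> 'm \<Rightarrow> 'm tangent \<Rightarrow> real^3"
  assumes \<Phi>: "form_smooth \<Phi>" "\<And>t p. tangent_linear A p (\<Phi> t p)" "\<And>t p. inj_on (\<Phi> t p) (tangent_space A p)"
    and \<alpha>: "form_smooth \<alpha>" "\<And>t p. tangent_linear A p (\<alpha> t p)"
    and \<delta>: "\<delta> > 0" and \<alpha>0: "\<And>t p X. X \<in> tangent_space A p \<Longrightarrow> t \<notin> {\<delta>..1 - \<delta>} \<Longrightarrow> \<alpha> t p X = 0"
  obtains G where "\<And>t p. msmooth A G t p" "\<And>t p. t \<notin> {0<..<1} \<Longrightarrow> G t p = 0"
    "\<And>t p. inj_on (\<lambda>X. \<Phi> t p X - \<alpha> t p X + differential (G t) X) (tangent_space A p)"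
proof -
  obtain c :: "nat \<Rightarrow> 'm chart" and K where c: "\<And>j. c j \<in> A" and K: "\<And>j. compact (K j)" "\<And>j. K j \<subseteq> fst (c j)"
    and cover: "\<And>p. \<exists>j. p \<in> interior (K j)"
    by (rule countable_compact_chart_cover) (rule that; assumption)
  have "\<exists>\<eta> :: 'm \<Rightarrow> real. \<exists>K' V. (\<forall>t p. msmooth A (\<lambda>_. \<eta>) t p) \<and> compact K' \<and> K' \<subseteq> fst (c j) \<and>
    (\<forall>p. p \<notin> K' \<longrightarrow> \<eta> p = 0) \<and> open V \<and> K j \<subseteq> V \<and> (\<forall>p\<in>V. \<eta> p = 1)" for j
  proof (rule surface_cutoff[OF c[of j] K(1)[of j] K(2)[of j] chart_open[OF c] order_refl])
    fix \<eta> :: "'m \<Rightarrow> real" and K' V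
    assume "\<And>t p. msmooth A (\<lambda>_. \<eta>) t p" "compact K'" "K' \<subseteq> fst (c j)" "\<And>p. p \<notin> K' \<Longrightarrow> \<eta> p = 0"
      "open V" "K j \<subseteq> V" "\<And>p. p \<in> V \<Longrightarrow> \<eta> p = 1"
    then show ?thesis by (intro exI[of _ \<eta>] exI[of _ K'] exI[of _ V]) simp
  qed
  then obtain \<eta> :: "nat \<Rightarrow> 'm \<Rightarrow> real" and K' V where \<eta>: "\<And>j t p. msmooth A (\<lambda>_. \<eta> j) t p"
    and K': "\<And>j. compact (K' j)" "\<And>j. K' j \<subseteq> fst (c j)" "\<And>j p. p \<notin> K' j \<Longrightarrow> \<eta> j p = 0"
    and V: "\<And>j. open (V j)" "\<And>j. K j \<subseteq> V j" "\<And>j p. p \<in> V j \<Longrightarrow> \<eta> j p = 1"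
    by metis
  \<comment> \<open>The share of \<open>\<alpha>\<close> that is still present before step
    \<open>j\<close>; the step removes the share \<open>\<eta> j * \<zeta> j\<close>. Near
    \<open>K i\<close> the share is 0 as soon as \<open>i < j\<close>, because one factor is
    \<open>1 - \<eta> i\<close>.\<close>
  define \<zeta> where "\<zeta> j p = (\<Prod>i<j. 1 - \<eta> i p)" for j p
  have \<zeta>s: "msmooth A (\<lambda>_. \<zeta> j) t p" for j t p
    unfolding \<zeta>_def by (intro msmooth_prod msmooth_diff msmooth_const \<eta>)
  have \<zeta>Suc: "\<zeta> (Suc j) p = \<zeta> j p - \<eta> j p * \<zeta> j p" for j p by (simp add: \<zeta>_def algebra_simps)
  define form where "form j G t p X = \<Phi> t p X - (1 - \<zeta> j p) *\<^sub>R \<alpha> t p X + differential (G t) X"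
    for j and G :: "real \<Rightarrow> 'm \<Rightarrow> real^3" and t p X
  define P where "P j G \<longleftrightarrow> (\<forall>t p. msmooth A G t p) \<and> (\<forall>t p. t \<notin> {0<..<1} \<longrightarrow> G t p = 0) \<and>
    (\<forall>t p. inj_on (form j G t p) (tangent_space A p))" for j and G :: "real \<Rightarrow> 'm \<Rightarrow> real^3"
  define Q where "Q j G G' \<longleftrightarrow> (\<forall>i<j. \<forall>p\<in>K i. \<forall>t. G' t p = G t p)" for j and G G' :: "real \<Rightarrow> 'm \<Rightarrow> real^3"
  have "\<exists>G. \<forall>n. P n (G n) \<and> Q n (G n) (G (Suc n))"
  proof (rule dependent_nat_choice)
    have z: "smooth_fun_on A UNIV (\<lambda>_. 0::real^3)" unfolding smooth_fun_iff by (intro allI msmooth_const)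
    have "form 0 (\<lambda>_ _. 0) t p X = \<Phi> t p X" if "X \<in> tangent_space A p" for t p X
      using differential_comb[OF that z z, of 0 0] by (simp add: form_def \<zeta>_def)
    then have "P 0 (\<lambda>_ _. 0)"
      unfolding P_def using \<Phi>(3) by (auto intro!: msmooth_const simp: inj_on_def)
    then show "\<exists>G. P 0 G" by blast
  next
    fix G j assume G: "P j G"
    have Gs: "msmooth A G t p" for t p using G unfolding P_def by blast
    \<comment> \<open>The correction of step \<open>j\<close> must stay off every \<open>K i\<close>
      with \<open>i < j\<close>, hence \<open>W\<close>. The term to be removed is supported in
      \<open>KW\<close>, since \<open>\<zeta> j\<close> vanishes on each \<open>V i\<close>. As
      \<open>V i\<close> is an open neighbourhood of \<open>K i\<close>, the set \<open>KW\<close>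
      is compact and still contained in \<open>W\<close>.\<close>
    define W where "W = fst (c j) - (\<Union>i<j. K i)"
    define KW where "KW = K' j - (\<Union>i<j. V i)"
    have W: "open W" "W \<subseteq> fst (c j)"
      unfolding W_def by (auto intro!: open_Diff closed_UN chart_open[OF c] compact_imp_closed[OF K(1)])
    have KW: "compact KW" "KW \<subseteq> W"
    proof -
      show "compact KW" unfolding KW_def by (intro compact_diff K' open_UN ballI V)
      show "KW \<subseteq> W" unfolding KW_def W_def using K'(2)[of j] V(2) by blast
    qed
    have 1: "form_smooth (form j G)"
      unfolding form_def
      by (intro form_smooth_add form_smooth_diff form_smooth_scaleR \<Phi> \<alpha> form_smooth_differential Gs
          msmooth_diff msmooth_const \<zeta>s)
    have 2: "tangent_linear A p (form j G t p)" for t p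
      unfolding form_def
      by (intro tangent_linear_add tangent_linear_diff tangent_linear_scaleR tangent_linear_differential \<Phi> \<alpha>)
    have 3: "inj_on (form j G t p) (tangent_space A p)" for t p using G unfolding P_def by blast
    have 4: "form_smooth (\<lambda>t p X. (\<eta> j p * \<zeta> j p) *\<^sub>R \<alpha> t p X)"
      by (intro form_smooth_scaleR msmooth_mult \<eta> \<zeta>s \<alpha>)
    have 5: "tangent_linear A p (\<lambda>X. (\<eta> j p * \<zeta> j p) *\<^sub>R \<alpha> t p X)" for t p
      by (intro tangent_linear_scaleR \<alpha>)
    have 6: "(\<eta> j p * \<zeta> j p) *\<^sub>R \<alpha> t p X = 0" if "X \<in> tangent_space A p" "t \<notin> {\<delta>..1 - \<delta>} \<or> p \<notin> KW" for t p X
    proof (cases "t \<in> {\<delta>..1 - \<delta>}")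
      case True
      then have "p \<notin> K' j \<or> (\<exists>i<j. p \<in> V i)" using that by (auto simp: KW_def)
      then have "\<eta> j p = 0 \<or> \<zeta> j p = 0" using K'(3) V(3) by (force simp: \<zeta>_def)
      then show ?thesis by auto
    qed (use \<alpha>0 that in auto)
    obtain g where g: "\<And>t p. msmooth A g t p" "\<And>t p. t \<notin> {0<..<1} \<or> p \<notin> W \<Longrightarrow> g t p = 0"
      "\<And>t p. inj_on (\<lambda>X. form j G t p X - (\<eta> j p * \<zeta> j p) *\<^sub>R \<alpha> t p X + differential (g t) X) (tangent_space A p)"
      by (rule h_principle_step[OF c W KW 1 2 3 4 5 \<delta> 6]) (assumption | rule that)+
    define G' where "G' t p = G t p + g t p" for t p
    have "form j G t p X - (\<eta> j p * \<zeta> j p) *\<^sub>R \<alpha> t p X + differential (g t) X = form (Suc j) G' t p X"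
      if "X \<in> tangent_space A p" for t p X
      using differential_add[OF that msmooth_imp_smooth_fun[OF Gs] msmooth_imp_smooth_fun[OF g(1)], of t t]
      by (simp add: form_def G'_def[abs_def] \<zeta>Suc algebra_simps)
    then have "inj_on (form (Suc j) G' t p) (tangent_space A p)" for t p
      using g(3)[of t p] by (simp add: inj_on_def)
    then have "P (Suc j) G'"
      unfolding P_def using G g(1,2) Gs by (auto simp: G'_def[abs_def] P_def intro: msmooth_add)
    moreover have "Q j G G'" unfolding Q_def G'_def using g(2) by (auto simp: W_def)
    ultimately show "\<exists>G'. P (Suc j) G' \<and> Q j G G'" by blast
  qed
  then obtain Gn where Gn: "\<And>n. P n (Gn n)" "\<And>n. Q n (Gn n) (Gn (Suc n))" by blast
  have stab: "Gn n t p = Gn (Suc i) t p" if "p \<in> K i" "Suc i \<le> n" for n i t p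
    using that(2)
  proof (induction n rule: dec_induct)
    case (step n)
    then show ?case using Gn(2)[of n] that(1) unfolding Q_def by (metis Suc_le_lessD)
  qed auto
  \<comment> \<open>Step \<open>i\<close> is the last one that may alter the values on
    \<open>K i\<close>, hence the successor in the index. The least \<open>i\<close> merely fixes a
    choice; any other one with \<open>p\<close> in \<open>K i\<close> gives the same value.\<close>
  define G where "G t p = Gn (Suc (LEAST i. p \<in> K i)) t p" for t p
  have GK: "G t p = Gn (Suc i) t p" if "p \<in> K i" for t p i
  proof -
    have "p \<in> K (LEAST i. p \<in> K i)" "(LEAST i. p \<in> K i) \<le> i" using that by (auto intro: LeastI Least_le)
    then show ?thesis unfolding G_def using stab[of p _ "Suc i" t] by auto
  qed
  have Gs: "msmooth A G t p" for t p
  proof -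
    obtain i where i: "p \<in> interior (K i)" using cover by blast
    have "msmooth A (Gn (Suc i)) t p" using Gn(1) unfolding P_def by blast
    then show ?thesis
    proof (rule msmooth_cong[of _ _ _ UNIV "interior (K i)"])
      show "Gn (Suc i) s q = G s q" if "q \<in> interior (K i)" for s q
        using GK[of q i s] that interior_subset by (metis in_mono)
    qed (use i in auto)
  qed
  show ?thesis
  proof (rule that[of G])
    show "msmooth A G t p" for t p by (rule Gs)
    show "G t p = 0" if "t \<notin> {0<..<1}" for t p using that Gn(1) unfolding P_def G_def by blast
    fix t p
    obtain i where i: "p \<in> interior (K i)" using cover by blast
    then have pK: "p \<in> K i" using interior_subset by blast
    have "\<zeta> (Suc i) p = 0" using V(2,3) pK by (force simp: \<zeta>_def)
    moreover have "differential (G t) X = differential (Gn (Suc i) t) X" if "X \<in> tangent_space A p" for X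
    proof (rule differential_local[OF that _ _ open_interior i])
      show "smooth_fun_on A UNIV (G t)" by (rule msmooth_imp_smooth_fun[OF Gs])
      show "smooth_fun_on A UNIV (Gn (Suc i) t)"
        using Gn(1) unfolding P_def by (blast intro: msmooth_imp_smooth_fun)
      show "G t q = Gn (Suc i) t q" if "q \<in> interior (K i)" for q using GK that interior_subset by blast
    qed
    ultimately have "\<Phi> t p X - \<alpha> t p X + differential (G t) X = form (Suc i) (Gn (Suc i)) t p X"
      if "X \<in> tangent_space A p" for X
      using that by (simp add: form_def)
    moreover have "inj_on (form (Suc i) (Gn (Suc i)) t p) (tangent_space A p)" using Gn(1) unfolding P_def by blast
    ultimately show "inj_on (\<lambda>X. \<Phi> t p X - \<alpha> t p X + differential (G t) X) (tangent_space A p)"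
      by (simp add: inj_on_def)
  qed
qed

end

section \<open>Quaternions\<close>

lemma bounded_bilinear_qmult: "bounded_bilinear (*\<^sub>q)"
proof -
  have "bilinear (*\<^sub>q)"
    unfolding bilinear_def linear_iff qmult_def
    by (auto simp: algebra_simps inner_add_left inner_add_right cross_add_left cross_add_right
        cross_mult_left cross_mult_right)
  then show ?thesis using bilinear_conv_bounded_bilinear by blast
qed

interpretation qm: bounded_bilinear "(*\<^sub>q)" by (rule bounded_bilinear_qmult)

lemma qmult_assoc: "x *\<^sub>q y *\<^sub>q z = x *\<^sub>q (y *\<^sub>q z)"
  by (simp add: qmult_def cross3_simps forall_3 prod_eq_iff)

lemma qone_left [simp]: "qone *\<^sub>q x = x" and qone_right [simp]: "x *\<^sub>q qone = x"
  by (simp_all add: qmult_def qone_def)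

lemma qconj_mult: "qconj (x *\<^sub>q y) = qconj y *\<^sub>q qconj x"
  by (simp add: qmult_def qconj_def cross3_simps forall_3 prod_eq_iff)

lemma qconj_qconj [simp]: "qconj (qconj x) = x" and qconj_qone [simp]: "qconj qone = qone"
  and qconj_qim: "qconj (qim v) = - qim v" and norm_qconj [simp]: "norm (qconj x) = norm x"
  and qconj_add: "qconj (x + y) = qconj x + qconj y" and qconj_scaleR: "qconj (r *\<^sub>R x) = r *\<^sub>R qconj x"
  and qconj_0 [simp]: "qconj 0 = 0" and qconj_minus: "qconj (- x) = - qconj x"
  by (simp_all add: qconj_def qone_def qim_def norm_prod_def zero_prod_def)

lemma bounded_linear_qconj: "bounded_linear qconj"
  by (rule bounded_linear_intro[of _ 1]) (simp_all add: qconj_add qconj_scaleR)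

lemma bounded_linear_qim: "bounded_linear qim"
  by (rule bounded_linear_intro[of _ 1]) (simp_all add: qim_def norm_prod_def)

lemma qim_simps [simp]: "qim 0 = 0" "qim (v + w) = qim v + qim w" "qim (r *\<^sub>R v) = r *\<^sub>R qim v"
  "qim (- v) = - qim v" "qim (v - w) = qim v - qim w" "qim v = qim w \<longleftrightarrow> v = w" "qim v = 0 \<longleftrightarrow> v = 0"
  "norm (qim v) = norm v" "snd (qim v) = v" "fst (qim v) = 0"
  by (simp_all add: qim_def norm_prod_def zero_prod_def)

lemma norm_qone [simp]: "norm qone = 1" by (simp add: qone_def norm_prod_def)

lemma qmult_conj: "x *\<^sub>q qconj x = (norm x)\<^sup>2 *\<^sub>R qone" "qconj x *\<^sub>q x = (norm x)\<^sup>2 *\<^sub>R qone"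
  by (simp_all add: qmult_def qconj_def qone_def norm_prod_def dot_square_norm power2_eq_square[symmetric] add_nonneg_nonneg)

lemma norm_qmult: "norm (x *\<^sub>q y) = norm x * norm y"
proof -
  have "(norm (x *\<^sub>q y))\<^sup>2 *\<^sub>R qone = (norm x * norm y)\<^sup>2 *\<^sub>R qone"
    unfolding qmult_conj(1)[symmetric]
    by (simp add: qconj_mult qmult_assoc[symmetric] power_mult_distrib)
      (simp add: qmult_assoc qmult_conj qm.scaleR_right qm.scaleR_left mult.commute)
  then have "(norm (x *\<^sub>q y))\<^sup>2 = (norm x * norm y)\<^sup>2" by (simp add: qone_def)
  then show ?thesis by (simp add: power2_eq_iff_nonneg)
qed

lemma qmult_eq_0_iff: "x *\<^sub>q y = 0 \<longleftrightarrow> x = 0 \<or> y = 0"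
  using norm_qmult[of x y] by (metis mult_eq_0_iff norm_eq_zero)

definition qinv :: "quat \<Rightarrow> quat" where
  "qinv x = (1 / (norm x)\<^sup>2) *\<^sub>R qconj x"

lemma qinv_left: "x \<noteq> 0 \<Longrightarrow> qinv x *\<^sub>q x = qone" and qinv_right: "x \<noteq> 0 \<Longrightarrow> x *\<^sub>q qinv x = qone"
  and qinv_nonzero: "x \<noteq> 0 \<Longrightarrow> qinv x \<noteq> 0"
proof -
  assume x: "x \<noteq> 0"
  show 1: "qinv x *\<^sub>q x = qone" "x *\<^sub>q qinv x = qone"
    using x by (simp_all add: qinv_def qm.scaleR_left qm.scaleR_right qmult_conj)
  show "qinv x \<noteq> 0" using 1(1) by (metis norm_qone norm_zero qm.zero_left zero_neq_one)
qed

lemma qmult_qim: "qim v *\<^sub>q qim w = (- (v \<bullet> w), cross3 v w)"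
  by (simp add: qmult_def qim_def)

lemma qim_snd: "qconj x = - x \<Longrightarrow> qim (snd x) = x"
  by (auto simp: qconj_def qim_def prod_eq_iff)

lemma sandwich_imaginary: "qim (snd (qconj \<mu> *\<^sub>q qim v *\<^sub>q \<mu>)) = qconj \<mu> *\<^sub>q qim v *\<^sub>q \<mu>"
  by (rule qim_snd) (simp add: qconj_mult qconj_qim qmult_assoc qm.minus_left qm.minus_right)

text \<open>A non-zero imaginary part of \<open>x\<close> would be parallel to both \<open>a\<close>
  and \<open>b\<close>.\<close>

lemma commutes_two_imaginary_imp_real:
  fixes a b :: "real^3"
  assumes "x *\<^sub>q qim a = qim a *\<^sub>q x" "x *\<^sub>q qim b = qim b *\<^sub>q x" "cross3 a b \<noteq> 0"
  shows "x = fst x *\<^sub>R qone"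
proof -
  have cr: "cross3 (snd x) v = 0" if "x *\<^sub>q qim v = qim v *\<^sub>q x" for v
  proof -
    have "cross3 (snd x) v = cross3 v (snd x)" using that by (simp add: qmult_def qim_def)
    then have "2 *\<^sub>R cross3 (snd x) v = 0" using cross_skew[of v "snd x"] by (simp add: scaleR_2)
    then show ?thesis by simp
  qed
  have par: "(snd x \<bullet> snd x) *\<^sub>R v = (snd x \<bullet> v) *\<^sub>R snd x" if "cross3 (snd x) v = 0" for v
  proof -
    have "(snd x \<bullet> snd x) *\<^sub>R v - (snd x \<bullet> v) *\<^sub>R snd x = - cross3 (snd x) (cross3 (snd x) v)"
      by (simp add: cross3_simps forall_3)
    then show ?thesis using that by simp
  qed
  have "snd x = 0"
  proof (rule ccontr)
    assume n: "snd x \<noteq> 0"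
    have "(snd x \<bullet> snd x)\<^sup>2 *\<^sub>R cross3 a b = cross3 ((snd x \<bullet> snd x) *\<^sub>R a) ((snd x \<bullet> snd x) *\<^sub>R b)"
      by (simp add: cross_mult_left cross_mult_right power2_eq_square)
    also have "\<dots> = 0" unfolding par[OF cr[OF assms(1)]] par[OF cr[OF assms(2)]]
      by (simp add: cross_mult_left cross_mult_right)
    finally show False using n assms(3) by simp
  qed
  then show ?thesis by (simp add: qone_def prod_eq_iff)
qed

subsection \<open>Unit quaternions linking conformal maps\<close>

text \<open>Conjugation by \<open>q\<close> is the rotation carrying \<open>\<alpha>\<close> to
  \<open>\<beta>\<close> up to a positive factor. Stated as an intertwining relation it needs no
  inverses and composes directly.\<close>

definition links :: "'x set \<Rightarrow> quat \<Rightarrow> ('x \<Rightarrow> real^3) \<Rightarrow> ('x \<Rightarrow> real^3) \<Rightarrow> bool" where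
  "links S q \<alpha> \<beta> \<longleftrightarrow> norm q = 1 \<and> (\<exists>r>0. \<forall>X\<in>S. q *\<^sub>q qim (\<alpha> X) = r *\<^sub>R (qim (\<beta> X) *\<^sub>q q))"

lemma links_refl: "links S qone \<alpha> \<alpha>"
  unfolding links_def by (auto intro!: exI[of _ 1])

lemma links_trans:
  assumes "links S q \<alpha> \<beta>" "links S q' \<beta> \<gamma>" shows "links S (q' *\<^sub>q q) \<alpha> \<gamma>"
proof -
  obtain r r' where r: "norm q = 1" "norm q' = 1" "r > 0" "r' > 0" "\<forall>X\<in>S. q *\<^sub>q qim (\<alpha> X) = r *\<^sub>R (qim (\<beta> X) *\<^sub>q q)"
    "\<forall>X\<in>S. q' *\<^sub>q qim (\<beta> X) = r' *\<^sub>R (qim (\<gamma> X) *\<^sub>q q')" using assms unfolding links_def by blast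
  have "q' *\<^sub>q q *\<^sub>q qim (\<alpha> X) = (r * r') *\<^sub>R (qim (\<gamma> X) *\<^sub>q (q' *\<^sub>q q))" if "X \<in> S" for X
  proof -
    have "q' *\<^sub>q q *\<^sub>q qim (\<alpha> X) = r *\<^sub>R ((q' *\<^sub>q qim (\<beta> X)) *\<^sub>q q)"
      using r(5) that by (simp add: qmult_assoc qm.scaleR_right)
    also have "\<dots> = (r * r') *\<^sub>R (qim (\<gamma> X) *\<^sub>q (q' *\<^sub>q q))"
      using r(6) that by (simp add: qmult_assoc qm.scaleR_left)
    finally show ?thesis .
  qed
  then show ?thesis unfolding links_def using r(1-4) by (auto simp: norm_qmult intro!: exI[of _ "r * r'"])
qed

text \<open>Norms show that the two scale factors agree. Then \<open>qconj q' *\<^sub>q q\<close>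
  commutes with two independent imaginary quaternions, so it is real and of norm 1. This is the
  two-fold covering of the rotations by the unit quaternions.\<close>

lemma links_unique:
  assumes l: "links S q \<alpha> \<beta>" "links S q' \<alpha> \<beta>" and XY: "X \<in> S" "Y \<in> S" "cross3 (\<alpha> X) (\<alpha> Y) \<noteq> 0"
  shows "q' = q \<or> q' = - q"
proof -
  obtain r r' where r: "norm q = 1" "norm q' = 1" "r > 0" "r' > 0" "\<And>X. X \<in> S \<Longrightarrow> q *\<^sub>q qim (\<alpha> X) = r *\<^sub>R (qim (\<beta> X) *\<^sub>q q)"
    "\<And>X. X \<in> S \<Longrightarrow> q' *\<^sub>q qim (\<alpha> X) = r' *\<^sub>R (qim (\<beta> X) *\<^sub>q q')" using l unfolding links_def by blast
  have "norm (\<alpha> X) = r * norm (\<beta> X)" "norm (\<alpha> X) = r' * norm (\<beta> X)"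
    using arg_cong[OF r(5)[OF XY(1)], of norm] arg_cong[OF r(6)[OF XY(1)], of norm] r(1-4)
    by (simp_all add: norm_qmult)
  moreover have "\<alpha> X \<noteq> 0" using XY(3) by auto
  ultimately have rr: "r' = r" by auto
  define x where "x = qconj q' *\<^sub>q q"
  have qq: "q' *\<^sub>q qconj q' = qone" "qconj q' *\<^sub>q q' = qone" "qconj q *\<^sub>q q = qone"
    using r(1,2) by (simp_all add: qmult_conj)
  have comm: "x *\<^sub>q qim (\<alpha> Z) = qim (\<alpha> Z) *\<^sub>q x" if Z: "Z \<in> S" for Z
  proof -
    have "qim (\<alpha> Z) = qconj q' *\<^sub>q (q' *\<^sub>q qim (\<alpha> Z))" by (simp add: qmult_assoc[symmetric] qq)
    also have "\<dots> = r *\<^sub>R (qconj q' *\<^sub>q qim (\<beta> Z) *\<^sub>q q')"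
      by (simp add: r(6)[OF Z] rr qm.scaleR_right qmult_assoc)
    finally have "qim (\<alpha> Z) *\<^sub>q x = r *\<^sub>R (qconj q' *\<^sub>q qim (\<beta> Z) *\<^sub>q (q' *\<^sub>q qconj q') *\<^sub>q q)"
      by (simp add: x_def qm.scaleR_left qmult_assoc)
    also have "\<dots> = qconj q' *\<^sub>q (q *\<^sub>q qim (\<alpha> Z))"
      by (simp add: qq r(5)[OF Z] qm.scaleR_right qmult_assoc)
    finally show ?thesis by (simp add: x_def qmult_assoc)
  qed
  have x: "x = fst x *\<^sub>R qone" by (rule commutes_two_imaginary_imp_real[OF comm[OF XY(1)] comm[OF XY(2)] XY(3)])
  have q: "q = fst x *\<^sub>R q'"
    using arg_cong[OF x, of "\<lambda>x. q' *\<^sub>q x"] by (simp add: x_def qmult_assoc[symmetric] qq qm.scaleR_right)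
  have "\<bar>fst x\<bar> = 1" using arg_cong[OF q, of norm] r by simp
  then consider "fst x = 1" | "fst x = -1" by linarith
  then show ?thesis using q by cases auto
qed

text \<open>The sign left open by \<open>links_unique\<close> is settled by the real part: a unit
  quaternion with real part above 9/10 has imaginary part below 1/2, so the product of two of them
  has positive real part. This is what makes products over ever finer partitions of time
  agree.\<close>

lemma links_compose_unique:
  assumes l: "links S q \<alpha> \<beta>" "links S q' \<beta> \<gamma>" "links S q'' \<alpha> \<gamma>"
    and XY: "X \<in> S" "Y \<in> S" "cross3 (\<alpha> X) (\<alpha> Y) \<noteq> 0"
    and re: "fst q > 9/10" "fst q' > 9/10" "fst q'' > 9/10"
  shows "q'' = q' *\<^sub>q q"
proof -
  have n: "norm q = 1" "norm q' = 1" using l unfolding links_def by auto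
  have "(norm (snd q))\<^sup>2 < (1/2)\<^sup>2" "(norm (snd q'))\<^sup>2 < (1/2)\<^sup>2"
    using n re mult_strict_mono[OF re(1) re(1)] mult_strict_mono[OF re(2) re(2)]
    by (auto simp: norm_prod_def power2_eq_square real_sqrt_eq_1_iff)
  then have "norm (snd q) < 1/2" "norm (snd q') < 1/2" by - (rule power2_less_imp_less, assumption, simp)+
  then have "norm (snd q') * norm (snd q) \<le> 1/2 * (1/2)" by (intro mult_mono) auto
  then have "snd q' \<bullet> snd q \<le> 1/4" using norm_cauchy_schwarz[of "snd q'" "snd q"] by linarith
  moreover have "fst q' * fst q > 9/10 * (9/10)" using re by (intro mult_strict_mono) auto
  ultimately have "fst (q' *\<^sub>q q) > 0" by (simp add: qmult_def)
  moreover have "q' *\<^sub>q q = q'' \<or> q' *\<^sub>q q = - q''"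
    using links_unique[OF l(3) links_trans[OF l(1,2)] XY] .
  ultimately show ?thesis using re(3) by auto
qed

definition third :: "real^3 \<Rightarrow> real^3 \<Rightarrow> real^3" where
  "third a b = cross3 ((1 / norm a) *\<^sub>R a) ((1 / norm b) *\<^sub>R b)"

text \<open>If \<open>e\<close> and \<open>e'\<close> are positively oriented orthonormal frames, then \<open>Q = 1 - \<Sum>\<^sub>i e'\<^sub>i e\<^sub>i\<close>
  satisfies \<open>Q e\<^sub>k = e'\<^sub>k Q\<close>.\<close>

definition frame_quat :: "real^3 \<Rightarrow> real^3 \<Rightarrow> real^3 \<Rightarrow> real^3 \<Rightarrow> quat" where
  "frame_quat a b a' b' = qone - qim ((1 / norm a') *\<^sub>R a') *\<^sub>q qim ((1 / norm a) *\<^sub>R a)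
     - qim ((1 / norm b') *\<^sub>R b') *\<^sub>q qim ((1 / norm b) *\<^sub>R b) - qim (third a' b') *\<^sub>q qim (third a b)"

definition link_quat :: "real^3 \<Rightarrow> real^3 \<Rightarrow> real^3 \<Rightarrow> real^3 \<Rightarrow> quat" where
  "link_quat a b a' b' = (1 / norm (frame_quat a b a' b')) *\<^sub>R frame_quat a b a' b'"

text \<open>The multiplication table of the quaternion units \<open>i\<close>, \<open>j\<close>,
  \<open>k\<close>, with \<open>e\<close>, \<open>f\<close>, \<open>g\<close> in their
  places.\<close>

lemma orthonormal_qmult:
  fixes e f :: "real^3"
  assumes "norm e = 1" "norm f = 1" "e \<bullet> f = 0"
  defines "g \<equiv> cross3 e f"
  shows "qim e *\<^sub>q qim e = - qone" "qim f *\<^sub>q qim f = - qone" "qim g *\<^sub>q qim g = - qone"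
    "qim e *\<^sub>q qim f = qim g" "qim f *\<^sub>q qim e = - qim g" "qim f *\<^sub>q qim g = qim e"
    "qim g *\<^sub>q qim f = - qim e" "qim g *\<^sub>q qim e = qim f" "qim e *\<^sub>q qim g = - qim f"
proof -
  have ee: "e \<bullet> e = 1" "f \<bullet> f = 1" using assms by (auto simp: dot_square_norm)
  have tr: "cross3 x (cross3 y z) = (x \<bullet> z) *\<^sub>R y - (x \<bullet> y) *\<^sub>R z" for x y z :: "real^3"
    by (simp add: cross3_simps forall_3)
  have gg: "g \<bullet> g = 1" unfolding g_def dot_cross using ee assms by (simp add: inner_commute)
  have c: "cross3 f g = e" "cross3 e g = - f" "cross3 g e = f" "cross3 g f = - e"
    using ee assms tr[of f e f] tr[of e e f] cross_skew[of g e] cross_skew[of g f]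
    by (simp_all add: g_def inner_commute)
  have o: "e \<bullet> g = 0" "f \<bullet> g = 0" "g \<bullet> e = 0" "g \<bullet> f = 0" by (simp_all add: g_def dot_cross_self)
  show "qim e *\<^sub>q qim e = - qone" "qim f *\<^sub>q qim f = - qone" "qim g *\<^sub>q qim g = - qone"
    "qim e *\<^sub>q qim f = qim g" "qim f *\<^sub>q qim e = - qim g" "qim f *\<^sub>q qim g = qim e"
    "qim g *\<^sub>q qim f = - qim e" "qim g *\<^sub>q qim e = qim f" "qim e *\<^sub>q qim g = - qim f"
    using ee gg c o assms(3) cross_skew[of f e]
    by (simp_all add: qmult_qim qone_def prod_eq_iff inner_commute g_def)
qed

lemma frame_quat_intertwines:
  fixes a b a' b' :: "real^3"
  assumes ab: "norm b = norm a" "a \<noteq> 0" "a \<bullet> b = 0" and ab': "norm b' = norm a'" "a' \<noteq> 0" "a' \<bullet> b' = 0"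
  shows "frame_quat a b a' b' *\<^sub>q qim a = (norm a / norm a') *\<^sub>R (qim a' *\<^sub>q frame_quat a b a' b')"
    and "frame_quat a b a' b' *\<^sub>q qim b = (norm a / norm a') *\<^sub>R (qim b' *\<^sub>q frame_quat a b a' b')"
proof -
  define e f where "e = (1 / norm a) *\<^sub>R a" and "f = (1 / norm b) *\<^sub>R b"
  define e' f' where "e' = (1 / norm a') *\<^sub>R a'" and "f' = (1 / norm b') *\<^sub>R b'"
  have n: "norm a > 0" "norm a' > 0" using ab ab' by auto
  then have "b \<noteq> 0" "b' \<noteq> 0" using ab(1) ab'(1) by auto
  note n = n this
  have o: "norm e = 1" "norm f = 1" "e \<bullet> f = 0" "norm e' = 1" "norm f' = 1" "e' \<bullet> f' = 0"
    using ab ab' n by (auto simp: e_def f_def e'_def f'_def)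
  note m = orthonormal_qmult[OF o(1-3)] orthonormal_qmult[OF o(4-6)]
  have ma: "qim x *\<^sub>q (qim y *\<^sub>q z) = qim x *\<^sub>q qim y *\<^sub>q z" for x y z by (simp add: qmult_assoc)
  have Q: "frame_quat a b a' b' = qone - qim e' *\<^sub>q qim e - qim f' *\<^sub>q qim f - qim (cross3 e' f') *\<^sub>q qim (cross3 e f)"
    by (simp add: frame_quat_def third_def e_def f_def e'_def f'_def)
  \<comment> \<open>With \<open>g = e x f\<close> and \<open>g' = e' x f'\<close> both sides of the
    first equation expand to \<open>e + e' + f' g - g' f\<close>; the second is analogous.\<close>
  have 1: "frame_quat a b a' b' *\<^sub>q qim e = qim e' *\<^sub>q frame_quat a b a' b'"
    "frame_quat a b a' b' *\<^sub>q qim f = qim f' *\<^sub>q frame_quat a b a' b'"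
    unfolding Q by (simp_all add: qm.diff_left qm.diff_right ma m qm.minus_left qm.minus_right)
      (simp_all add: qmult_assoc m qm.minus_left qm.minus_right)
  have "qim a = norm a *\<^sub>R qim e" "qim b = norm a *\<^sub>R qim f" "norm a' *\<^sub>R qim e' = qim a'" "norm a' *\<^sub>R qim f' = qim b'"
    using n ab ab' by (simp_all add: e_def f_def e'_def f'_def)
  then show "frame_quat a b a' b' *\<^sub>q qim a = (norm a / norm a') *\<^sub>R (qim a' *\<^sub>q frame_quat a b a' b')"
    "frame_quat a b a' b' *\<^sub>q qim b = (norm a / norm a') *\<^sub>R (qim b' *\<^sub>q frame_quat a b a' b')"
    using 1 n by (simp_all add: qm.scaleR_right qm.scaleR_left flip: \<open>norm a' *\<^sub>R qim e' = qim a'\<close> \<open>norm a' *\<^sub>R qim f' = qim b'\<close>)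
qed

text \<open>For equal frames the quaternion is 4. If the frame vectors differ by less than 1/10,
  each of the three inner products exceeds 99/100, so the real part exceeds 397/100, while the three
  cross products contribute less than 3/10 to the imaginary part. Normalising therefore leaves a
  real part above 9/10.\<close>

lemma frame_quat_close:
  fixes a b a' b' :: "real^3"
  assumes ab: "norm b = norm a" "a \<noteq> 0" "a \<bullet> b = 0" and ab': "norm b' = norm a'" "a' \<noteq> 0" "a' \<bullet> b' = 0"
    and close: "norm ((1 / norm a) *\<^sub>R a - (1 / norm a') *\<^sub>R a') < 1/10"
      "norm ((1 / norm b) *\<^sub>R b - (1 / norm b') *\<^sub>R b') < 1/10" "norm (third a b - third a' b') < 1/10"
  shows "frame_quat a b a' b' \<noteq> 0" "fst (link_quat a b a' b') > 9/10"
proof -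
  define e f where "e = (1 / norm a) *\<^sub>R a" and "f = (1 / norm b) *\<^sub>R b"
  define e' f' where "e' = (1 / norm a') *\<^sub>R a'" and "f' = (1 / norm b') *\<^sub>R b'"
  have n: "norm a > 0" "norm a' > 0" using ab ab' by auto
  then have "b \<noteq> 0" "b' \<noteq> 0" using ab(1) ab'(1) by auto
  note n = n this
  have o: "norm e = 1" "norm f = 1" "e \<bullet> f = 0" "norm e' = 1" "norm f' = 1" "e' \<bullet> f' = 0"
    using ab ab' n by (auto simp: e_def f_def e'_def f'_def)
  have t: "third a b = cross3 e f" "third a' b' = cross3 e' f'"
    by (simp_all add: third_def e_def f_def e'_def f'_def)
  have nt: "norm (cross3 e f) = 1" "norm (cross3 e' f') = 1"
    using o by (simp_all add: norm_eq_1 dot_cross inner_commute)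
  have in1: "x \<bullet> y > 99/100" "norm (cross3 x y) < 1/10"
    if "norm x = 1" "norm y = 1" "norm (y - x) < 1/10" for x y :: "real^3"
  proof -
    have "(norm (y - x))\<^sup>2 < (1/10)\<^sup>2" using that(3) by (intro power_strict_mono) auto
    moreover have "(norm (y - x))\<^sup>2 = 2 - 2 * (x \<bullet> y)"
    proof -
      have "(y - x) \<bullet> (y - x) = y \<bullet> y - 2 * (x \<bullet> y) + x \<bullet> x"
        by (simp add: inner_diff_left inner_diff_right inner_commute)
      then show ?thesis using that(1,2) by (simp add: power2_norm_eq_inner norm_eq_1)
    qed
    ultimately show "x \<bullet> y > 99/100" by (simp add: power2_eq_square)
    have "cross3 x y = cross3 x (y - x)" by (simp add: cross3_diff_right)
    then show "norm (cross3 x y) < 1/10" using norm_cross3_le[of x "y - x"] that by simp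
  qed
  note c1 = in1[OF o(4,1) close(1)[folded e_def e'_def]]
  note c2 = in1[OF o(5,2) close(2)[folded f_def f'_def]]
  note c3 = in1[OF nt(2,1) close(3)[unfolded t]]
  let ?Q = "frame_quat a b a' b'"
  have fQ: "fst ?Q > 397/100"
    using c1(1) c2(1) c3(1) by (simp add: frame_quat_def t qmult_qim qone_def flip: e_def f_def e'_def f'_def)
  have "snd ?Q = - (cross3 e' e + cross3 f' f + cross3 (cross3 e' f') (cross3 e f))"
    by (simp add: frame_quat_def t qmult_qim qone_def flip: e_def f_def e'_def f'_def)
  also have "norm \<dots> \<le> norm (cross3 e' e) + norm (cross3 f' f) + norm (cross3 (cross3 e' f') (cross3 e f))"
    unfolding norm_minus_cancel by (intro order_trans[OF norm_triangle_ineq] add_mono order_refl norm_triangle_ineq)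
  also have "\<dots> < 3/10" using c1(2) c2(2) c3(2) by linarith
  finally have sQ: "norm (snd ?Q) < 3/10" .
  show Q0: "?Q \<noteq> 0" using fQ by auto
  have "norm ?Q \<le> fst ?Q + norm (snd ?Q)"
    using norm_triangle_ineq[of "(fst ?Q, 0)" "(0, snd ?Q)"] fQ by (simp add: norm_prod_def)
  also have "\<dots> < 10/9 * fst ?Q" using fQ sQ by linarith
  finally show "fst (link_quat a b a' b') > 9/10" using Q0 by (simp add: link_quat_def field_simps)
qed

section \<open>The conformal part of a pair of vectors\<close>

text \<open>Polar decomposition in closed form. If \<open>G\<close> is the Gram matrix of
  \<open>(a, b)\<close> and \<open>d\<close> the square root of its determinant, the positive factor
  of determinant 1 is the root of \<open>G / d\<close>, which for 2 by 2 matrices equals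
  \<open>(G + d I) / s\<close> with \<open>s = sqrt (d (tr G + 2 d))\<close>. Its inverse is its
  adjugate, and \<open>conf_part1\<close>, \<open>conf_part2\<close> are the columns of
  \<open>(a, b)\<close> times that inverse.\<close>

definition conf_part1 :: "real^3 \<Rightarrow> real^3 \<Rightarrow> real^3" where
  "conf_part1 a b = (1 / sqrt (norm (cross3 a b) * (a \<bullet> a + b \<bullet> b + 2 * norm (cross3 a b)))) *\<^sub>R
     ((norm (cross3 a b) + b \<bullet> b) *\<^sub>R a - (a \<bullet> b) *\<^sub>R b)"

definition conf_part2 :: "real^3 \<Rightarrow> real^3 \<Rightarrow> real^3" where
  "conf_part2 a b = (1 / sqrt (norm (cross3 a b) * (a \<bullet> a + b \<bullet> b + 2 * norm (cross3 a b)))) *\<^sub>R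
     ((norm (cross3 a b) + a \<bullet> a) *\<^sub>R b - (a \<bullet> b) *\<^sub>R a)"

lemma gram_det: "(norm (cross3 a b))\<^sup>2 = (a \<bullet> a) * (b \<bullet> b) - (a \<bullet> b)\<^sup>2"
  using norm_cross_dot[of a b] by (simp add: power_mult_distrib dot_square_norm)

text \<open>The coefficients in the last three claims are the matrix entries of the positive factor.
  Every claim reduces to one relation, that \<open>d^2\<close> is the Gram determinant.\<close>

lemma conf_part_properties:
  fixes a b :: "real^3"
  assumes "cross3 a b \<noteq> 0"
  defines "d \<equiv> norm (cross3 a b)" and "D \<equiv> a \<bullet> a + b \<bullet> b + 2 * norm (cross3 a b)"
  defines "w1 \<equiv> conf_part1 a b" and "w2 \<equiv> conf_part2 a b"
  shows "w1 \<bullet> w2 = 0" "w1 \<bullet> w1 = d" "w2 \<bullet> w2 = d" "d > 0" "D > 0"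
    "a = ((a \<bullet> a + d) / sqrt (d * D)) *\<^sub>R w1 + ((a \<bullet> b) / sqrt (d * D)) *\<^sub>R w2"
    "b = ((a \<bullet> b) / sqrt (d * D)) *\<^sub>R w1 + ((b \<bullet> b + d) / sqrt (d * D)) *\<^sub>R w2"
    "((a \<bullet> a + d) / sqrt (d * D)) * ((b \<bullet> b + d) / sqrt (d * D)) - ((a \<bullet> b) / sqrt (d * D))\<^sup>2 = 1"
proof -
  show d: "d > 0" using assms(1) by (simp add: d_def)
  show D: "D > 0" using d by (simp add: D_def d_def add_nonneg_pos)
  define s where "s = sqrt (d * D)"
  have s: "s > 0" "s * s = d * D" using d D by (simp_all add: s_def)
  have dd: "d * d = (a \<bullet> a) * (b \<bullet> b) - (a \<bullet> b) * (a \<bullet> b)"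
    using gram_det[of a b] by (simp add: d_def power2_eq_square)
  have DD: "D = a \<bullet> a + b \<bullet> b + 2 * d" by (simp add: D_def d_def)
  have w: "w1 = (1 / s) *\<^sub>R ((d + b \<bullet> b) *\<^sub>R a - (a \<bullet> b) *\<^sub>R b)" "w2 = (1 / s) *\<^sub>R ((d + a \<bullet> a) *\<^sub>R b - (a \<bullet> b) *\<^sub>R a)"
    by (simp_all add: w1_def w2_def conf_part1_def conf_part2_def s_def d_def D_def)
  note ic = inner_commute[of b a]
  have i: "((d + b \<bullet> b) *\<^sub>R a - (a \<bullet> b) *\<^sub>R b) \<bullet> ((d + a \<bullet> a) *\<^sub>R b - (a \<bullet> b) *\<^sub>R a) = 0"
    "((d + b \<bullet> b) *\<^sub>R a - (a \<bullet> b) *\<^sub>R b) \<bullet> ((d + b \<bullet> b) *\<^sub>R a - (a \<bullet> b) *\<^sub>R b) = d * (d * D)"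
    "((d + a \<bullet> a) *\<^sub>R b - (a \<bullet> b) *\<^sub>R a) \<bullet> ((d + a \<bullet> a) *\<^sub>R b - (a \<bullet> b) *\<^sub>R a) = d * (d * D)"
    using dd by (simp_all add: inner_diff_left inner_diff_right ic DD) algebra+
  show "w1 \<bullet> w2 = 0" "w1 \<bullet> w1 = d" "w2 \<bullet> w2 = d"
  proof -
    show "w1 \<bullet> w2 = 0" "w1 \<bullet> w1 = d" "w2 \<bullet> w2 = d"
      unfolding w inner_scaleR_left inner_scaleR_right i s(2)[symmetric] using s(1) by simp_all
  qed
  have v: "(a \<bullet> a + d) *\<^sub>R ((d + b \<bullet> b) *\<^sub>R a - (a \<bullet> b) *\<^sub>R b) + (a \<bullet> b) *\<^sub>R ((d + a \<bullet> a) *\<^sub>R b - (a \<bullet> b) *\<^sub>R a)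
      = (s * s) *\<^sub>R a"
    "(a \<bullet> b) *\<^sub>R ((d + b \<bullet> b) *\<^sub>R a - (a \<bullet> b) *\<^sub>R b) + (b \<bullet> b + d) *\<^sub>R ((d + a \<bullet> a) *\<^sub>R b - (a \<bullet> b) *\<^sub>R a)
      = (s * s) *\<^sub>R b"
  proof -
    have e: "(a \<bullet> a + d) * (d + b \<bullet> b) - (a \<bullet> b) * (a \<bullet> b) = s * s"
      "(b \<bullet> b + d) * (d + a \<bullet> a) - (a \<bullet> b) * (a \<bullet> b) = s * s"
      unfolding s(2) DD using dd by algebra+
    show "(a \<bullet> a + d) *\<^sub>R ((d + b \<bullet> b) *\<^sub>R a - (a \<bullet> b) *\<^sub>R b) + (a \<bullet> b) *\<^sub>R ((d + a \<bullet> a) *\<^sub>R b - (a \<bullet> b) *\<^sub>R a)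
      = (s * s) *\<^sub>R a"
      unfolding e(1)[symmetric] by (simp add: algebra_simps)
    show "(a \<bullet> b) *\<^sub>R ((d + b \<bullet> b) *\<^sub>R a - (a \<bullet> b) *\<^sub>R b) + (b \<bullet> b + d) *\<^sub>R ((d + a \<bullet> a) *\<^sub>R b - (a \<bullet> b) *\<^sub>R a)
      = (s * s) *\<^sub>R b"
      unfolding e(2)[symmetric] by (simp add: algebra_simps)
  qed
  have sc: "x = (1 / (s * s)) *\<^sub>R ((s * s) *\<^sub>R x)" for x :: "real^3" using s(1) by simp
  show "a = ((a \<bullet> a + d) / sqrt (d * D)) *\<^sub>R w1 + ((a \<bullet> b) / sqrt (d * D)) *\<^sub>R w2"
    by (subst sc, subst v(1)[symmetric]) (simp add: w scaleR_add_right flip: s_def)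
  show "b = ((a \<bullet> b) / sqrt (d * D)) *\<^sub>R w1 + ((b \<bullet> b + d) / sqrt (d * D)) *\<^sub>R w2"
    by (subst sc, subst v(2)[symmetric]) (simp add: w scaleR_add_right flip: s_def)
  have "(a \<bullet> a + d) * (b \<bullet> b + d) - (a \<bullet> b)\<^sup>2 = s * s" unfolding s(2) DD power2_eq_square using dd by algebra
  then show "((a \<bullet> a + d) / sqrt (d * D)) * ((b \<bullet> b + d) / sqrt (d * D)) - ((a \<bullet> b) / sqrt (d * D))\<^sup>2 = 1"
    using s(1) unfolding s_def[symmetric] by (simp add: field_simps power2_eq_square)
qed

text \<open>The determinant condition makes the area of \<open>(a, b)\<close> equal to
  \<open>l = w1 . w1\<close>, so \<open>G = l B^2\<close> for the matrix \<open>B\<close> of the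
  coefficients. By \<open>tr(B^2) + 2 = (tr B)^2\<close>, valid for determinant 1, the square root
  in the formula is \<open>l\<close> times the trace of \<open>B\<close>. Positive diagonal entries
  select its sign.\<close>

lemma conf_part_unique:
  fixes w1 w2 :: "real^3"
  assumes w: "w1 \<bullet> w2 = 0" "w2 \<bullet> w2 = w1 \<bullet> w1" "w1 \<noteq> 0"
    and b: "b11 * b22 - b12 * b12 = 1" "b11 > 0" "b22 > 0"
    and ab: "a = b11 *\<^sub>R w1 + b12 *\<^sub>R w2" "b = b12 *\<^sub>R w1 + b22 *\<^sub>R w2"
  shows "conf_part1 a b = w1" "conf_part2 a b = w2"
proof -
  define l where "l = w1 \<bullet> w1"
  have l: "l > 0" "w1 \<bullet> w1 = l" "w2 \<bullet> w2 = l" "w2 \<bullet> w1 = 0" using w by (auto simp: l_def inner_commute)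
  have "cross3 a b = (b11 * b22 - b12 * b12) *\<^sub>R cross3 w1 w2"
    unfolding ab using cross_skew[of w2 w1]
    by (simp add: cross_add_left cross_add_right cross_mult_left cross_mult_right algebra_simps)
  then have "(norm (cross3 a b))\<^sup>2 = l\<^sup>2" using b(1) gram_det[of w1 w2] w l by (simp add: power2_eq_square)
  then have d: "norm (cross3 a b) = l" using l(1) by (simp add: power2_eq_iff_nonneg)
  have aa: "a \<bullet> a = l * (b11 * b11 + b12 * b12)" and bb: "b \<bullet> b = l * (b12 * b12 + b22 * b22)"
    and ib: "a \<bullet> b = l * (b12 * (b11 + b22))"
    unfolding ab by (simp_all add: inner_add_left inner_add_right l w algebra_simps)
  have "l * (a \<bullet> a + b \<bullet> b + 2 * l) = (l * (b11 + b22))\<^sup>2"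
    unfolding aa bb power2_eq_square using b(1) by algebra
  then have s: "sqrt (l * (a \<bullet> a + b \<bullet> b + 2 * l)) = l * (b11 + b22)" using l b by simp
  have e: "(l + l * (b12 * b12 + b22 * b22)) * b11 - l * (b12 * (b11 + b22)) * b12 = l * (b11 + b22)"
    "(l + l * (b12 * b12 + b22 * b22)) * b12 - l * (b12 * (b11 + b22)) * b22 = 0"
    "(l + l * (b11 * b11 + b12 * b12)) * b22 - l * (b12 * (b11 + b22)) * b12 = l * (b11 + b22)"
    "(l + l * (b11 * b11 + b12 * b12)) * b12 - l * (b12 * (b11 + b22)) * b11 = 0"
    using b(1) by algebra+
  have v: "x *\<^sub>R (p *\<^sub>R w1 + q *\<^sub>R w2) - y *\<^sub>R (p' *\<^sub>R w1 + q' *\<^sub>R w2) = (x * p - y * p') *\<^sub>R w1 + (x * q - y * q') *\<^sub>R w2"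
    for x y p q p' q' by (simp add: algebra_simps)
  show "conf_part1 a b = w1"
    unfolding conf_part1_def d s unfolding aa bb ib unfolding ab v e using l b by simp
  show "conf_part2 a b = w2"
    unfolding conf_part2_def d s unfolding aa bb ib unfolding ab v e using l b by simp
qed

section \<open>Orthonormal frames and polar decomposition\<close>

locale conformal_surface = surface A
  for A :: "('m::{t2_space, second_countable_topology}) chart set" +
  fixes g :: "'m metric" and C :: "'m metric set"
  assumes metric: "riemannian_metric A g"
    and C_eq: "C = {g'. riemannian_metric A g' \<and> conformally_equivalent A g g'}"
begin

abbreviation "TS \<equiv> tangent_space A"
abbreviation "cv \<equiv> coord_vector A"

section \<open>A representative metric and its Gram-Schmidt frame in a chart\<close>

lemma g_in_C: "g \<in> C"
proof -
  have "smooth_fun_on A UNIV (\<lambda>_. 1::real)" unfolding smooth_fun_iff by (intro allI msmooth_const)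
  then have "conformally_equivalent A g g" unfolding conformally_equivalent_def by (intro exI[of _ "\<lambda>_. 1"]) simp
  then show ?thesis unfolding C_eq using metric by blast
qed

lemma tzero_eq: "c \<in> A \<Longrightarrow> p \<in> fst c \<Longrightarrow> cv c 0 p = tzero"
  using coord_vector_comb[of c p 0 0 0 0] by (simp add: tcomb_def tzero_def)

lemma tcomb_tangent: "X \<in> TS p \<Longrightarrow> Y \<in> TS p \<Longrightarrow> tcomb a X b Y \<in> TS p"
proof -
  assume XY: "X \<in> TS p" "Y \<in> TS p"
  obtain c where c: "c \<in> A" "p \<in> fst c" by (rule chart_exists)
  obtain v w where "X = cv c v p" "Y = cv c w p" using XY unfolding tangent_space_eq[OF c] by blast
  then show ?thesis using coord_vector_comb[OF c, symmetric] coord_vector_tangent[OF c] by simp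
qed

lemma metric_sym: "X \<in> TS p \<Longrightarrow> Y \<in> TS p \<Longrightarrow> g p X Y = g p Y X"
  and metric_pos: "X \<in> TS p \<Longrightarrow> X \<noteq> tzero \<Longrightarrow> g p X X > 0"
  and metric_comb_right: "X \<in> TS p \<Longrightarrow> Y \<in> TS p \<Longrightarrow> Z \<in> TS p \<Longrightarrow> g p X (tcomb a Y b Z) = a * g p X Y + b * g p X Z"
  using metric unfolding riemannian_metric_def tangent_linear_def by auto

lemma metric_comb_left:
  "X \<in> TS p \<Longrightarrow> Y \<in> TS p \<Longrightarrow> Z \<in> TS p \<Longrightarrow> g p (tcomb a Y b Z) X = a * g p Y X + b * g p Z X"
  by (simp add: metric_sym[of _ p X] tcomb_tangent metric_comb_right)

text \<open>The coefficients of the first fundamental form in the chart \<open>c\<close>, and its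
  determinant \<open>gW\<close>. The vectors \<open>fr1\<close>, \<open>fr2\<close> arise from the
  coordinate frame by Gram-Schmidt; explicit formulas make their smoothness visible.\<close>

definition "gE c p = g p (cv c (axis 1 1) p) (cv c (axis 1 1) p)"
definition "gF c p = g p (cv c (axis 1 1) p) (cv c (axis 2 1) p)"
definition "gG c p = g p (cv c (axis 2 1) p) (cv c (axis 2 1) p)"
definition "gW c p = gE c p * gG c p - gF c p * gF c p"
definition frv1 :: "'m chart \<Rightarrow> 'm \<Rightarrow> real^2" where "frv1 c p = (1 / sqrt (gE c p)) *\<^sub>R axis 1 1"
definition frv2 :: "'m chart \<Rightarrow> 'm \<Rightarrow> real^2" where
  "frv2 c p = (1 / sqrt (gE c p * gW c p)) *\<^sub>R (gE c p *\<^sub>R axis 2 1 - gF c p *\<^sub>R axis 1 1)"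
definition "fr1 c p = cv c (frv1 c p) p"
definition "fr2 c p = cv c (frv2 c p) p"

context
  fixes c p assumes c: "c \<in> A" "p \<in> fst c"
begin

lemma metric_coord:
  "g p (cv c v p) (cv c w p) = v $ 1 * w $ 1 * gE c p + (v $ 1 * w $ 2 + v $ 2 * w $ 1) * gF c p + v $ 2 * w $ 2 * gG c p"
proof -
  note T = coord_vector_tangent[OF c]
  have e: "cv c u p = tcomb (u $ 1) (cv c (axis 1 1) p) (u $ 2) (cv c (axis 2 1) p)" for u
    using coord_vector_comb[OF c, of "u $ 1" "axis 1 1" "u $ 2" "axis 2 1"] vec2_eq_axis[of u] by metis
  show ?thesis
    unfolding gE_def gF_def gG_def e[of v] e[of w]
    using metric_sym[OF T T, of "axis 2 1" "axis 1 1"]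
    by (simp add: metric_comb_left metric_comb_right T tcomb_tangent algebra_simps)
qed

lemma gE_pos: "gE c p > 0" and gW_pos: "gW c p > 0"
proof -
  have nz: "cv c v p \<noteq> tzero" if "v \<noteq> 0" for v using coord_vector_inj[OF c] tzero_eq[OF c] that by metis
  show E: "gE c p > 0" unfolding gE_def
    by (rule metric_pos[OF coord_vector_tangent[OF c] nz]) (simp add: axis_eq_0_iff)
  let ?v = "gE c p *\<^sub>R axis 2 1 - gF c p *\<^sub>R axis 1 1 :: real^2"
  have v: "?v $ 1 = - gF c p" "?v $ 2 = gE c p" by (simp_all add: axis_def)
  then have "?v \<noteq> 0" using E by (metis less_irrefl zero_index)
  from metric_pos[OF coord_vector_tangent[OF c] nz[OF this]]
  have "gE c p * gW c p > 0" unfolding metric_coord v gW_def by (simp add: algebra_simps)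
  then show "gW c p > 0" using E by (simp add: zero_less_mult_iff)
qed

lemma frame_tangent: "fr1 c p \<in> TS p" "fr2 c p \<in> TS p"
  unfolding fr1_def fr2_def by (rule coord_vector_tangent[OF c])+

lemma frame_orthonormal: "g p (fr1 c p) (fr1 c p) = 1" "g p (fr1 c p) (fr2 c p) = 0" "g p (fr2 c p) (fr1 c p) = 0"
  "g p (fr2 c p) (fr2 c p) = 1"
proof -
  have s: "sqrt (gE c p) * sqrt (gE c p) = gE c p" "sqrt (gE c p * gW c p) * sqrt (gE c p * gW c p) = gE c p * gW c p"
    "sqrt (gE c p) > 0" "sqrt (gE c p * gW c p) > 0"
    using gE_pos gW_pos by (simp_all add: mult_pos_pos)
  have v: "frv1 c p $ 1 = 1 / sqrt (gE c p)" "frv1 c p $ 2 = 0" "frv2 c p $ 1 = - gF c p / sqrt (gE c p * gW c p)"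
    "frv2 c p $ 2 = gE c p / sqrt (gE c p * gW c p)"
    by (simp_all add: frv1_def frv2_def axis_def)
  show "g p (fr1 c p) (fr1 c p) = 1" unfolding fr1_def fr2_def metric_coord v using s gE_pos by simp
  show "g p (fr1 c p) (fr2 c p) = 0" unfolding fr1_def fr2_def metric_coord v using s by (simp add: field_simps)
  then show "g p (fr2 c p) (fr1 c p) = 0" using metric_sym frame_tangent by metis
  have "g p (fr2 c p) (fr2 c p) = (gE c p * gW c p) / (sqrt (gE c p * gW c p) * sqrt (gE c p * gW c p))"
    unfolding fr1_def fr2_def metric_coord v gW_def using s(4)[unfolded gW_def] by (simp add: field_simps)
  then show "g p (fr2 c p) (fr2 c p) = 1" unfolding s(2) using gE_pos gW_pos by simp
qed

lemma coord_vector_frame: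
  "cv c v p = tcomb (v $ 1 * sqrt (gE c p) + v $ 2 * gF c p / sqrt (gE c p)) (fr1 c p)
     (v $ 2 * sqrt (gE c p * gW c p) / gE c p) (fr2 c p)"
proof -
  have s: "sqrt (gE c p) * sqrt (gE c p) = gE c p" "sqrt (gE c p) > 0" "sqrt (gE c p * gW c p) > 0"
    using gE_pos gW_pos by (simp_all add: mult_pos_pos)
  have "v = (v $ 1 * sqrt (gE c p) + v $ 2 * gF c p / sqrt (gE c p)) *\<^sub>R frv1 c p
      + (v $ 2 * sqrt (gE c p * gW c p) / gE c p) *\<^sub>R frv2 c p"
    using s gE_pos gW_pos by (simp add: vec_eq_iff forall_2 frv1_def frv2_def axis_def field_simps)
  then show ?thesis unfolding fr1_def fr2_def coord_vector_comb[OF c, symmetric] by simp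
qed

lemma frame_expand:
  assumes "X \<in> TS p" shows "X = tcomb (g p X (fr1 c p)) (fr1 c p) (g p X (fr2 c p)) (fr2 c p)"
proof -
  obtain v where "X = cv c v p" using assms tangent_space_eq[OF c] by blast
  then obtain a b where X: "X = tcomb a (fr1 c p) b (fr2 c p)" using coord_vector_frame by blast
  show ?thesis unfolding X
    by (simp add: metric_comb_left frame_tangent frame_orthonormal)
qed

lemma linear_frame:
  assumes "tangent_linear A p \<alpha>" "X \<in> TS p"
  shows "\<alpha> X = g p X (fr1 c p) *\<^sub>R \<alpha> (fr1 c p) + g p X (fr2 c p) *\<^sub>R \<alpha> (fr2 c p)"
  using assms frame_expand[OF assms(2)] frame_tangent unfolding tangent_linear_def by metis

lemma metric_frame:
  assumes "X \<in> TS p" "Y \<in> TS p"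
  shows "g p X Y = g p X (fr1 c p) * g p Y (fr1 c p) + g p X (fr2 c p) * g p Y (fr2 c p)"
proof -
  have "g p X Y = g p X (tcomb (g p Y (fr1 c p)) (fr1 c p) (g p Y (fr2 c p)) (fr2 c p))"
    using frame_expand[OF assms(2)] by simp
  then show ?thesis by (simp add: metric_comb_right assms frame_tangent)
qed

lemma inj_frame_iff:
  fixes \<alpha> :: "'m tangent \<Rightarrow> real^3"
  assumes "tangent_linear A p \<alpha>"
  shows "inj_on \<alpha> (TS p) \<longleftrightarrow> cross3 (\<alpha> (fr1 c p)) (\<alpha> (fr2 c p)) \<noteq> 0"
proof -
  have v: "frv1 c p $ 1 = 1 / sqrt (gE c p)" "frv1 c p $ 2 = 0" "frv2 c p $ 1 = - gF c p / sqrt (gE c p * gW c p)"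
    "frv2 c p $ 2 = gE c p / sqrt (gE c p * gW c p)"
    by (simp_all add: frv1_def frv2_def axis_def)
  have "cross3 (\<alpha> (fr1 c p)) (\<alpha> (fr2 c p)) = (1 / sqrt (gE c p) * (gE c p / sqrt (gE c p * gW c p))) *\<^sub>R
      cross3 (\<alpha> (cv c (axis 1 1) p)) (\<alpha> (cv c (axis 2 1) p))"
    unfolding fr1_def fr2_def tangent_linear_coord[OF assms c, of "frv1 c p"] tangent_linear_coord[OF assms c, of "frv2 c p"] v
    by (simp add: cross_add_right cross3_diff_right cross_mult_left cross_mult_right)
  then show ?thesis using inj_form_iff[OF assms c] gE_pos gW_pos by (simp add: mult_pos_pos)
qed

text \<open>Conformality with respect to a whole class of metrics can be tested on one orthonormal
  frame of one representative; for another metric of the class the factor is divided by its ratio to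
  \<open>g\<close>.\<close>

lemma conf_maps_frame_iff:
  "\<omega> \<in> conf_maps A C p \<longleftrightarrow> tangent_linear A p \<omega> \<and> \<omega> (fr1 c p) \<noteq> 0 \<and>
     \<omega> (fr1 c p) \<bullet> \<omega> (fr2 c p) = 0 \<and> \<omega> (fr2 c p) \<bullet> \<omega> (fr2 c p) = \<omega> (fr1 c p) \<bullet> \<omega> (fr1 c p)"
proof
  assume \<omega>: "\<omega> \<in> conf_maps A C p"
  then have lin: "tangent_linear A p \<omega>" unfolding conf_maps_def by blast
  obtain r where r: "r > 0" "\<forall>X\<in>TS p. \<forall>Y\<in>TS p. \<omega> X \<bullet> \<omega> Y = r * g p X Y"
    using \<omega> g_in_C unfolding conf_maps_def by blast
  then have i: "\<omega> (fr1 c p) \<bullet> \<omega> (fr1 c p) = r" "\<omega> (fr1 c p) \<bullet> \<omega> (fr2 c p) = 0" "\<omega> (fr2 c p) \<bullet> \<omega> (fr2 c p) = r"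
    using frame_tangent frame_orthonormal by simp_all
  then show "tangent_linear A p \<omega> \<and> \<omega> (fr1 c p) \<noteq> 0 \<and>
     \<omega> (fr1 c p) \<bullet> \<omega> (fr2 c p) = 0 \<and> \<omega> (fr2 c p) \<bullet> \<omega> (fr2 c p) = \<omega> (fr1 c p) \<bullet> \<omega> (fr1 c p)"
    using lin r(1) by auto
next
  assume a: "tangent_linear A p \<omega> \<and> \<omega> (fr1 c p) \<noteq> 0 \<and>
     \<omega> (fr1 c p) \<bullet> \<omega> (fr2 c p) = 0 \<and> \<omega> (fr2 c p) \<bullet> \<omega> (fr2 c p) = \<omega> (fr1 c p) \<bullet> \<omega> (fr1 c p)"
  define r where "r = \<omega> (fr1 c p) \<bullet> \<omega> (fr1 c p)"
  have r: "r > 0" "\<omega> (fr1 c p) \<bullet> \<omega> (fr1 c p) = r" "\<omega> (fr2 c p) \<bullet> \<omega> (fr2 c p) = r" using a by (auto simp: r_def)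
  have "(norm (cross3 (\<omega> (fr1 c p)) (\<omega> (fr2 c p))))\<^sup>2 = r * r" unfolding gram_det using a r by simp
  then have inj: "inj_on \<omega> (TS p)" using inj_frame_iff a r(1) by auto
  have eq: "\<omega> X \<bullet> \<omega> Y = r * g p X Y" if "X \<in> TS p" "Y \<in> TS p" for X Y
  proof -
    have "(x *\<^sub>R \<omega> (fr1 c p) + y *\<^sub>R \<omega> (fr2 c p)) \<bullet> (x' *\<^sub>R \<omega> (fr1 c p) + y' *\<^sub>R \<omega> (fr2 c p)) = r * (x * x' + y * y')" for x y x' y'
      using a r inner_commute[of "\<omega> (fr2 c p)" "\<omega> (fr1 c p)"] by (simp add: inner_add_left inner_add_right algebra_simps)
    then show ?thesis
      using metric_frame[OF that] linear_frame[OF conjunct1[OF a] that(1)] linear_frame[OF conjunct1[OF a] that(2)] by metis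
  qed
  show "\<omega> \<in> conf_maps A C p"
    unfolding conf_maps_def
  proof (intro CollectI conjI ballI inj)
    fix g' assume "g' \<in> C"
    then obtain \<rho> where \<rho>: "\<rho> p > 0" "\<forall>X\<in>TS p. \<forall>Y\<in>TS p. g' p X Y = \<rho> p * g p X Y"
      unfolding C_eq conformally_equivalent_def by blast
    then show "\<exists>r>0. \<forall>X\<in>TS p. \<forall>Y\<in>TS p. \<omega> X \<bullet> \<omega> Y = r * g' p X Y"
      using eq r(1) by (intro exI[of _ "r / \<rho> p"]) auto
  qed (use a in blast)
qed

end

text \<open>The part of \<open>conformal_decomposition\<close> that concerns a single tangent plane.
  Existence and uniqueness are linear algebra there, and smoothness is added afterwards.\<close>

definition polar :: "'m \<Rightarrow> ('m tangent \<Rightarrow> real^3) \<Rightarrow> ('m tangent \<Rightarrow> real^3) \<Rightarrow> ('m tangent \<Rightarrow> 'm tangent) \<Rightarrow> bool" where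
  "polar p \<alpha> \<omega> B \<longleftrightarrow> tangent_endo A p B \<and> \<omega> \<in> conf_maps A C p \<and> tangent_det A p B 1 \<and>
     (\<forall>X\<in>TS p. \<alpha> X = \<omega> (B X) \<and> (\<forall>g\<in>C. (X \<noteq> tzero \<longrightarrow> g p (B X) X > 0) \<and> (\<forall>Y\<in>TS p. g p (B X) Y = g p X (B Y))))"

lemma conformal_decomposition_iff:
  "conformal_decomposition A C f \<omega> B \<longleftrightarrow> smooth_form_on A UNIV \<omega> \<and> smooth_endo_field A B \<and>
     (\<forall>p. polar p (differential f) (\<omega> p) (B p))"
  unfolding conformal_decomposition_def polar_def smooth_endo_field_def by blast

section \<open>Matrices and determinants of tangent endomorphisms\<close>

lemma endo_matrix:
  assumes c: "c \<in> A" "p \<in> fst c" and B: "tangent_endo A p B"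
  obtains M :: "real^2^2" where "\<And>v. B (cv c v p) = cv c (M *v v) p"
proof -
  have T: "cv c v p \<in> TS p" for v by (rule coord_vector_tangent[OF c])
  have "B (cv c v p) \<in> range (\<lambda>v. cv c v p)" for v
    using B T[of v] unfolding tangent_endo_def tangent_space_eq[OF c, symmetric] by blast
  then obtain w1 w2 where w: "B (cv c (axis 1 1) p) = cv c w1 p" "B (cv c (axis 2 1) p) = cv c w2 p" by (meson rangeE)
  define M :: "real^2^2" where "M = (\<chi> i j. if j = 1 then w1 $ i else w2 $ i)"
  have "B (cv c v p) = cv c (M *v v) p" for v
  proof -
    have "B (cv c v p) = tcomb (v $ 1) (cv c w1 p) (v $ 2) (cv c w2 p)"
      using B T w coord_vector_comb[OF c, of "v $ 1" "axis 1 1" "v $ 2" "axis 2 1"] vec2_eq_axis[of v]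
      unfolding tangent_endo_def by metis
    also have "\<dots> = cv c (v $ 1 *\<^sub>R w1 + v $ 2 *\<^sub>R w2) p" by (rule coord_vector_comb[OF c, symmetric])
    also have "v $ 1 *\<^sub>R w1 + v $ 2 *\<^sub>R w2 = M *v v"
      by (auto simp: vec_eq_iff M_def matrix_vector_mult_def sum_2)
    finally show ?thesis .
  qed
  then show ?thesis using that by blast
qed

lemma coord_vector_sum:
  assumes "c \<in> A" "p \<in> fst c"
  shows "(\<lambda>h. \<Sum>i\<in>UNIV. a $ i * cv c (m i) p h) = cv c (\<Sum>i\<in>(UNIV::2 set). a $ i *\<^sub>R m i) p"
  by (rule ext) (simp add: sum_2 coord_vector_comb[OF assms] tcomb_def)

text \<open>\<open>tangent_det\<close> admits an arbitrary basis, so its independence of the basis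
  has to be shown. The matrix \<open>N\<close> of a basis is injective because 0 has a unique
  expansion, and \<open>M ** N = N ** a\<close> gives equal determinants.\<close>

lemma tangent_det_iff:
  assumes c: "c \<in> A" "p \<in> fst c" and M: "\<And>v. B (cv c v p) = cv c (M *v v) p"
  shows "tangent_det A p B d \<longleftrightarrow> det M = d"
proof
  assume "tangent_det A p B d"
  then obtain e and a :: "real^2^2" where e: "tangent_basis A p e" "\<And>j. B (e j) = (\<lambda>h. \<Sum>i\<in>UNIV. a $ i $ j * e i h)" "det a = d"
    unfolding tangent_det_def by blast
  have "e i \<in> range (\<lambda>v. cv c v p)" for i using e(1) unfolding tangent_basis_def tangent_space_eq[OF c, symmetric] by blast
  then have "\<forall>i. \<exists>m. e i = cv c m p" by blast
  then obtain m where m: "\<And>i. e i = cv c (m i) p" by metis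
  define N :: "real^2^2" where "N = (\<chi> r i. m i $ r)"
  have N: "N *v v = (\<Sum>i\<in>UNIV. v $ i *\<^sub>R m i)" for v
    by (auto simp: vec_eq_iff N_def matrix_vector_mult_def mult.commute)
  have "v = 0" if "N *v v = 0" for v
  proof -
    have "(\<lambda>h. \<Sum>i\<in>UNIV. v $ i * e i h) = (\<lambda>h. \<Sum>i\<in>UNIV. (0::real^2) $ i * e i h)"
      unfolding m coord_vector_sum[OF c] using that N by simp
    moreover have "(\<lambda>h. \<Sum>i\<in>UNIV. (0::real^2) $ i * e i h) \<in> TS p"
      unfolding m coord_vector_sum[OF c] by (rule coord_vector_tangent[OF c])
    ultimately show ?thesis
      using e(1)[unfolded tangent_basis_def, THEN conjunct2, THEN bspec, of "\<lambda>h. \<Sum>i\<in>UNIV. (0::real^2) $ i * e i h"] by auto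
  qed
  then have "inj ((*v) N)" by (simp add: linear_injective_0 matrix_vector_mul_linear)
  then have N0: "det N \<noteq> 0" by (metis invertible_det_nz invertible_left_inverse matrix_left_invertible_injective)
  have "M *v m j = (\<Sum>i\<in>UNIV. a $ i $ j *\<^sub>R m i)" for j
  proof -
    have "cv c (M *v m j) p = cv c (\<Sum>i\<in>UNIV. (\<chi> i. a $ i $ j) $ i *\<^sub>R m i) p"
      unfolding coord_vector_sum[OF c, symmetric] M[symmetric] using e(2)[of j] m by simp
    then show ?thesis using coord_vector_inj[OF c] by fastforce
  qed
  then have "M ** N = N ** a"
    by (auto simp: vec_eq_iff matrix_matrix_mult_def matrix_vector_mult_def N_def mult.commute)
  then have "det M * det N = det N * det a" by (metis det_mul)
  then show "det M = d" using N0 e(3) by simp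
next
  assume d: "det M = d"
  define e where "e i = cv c (axis i 1) p" for i
  have sum: "(\<lambda>h. \<Sum>i\<in>UNIV. v $ i * e i h) = cv c v p" for v
    unfolding e_def coord_vector_sum[OF c] by (simp add: sum_2 flip: vec2_eq_axis)
  have "tangent_basis A p e"
    unfolding tangent_basis_def
  proof (intro conjI allI ballI)
    show "e i \<in> TS p" for i unfolding e_def by (rule coord_vector_tangent[OF c])
    fix X assume "X \<in> TS p"
    then obtain v where "X = cv c v p" using tangent_space_eq[OF c] by blast
    then show "\<exists>!v::real^2. X = (\<lambda>h. \<Sum>i\<in>UNIV. v $ i * e i h)"
      unfolding sum using coord_vector_inj[OF c] by blast
  qed
  moreover have "B (e j) = (\<lambda>h. \<Sum>i\<in>UNIV. M $ i $ j * e i h)" for j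
    using sum[of "M *v axis j 1"] by (simp add: e_def M matrix_vector_mult_basis column_def)
  ultimately show "tangent_det A p B d" unfolding tangent_det_def using d by blast
qed

lemma endo_frame_det:
  assumes c: "c \<in> A" "p \<in> fst c" and B: "tangent_endo A p B"
    and b: "B (fr1 c p) = tcomb b11 (fr1 c p) b21 (fr2 c p)" "B (fr2 c p) = tcomb b12 (fr1 c p) b22 (fr2 c p)"
  shows "tangent_det A p B d \<longleftrightarrow> b11 * b22 - b12 * b21 = d"
proof -
  obtain M where M: "\<And>v. B (cv c v p) = cv c (M *v v) p" by (rule endo_matrix[OF c B]) blast
  define N :: "real^2^2" where "N = (\<chi> r i. if i = 1 then frv1 c p $ r else frv2 c p $ r)"
  define b :: "real^2^2" where "b = (\<chi> i j. if i = 1 then if j = 1 then b11 else b12 else if j = 1 then b21 else b22)"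
  have "M *v frv1 c p = b11 *\<^sub>R frv1 c p + b21 *\<^sub>R frv2 c p" "M *v frv2 c p = b12 *\<^sub>R frv1 c p + b22 *\<^sub>R frv2 c p"
    using b M coord_vector_inj[OF c] unfolding fr1_def fr2_def coord_vector_comb[OF c, symmetric] by metis+
  then have "M ** N = N ** b"
    by (auto simp: vec_eq_iff matrix_matrix_mult_def matrix_vector_mult_def N_def b_def sum_2 forall_2 mult.commute)
  then have "det M * det N = det N * det b" by (metis det_mul)
  moreover have "det N \<noteq> 0"
    using gE_pos[OF c] gW_pos[OF c] by (simp add: det_2 N_def frv1_def frv2_def axis_def)
  ultimately have "det M = det b" by simp
  then show ?thesis unfolding tangent_det_iff[OF c M] by (simp add: det_2 b_def)
qed

text \<open>In an orthonormal frame the self-adjoint factor has a symmetric matrix with positive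
  diagonal and determinant 1, which puts \<open>conf_part_unique\<close> in force. So the conformal
  factor is determined on the frame by a formula in \<open>\<alpha>\<close> alone.\<close>

lemma polar_frame:
  assumes c: "c \<in> A" "p \<in> fst c" and P: "polar p \<alpha> \<omega> B"
  shows "\<omega> (fr1 c p) = conf_part1 (\<alpha> (fr1 c p)) (\<alpha> (fr2 c p))" "\<omega> (fr2 c p) = conf_part2 (\<alpha> (fr1 c p)) (\<alpha> (fr2 c p))"
proof -
  let ?X = "fr1 c p" and ?Y = "fr2 c p"
  note T = frame_tangent[OF c]
  have B: "tangent_endo A p B" and \<omega>: "\<omega> \<in> conf_maps A C p" and det: "tangent_det A p B 1"
    and \<alpha>: "\<And>X. X \<in> TS p \<Longrightarrow> \<alpha> X = \<omega> (B X)" using P unfolding polar_def by auto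
  have pos: "X \<in> TS p \<Longrightarrow> X \<noteq> tzero \<Longrightarrow> g p (B X) X > 0" and sym: "X \<in> TS p \<Longrightarrow> Y \<in> TS p \<Longrightarrow> g p (B X) Y = g p X (B Y)" for X Y
    using P g_in_C unfolding polar_def by auto
  have BT: "B ?X \<in> TS p" "B ?Y \<in> TS p" using B T unfolding tangent_endo_def by auto
  have eX: "B ?X = tcomb (g p (B ?X) ?X) ?X (g p (B ?X) ?Y) ?Y" by (rule frame_expand[OF c BT(1)])
  have eY: "B ?Y = tcomb (g p (B ?Y) ?X) ?X (g p (B ?Y) ?Y) ?Y" by (rule frame_expand[OF c BT(2)])
  have s: "g p (B ?Y) ?X = g p (B ?X) ?Y" using sym[OF T(2,1)] metric_sym[OF T(2) BT(1)] by simp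
  have "g p (B ?X) ?X * g p (B ?Y) ?Y - g p (B ?X) ?Y * g p (B ?X) ?Y = 1"
    using endo_frame_det[OF c B eX eY, of 1] det unfolding s by simp
  moreover have "?X \<noteq> tzero" "?Y \<noteq> tzero"
    using frame_orthonormal[OF c] metric_comb_left[OF T(1) T(1) T(1), of 0 0] metric_comb_left[OF T(2) T(2) T(2), of 0 0]
    by (auto simp: tcomb_def tzero_def)
  then have "g p (B ?X) ?X > 0" "g p (B ?Y) ?Y > 0" using pos T by auto
  moreover have lin: "tangent_linear A p \<omega>" and w: "\<omega> ?X \<bullet> \<omega> ?Y = 0" "\<omega> ?Y \<bullet> \<omega> ?Y = \<omega> ?X \<bullet> \<omega> ?X" "\<omega> ?X \<noteq> 0"
    using \<omega> unfolding conf_maps_frame_iff[OF c] by auto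
  moreover have "\<alpha> ?X = g p (B ?X) ?X *\<^sub>R \<omega> ?X + g p (B ?X) ?Y *\<^sub>R \<omega> ?Y"
    "\<alpha> ?Y = g p (B ?X) ?Y *\<^sub>R \<omega> ?X + g p (B ?Y) ?Y *\<^sub>R \<omega> ?Y"
    using \<alpha>[OF T(1)] \<alpha>[OF T(2)] linear_frame[OF c lin BT(1)] linear_frame[OF c lin BT(2)] s by simp_all
  ultimately show "\<omega> ?X = conf_part1 (\<alpha> ?X) (\<alpha> ?Y)" "\<omega> ?Y = conf_part2 (\<alpha> ?X) (\<alpha> ?Y)"
    using conf_part_unique[OF w] by metis+
qed

text \<open>The two polar factors written out in the frame of one chart and extended linearly. On
  tangent vectors they do not depend on the chart, by \<open>polar_unique\<close>.\<close>

definition cform :: "'m chart \<Rightarrow> 'm \<Rightarrow> ('m tangent \<Rightarrow> real^3) \<Rightarrow> 'm tangent \<Rightarrow> real^3" where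
  "cform c p \<alpha> X = g p X (fr1 c p) *\<^sub>R conf_part1 (\<alpha> (fr1 c p)) (\<alpha> (fr2 c p))
     + g p X (fr2 c p) *\<^sub>R conf_part2 (\<alpha> (fr1 c p)) (\<alpha> (fr2 c p))"

definition bform :: "'m chart \<Rightarrow> 'm \<Rightarrow> ('m tangent \<Rightarrow> real^3) \<Rightarrow> 'm tangent \<Rightarrow> 'm tangent" where
  "bform c p \<alpha> X = (let a = \<alpha> (fr1 c p); b = \<alpha> (fr2 c p); d = norm (cross3 a b); s = sqrt (d * (a \<bullet> a + b \<bullet> b + 2 * d)) in
     tcomb ((a \<bullet> a + d) / s * g p X (fr1 c p) + (a \<bullet> b) / s * g p X (fr2 c p)) (fr1 c p)
           ((a \<bullet> b) / s * g p X (fr1 c p) + (b \<bullet> b + d) / s * g p X (fr2 c p)) (fr2 c p))"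

lemma polar_exists:
  assumes c: "c \<in> A" "p \<in> fst c" and \<alpha>: "tangent_linear A p \<alpha>" "inj_on \<alpha> (TS p)"
  shows "polar p \<alpha> (cform c p \<alpha>) (bform c p \<alpha>)"
proof -
  let ?X = "fr1 c p" and ?Y = "fr2 c p"
  define a b where "a = \<alpha> ?X" and "b = \<alpha> ?Y"
  define d s where "d = norm (cross3 a b)" and "s = sqrt (d * (a \<bullet> a + b \<bullet> b + 2 * d))"
  define b11 b12 b22 where "b11 = (a \<bullet> a + d) / s" and "b12 = (a \<bullet> b) / s" and "b22 = (b \<bullet> b + d) / s"
  let ?B = "bform c p \<alpha>" and ?\<omega> = "cform c p \<alpha>"
  note T = frame_tangent[OF c]
  have cr: "cross3 a b \<noteq> 0" using \<alpha> inj_frame_iff[OF c] unfolding a_def b_def by blast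
  note cp = conf_part_properties[OF cr, folded d_def, folded s_def, folded b11_def b12_def b22_def]
  have s: "s > 0" using cp(4,5) by (simp add: s_def)
  have Bdef: "?B X = tcomb (b11 * g p X ?X + b12 * g p X ?Y) ?X (b12 * g p X ?X + b22 * g p X ?Y) ?Y" for X
    by (simp add: bform_def Let_def a_def b_def d_def s_def b11_def b12_def b22_def)
  have bp: "b11 > 0" "b22 > 0" using cp(4) s by (simp_all add: b11_def b22_def add_nonneg_pos)
  have lin: "tangent_linear A p ?\<omega>"
    unfolding tangent_linear_def cform_def by (simp add: metric_comb_left T algebra_simps)
  have \<omega>X: "?\<omega> ?X = conf_part1 a b" "?\<omega> ?Y = conf_part2 a b"
    by (simp_all add: cform_def frame_orthonormal[OF c] a_def b_def)
  have endo: "tangent_endo A p ?B"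
    unfolding tangent_endo_def Bdef
    by (auto simp: tcomb_tangent T metric_comb_left) (auto simp: tcomb_def algebra_simps)
  have BX: "?B ?X = tcomb b11 ?X b12 ?Y" "?B ?Y = tcomb b12 ?X b22 ?Y"
    by (simp_all add: Bdef frame_orthonormal[OF c])
  have det: "b11 * b22 - b12 * b12 = 1" using cp(8) by (simp add: power2_eq_square)
  have gB: "g p (?B X) Y = (b11 * g p X ?X + b12 * g p X ?Y) * g p Y ?X + (b12 * g p X ?X + b22 * g p X ?Y) * g p Y ?Y"
    if "X \<in> TS p" "Y \<in> TS p" for X Y
    unfolding Bdef using that by (simp add: metric_comb_left T metric_sym[of _ p Y])
  have pos: "g p (?B X) X > 0" if X: "X \<in> TS p" "X \<noteq> tzero" for X
  proof -
    define x y where "x = g p X ?X" and "y = g p X ?Y"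
    have "x \<noteq> 0 \<or> y \<noteq> 0"
      using frame_expand[OF c X(1)] X(2) by (auto simp: x_def y_def tcomb_def tzero_def)
    \<comment> \<open>Completing the square: a symmetric matrix with positive first entry and
      positive determinant is positive definite.\<close>
    have "b11 * g p (?B X) X = (b11 * x + b12 * y)\<^sup>2 + (b11 * b22 - b12 * b12) * y\<^sup>2"
      unfolding gB[OF X(1) X(1)] x_def y_def by (simp add: power2_eq_square algebra_simps)
    also have "\<dots> > 0"
    proof (cases "y = 0")
      case True
      then show ?thesis using \<open>x \<noteq> 0 \<or> y \<noteq> 0\<close> bp by simp
    next
      case False
      then show ?thesis unfolding det by (simp add: add_nonneg_pos)
    qed
    finally show ?thesis using bp by (simp add: zero_less_mult_iff)
  qed
  have BT: "?B X \<in> TS p" if "X \<in> TS p" for X using endo that unfolding tangent_endo_def by blast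
  have sym: "g p (?B X) Y = g p X (?B Y)" if XY: "X \<in> TS p" "Y \<in> TS p" for X Y
  proof -
    have "g p X (?B Y) = g p (?B Y) X" using metric_sym XY BT by blast
    then show ?thesis unfolding gB[OF XY] gB[OF XY(2,1)] by (simp add: algebra_simps)
  qed
  show ?thesis
    unfolding polar_def
  proof (intro conjI ballI endo)
    have "conf_part1 a b \<noteq> 0" using cp(2,4) by auto
    then show "?\<omega> \<in> conf_maps A C p"
      unfolding conf_maps_frame_iff[OF c] \<omega>X using lin cp(1-3) by simp
    show "tangent_det A p ?B 1" using endo_frame_det[OF c endo BX, of 1] det by simp
    fix X assume X: "X \<in> TS p"
    have lX: "?\<omega> (tcomb x ?X y ?Y) = x *\<^sub>R conf_part1 a b + y *\<^sub>R conf_part2 a b" for x y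
      using lin T \<omega>X unfolding tangent_linear_def by metis
    have "\<alpha> X = g p X ?X *\<^sub>R (b11 *\<^sub>R conf_part1 a b + b12 *\<^sub>R conf_part2 a b)
        + g p X ?Y *\<^sub>R (b12 *\<^sub>R conf_part1 a b + b22 *\<^sub>R conf_part2 a b)"
      using linear_frame[OF c \<alpha>(1) X] cp(6,7) unfolding a_def[symmetric] b_def[symmetric] by metis
    also have "\<dots> = ?\<omega> (?B X)" unfolding Bdef lX by (simp add: algebra_simps)
    finally show "\<alpha> X = ?\<omega> (?B X)" .
    fix g' assume "g' \<in> C"
    then obtain \<rho> where \<rho>: "\<rho> p > 0" "\<And>X Y. X \<in> TS p \<Longrightarrow> Y \<in> TS p \<Longrightarrow> g' p X Y = \<rho> p * g p X Y"
      unfolding C_eq conformally_equivalent_def by blast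
    show "X \<noteq> tzero \<longrightarrow> g' p (?B X) X > 0" using \<rho> pos X BT by simp
    show "g' p (?B X) Y = g' p X (?B Y)" if "Y \<in> TS p" for Y using \<rho>(2) sym X BT that by simp
  qed
qed

text \<open>The formula of \<open>polar_frame\<close> fixes the conformal factor, whose injectivity
  then fixes the other one.\<close>

lemma polar_unique:
  assumes P: "polar p \<alpha> \<omega> B" "polar p \<alpha> \<omega>' B'" and X: "X \<in> TS p"
  shows "\<omega> X = \<omega>' X" "B X = B' X"
proof -
  obtain c where c: "c \<in> A" "p \<in> fst c" by (rule chart_exists)
  have lin: "tangent_linear A p \<omega>" "tangent_linear A p \<omega>'" and inj: "inj_on \<omega> (TS p)"
    using P unfolding polar_def conf_maps_def by blast+
  have eq: "\<omega> Y = \<omega>' Y" if "Y \<in> TS p" for Y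
    unfolding linear_frame[OF c lin(1) that] linear_frame[OF c lin(2) that] polar_frame[OF c P(1)] polar_frame[OF c P(2)] ..
  then show "\<omega> X = \<omega>' X" using X .
  have "B X \<in> TS p" "B' X \<in> TS p" "\<omega> (B X) = \<omega>' (B' X)"
    using P X unfolding polar_def tangent_endo_def by metis+
  then show "B X = B' X" using eq inj unfolding inj_on_def by metis
qed

text \<open>A choice of chart at every point, with no regularity in the point. Smoothness is
  recovered by comparison with the frame of one fixed chart near the point in question.\<close>

definition chart_at :: "'m \<Rightarrow> 'm chart" where "chart_at p = (SOME c. c \<in> A \<and> p \<in> fst c)"

lemma chart_at: "chart_at p \<in> A" "p \<in> fst (chart_at p)"
  using chart_exists[of p] someI_ex[of "\<lambda>c. c \<in> A \<and> p \<in> fst c"] unfolding chart_at_def by blast+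

definition cpart :: "'m \<Rightarrow> ('m tangent \<Rightarrow> real^3) \<Rightarrow> 'm tangent \<Rightarrow> real^3" where
  "cpart p \<alpha> = restrict (cform (chart_at p) p \<alpha>) (TS p)"

section \<open>The conformal part as a chart-free object\<close>

lemma cpart_eq:
  assumes "c \<in> A" "p \<in> fst c" "tangent_linear A p \<alpha>" "inj_on \<alpha> (TS p)" "X \<in> TS p"
  shows "cpart p \<alpha> X = cform c p \<alpha> X" "bform (chart_at p) p \<alpha> X = bform c p \<alpha> X"
  using polar_unique[OF polar_exists[OF chart_at assms(3,4)] polar_exists[OF assms(1-4)] assms(5)] assms(5)
  by (simp_all add: cpart_def)

lemma cpart_conf: "tangent_linear A p \<alpha> \<Longrightarrow> inj_on \<alpha> (TS p) \<Longrightarrow> cpart p \<alpha> \<in> conf_maps A C p"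
  and polar_cpart: "tangent_linear A p \<alpha> \<Longrightarrow> inj_on \<alpha> (TS p) \<Longrightarrow> polar p \<alpha> (cpart p \<alpha>) (bform (chart_at p) p \<alpha>)"
proof -
  assume \<alpha>: "tangent_linear A p \<alpha>" "inj_on \<alpha> (TS p)"
  note P = polar_exists[OF chart_at \<alpha>]
  have e: "cpart p \<alpha> X = cform (chart_at p) p \<alpha> X" if "X \<in> TS p" for X using that by (simp add: cpart_def)
  have "cpart p \<alpha> \<in> conf_maps A C p \<longleftrightarrow> cform (chart_at p) p \<alpha> \<in> conf_maps A C p"
    unfolding conf_maps_def tangent_linear_def using e tcomb_tangent by (simp add: inj_on_def)
  then show 1: "cpart p \<alpha> \<in> conf_maps A C p" using P unfolding polar_def by blast
  have "bform (chart_at p) p \<alpha> X \<in> TS p" if "X \<in> TS p" for X using P that unfolding polar_def tangent_endo_def by blast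
  then show "polar p \<alpha> (cpart p \<alpha>) (bform (chart_at p) p \<alpha>)" using P 1 e unfolding polar_def by simp
qed

lemma cpart_frame:
  assumes c: "c \<in> A" "p \<in> fst c" and \<alpha>: "tangent_linear A p \<alpha>" "inj_on \<alpha> (TS p)"
  shows "cpart p \<alpha> (fr1 c p) = conf_part1 (\<alpha> (fr1 c p)) (\<alpha> (fr2 c p))"
    "cpart p \<alpha> (fr2 c p) = conf_part2 (\<alpha> (fr1 c p)) (\<alpha> (fr2 c p))"
  using polar_frame[OF c polar_cpart[OF \<alpha>]] .

lemma cpart_conformal:
  assumes \<omega>: "\<omega> \<in> conf_maps A C p" and X: "X \<in> TS p" shows "cpart p \<omega> X = \<omega> X"
proof -
  obtain c where c: "c \<in> A" "p \<in> fst c" by (rule chart_exists)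
  have l: "tangent_linear A p \<omega>" "inj_on \<omega> (TS p)" and "cpart p \<omega> \<in> conf_maps A C p"
    using \<omega> cpart_conf unfolding conf_maps_def by auto
  then have l': "tangent_linear A p (cpart p \<omega>)" unfolding conf_maps_def by blast
  have w: "\<omega> (fr1 c p) \<bullet> \<omega> (fr2 c p) = 0" "\<omega> (fr2 c p) \<bullet> \<omega> (fr2 c p) = \<omega> (fr1 c p) \<bullet> \<omega> (fr1 c p)" "\<omega> (fr1 c p) \<noteq> 0"
    using \<omega> unfolding conf_maps_frame_iff[OF c] by auto
  \<comment> \<open>The numbers 1, 1, 0 are the matrix entries of the identity, the positive factor
    of a map that is already conformal.\<close>
  show ?thesis
    unfolding linear_frame[OF c l(1) X] linear_frame[OF c l' X] cpart_frame[OF c l]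
    using conf_part_unique[OF w, of 1 1 0] by simp
qed

subsection \<open>Smoothness\<close>

lemma msmooth_metric: "c \<in> A \<Longrightarrow> p \<in> fst c \<Longrightarrow> msmooth A (\<lambda>_ q. g q (cv c v q) (cv c w q)) t p"
  using metric smooth_fun_on_iff[OF chart_open] unfolding riemannian_metric_def by blast

lemma msmooth_gEFG:
  assumes "c \<in> A" "p \<in> fst c"
  shows "msmooth A (\<lambda>_. gE c) t p" "msmooth A (\<lambda>_. gF c) t p" "msmooth A (\<lambda>_. gW c) t p"
proof -
  show 1: "msmooth A (\<lambda>_. gE c) t p" "msmooth A (\<lambda>_. gF c) t p"
    unfolding gE_def gF_def by (rule msmooth_metric[OF assms])+
  have "msmooth A (\<lambda>_. gG c) t p" unfolding gG_def by (rule msmooth_metric[OF assms])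
  then show "msmooth A (\<lambda>_. gW c) t p" unfolding gW_def by (intro msmooth_diff msmooth_mult 1)
qed

lemma msmooth_frv:
  assumes "c \<in> A" "p \<in> fst c"
  shows "msmooth A (\<lambda>_. frv1 c) t p" "msmooth A (\<lambda>_. frv2 c) t p"
  unfolding frv1_def frv2_def using gE_pos[OF assms] gW_pos[OF assms]
  by (auto intro!: msmooth_scaleR msmooth_diff msmooth_divide msmooth_sqrt msmooth_mult msmooth_const msmooth_gEFG[OF assms])

lemma msmooth_form_vector:
  fixes \<Phi> :: "real \<Rightarrow> 'm \<Rightarrow> 'm tangent \<Rightarrow> 'b::euclidean_space"
  assumes \<Phi>: "\<And>i. msmooth A (\<lambda>t q. \<Phi> t q (cv c (axis i 1) q)) t p" "\<And>t q. tangent_linear A q (\<Phi> t q)"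
    and c: "c \<in> A" "p \<in> fst c" and V: "msmooth A (\<lambda>_. V) t p"
  shows "msmooth A (\<lambda>t q. \<Phi> t q (cv c (V q) q)) t p"
proof (rule msmooth_cong[of "\<lambda>t q. V q $ 1 *\<^sub>R \<Phi> t q (cv c (axis 1 1) q) + V q $ 2 *\<^sub>R \<Phi> t q (cv c (axis 2 1) q)" _ _ UNIV "fst c"])
  show "msmooth A (\<lambda>t q. V q $ 1 *\<^sub>R \<Phi> t q (cv c (axis 1 1) q) + V q $ 2 *\<^sub>R \<Phi> t q (cv c (axis 2 1) q)) t p"
    by (intro msmooth_add msmooth_scaleR msmooth_nth V \<Phi>)
  show "V q $ 1 *\<^sub>R \<Phi> t q (cv c (axis 1 1) q) + V q $ 2 *\<^sub>R \<Phi> t q (cv c (axis 2 1) q) = \<Phi> t q (cv c (V q) q)"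
    if "q \<in> fst c" for t q
    by (rule tangent_linear_coord[OF \<Phi>(2) c(1) that, symmetric])
qed (use c chart_open[OF c(1)] in auto)

lemma msmooth_form_frame:
  assumes "form_smooth \<Phi>" "\<And>t q. tangent_linear A q (\<Phi> t q)" "c \<in> A" "p \<in> fst c"
  shows "msmooth A (\<lambda>t q. \<Phi> t q (fr1 c q)) t p" "msmooth A (\<lambda>t q. \<Phi> t q (fr2 c q)) t p"
  unfolding fr1_def fr2_def
  by (rule msmooth_form_vector[OF form_smoothD[OF assms(1,3,4)] assms(2-4)] msmooth_frv[OF assms(3,4)])+

lemma msmooth_metric_frame:
  assumes c: "c \<in> A" "p \<in> fst c"
  shows "msmooth A (\<lambda>_ q. g q (cv c v q) (fr1 c q)) t p" "msmooth A (\<lambda>_ q. g q (cv c v q) (fr2 c q)) t p"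
proof -
  have "msmooth A (\<lambda>_ q. g q (cv c v q) (cv c (V q) q)) t p" if V: "msmooth A (\<lambda>_. V) t p" for V
  proof (rule msmooth_cong[of "\<lambda>_ q. V q $ 1 * g q (cv c v q) (cv c (axis 1 1) q) + V q $ 2 * g q (cv c v q) (cv c (axis 2 1) q)" _ _ UNIV "fst c"])
    show "msmooth A (\<lambda>_ q. V q $ 1 * g q (cv c v q) (cv c (axis 1 1) q) + V q $ 2 * g q (cv c v q) (cv c (axis 2 1) q)) t p"
      by (intro msmooth_add msmooth_mult msmooth_nth V msmooth_metric c)
    show "V q $ 1 * g q (cv c v q) (cv c (axis 1 1) q) + V q $ 2 * g q (cv c v q) (cv c (axis 2 1) q) = g q (cv c v q) (cv c (V q) q)"
      if "q \<in> fst c" for q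
      using metric_comb_right[OF coord_vector_tangent[OF c(1) that] coord_vector_tangent[OF c(1) that] coord_vector_tangent[OF c(1) that]]
        coord_vector_comb[OF c(1) that, of "V q $ 1" "axis 1 1" "V q $ 2" "axis 2 1"] vec2_eq_axis[of "V q"] by metis
  qed (use c chart_open[OF c(1)] in auto)
  then show "msmooth A (\<lambda>_ q. g q (cv c v q) (fr1 c q)) t p" "msmooth A (\<lambda>_ q. g q (cv c v q) (fr2 c q)) t p"
    unfolding fr1_def fr2_def using msmooth_frv[OF c] by blast+
qed

lemma form_smooth_frame:
  fixes \<Phi> :: "real \<Rightarrow> 'm \<Rightarrow> 'm tangent \<Rightarrow> 'b::euclidean_space"
  assumes "\<And>t q. tangent_linear A q (\<Phi> t q)"
    "\<And>c t p. c \<in> A \<Longrightarrow> p \<in> fst c \<Longrightarrow> msmooth A (\<lambda>t q. \<Phi> t q (fr1 c q)) t p"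
    "\<And>c t p. c \<in> A \<Longrightarrow> p \<in> fst c \<Longrightarrow> msmooth A (\<lambda>t q. \<Phi> t q (fr2 c q)) t p"
  shows "form_smooth \<Phi>"
  unfolding form_smooth_def
proof (intro allI ballI impI)
  fix t p c v assume c: "c \<in> A" "p \<in> fst c"
  show "msmooth A (\<lambda>t q. \<Phi> t q (cv c v q)) t p"
  proof (rule msmooth_cong[of "\<lambda>t q. g q (cv c v q) (fr1 c q) *\<^sub>R \<Phi> t q (fr1 c q) + g q (cv c v q) (fr2 c q) *\<^sub>R \<Phi> t q (fr2 c q)" _ _ UNIV "fst c"])
    show "msmooth A (\<lambda>t q. g q (cv c v q) (fr1 c q) *\<^sub>R \<Phi> t q (fr1 c q) + g q (cv c v q) (fr2 c q) *\<^sub>R \<Phi> t q (fr2 c q)) t p"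
      by (intro msmooth_add msmooth_scaleR msmooth_metric_frame assms c)
  qed (use c chart_open[OF c(1)] linear_frame[OF c(1) _ assms(1) coord_vector_tangent[OF c(1)]] in auto)
qed

lemma msmooth_conf_part:
  assumes "msmooth A a t p" "msmooth A b t p" "cross3 (a t p) (b t p) \<noteq> 0"
  shows "msmooth A (\<lambda>t p. conf_part1 (a t p) (b t p)) t p" "msmooth A (\<lambda>t p. conf_part2 (a t p) (b t p)) t p"
proof -
  have "norm (cross3 (a t p) (b t p)) * (a t p \<bullet> a t p + b t p \<bullet> b t p + 2 * norm (cross3 (a t p) (b t p))) > 0"
    using conf_part_properties(4,5)[OF assms(3)] by (rule mult_pos_pos)
  then show "msmooth A (\<lambda>t p. conf_part1 (a t p) (b t p)) t p" "msmooth A (\<lambda>t p. conf_part2 (a t p) (b t p)) t p"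
    unfolding conf_part1_def conf_part2_def using assms
    by (auto intro!: msmooth_scaleR msmooth_diff msmooth_divide msmooth_sqrt msmooth_mult msmooth_const msmooth_add msmooth_inner
        msmooth_norm msmooth_cross3)
qed

lemma form_smooth_cpart:
  fixes \<Phi> :: "real \<Rightarrow> 'm \<Rightarrow> 'm tangent \<Rightarrow> real^3"
  assumes \<Phi>: "form_smooth \<Phi>" "\<And>t p. tangent_linear A p (\<Phi> t p)" "\<And>t p. inj_on (\<Phi> t p) (TS p)"
  shows "form_smooth (\<lambda>t p. cpart p (\<Phi> t p))"
proof (rule form_smooth_frame)
  show "tangent_linear A q (cpart q (\<Phi> t q))" for t q
    using cpart_conf[OF \<Phi>(2,3)] unfolding conf_maps_def by blast
  fix c t p assume c: "c \<in> A" "p \<in> fst c"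
  have nz: "cross3 (\<Phi> t p (fr1 c p)) (\<Phi> t p (fr2 c p)) \<noteq> 0" using inj_frame_iff[OF c \<Phi>(2)] \<Phi>(3) by blast
  note s = msmooth_conf_part[OF msmooth_form_frame[OF \<Phi>(1,2) c] nz]
  show "msmooth A (\<lambda>t q. cpart q (\<Phi> t q) (fr1 c q)) t p"
    by (rule msmooth_cong[OF s(1), of UNIV "fst c"]) (use c chart_open[OF c(1)] cpart_frame[OF c(1) _ \<Phi>(2,3)] in auto)
  show "msmooth A (\<lambda>t q. cpart q (\<Phi> t q) (fr2 c q)) t p"
    by (rule msmooth_cong[OF s(2), of UNIV "fst c"]) (use c chart_open[OF c(1)] cpart_frame[OF c(1) _ \<Phi>(2,3)] in auto)
qed

lemma smooth_fun_coord:
  assumes h: "smooth_fun_on A UNIV (h :: 'm \<Rightarrow> real)" and c: "c \<in> A" "p \<in> fst c"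
  shows "msmooth A (\<lambda>_ q. cv c v q h) t p"
proof -
  \<comment> \<open>\<open>differential\<close> takes maps into three-space, so a real function is
    placed in the first coordinate.\<close>
  define k where "k q = (axis 1 (h q) :: real^3)" for q
  have k: "msmooth A (\<lambda>_. k) t p" for t p
  proof -
    have "k = (\<lambda>q. h q *\<^sub>R axis 1 1)" by (auto simp: k_def vec_eq_iff axis_def)
    then show ?thesis using h unfolding smooth_fun_on_iff[OF open_UNIV, of h t] by (auto intro!: msmooth_scaleR msmooth_const)
  qed
  have "msmooth A (\<lambda>_ q. differential k (cv c v q) $ 1) t p"
    by (intro msmooth_nth form_smoothD[OF form_smooth_differential[of "\<lambda>_. k"]] k c)
  then show ?thesis by (simp add: differential_def k_def)
qed

text \<open>Resolves the definite description in \<open>conformal_part\<close>. Existence asks for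
  smoothness of both factors; uniqueness is pointwise on tangent vectors, while extensionality
  settles all other arguments, which is also why \<open>cpart\<close> is restricted to the tangent
  space.\<close>

theorem conformal_part_eq:
  assumes f: "f \<in> immersions A"
  shows "conformal_part A C f = (\<lambda>p. cpart p (differential f))"
proof -
  have fs: "smooth_fun_on A UNIV f" and inj: "\<And>p. inj_on (differential f) (TS p)"
    using f unfolding immersions_def by auto
  have fm: "msmooth A (\<lambda>_. f) t p" for t p using fs smooth_fun_on_iff[OF open_UNIV, of f t] by blast
  note lin = tangent_linear_differential
  let ?\<omega> = "\<lambda>p. cpart p (differential f)" and ?B = "\<lambda>p. bform (chart_at p) p (differential f)"
  have P: "polar p (differential f) (?\<omega> p) (?B p)" for p by (rule polar_cpart[OF lin inj])
  have df: "form_smooth (\<lambda>_ _. differential f)" by (rule form_smooth_differential[of "\<lambda>_. f", OF fm])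
  have \<omega>s: "smooth_form_on A UNIV ?\<omega>"
    unfolding smooth_form_on_iff by (rule form_smooth_cpart[OF df lin inj])
  have Bs: "smooth_endo_field A ?B"
    unfolding smooth_endo_field_def
  proof (intro conjI allI ballI impI)
    show "tangent_endo A p (?B p)" for p using P unfolding polar_def by blast
    fix c v and h :: "'m \<Rightarrow> real" assume c: "c \<in> A" and h: "smooth_fun_on A UNIV h"
    show "smooth_fun_on A (fst c) (\<lambda>p. ?B p (cv c v p) h)"
      unfolding smooth_fun_on_iff[OF chart_open[OF c], where t = 0]
    proof
      fix p assume p: "p \<in> fst c"
      let ?a = "\<lambda>q. differential f (fr1 c q)" and ?b = "\<lambda>q. differential f (fr2 c q)"
      let ?d = "\<lambda>q. norm (cross3 (?a q) (?b q))"
      let ?s = "\<lambda>q. sqrt (?d q * (?a q \<bullet> ?a q + ?b q \<bullet> ?b q + 2 * ?d q))"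
      \<comment> \<open>The value on \<open>h\<close> of the endomorphism applied to a coordinate
        vector, in the frame of the fixed chart \<open>c\<close> instead of the irregular
        \<open>chart_at\<close>.\<close>
      let ?G = "\<lambda>q. ((?a q \<bullet> ?a q + ?d q) / ?s q * g q (cv c v q) (fr1 c q) + (?a q \<bullet> ?b q) / ?s q * g q (cv c v q) (fr2 c q)) * fr1 c q h
         + ((?a q \<bullet> ?b q) / ?s q * g q (cv c v q) (fr1 c q) + (?b q \<bullet> ?b q + ?d q) / ?s q * g q (cv c v q) (fr2 c q)) * fr2 c q h"
      have nz: "cross3 (?a p) (?b p) \<noteq> 0" using inj_frame_iff[OF c p lin] inj by blast
      have pos: "?d p * (?a p \<bullet> ?a p + ?b p \<bullet> ?b p + 2 * ?d p) > 0"
        using conf_part_properties(4,5)[OF nz] by (rule mult_pos_pos)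
      have ev: "tangent_linear A q (\<lambda>X. X h)" for q by (simp add: tangent_linear_def tcomb_def)
      have ab: "msmooth A (\<lambda>_. ?a) 0 p" "msmooth A (\<lambda>_. ?b) 0 p" by (rule msmooth_form_frame[OF df lin c p])+
      have fh: "msmooth A (\<lambda>_ q. fr1 c q h) 0 p" "msmooth A (\<lambda>_ q. fr2 c q h) 0 p"
        unfolding fr1_def fr2_def
        by (rule msmooth_form_vector[where \<Phi> = "\<lambda>_ _ X. X h", OF smooth_fun_coord[OF h c p] ev c p] msmooth_frv[OF c p])+
      have "msmooth A (\<lambda>_. ?G) 0 p"
        using pos nz ab fh
        by (intro msmooth_add msmooth_mult msmooth_divide msmooth_sqrt msmooth_inner msmooth_norm msmooth_cross3
            msmooth_const msmooth_metric_frame c p) auto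
      then show "msmooth A (\<lambda>_ p. ?B p (cv c v p) h) 0 p"
      proof (rule msmooth_cong[of _ _ _ UNIV "fst c"])
        fix q assume q: "q \<in> fst c"
        show "?G q = ?B q (cv c v q) h"
          unfolding cpart_eq(2)[OF c q lin inj coord_vector_tangent[OF c q]]
          unfolding bform_def Let_def tcomb_def by simp
      qed (use c chart_open[OF c] p in auto)
    qed
  qed
  show ?thesis
    unfolding conformal_part_def
  proof (rule the_equality)
    show "(\<forall>p. ?\<omega> p \<in> extensional (TS p)) \<and> (\<exists>B. conformal_decomposition A C f ?\<omega> B)"
      unfolding conformal_decomposition_iff using \<omega>s Bs P by (auto simp: cpart_def)
    fix \<omega> assume \<omega>: "(\<forall>p. \<omega> p \<in> extensional (TS p)) \<and> (\<exists>B. conformal_decomposition A C f \<omega> B)"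
    then obtain B where "\<And>p. polar p (differential f) (\<omega> p) (B p)" unfolding conformal_decomposition_iff by blast
    from polar_unique(1)[OF this P] have "\<omega> p X = ?\<omega> p X" if "X \<in> TS p" for p X using that .
    moreover have "\<omega> p X = ?\<omega> p X" if "X \<notin> TS p" for p X
      using \<omega> that extensional_arb[of "\<omega> p" "TS p" X] by (simp add: cpart_def)
    ultimately show "\<omega> = ?\<omega>" by (intro ext) blast
  qed
qed

end

section \<open>Spin equivalence of conformal forms\<close>

context conformal_surface begin

text \<open>How the form \<open>(\<psi>, \<psi>)\<close> changes when the section is multiplied by a
  nowhere vanishing quaternionic function. The scalar \<open>\<mu>\<close> is not normalised, so it
  absorbs the conformal factor as well as the rotation.\<close>

definition speq :: "('m \<Rightarrow> 'm tangent \<Rightarrow> real^3) \<Rightarrow> ('m \<Rightarrow> 'm tangent \<Rightarrow> real^3) \<Rightarrow> bool" where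
  "speq \<omega> \<omega>' \<longleftrightarrow> (\<exists>\<mu>. smooth_fun_on A UNIV \<mu> \<and> (\<forall>p. \<mu> p \<noteq> 0 \<and>
     (\<forall>X\<in>TS p. qim (\<omega> p X) = qconj (\<mu> p) *\<^sub>q qim (\<omega>' p X) *\<^sub>q \<mu> p)))"

lemmas msmooth_qmult = msmooth_bilinear[OF bounded_bilinear_qmult]
lemmas msmooth_qim = msmooth_linear[OF bounded_linear_qim]
lemmas msmooth_qconj = msmooth_linear[OF bounded_linear_qconj]

lemma msmooth_qinv: "msmooth A F t p \<Longrightarrow> F t p \<noteq> 0 \<Longrightarrow> msmooth A (\<lambda>t p. qinv (F t p)) t p"
  unfolding qinv_def power2_eq_square
  by (intro msmooth_scaleR msmooth_divide msmooth_mult msmooth_norm msmooth_qconj msmooth_const) auto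

section \<open>Spin equivalence is an equivalence relation\<close>

lemma speq_refl: "speq \<omega> \<omega>"
proof -
  have "qone \<noteq> 0" by (simp add: qone_def zero_prod_def)
  moreover have "smooth_fun_on A UNIV (\<lambda>_. qone)" unfolding smooth_fun_iff by (intro allI msmooth_const)
  ultimately show ?thesis unfolding speq_def by (intro exI[of _ "\<lambda>_. qone"]) simp
qed

lemma speq_sym: assumes "speq \<omega> \<omega>'" shows "speq \<omega>' \<omega>"
proof -
  obtain \<mu> where \<mu>: "smooth_fun_on A UNIV \<mu>" "\<And>p. \<mu> p \<noteq> 0"
    "\<And>p X. X \<in> TS p \<Longrightarrow> qim (\<omega> p X) = qconj (\<mu> p) *\<^sub>q qim (\<omega>' p X) *\<^sub>q \<mu> p"
    using assms unfolding speq_def by blast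
  have "qim (\<omega>' p X) = qconj (qinv (\<mu> p)) *\<^sub>q qim (\<omega> p X) *\<^sub>q qinv (\<mu> p)" if "X \<in> TS p" for p X
  proof -
    have "qconj (qinv (\<mu> p)) *\<^sub>q qim (\<omega> p X) *\<^sub>q qinv (\<mu> p)
      = qconj (\<mu> p *\<^sub>q qinv (\<mu> p)) *\<^sub>q qim (\<omega>' p X) *\<^sub>q (\<mu> p *\<^sub>q qinv (\<mu> p))"
      by (simp add: \<mu>(3)[OF that] qconj_mult qmult_assoc)
    then show ?thesis by (simp add: qinv_right \<mu>(2))
  qed
  then show ?thesis
    unfolding speq_def using \<mu>(1,2) unfolding smooth_fun_iff
    by (intro exI[of _ "\<lambda>p. qinv (\<mu> p)"]) (auto intro: msmooth_qinv simp: qinv_nonzero)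
qed

lemma speq_trans: assumes "speq \<omega> \<omega>'" "speq \<omega>' \<omega>''" shows "speq \<omega> \<omega>''"
proof -
  obtain \<mu> \<nu> where \<mu>: "smooth_fun_on A UNIV \<mu>" "\<And>p. \<mu> p \<noteq> 0"
    "\<And>p X. X \<in> TS p \<Longrightarrow> qim (\<omega> p X) = qconj (\<mu> p) *\<^sub>q qim (\<omega>' p X) *\<^sub>q \<mu> p"
    and \<nu>: "smooth_fun_on A UNIV \<nu>" "\<And>p. \<nu> p \<noteq> 0"
    "\<And>p X. X \<in> TS p \<Longrightarrow> qim (\<omega>' p X) = qconj (\<nu> p) *\<^sub>q qim (\<omega>'' p X) *\<^sub>q \<nu> p"
    using assms unfolding speq_def by metis
  show ?thesis
    unfolding speq_def
  proof (intro exI[of _ "\<lambda>p. \<nu> p *\<^sub>q \<mu> p"] conjI allI ballI)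
    show "smooth_fun_on A UNIV (\<lambda>p. \<nu> p *\<^sub>q \<mu> p)"
      using \<mu>(1) \<nu>(1) unfolding smooth_fun_iff by (auto intro: msmooth_qmult)
  qed (use \<mu>(2,3) \<nu>(2,3) in \<open>auto simp: qmult_eq_0_iff qconj_mult qmult_assoc\<close>)
qed

lemma speq_cong:
  assumes "speq \<omega> \<omega>'" "\<And>p X. X \<in> TS p \<Longrightarrow> \<omega> p X = \<eta> p X" "\<And>p X. X \<in> TS p \<Longrightarrow> \<omega>' p X = \<eta>' p X"
  shows "speq \<eta> \<eta>'"
  using assms unfolding speq_def by metis

section \<open>Lifting a path of conformal forms to quaternions\<close>

lemma conf_frame_norm:
  assumes "c \<in> A" "p \<in> fst c" "\<omega> \<in> conf_maps A C p"
  shows "norm (\<omega> (fr2 c p)) = norm (\<omega> (fr1 c p))" "\<omega> (fr1 c p) \<noteq> 0" "\<omega> (fr1 c p) \<bullet> \<omega> (fr2 c p) = 0"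
    "cross3 (\<omega> (fr1 c p)) (\<omega> (fr2 c p)) \<noteq> 0"
proof -
  show *: "norm (\<omega> (fr2 c p)) = norm (\<omega> (fr1 c p))" "\<omega> (fr1 c p) \<noteq> 0" "\<omega> (fr1 c p) \<bullet> \<omega> (fr2 c p) = 0"
    using assms(3) unfolding conf_maps_frame_iff[OF assms(1,2)] by (auto simp: norm_eq_sqrt_inner)
  show "cross3 (\<omega> (fr1 c p)) (\<omega> (fr2 c p)) \<noteq> 0"
    using inj_frame_iff[OF assms(1,2)] assms(3) unfolding conf_maps_def by blast
qed

lemma links_link_quat:
  assumes c: "c \<in> A" "p \<in> fst c" and \<omega>: "\<omega> \<in> conf_maps A C p" "\<omega>' \<in> conf_maps A C p"
    and nz: "frame_quat (\<omega> (fr1 c p)) (\<omega> (fr2 c p)) (\<omega>' (fr1 c p)) (\<omega>' (fr2 c p)) \<noteq> 0"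
  shows "links (TS p) (link_quat (\<omega> (fr1 c p)) (\<omega> (fr2 c p)) (\<omega>' (fr1 c p)) (\<omega>' (fr2 c p))) \<omega> \<omega>'"
proof -
  let ?Q = "frame_quat (\<omega> (fr1 c p)) (\<omega> (fr2 c p)) (\<omega>' (fr1 c p)) (\<omega>' (fr2 c p))"
  let ?q = "link_quat (\<omega> (fr1 c p)) (\<omega> (fr2 c p)) (\<omega>' (fr1 c p)) (\<omega>' (fr2 c p))"
  define r where "r = norm (\<omega> (fr1 c p)) / norm (\<omega>' (fr1 c p))"
  note n = conf_frame_norm[OF c \<omega>(1)] and n' = conf_frame_norm[OF c \<omega>(2)]
  have lin: "tangent_linear A p \<omega>" "tangent_linear A p \<omega>'" using \<omega> unfolding conf_maps_def by auto
  note Q = frame_quat_intertwines[OF n(1-3) n'(1-3), folded r_def]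
  have "?Q *\<^sub>q qim (\<omega> X) = r *\<^sub>R (qim (\<omega>' X) *\<^sub>q ?Q)" if "X \<in> TS p" for X
    unfolding linear_frame[OF c lin(1) that] linear_frame[OF c lin(2) that]
    by (simp add: qm.add_left qm.add_right qm.scaleR_left qm.scaleR_right Q scaleR_add_right mult.commute)
  then have "?q *\<^sub>q qim (\<omega> X) = r *\<^sub>R (qim (\<omega>' X) *\<^sub>q ?q)" if "X \<in> TS p" for X
    using that by (simp add: link_quat_def qm.scaleR_left qm.scaleR_right)
  then show ?thesis
    unfolding links_def using nz n(2) n'(2) by (auto simp: link_quat_def r_def intro!: exI[of _ r])
qed

lemma msmooth_continuous:
  assumes "c \<in> A" "\<And>p. p \<in> fst c \<Longrightarrow> msmooth A (\<lambda>_. h) t p"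
  shows "continuous_on (snd c ` fst c) (\<lambda>y. h (cinv c y))"
proof (rule smooth_continuous_on)
  fix y assume "y \<in> snd c ` fst c"
  then obtain p where "p \<in> fst c" "y = snd c p" by blast
  then show "smooth_at (\<lambda>y. h (cinv c y)) y"
    using msmooth_slice_iff[OF assms(1), of p h t] assms(2) by (simp add: o_def)
qed

lemma form_smooth_continuous:
  assumes "form_smooth \<Phi>" "c \<in> A"
  shows "continuous_on (I \<times> snd c ` fst c) (\<lambda>(t, y). \<Phi> t (cinv c y) (cv c v (cinv c y)))"
proof -
  have "continuous_on (I \<times> snd c ` fst c) (pull c (\<lambda>t q. \<Phi> t q (cv c v q)))"
  proof (rule smooth_continuous_on)
    fix z assume "z \<in> I \<times> snd c ` fst c"
    then obtain t p where "p \<in> fst c" "z = (t, snd c p)" by blast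
    then show "smooth_at (pull c (\<lambda>t q. \<Phi> t q (cv c v q))) z"
      using form_smoothD[OF assms] msmooth_chart[OF assms(2)] by blast
  qed
  then show ?thesis by (simp add: pull_def case_prod_beta')
qed

text \<open>The quaternion linking the two ends of a path of conformal forms is the product of the
  quaternions close to 1 that link its values at consecutive multiples of \<open>2\<^sup>-\<^sup>k\<close>; locally it does not
  depend on \<open>k\<close> once \<open>k\<close> is large.\<close>

theorem conformal_path_speq:
  fixes \<omega> :: "real \<Rightarrow> 'm \<Rightarrow> 'm tangent \<Rightarrow> real^3"
  assumes conf: "\<And>t p. t \<in> {0..1} \<Longrightarrow> \<omega> t p \<in> conf_maps A C p"
    and smooth: "\<And>t. t \<in> {0..1} \<Longrightarrow> form_smooth (\<lambda>_. \<omega> t)"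
    and cont: "\<And>c. c \<in> A \<Longrightarrow> continuous_on ({0..1} \<times> snd c ` fst c) (\<lambda>(t, y). \<omega> t (cinv c y) (fr1 c (cinv c y)))"
      "\<And>c. c \<in> A \<Longrightarrow> continuous_on ({0..1} \<times> snd c ` fst c) (\<lambda>(t, y). \<omega> t (cinv c y) (fr2 c (cinv c y)))"
  shows "speq (\<omega> 0) (\<omega> 1)"
proof -
  \<comment> \<open>\<open>lq\<close> is explicit in the frame of a chart and therefore smooth;
    \<open>ul\<close> refers to no chart and is thus globally defined. Where both exist with real
    part above 9/10 they coincide, so \<open>ul\<close> inherits smoothness.\<close>
  define lq where "lq c s t p = link_quat (\<omega> s p (fr1 c p)) (\<omega> s p (fr2 c p)) (\<omega> t p (fr1 c p)) (\<omega> t p (fr2 c p))" for c s t p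
  define ul where "ul s t p = (SOME q. links (TS p) q (\<omega> s p) (\<omega> t p) \<and> fst q > 9/10)" for s t p
  have lin: "tangent_linear A p (\<omega> t p)" if "t \<in> {0..1}" for t p using conf[OF that] unfolding conf_maps_def by blast
  \<comment> \<open>Uniform continuity of the normalised frames on a compact set
    \<open>[0, 1] x ball\<close> supplies one \<open>\<delta>\<close> for all times and for all
    points near \<open>p0\<close>.\<close>
  have local: "\<exists>V \<delta>. open V \<and> p0 \<in> V \<and> V \<subseteq> fst c \<and> \<delta> > 0 \<and> (\<forall>p\<in>V. \<forall>s\<in>{0..1}. \<forall>t\<in>{0..1}. \<bar>s - t\<bar> < \<delta> \<longrightarrow>
      frame_quat (\<omega> s p (fr1 c p)) (\<omega> s p (fr2 c p)) (\<omega> t p (fr1 c p)) (\<omega> t p (fr2 c p)) \<noteq> 0 \<and>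
      links (TS p) (ul s t p) (\<omega> s p) (\<omega> t p) \<and> fst (ul s t p) > 9/10 \<and> ul s t p = lq c s t p)"
    if c: "c \<in> A" "p0 \<in> fst c" for c p0
  proof -
    obtain e where e: "e > 0" "cball (snd c p0) e \<subseteq> snd c ` fst c"
      using chart_image_open[OF c(1)] c(2) open_contains_cball by blast
    let ?K = "{0..1::real} \<times> cball (snd c p0) e"
    have K: "compact ?K" by (intro compact_Times) auto
    define a where "a = (\<lambda>(t, y). \<omega> t (cinv c y) (fr1 c (cinv c y)))"
    define b where "b = (\<lambda>(t, y). \<omega> t (cinv c y) (fr2 c (cinv c y)))"
    have ab: "continuous_on ?K a" "continuous_on ?K b"
      unfolding a_def b_def using e(2) by (auto intro: continuous_on_subset[OF cont(1)[OF c(1)]] continuous_on_subset[OF cont(2)[OF c(1)]])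
    have nz: "a z \<noteq> 0" "b z \<noteq> 0" if z: "z \<in> ?K" for z
    proof -
      obtain t y where ty: "z = (t, y)" "t \<in> {0..1}" "y \<in> snd c ` fst c" using z e(2) by blast
      show "a z \<noteq> 0" "b z \<noteq> 0"
        using conf_frame_norm[OF c(1) cinv_in[OF ty(3)] conf[OF ty(2)]] ty(1) by (auto simp: a_def b_def)
    qed
    have n1: "continuous_on ?K (\<lambda>z. (1 / norm (a z)) *\<^sub>R a z)" and n2: "continuous_on ?K (\<lambda>z. (1 / norm (b z)) *\<^sub>R b z)"
      using nz by (auto intro!: continuous_intros ab)
    have n3: "continuous_on ?K (\<lambda>z. third (a z) (b z))" unfolding third_def by (intro continuous_on_cross n1 n2)
    obtain d1 where d1: "d1 > 0" "\<And>z z'. z \<in> ?K \<Longrightarrow> z' \<in> ?K \<Longrightarrow> dist z' z < d1 \<Longrightarrow> dist ((1 / norm (a z')) *\<^sub>R a z') ((1 / norm (a z)) *\<^sub>R a z) < 1/10"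
      using compact_uniformly_continuous[OF n1 K] unfolding uniformly_continuous_on_def by (metis zero_less_divide_1_iff zero_less_numeral)
    obtain d2 where d2: "d2 > 0" "\<And>z z'. z \<in> ?K \<Longrightarrow> z' \<in> ?K \<Longrightarrow> dist z' z < d2 \<Longrightarrow> dist ((1 / norm (b z')) *\<^sub>R b z') ((1 / norm (b z)) *\<^sub>R b z) < 1/10"
      using compact_uniformly_continuous[OF n2 K] unfolding uniformly_continuous_on_def by (metis zero_less_divide_1_iff zero_less_numeral)
    obtain d3 where d3: "d3 > 0" "\<And>z z'. z \<in> ?K \<Longrightarrow> z' \<in> ?K \<Longrightarrow> dist z' z < d3 \<Longrightarrow> dist (third (a z') (b z')) (third (a z) (b z)) < 1/10"
      using compact_uniformly_continuous[OF n3 K] unfolding uniformly_continuous_on_def by (metis zero_less_divide_1_iff zero_less_numeral)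
    let ?V = "fst c \<inter> snd c -` ball (snd c p0) e"
    have V: "open ?V" by (rule continuous_open_preimage[OF chart_continuous[OF c(1)] chart_open[OF c(1)]]) simp
    have key: "frame_quat (\<omega> s p (fr1 c p)) (\<omega> s p (fr2 c p)) (\<omega> t p (fr1 c p)) (\<omega> t p (fr2 c p)) \<noteq> 0 \<and>
      links (TS p) (ul s t p) (\<omega> s p) (\<omega> t p) \<and> fst (ul s t p) > 9/10 \<and> ul s t p = lq c s t p"
      if p: "p \<in> ?V" and st: "s \<in> {0..1}" "t \<in> {0..1}" "\<bar>s - t\<bar> < min d1 (min d2 d3)" for p s t
    proof -
      have pc: "p \<in> fst c" using p by blast
      have z: "(s, snd c p) \<in> ?K" "(t, snd c p) \<in> ?K" using p st by auto
      have d: "dist (s, snd c p) (t, snd c p) = \<bar>s - t\<bar>" by (simp add: dist_Pair_Pair dist_real_def)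
      have ab: "a (t, snd c p) = \<omega> t p (fr1 c p)" "b (t, snd c p) = \<omega> t p (fr2 c p)" for t
        using cinv_chart[OF c(1) pc] by (simp_all add: a_def b_def)
      note cs = conf_frame_norm[OF c(1) pc conf[OF st(1)]] and ct = conf_frame_norm[OF c(1) pc conf[OF st(2)]]
      have close: "norm ((1 / norm (\<omega> s p (fr1 c p))) *\<^sub>R \<omega> s p (fr1 c p) - (1 / norm (\<omega> t p (fr1 c p))) *\<^sub>R \<omega> t p (fr1 c p)) < 1/10"
        "norm ((1 / norm (\<omega> s p (fr2 c p))) *\<^sub>R \<omega> s p (fr2 c p) - (1 / norm (\<omega> t p (fr2 c p))) *\<^sub>R \<omega> t p (fr2 c p)) < 1/10"
        "norm (third (\<omega> s p (fr1 c p)) (\<omega> s p (fr2 c p)) - third (\<omega> t p (fr1 c p)) (\<omega> t p (fr2 c p))) < 1/10"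
        using d1(2)[OF z(2,1)] d2(2)[OF z(2,1)] d3(2)[OF z(2,1)] st(3) unfolding d ab dist_norm by simp_all
      note fq = frame_quat_close[OF cs(1-3) ct(1-3) close]
      have l: "links (TS p) (lq c s t p) (\<omega> s p) (\<omega> t p)"
        unfolding lq_def by (rule links_link_quat[OF c(1) pc conf[OF st(1)] conf[OF st(2)] fq(1)])
      have lf: "fst (lq c s t p) > 9/10" using fq(2) by (simp add: lq_def)
      then have u: "links (TS p) (ul s t p) (\<omega> s p) (\<omega> t p) \<and> fst (ul s t p) > 9/10"
        unfolding ul_def by (intro someI[of "\<lambda>q. links (TS p) q (\<omega> s p) (\<omega> t p) \<and> fst q > 9/10"]) (use l in blast)
      have "ul s t p = lq c s t p \<or> ul s t p = - lq c s t p"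
        by (rule links_unique[where \<alpha> = "\<omega> s p" and X = "fr1 c p" and Y = "fr2 c p"])
          (use l u cs(4) frame_tangent[OF c(1) pc] in blast)+
      then show ?thesis using u lf fq(1) by auto
    qed
    show ?thesis
    proof (rule exI[of _ ?V], rule exI[of _ "min d1 (min d2 d3)"], intro conjI V)
      show "p0 \<in> ?V" using c e(1) by simp
      show "min d1 (min d2 d3) > 0" using d1(1) d2(1) d3(1) by simp
    qed (use key in blast)+
  qed
  \<comment> \<open>The product of the short lifts over the first \<open>j\<close> of
    \<open>2^k\<close> time steps. The newest factor stands on the left, as in
    \<open>links_trans\<close>.\<close>
  define pr where "pr k j p = rec_nat qone (\<lambda>i q. ul (real i / 2^k) (real (Suc i) / 2^k) p *\<^sub>q q) j" for k :: nat and j p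
  have pr0: "pr k 0 p = qone" and prS: "pr k (Suc j) p = ul (real j / 2^k) (real (Suc j) / 2^k) p *\<^sub>q pr k j p" for k j p
    by (simp_all add: pr_def)
  \<comment> \<open>On a non-compact surface no single \<open>k\<close> need be fine enough
    everywhere, so the eventual value at each point is taken; near a given point one
    \<open>k\<close> suffices.\<close>
  define L where "L p = (SOME q. \<exists>k0. \<forall>k\<ge>k0. pr k (2^k) p = q)" for p
  have step: "\<bar>real j / 2^k - real (Suc j) / 2^k\<bar> = 1 / 2^k" for j k :: nat
    by (simp add: field_simps abs_if)
  have in01: "real j / 2^k \<in> {0..1}" if "j \<le> 2^k" for j k :: nat
    using that by (simp add: field_simps)
  have ex: "links (TS p0) (L p0) (\<omega> 0 p0) (\<omega> 1 p0) \<and> msmooth A (\<lambda>_. L) 0 p0" if c: "c \<in> A" "p0 \<in> fst c" for c p0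
  proof -
    obtain V \<delta> where V: "open V" "p0 \<in> V" "V \<subseteq> fst c" "\<delta> > 0"
      and key: "\<And>p s t. p \<in> V \<Longrightarrow> s \<in> {0..1} \<Longrightarrow> t \<in> {0..1} \<Longrightarrow> \<bar>s - t\<bar> < \<delta> \<Longrightarrow>
        frame_quat (\<omega> s p (fr1 c p)) (\<omega> s p (fr2 c p)) (\<omega> t p (fr1 c p)) (\<omega> t p (fr2 c p)) \<noteq> 0 \<and>
        links (TS p) (ul s t p) (\<omega> s p) (\<omega> t p) \<and> fst (ul s t p) > 9/10 \<and> ul s t p = lq c s t p"
      using local[OF c] by meson
    obtain k0 where "(1/2)^k0 < \<delta>" using real_arch_pow_inv[OF V(4), of "1/2"] by auto
    then have k0: "1 / 2^k < \<delta>" if "k \<ge> k0" for k :: nat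
      using power_decreasing[OF that, of "1/2::real"] by (simp add: power_one_over)
    have ks: "links (TS p) (ul (real j / 2^k) (real (Suc j) / 2^k) p) (\<omega> (real j / 2^k) p) (\<omega> (real (Suc j) / 2^k) p) \<and>
        fst (ul (real j / 2^k) (real (Suc j) / 2^k) p) > 9/10" if "p \<in> V" "k \<ge> k0" "Suc j \<le> 2^k" for p k j
      using key[OF that(1) in01 in01, of j k "Suc j" k] step[of j k] k0[OF that(2)] that(3) by auto
    \<comment> \<open>Halving the time step replaces each factor by a product of two with the same
      ends, and \<open>links_compose_unique\<close> says that nothing changes.\<close>
    have dbl: "pr (Suc k) (2 * j) p = pr k j p" if p: "p \<in> V" and k: "k \<ge> k0" and "j \<le> 2^k" for p k j
      using that(3)
    proof (induction j)
      case 0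
      then show ?case by (simp add: pr0)
    next
      case (Suc j)
      have f: "real (2 * j) / 2 ^ Suc k = real j / 2^k" "real (Suc (Suc (2 * j))) / 2 ^ Suc k = real (Suc j) / 2^k"
        by (simp_all add: field_simps)
      have le: "Suc (2 * j) \<le> 2 ^ Suc k" "Suc (Suc (2 * j)) \<le> 2 ^ Suc k" using Suc.prems by auto
      note k1 = ks[OF p _ le(1), unfolded f] and k2 = ks[OF p _ le(2), unfolded f] and k3 = ks[OF p k Suc.prems]
      have XY: "cross3 (\<omega> (real j / 2^k) p (fr1 c p)) (\<omega> (real j / 2^k) p (fr2 c p)) \<noteq> 0"
        using conf_frame_norm(4)[OF c(1) _ conf[OF in01]] p V(3) Suc.prems by auto
      have "ul (real j / 2^k) (real (Suc j) / 2^k) p = ul (real (Suc (2 * j)) / 2 ^ Suc k) (real (Suc j) / 2^k) p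
          *\<^sub>q ul (real j / 2^k) (real (Suc (2 * j)) / 2 ^ Suc k) p"
      proof (rule links_compose_unique[where S = "TS p" and \<alpha> = "\<omega> (real j / 2^k) p" and \<gamma> = "\<omega> (real (Suc j) / 2^k) p"
            and \<beta> = "\<omega> (real (Suc (2 * j)) / 2 ^ Suc k) p" and X = "fr1 c p" and Y = "fr2 c p"])
        show "fr1 c p \<in> TS p" "fr2 c p \<in> TS p" using frame_tangent[OF c(1)] p V(3) by blast+
      qed (use k1 k2 k3 k XY in simp_all)
      moreover have "2 * Suc j = Suc (Suc (2 * j))" by simp
      ultimately show ?case using Suc.IH Suc.prems prS f by (metis Suc_leD qmult_assoc)
    qed
    have stab: "pr k (2^k) p = pr k0 (2^k0) p" if "p \<in> V" "k \<ge> k0" for p k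
      using that(2)
    proof (induction k rule: dec_induct)
      case (step n)
      then show ?case using dbl[OF that(1) step(1), of "2^n"] by simp
    qed simp
    have L: "L p = pr k0 (2^k0) p" if p: "p \<in> V" for p
    proof -
      have "\<exists>k0. \<forall>k\<ge>k0. pr k (2^k) p = L p"
        unfolding L_def by (rule someI[of _ "pr k0 (2^k0) p"]) (use stab[OF p] in blast)
      then obtain k1 where "\<forall>k\<ge>k1. pr k (2^k) p = L p" by blast
      then show ?thesis using stab[OF p, of "max k0 k1"] by simp
    qed
    have prl: "links (TS p) (pr k0 j p) (\<omega> 0 p) (\<omega> (real j / 2^k0) p)" if p: "p \<in> V" and "j \<le> 2^k0" for p j
      using that(2)
    proof (induction j)
      case 0
      then show ?case by (simp add: pr0 links_refl)
    next
      case (Suc j)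
      then show ?case unfolding prS using links_trans[OF Suc.IH conjunct1[OF ks[OF p order_refl Suc.prems]]] by simp
    qed
    have prs: "msmooth A (\<lambda>_. pr k0 j) 0 p" if p: "p \<in> V" and "j \<le> 2^k0" for p j
      using that(2)
    proof (induction j)
      case 0
      then show ?case by (simp add: pr0[abs_def] msmooth_const)
    next
      case (Suc j)
      let ?s = "real j / 2^k0" and ?t = "real (Suc j) / 2^k0"
      have st: "?s \<in> {0..1}" "?t \<in> {0..1}" using in01[of j k0] in01[of "Suc j" k0] Suc.prems by auto
      have small: "\<bar>?s - ?t\<bar> < \<delta>" using step[of j k0] k0[OF order_refl] by simp
      have pc: "p \<in> fst c" using p V(3) by blast
      note fs = msmooth_form_frame[OF smooth[OF st(1)] lin[OF st(1)] c(1) pc, of 0]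
      note ft = msmooth_form_frame[OF smooth[OF st(2)] lin[OF st(2)] c(1) pc, of 0]
      note ns = conf_frame_norm[OF c(1) pc conf[OF st(1)]] and nt = conf_frame_norm[OF c(1) pc conf[OF st(2)]]
      have nz: "\<omega> ?s p (fr2 c p) \<noteq> 0" "\<omega> ?t p (fr2 c p) \<noteq> 0" using ns(4) nt(4) by auto
      have "msmooth A (\<lambda>_. lq c ?s ?t) 0 p"
        unfolding lq_def link_quat_def
        using key[OF p st small] ns(2) nt(2) nz
        unfolding frame_quat_def third_def
        by (intro msmooth_scaleR msmooth_diff msmooth_divide msmooth_norm msmooth_qmult msmooth_qim msmooth_const
            msmooth_cross3 fs ft) auto
      then have "msmooth A (\<lambda>_. ul ?s ?t) 0 p"
        by (rule msmooth_cong[of _ _ _ UNIV V]) (use key[OF _ st small] V p in auto)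
      then show ?case unfolding prS[abs_def] using Suc by (intro msmooth_qmult) auto
    qed
    have "msmooth A (\<lambda>_. L) 0 p" if p: "p \<in> V" for p
      by (rule msmooth_cong[OF prs[OF p order_refl], of UNIV V]) (use L V p in auto)
    moreover have "links (TS p) (L p) (\<omega> 0 p) (\<omega> 1 p)" if p: "p \<in> V" for p using prl[OF p order_refl] L[OF p] by simp
    ultimately show ?thesis using V(2) by blast
  qed
  have Ls: "msmooth A (\<lambda>_. L) 0 p" and Ll: "links (TS p) (L p) (\<omega> 0 p) (\<omega> 1 p)" for p
  proof -
    obtain c where c: "c \<in> A" "p \<in> fst c" by (rule chart_exists)
    show "msmooth A (\<lambda>_. L) 0 p" "links (TS p) (L p) (\<omega> 0 p) (\<omega> 1 p)" using ex[OF c] by simp_all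
  qed
  have "\<forall>p. \<exists>r>0. \<forall>X\<in>TS p. L p *\<^sub>q qim (\<omega> 0 p X) = r *\<^sub>R (qim (\<omega> 1 p X) *\<^sub>q L p)" using Ll unfolding links_def by blast
  then obtain r where r: "\<And>p. r p > 0" "\<And>p X. X \<in> TS p \<Longrightarrow> L p *\<^sub>q qim (\<omega> 0 p X) = r p *\<^sub>R (qim (\<omega> 1 p X) *\<^sub>q L p)" by metis
  have Ln: "norm (L p) = 1" for p using Ll unfolding links_def by blast
  \<comment> \<open>The scale factor, so far only chosen pointwise, is a quotient of norms; hence it
    is unique and smooth.\<close>
  have rn: "norm (\<omega> 0 p X) = r p * norm (\<omega> 1 p X)" if "X \<in> TS p" for p X
    using arg_cong[OF r(2)[OF that], of norm] Ln r(1)[of p] by (simp add: norm_qmult)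
  have rs: "msmooth A (\<lambda>_. r) 0 p" for p
  proof -
    obtain c where c: "c \<in> A" "p \<in> fst c" by (rule chart_exists)
    have nz: "\<omega> t q (fr1 c q) \<noteq> 0" if "t \<in> {0..1}" "q \<in> fst c" for t q using conf_frame_norm(2)[OF c(1) that(2) conf[OF that(1)]] .
    have "msmooth A (\<lambda>_ q. norm (\<omega> 0 q (fr1 c q)) / norm (\<omega> 1 q (fr1 c q))) 0 p"
    proof (intro msmooth_divide msmooth_norm)
      show "msmooth A (\<lambda>_ q. \<omega> 0 q (fr1 c q)) 0 p" "msmooth A (\<lambda>_ q. \<omega> 1 q (fr1 c q)) 0 p"
        by (rule msmooth_form_frame(1)[OF smooth lin c]; simp)+
    qed (use nz[of 0 p] nz[of 1 p] c in auto)
    then show ?thesis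
      by (rule msmooth_cong[of _ _ _ UNIV "fst c"])
        (use c chart_open[OF c(1)] nz rn[OF frame_tangent(1)[OF c(1)]] in auto)
  qed
  show ?thesis
    unfolding speq_def
  \<comment> \<open>\<open>L\<close> gives the rotation, and conjugation by \<open>sqrt r\<close>
    times \<open>L\<close> multiplies by \<open>r\<close> in addition.\<close>
  proof (intro exI[of _ "\<lambda>p. sqrt (r p) *\<^sub>R L p"] conjI allI ballI)
    show "smooth_fun_on A UNIV (\<lambda>p. sqrt (r p) *\<^sub>R L p)"
      unfolding smooth_fun_iff using r(1) by (intro allI msmooth_scaleR msmooth_sqrt rs Ls)
    show "sqrt (r p) *\<^sub>R L p \<noteq> 0" for p using r(1)[of p] Ln[of p] by auto
    fix p X assume X: "X \<in> TS p"
    have "qconj (sqrt (r p) *\<^sub>R L p) *\<^sub>q qim (\<omega> 1 p X) *\<^sub>q (sqrt (r p) *\<^sub>R L p) = qconj (L p) *\<^sub>q (r p *\<^sub>R (qim (\<omega> 1 p X) *\<^sub>q L p))"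
      using r(1)[of p] by (simp add: qconj_scaleR qm.scaleR_left qm.scaleR_right qmult_assoc)
    also have "\<dots> = qconj (L p) *\<^sub>q L p *\<^sub>q qim (\<omega> 0 p X)" unfolding r(2)[OF X, symmetric] by (simp add: qmult_assoc)
    also have "\<dots> = qim (\<omega> 0 p X)" using Ln[of p] by (simp add: qmult_conj)
    finally show "qim (\<omega> 0 p X) = qconj (sqrt (r p) *\<^sub>R L p) *\<^sub>q qim (\<omega> 1 p X) *\<^sub>q (sqrt (r p) *\<^sub>R L p)" ..
  qed
qed

text \<open>Taking conformal parts turns any path of injective forms into a path of conformal ones.
  In time only continuity on the closed interval is asked: a homotopy that is smooth up to its ends
  provides this without being continued through immersions beyond them.\<close>

theorem formal_homotopy_speq:
  fixes \<Phi> :: "real \<Rightarrow> 'm \<Rightarrow> 'm tangent \<Rightarrow> real^3"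
  assumes lin: "\<And>t p. t \<in> {0..1} \<Longrightarrow> tangent_linear A p (\<Phi> t p)" and inj: "\<And>t p. t \<in> {0..1} \<Longrightarrow> inj_on (\<Phi> t p) (TS p)"
    and smooth: "\<And>t. t \<in> {0..1} \<Longrightarrow> form_smooth (\<lambda>_. \<Phi> t)"
    and cont: "\<And>c i. c \<in> A \<Longrightarrow> continuous_on ({0..1} \<times> snd c ` fst c) (\<lambda>(t, y). \<Phi> t (cinv c y) (cv c (axis i 1) (cinv c y)))"
  shows "speq (\<lambda>p. cpart p (\<Phi> 0 p)) (\<lambda>p. cpart p (\<Phi> 1 p))"
proof (rule conformal_path_speq[where \<omega> = "\<lambda>t p. cpart p (\<Phi> t p)"])
  show "cpart p (\<Phi> t p) \<in> conf_maps A C p" if "t \<in> {0..1}" for t p by (rule cpart_conf[OF lin inj]) fact+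
  show "form_smooth (\<lambda>_ p. cpart p (\<Phi> t p))" if "t \<in> {0..1}" for t
    by (rule form_smooth_cpart[OF smooth lin inj]) fact+
  fix c assume c: "c \<in> A"
  let ?S = "{0..1::real} \<times> snd c ` fst c"
  let ?f = "\<lambda>v z. \<Phi> (fst z) (cinv c (snd z)) (cv c (v (cinv c (snd z))) (cinv c (snd z)))"
  have ci: "cinv c (snd z) \<in> fst c" "fst z \<in> {0..1}" if "z \<in> ?S" for z using that cinv_in[of "snd z" c] by (auto simp: mem_Times_iff)
  have fr: "continuous_on ?S (?f V)" if V: "\<And>p. p \<in> fst c \<Longrightarrow> msmooth A (\<lambda>_. V) 0 p" for V
  proof (rule continuous_on_eq)
    have "continuous_on (snd c ` fst c) (\<lambda>y. V (cinv c y))" by (rule msmooth_continuous[OF c V])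
    then have v: "continuous_on ?S (\<lambda>z. V (cinv c (snd z)))"
      by (rule continuous_on_compose2) (auto intro!: continuous_intros)
    then show "continuous_on ?S (\<lambda>z. V (cinv c (snd z)) $ 1 *\<^sub>R ?f (\<lambda>_. axis 1 1) z + V (cinv c (snd z)) $ 2 *\<^sub>R ?f (\<lambda>_. axis 2 1) z)"
      using cont[OF c, of 1] cont[OF c, of 2] by (auto intro!: continuous_intros simp: case_prod_beta')
    show "V (cinv c (snd z)) $ 1 *\<^sub>R ?f (\<lambda>_. axis 1 1) z + V (cinv c (snd z)) $ 2 *\<^sub>R ?f (\<lambda>_. axis 2 1) z = ?f V z" if "z \<in> ?S" for z
      using tangent_linear_coord[OF lin c, of "fst z" "cinv c (snd z)" "V (cinv c (snd z))"] ci[OF that] by simp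
  qed
  have a: "continuous_on ?S (\<lambda>z. \<Phi> (fst z) (cinv c (snd z)) (fr1 c (cinv c (snd z))))"
    and b: "continuous_on ?S (\<lambda>z. \<Phi> (fst z) (cinv c (snd z)) (fr2 c (cinv c (snd z))))"
    unfolding fr1_def fr2_def using fr msmooth_frv[OF c] by blast+
  have nz: "cross3 (\<Phi> (fst z) (cinv c (snd z)) (fr1 c (cinv c (snd z)))) (\<Phi> (fst z) (cinv c (snd z)) (fr2 c (cinv c (snd z)))) \<noteq> 0"
    if "z \<in> ?S" for z using inj_frame_iff[OF c ci(1)[OF that] lin] inj ci(2)[OF that] by blast
  note pos = conf_part_properties(4,5)[OF nz]
  have cp: "continuous_on ?S (\<lambda>z. conf_part1 (\<Phi> (fst z) (cinv c (snd z)) (fr1 c (cinv c (snd z)))) (\<Phi> (fst z) (cinv c (snd z)) (fr2 c (cinv c (snd z)))))"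
    "continuous_on ?S (\<lambda>z. conf_part2 (\<Phi> (fst z) (cinv c (snd z)) (fr1 c (cinv c (snd z)))) (\<Phi> (fst z) (cinv c (snd z)) (fr2 c (cinv c (snd z)))))"
    unfolding conf_part1_def conf_part2_def
    using mult_pos_pos[OF pos] by (auto intro!: continuous_intros continuous_on_cross a b simp: less_imp_neq[symmetric]) (fastforce dest: mult_pos_pos[OF pos])+
  show "continuous_on ?S (\<lambda>(t, y). cpart (cinv c y) (\<Phi> t (cinv c y)) (fr1 c (cinv c y)))"
    by (rule continuous_on_eq[OF cp(1)]) (use cpart_frame(1)[OF c ci(1) lin inj] ci(2) in \<open>auto simp: case_prod_beta\<close>)
  show "continuous_on ?S (\<lambda>(t, y). cpart (cinv c y) (\<Phi> t (cinv c y)) (fr2 c (cinv c y)))"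
    by (rule continuous_on_eq[OF cp(2)]) (use cpart_frame(2)[OF c ci(1) lin inj] ci(2) in \<open>auto simp: case_prod_beta\<close>)
qed

end

section \<open>Spin bundles with a nowhere vanishing section\<close>

lemma qmult_left_cancel: "x \<noteq> 0 \<Longrightarrow> x *\<^sub>q y = x *\<^sub>q z \<longleftrightarrow> y = z"
  by (metis qinv_left qmult_assoc qone_left)

text \<open>Multiplicativity of the norm, polarised.\<close>

lemma inner_qmult: "(a *\<^sub>q x) \<bullet> (a *\<^sub>q y) = (norm a)\<^sup>2 * (x \<bullet> y)" "(x *\<^sub>q a) \<bullet> (y *\<^sub>q a) = (norm a)\<^sup>2 * (x \<bullet> y)"
proof -
  have "4 * ((a *\<^sub>q x) \<bullet> (a *\<^sub>q y)) = (norm (a *\<^sub>q (x + y)))\<^sup>2 - (norm (a *\<^sub>q (x - y)))\<^sup>2"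
    "4 * ((x *\<^sub>q a) \<bullet> (y *\<^sub>q a)) = (norm ((x + y) *\<^sub>q a))\<^sup>2 - (norm ((x - y) *\<^sub>q a))\<^sup>2"
    by (simp_all only: power2_norm_eq_inner qm.add_right qm.diff_right qm.add_left qm.diff_left)
      (simp_all add: inner_add_left inner_add_right inner_diff_left inner_diff_right inner_commute)
  moreover have "4 * (x \<bullet> y) = (norm (x + y))\<^sup>2 - (norm (x - y))\<^sup>2"
    by (simp only: power2_norm_eq_inner)
      (simp add: inner_add_left inner_add_right inner_diff_left inner_diff_right inner_commute)
  ultimately have "4 * ((a *\<^sub>q x) \<bullet> (a *\<^sub>q y)) = (norm a)\<^sup>2 * (4 * (x \<bullet> y))"
    "4 * ((x *\<^sub>q a) \<bullet> (y *\<^sub>q a)) = (norm a)\<^sup>2 * (4 * (x \<bullet> y))"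
    by (simp_all add: norm_qmult power_mult_distrib right_diff_distrib mult.commute)
  then show "(a *\<^sub>q x) \<bullet> (a *\<^sub>q y) = (norm a)\<^sup>2 * (x \<bullet> y)" "(x *\<^sub>q a) \<bullet> (y *\<^sub>q a) = (norm a)\<^sup>2 * (x \<bullet> y)"
    by simp_all
qed

lemma qconj_eq_0_iff [simp]: "qconj x = 0 \<longleftrightarrow> x = 0"
  by (metis norm_qconj norm_eq_zero)

lemma inner_qim [simp]: "qim v \<bullet> qim w = v \<bullet> w" by (simp add: qim_def)

context conformal_surface begin

section \<open>Quaternionic coordinates relative to a section\<close>

lemma fibre_rqs:
  assumes "quaternionic_line_bundle A L"
  shows "right_quaternionic_space (fibre L p) (bzero L p) (badd L) (bscale L)"
  using assms unfolding quaternionic_line_bundle_def by (elim conjE) (erule spec)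

text \<open>A criterion that any additive map respects; it shows that bundle maps send zero to zero
  and that scaling by 0 gives zero.\<close>

lemma rqs_idempotent_zero:
  assumes "right_quaternionic_space V z pl sc" "u \<in> V" "pl u u = u" shows "u = z"
proof -
  have assoc: "\<And>a b c. a \<in> V \<Longrightarrow> b \<in> V \<Longrightarrow> c \<in> V \<Longrightarrow> pl (pl a b) c = pl a (pl b c)"
    and zV: "z \<in> V" and comm: "\<And>a b. a \<in> V \<Longrightarrow> b \<in> V \<Longrightarrow> pl a b = pl b a"
    and zu: "pl z u = u" and inv: "\<exists>v\<in>V. pl u v = z"
    using assms(1,2) unfolding right_quaternionic_space_def by blast+
  obtain v where v: "v \<in> V" "pl u v = z" using inv by blast
  have "z = pl (pl u u) v" using v assms(3) by simp
  also have "\<dots> = pl u z" using assoc[OF assms(2) assms(2) v(1)] v(2) by simp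
  also have "\<dots> = u" using comm[OF assms(2) zV] zu by simp
  finally show ?thesis ..
qed

lemma trivialisation:
  assumes "quaternionic_line_bundle A L"
  obtains U \<Phi> where "(U, \<Phi>) \<in> btrivs L" "p \<in> U"
proof -
  have "(\<Union>(U, \<Phi>)\<in>btrivs L. U) = UNIV" using assms unfolding quaternionic_line_bundle_def by (elim conjE)
  then have "p \<in> (\<Union>(U, \<Phi>)\<in>btrivs L. U)" by simp
  then show ?thesis using that by auto
qed

lemma trivialisation_props:
  assumes L: "quaternionic_line_bundle A L" and t: "(U, \<Phi>) \<in> btrivs L" and p: "p \<in> U"
  shows "open U" "inj_on \<Phi> (fibre L p)" "\<Phi> ` fibre L p = UNIV"
    "\<psi> \<in> fibre L p \<Longrightarrow> \<Phi> (bscale L \<psi> a) = \<Phi> \<psi> *\<^sub>q a"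
    "\<psi> \<in> fibre L p \<Longrightarrow> \<psi> \<noteq> bzero L p \<Longrightarrow> \<Phi> \<psi> \<noteq> 0"
proof -
  have props: "open U \<and> (\<forall>p\<in>U. bij_betw \<Phi> (fibre L p) UNIV \<and>
          (\<forall>\<psi>\<in>fibre L p. \<forall>\<phi>\<in>fibre L p. \<Phi> (badd L \<psi> \<phi>) = \<Phi> \<psi> + \<Phi> \<phi>) \<and>
          (\<forall>\<psi>\<in>fibre L p. \<forall>a. \<Phi> (bscale L \<psi> a) = \<Phi> \<psi> *\<^sub>q a))"
    using L t unfolding quaternionic_line_bundle_def by blast
  then show "open U" "inj_on \<Phi> (fibre L p)" "\<Phi> ` fibre L p = UNIV"
    "\<psi> \<in> fibre L p \<Longrightarrow> \<Phi> (bscale L \<psi> a) = \<Phi> \<psi> *\<^sub>q a"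
    using p unfolding bij_betw_def by blast+
  note inj = \<open>inj_on \<Phi> (fibre L p)\<close>
  have z: "bzero L p \<in> fibre L p" "badd L (bzero L p) (bzero L p) = bzero L p"
    using fibre_rqs[OF L, of p] unfolding right_quaternionic_space_def by blast+
  then have "\<Phi> (bzero L p) = \<Phi> (bzero L p) + \<Phi> (bzero L p)" using props p by metis
  then have "\<Phi> (bzero L p) = 0" by simp
  then show "\<psi> \<in> fibre L p \<Longrightarrow> \<psi> \<noteq> bzero L p \<Longrightarrow> \<Phi> \<psi> \<noteq> 0"
    using inj z(1) unfolding inj_on_def by metis
qed

lemma section_bij:
  assumes L: "quaternionic_line_bundle A L" and s: "s p \<in> fibre L p" "s p \<noteq> bzero L p"
  shows "bij_betw (bscale L (s p)) UNIV (fibre L p)"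
proof -
  obtain U \<Phi> where t: "(U, \<Phi>) \<in> btrivs L" "p \<in> U" by (rule trivialisation[OF L])
  note P = trivialisation_props[OF L t]
  have sc: "bscale L (s p) h \<in> fibre L p" for h
    using fibre_rqs[OF L, of p] s(1) unfolding right_quaternionic_space_def by blast
  show ?thesis
  proof (rule bij_betw_imageI)
    show "inj (bscale L (s p))"
      by (rule injI) (metis P(4,5) qmult_left_cancel s)
    show "range (bscale L (s p)) = fibre L p"
    proof (intro equalityI subsetI)
      fix \<psi> assume \<psi>: "\<psi> \<in> fibre L p"
      have "\<Phi> (bscale L (s p) (qinv (\<Phi> (s p)) *\<^sub>q \<Phi> \<psi>)) = \<Phi> \<psi>"
        using P(5)[OF s] by (simp add: P(4)[OF s(1)] qmult_assoc[symmetric] qinv_right)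
      then show "\<psi> \<in> range (bscale L (s p))" using P(2) \<psi> sc unfolding inj_on_def by (metis rangeI)
    qed (use sc in auto)
  qed
qed

text \<open>In a trivialisation, \<open>h\<close> is the coordinate of \<open>\<sigma>\<close>
  multiplied from the left by the inverse of that of \<open>s\<close>. So a nowhere vanishing
  section identifies smooth sections with smooth quaternion valued functions, also over open
  subsets.\<close>

lemma section_smooth_iff:
  assumes L: "quaternionic_line_bundle A L" and s: "smooth_section A L UNIV s" "\<And>p. s p \<noteq> bzero L p"
    and W: "open W" and \<sigma>: "\<And>p. p \<in> W \<Longrightarrow> \<sigma> p = bscale L (s p) (h p)"
  shows "smooth_section A L W \<sigma> \<longleftrightarrow> smooth_fun_on A W h"
proof -
  have sf: "s p \<in> fibre L p" for p using s(1) unfolding smooth_section_def by blast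
  have \<sigma>f: "\<sigma> p \<in> fibre L p" if "p \<in> W" for p
    using fibre_rqs[OF L, of p] sf \<sigma>[OF that] unfolding right_quaternionic_space_def by metis
  have \<Phi>s: "msmooth A (\<lambda>_ p. \<Phi> (s p)) 0 p" if "(U, \<Phi>) \<in> btrivs L" "p \<in> U" for U \<Phi> p
  proof -
    have "smooth_fun_on A U (\<lambda>p. \<Phi> (s p))" using s(1) that unfolding smooth_section_def by auto
    then show ?thesis using smooth_fun_on_iff[OF trivialisation_props(1)[OF L that]] that(2) by blast
  qed
  have \<Phi>\<sigma>: "\<Phi> (\<sigma> p) = \<Phi> (s p) *\<^sub>q h p" if "(U, \<Phi>) \<in> btrivs L" "p \<in> U" "p \<in> W" for U \<Phi> p
    unfolding \<sigma>[OF that(3)] by (rule trivialisation_props(4)[OF L that(1,2) sf])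
  show ?thesis
  proof
    assume sm: "smooth_section A L W \<sigma>"
    show "smooth_fun_on A W h"
      unfolding smooth_fun_on_iff[OF W, where t = 0]
    proof
      fix p assume p: "p \<in> W"
      obtain U \<Phi> where t: "(U, \<Phi>) \<in> btrivs L" "p \<in> U" by (rule trivialisation[OF L])
      note P = trivialisation_props[OF L t(1)]
      have op: "open (U \<inter> W)" using P(1)[OF t(2)] W by blast
      have "smooth_fun_on A (U \<inter> W) (\<lambda>p. \<Phi> (\<sigma> p))" using sm t(1) unfolding smooth_section_def by auto
      then have "msmooth A (\<lambda>_ p. \<Phi> (\<sigma> p)) 0 p" using smooth_fun_on_iff[OF op] t(2) p by blast
      then have "msmooth A (\<lambda>_ p. qinv (\<Phi> (s p)) *\<^sub>q \<Phi> (\<sigma> p)) 0 p"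
        using P(5)[OF t(2) sf s(2)] by (intro msmooth_qmult msmooth_qinv \<Phi>s[OF t])
      then show "msmooth A (\<lambda>_. h) 0 p"
        by (rule msmooth_cong[of _ _ _ UNIV "U \<inter> W"])
          (use op t p P(5)[OF _ sf s(2)] in \<open>auto simp: \<Phi>\<sigma>[OF t(1)] qmult_assoc[symmetric] qinv_left\<close>)
    qed
  next
    assume sm: "smooth_fun_on A W h"
    have "smooth_fun_on A (U \<inter> W) (\<lambda>p. \<Phi> (\<sigma> p))" if t: "(U, \<Phi>) \<in> btrivs L" for U \<Phi>
      \<comment> \<open>\<open>trivialisation_props\<close> takes a point of \<open>U\<close>, even
        for the openness of \<open>U\<close>.\<close>
      proof (cases "U = {}")
        case True
        then show ?thesis using smooth_fun_on_iff[of "{}"] by simp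
      next
        case False
        then have op: "open (U \<inter> W)" using trivialisation_props(1)[OF L t] W by blast
        show ?thesis
          unfolding smooth_fun_on_iff[OF op, where t = 0]
        proof
          fix p assume p: "p \<in> U \<inter> W"
          have "msmooth A (\<lambda>_ p. \<Phi> (s p) *\<^sub>q h p) 0 p"
            using sm p \<Phi>s[OF t] unfolding smooth_fun_on_iff[OF W, where t = 0] by (intro msmooth_qmult) auto
          then show "msmooth A (\<lambda>_ p. \<Phi> (\<sigma> p)) 0 p"
            by (rule msmooth_cong[of _ _ _ UNIV "U \<inter> W"]) (use op p \<Phi>\<sigma>[OF t] in auto)
        qed
      qed
    then show "smooth_section A L W \<sigma>" unfolding smooth_section_def using \<sigma>f by auto
  qed
qed

text \<open>Skew symmetry makes \<open>(s, s)\<close> purely imaginary, so keeping only the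
  imaginary part loses nothing.\<close>

definition section_form :: "('m, 'e) spin \<Rightarrow> ('m \<Rightarrow> 'e) \<Rightarrow> 'm \<Rightarrow> 'm tangent \<Rightarrow> real^3" where
  "section_form L s p X = snd (pairing L (s p) (s p) X)"

lemma section_form_pairing:
  assumes L: "spin_bundle A L" and s: "s p \<in> fibre L p" and X: "X \<in> TS p"
  shows "pairing L (bscale L (s p) a) (bscale L (s p) b) X = qconj a *\<^sub>q qim (section_form L s p X) *\<^sub>q b"
proof -
  have "pairing L (bscale L (s p) a) (bscale L (s p) b) X = qconj a *\<^sub>q pairing L (s p) (s p) X *\<^sub>q b"
    and c: "qconj (pairing L (s p) (s p) X) = - pairing L (s p) (s p) X"
    using L s X unfolding spin_bundle_def by blast+
  then show ?thesis unfolding section_form_def qim_snd[OF c] by simp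
qed

text \<open>A right-linear map of line bundles is determined by \<open>T s = s' \<mu>\<close>.
  Sesquilinearity of the pairings reduces their compatibility with \<open>T\<close> to the pair
  \<open>(s, s)\<close>, where it is precisely the relation in \<open>speq\<close>.\<close>

theorem spin_isomorphic_iff_speq:
  fixes L :: "('m, 'e) spin" and L' :: "('m, 'd) spin"
  assumes L: "spin_bundle A L" and s: "smooth_section A L UNIV s" "\<And>p. s p \<noteq> bzero L p"
    and L': "spin_bundle A L'" and s': "smooth_section A L' UNIV s'" "\<And>p. s' p \<noteq> bzero L' p"
  shows "spin_isomorphic A L L' \<longleftrightarrow> speq (section_form L s) (section_form L' s')"
proof -
  have qL: "quaternionic_line_bundle A L" and qL': "quaternionic_line_bundle A L'"
    using L L' unfolding spin_bundle_def by auto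
  have sf: "s p \<in> fibre L p" "s' p \<in> fibre L' p" for p using s(1) s'(1) unfolding smooth_section_def by blast+
  note rL = fibre_rqs[OF qL] and rL' = fibre_rqs[OF qL']
  note bij = section_bij[where s = s, OF qL sf(1) s(2)] and bij' = section_bij[where s = s', OF qL' sf(2) s'(2)]
  have one: "bscale L (s p) qone = s p" for p using rL[of p] sf(1)[of p] unfolding right_quaternionic_space_def by blast
  show ?thesis
  proof
    assume "spin_isomorphic A L L'"
    then obtain T where T0: "\<forall>p. bij_betw T (fibre L p) (fibre L' p) \<and>
          (\<forall>\<psi>\<in>fibre L p. \<forall>\<phi>\<in>fibre L p.
             T (badd L \<psi> \<phi>) = badd L' (T \<psi>) (T \<phi>) \<and>
             (\<forall>a. T (bscale L \<psi> a) = bscale L' (T \<psi>) a) \<and>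
             (\<forall>X\<in>TS p. pairing L' (T \<psi>) (T \<phi>) X = pairing L \<psi> \<phi> X))"
      "\<forall>W s. open W \<longrightarrow> smooth_section A L W s \<longrightarrow> smooth_section A L' W (\<lambda>p. T (s p))"
      unfolding spin_isomorphic_def by (elim exE conjE) (rule that)
    have T: "\<And>p. bij_betw T (fibre L p) (fibre L' p)"
      "\<And>p \<psi> \<phi>. \<psi> \<in> fibre L p \<Longrightarrow> \<phi> \<in> fibre L p \<Longrightarrow> T (badd L \<psi> \<phi>) = badd L' (T \<psi>) (T \<phi>)"
      "\<And>p \<psi> \<phi> X. \<psi> \<in> fibre L p \<Longrightarrow> \<phi> \<in> fibre L p \<Longrightarrow> X \<in> TS p \<Longrightarrow> pairing L' (T \<psi>) (T \<phi>) X = pairing L \<psi> \<phi> X"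
      "\<And>W s. open W \<Longrightarrow> smooth_section A L W s \<Longrightarrow> smooth_section A L' W (\<lambda>p. T (s p))"
      using T0 by (simp_all only: Ball_def)
    have Tf: "T (s p) \<in> fibre L' p" for p using T(1)[of p] sf(1) unfolding bij_betw_def by blast
    have "\<exists>m. T (s p) = bscale L' (s' p) m" for p using Tf[of p] bij'[of p] unfolding bij_betw_def by blast
    then obtain \<mu> where \<mu>: "\<And>p. T (s p) = bscale L' (s' p) (\<mu> p)" by metis
    have "smooth_fun_on A UNIV \<mu>"
      using section_smooth_iff[OF qL' s' open_UNIV \<mu>] T(4)[OF open_UNIV s(1)] by blast
    moreover have "\<mu> p \<noteq> 0" for p
    proof
      assume 0: "\<mu> p = 0"
      have z: "bzero L p \<in> fibre L p" "badd L (bzero L p) (bzero L p) = bzero L p"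
        using rL[of p] unfolding right_quaternionic_space_def by blast+
      have Tz: "T (bzero L p) \<in> fibre L' p" using T(1)[of p] z(1) unfolding bij_betw_def by blast
      have "badd L' (T (bzero L p)) (T (bzero L p)) = T (bzero L p)" using T(2)[OF z(1) z(1)] z(2) by simp
      from rqs_idempotent_zero[OF rL' Tz this] have 1: "T (bzero L p) = bzero L' p" .
      have "badd L' (bscale L' (s' p) 0) (bscale L' (s' p) 0) = bscale L' (s' p) (0 + 0)"
        using rL'[of p] sf(2)[of p] unfolding right_quaternionic_space_def by metis
      moreover have "bscale L' (s' p) 0 \<in> fibre L' p" using \<mu>[of p] 0 Tf[of p] by simp
      ultimately have "bscale L' (s' p) 0 = bzero L' p" using rqs_idempotent_zero[OF rL'] by simp
      then have "T (s p) = T (bzero L p)" using \<mu>[of p] 0 1 by simp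
      then have "s p = bzero L p" using T(1)[of p] sf(1) z(1) unfolding bij_betw_def inj_on_def by blast
      then show False using s(2) by blast
    qed
    moreover have "qim (section_form L s p X) = qconj (\<mu> p) *\<^sub>q qim (section_form L' s' p X) *\<^sub>q \<mu> p" if X: "X \<in> TS p" for p X
    proof -
      have "qim (section_form L s p X) = pairing L (s p) (s p) X"
        using section_form_pairing[where s = s, OF L sf(1) X, of qone qone] one by simp
      also have "\<dots> = pairing L' (bscale L' (s' p) (\<mu> p)) (bscale L' (s' p) (\<mu> p)) X"
        using T(3)[OF sf(1) sf(1) X] \<mu> by simp
      finally show ?thesis unfolding section_form_pairing[where s = s', OF L' sf(2) X] .
    qed
    ultimately show "speq (section_form L s) (section_form L' s')" unfolding speq_def by blast
  next
    assume "speq (section_form L s) (section_form L' s')"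
    then obtain \<mu> where \<mu>: "smooth_fun_on A UNIV \<mu>" "\<And>p. \<mu> p \<noteq> 0"
      "\<And>p X. X \<in> TS p \<Longrightarrow> qim (section_form L s p X) = qconj (\<mu> p) *\<^sub>q qim (section_form L' s' p X) *\<^sub>q \<mu> p"
      unfolding speq_def by blast
    \<comment> \<open>The quaternionic coordinate of a vector relative to \<open>s\<close>; in
      coordinates \<open>T\<close> is left multiplication by \<open>\<mu>\<close>.\<close>
    define co where "co \<psi> = the_inv_into UNIV (bscale L (s (bproj L \<psi>))) \<psi>" for \<psi>
    define T where "T \<psi> = bscale L' (s' (bproj L \<psi>)) (\<mu> (bproj L \<psi>) *\<^sub>q co \<psi>)" for \<psi>
    have pr: "bproj L \<psi> = p" if "\<psi> \<in> fibre L p" for \<psi> p using that unfolding fibre_def by blast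
    have scf: "bscale L (s p) h \<in> fibre L p" for p h using bij[of p] unfolding bij_betw_def by blast
    have co: "co (bscale L (s p) h) = h" for p h
      unfolding co_def pr[OF scf] using the_inv_into_f_f[of "bscale L (s p)" UNIV] bij[of p] unfolding bij_betw_def by simp
    have T: "T (bscale L (s p) h) = bscale L' (s' p) (\<mu> p *\<^sub>q h)" for p h
      unfolding T_def co pr[OF scf] ..
    have ex: "\<exists>h. \<psi> = bscale L (s p) h" if "\<psi> \<in> fibre L p" for \<psi> p using that bij[of p] unfolding bij_betw_def by blast
    have add: "badd L (bscale L (s p) a) (bscale L (s p) b) = bscale L (s p) (a + b)" for p a b
      using rL[of p] sf(1)[of p] unfolding right_quaternionic_space_def by metis
    have add': "badd L' (bscale L' (s' p) a) (bscale L' (s' p) b) = bscale L' (s' p) (a + b)" for p a b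
      using rL'[of p] sf(2)[of p] unfolding right_quaternionic_space_def by metis
    have sc: "bscale L (bscale L (s p) a) b = bscale L (s p) (a *\<^sub>q b)" for p a b
      using rL[of p] sf(1)[of p] unfolding right_quaternionic_space_def by metis
    have sc': "bscale L' (bscale L' (s' p) a) b = bscale L' (s' p) (a *\<^sub>q b)" for p a b
      using rL'[of p] sf(2)[of p] unfolding right_quaternionic_space_def by metis
    show "spin_isomorphic A L L'"
      unfolding spin_isomorphic_def
    proof (intro exI[of _ T] conjI allI ballI impI)
      fix p
      have "bij ((*\<^sub>q) (\<mu> p))"
        by (rule o_bij[of "(*\<^sub>q) (qinv (\<mu> p))"]) (auto simp: fun_eq_iff qmult_assoc[symmetric] qinv_left qinv_right \<mu>(2))
      from bij_betw_trans[OF bij_betw_trans[OF bij_betw_the_inv_into[OF bij] this] bij']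
      have "bij_betw (bscale L' (s' p) \<circ> ((*\<^sub>q) (\<mu> p) \<circ> the_inv_into UNIV (bscale L (s p)))) (fibre L p) (fibre L' p)" .
      then show "bij_betw T (fibre L p) (fibre L' p)"
        by (rule bij_betw_cong[THEN iffD1, rotated]) (simp add: T_def co_def pr)
      fix \<psi> \<phi> assume "\<psi> \<in> fibre L p" "\<phi> \<in> fibre L p"
      then obtain h k where hk: "\<psi> = bscale L (s p) h" "\<phi> = bscale L (s p) k" using ex by metis
      show "T (badd L \<psi> \<phi>) = badd L' (T \<psi>) (T \<phi>)"
        unfolding hk add T add' by (simp add: qm.add_right)
      show "T (bscale L \<psi> a) = bscale L' (T \<psi>) a" for a
        unfolding hk sc T sc' by (simp add: qmult_assoc)
      show "pairing L' (T \<psi>) (T \<phi>) X = pairing L \<psi> \<phi> X" if X: "X \<in> TS p" for X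
        unfolding hk T section_form_pairing[where s = s, OF L sf(1) X] section_form_pairing[where s = s', OF L' sf(2) X] \<mu>(3)[OF X]
        by (simp add: qconj_mult qmult_assoc)
    next
      fix W \<sigma> assume W: "open W" and \<sigma>: "smooth_section A L W \<sigma>"
      have "\<forall>p. \<exists>h. p \<in> W \<longrightarrow> \<sigma> p = bscale L (s p) h" using \<sigma> ex unfolding smooth_section_def by blast
      then obtain h where h: "\<And>p. p \<in> W \<Longrightarrow> \<sigma> p = bscale L (s p) (h p)" by metis
      have "smooth_fun_on A W h" using section_smooth_iff[where \<sigma> = \<sigma>, OF qL s W h] \<sigma> by blast
      then have "smooth_fun_on A W (\<lambda>p. \<mu> p *\<^sub>q h p)"
        using \<mu>(1) unfolding smooth_fun_on_iff[OF W, where t = 0] smooth_fun_iff by (auto intro: msmooth_qmult)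
      then show "smooth_section A L' W (\<lambda>p. T (\<sigma> p))"
        using section_smooth_iff[OF qL' s' W, of "\<lambda>p. T (\<sigma> p)" "\<lambda>p. \<mu> p *\<^sub>q h p"] h T by simp
    qed
  qed
qed

text \<open>No section has to be constructed. The metric \<open>g\<close> belongs to the induced
  structure, and membership there already exhibits a nowhere vanishing global section whose metric
  is conformal to \<open>g\<close>.\<close>

lemma spin_bundle_section:
  assumes "L \<in> spin_bundles A C"
  obtains s where "smooth_section A L UNIV s" "\<And>p. s p \<noteq> bzero L p" "form_smooth (\<lambda>_. section_form L s)"
    "\<And>p. section_form L s p \<in> conf_maps A C p"
proof -
  have L: "spin_bundle A L" and "g \<in> induced_conformal_structure A L"
    using assms g_in_C unfolding spin_bundles_def by auto
  then obtain s where s: "smooth_section A L UNIV s" "\<And>p. s p \<noteq> bzero L p"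
    and ce: "conformally_equivalent A (section_metric L s) g" unfolding induced_conformal_structure_def by blast
  have sf: "s p \<in> fibre L p" for p using s(1) unfolding smooth_section_def by blast
  have qL: "quaternionic_line_bundle A L" using L unfolding spin_bundle_def by (elim conjE)
  have one: "bscale L (s p) qone = s p" for p
    using fibre_rqs[OF qL, of p] sf[of p] unfolding right_quaternionic_space_def by blast
  have pr: "qim (section_form L s p X) = pairing L (s p) (s p) X" if "X \<in> TS p" for p X
    using section_form_pairing[where s = s, OF L sf that, of qone qone] one by simp
  have lp: "tangent_linear A p (pairing L (s p) (s p))" for p
    using L sf[of p] unfolding spin_bundle_def by (elim conjE allE[of _ p]) blast
  have lin: "tangent_linear A p (section_form L s p)" for p
    unfolding section_form_def[abs_def] by (rule tangent_linear_linear[OF _ lp]) (simp add: linear_snd)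
  show ?thesis
  proof (rule that[OF s])
    have "smooth_form_on A UNIV (\<lambda>p. pairing L (s p) (s p))" using L s(1) unfolding spin_bundle_def by blast
    then have "form_smooth (\<lambda>_ p. pairing L (s p) (s p))" by (simp only: smooth_form_on_iff)
    then show "form_smooth (\<lambda>_. section_form L s)"
      unfolding form_smooth_def section_form_def[abs_def] using msmooth_linear[OF bounded_linear_snd] by blast
    fix p
    obtain \<rho> where \<rho>: "\<rho> p > 0" "\<And>X Y. X \<in> TS p \<Longrightarrow> Y \<in> TS p \<Longrightarrow> g p X Y = \<rho> p * section_metric L s p X Y"
      using ce unfolding conformally_equivalent_def by blast
    have eq: "section_form L s p X \<bullet> section_form L s p Y = 1 / \<rho> p * g p X Y" if "X \<in> TS p" "Y \<in> TS p" for X Y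
      using \<rho> that by (simp add: section_metric_def pr[symmetric])
    obtain c where c: "c \<in> A" "p \<in> fst c" by (rule chart_exists)
    note T = frame_tangent[OF c]
    show "section_form L s p \<in> conf_maps A C p"
      unfolding conf_maps_frame_iff[OF c] using lin eq[OF T(1) T(1)] eq[OF T(1) T(2)] eq[OF T(2) T(2)] frame_orthonormal[OF c] \<rho>(1)
      by auto
  qed
qed

text \<open>The shape of \<open>induced_spin_bundle\<close> with an arbitrary form in place of the
  conformal part of an immersion, so that bundle axioms and immersions are treated
  separately.\<close>

definition triv_spin :: "('m \<Rightarrow> 'm tangent \<Rightarrow> real^3) \<Rightarrow> ('m, 'm \<times> quat) spin" where
  "triv_spin \<omega> =
     \<lparr> tot = UNIV, bproj = fst, bzero = (\<lambda>p. (p, 0)), badd = (\<lambda>\<psi> \<phi>. (fst \<psi>, snd \<psi> + snd \<phi>)),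
       bscale = (\<lambda>\<psi> a. (fst \<psi>, snd \<psi> *\<^sub>q a)), btrivs = {(UNIV, snd)},
       pairing = (\<lambda>\<psi> \<phi> X. qconj (snd \<psi>) *\<^sub>q qim (\<omega> (fst \<psi>) X) *\<^sub>q snd \<phi>) \<rparr>"

section \<open>The trivial bundle of a conformal form\<close>

lemma triv_spin_simps [simp]:
  "bproj (triv_spin \<omega>) = fst" "bzero (triv_spin \<omega>) p = (p, 0)" "badd (triv_spin \<omega>) \<psi> \<phi> = (fst \<psi>, snd \<psi> + snd \<phi>)"
  "bscale (triv_spin \<omega>) \<psi> a = (fst \<psi>, snd \<psi> *\<^sub>q a)" "btrivs (triv_spin \<omega>) = {(UNIV, snd)}"
  "pairing (triv_spin \<omega>) \<psi> \<phi> X = qconj (snd \<psi>) *\<^sub>q qim (\<omega> (fst \<psi>) X) *\<^sub>q snd \<phi>"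
  "fibre (triv_spin \<omega>) p = {p} \<times> UNIV"
  by (auto simp: triv_spin_def fibre_def)

lemma induced_spin_bundle_eq: "induced_spin_bundle A C f = triv_spin (conformal_part A C f)"
  by (simp add: induced_spin_bundle_def triv_spin_def)

lemma triv_spin_section_iff: "smooth_section A (triv_spin \<omega>) W s \<longleftrightarrow> (\<forall>p\<in>W. fst (s p) = p) \<and> smooth_fun_on A W (\<lambda>p. snd (s p))"
  by (auto simp: smooth_section_def mem_Times_iff)

lemma triv_spin_section:
  "smooth_section A (triv_spin \<omega>) UNIV (\<lambda>p. (p, qone))" "(p, qone) \<noteq> bzero (triv_spin \<omega>) p"
  "section_form (triv_spin \<omega>) (\<lambda>p. (p, qone)) = \<omega>"
  unfolding triv_spin_section_iff smooth_fun_iff section_form_def[abs_def]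
  by (auto simp: qone_def[symmetric] intro: msmooth_const) (simp add: qone_def zero_prod_def)

text \<open>If \<open>\<omega>\<close> has conformal factor \<open>r\<close>, a section with
  coordinate \<open>h\<close> induces the metric \<open>|h|^4 r g\<close>. Any nowhere vanishing
  section thus gives the class of \<open>g\<close>, and the constant section 1 suffices to reach
  every member of it.\<close>

theorem triv_spin_in_spin_bundles:
  assumes \<omega>: "form_smooth (\<lambda>_. \<omega>)" "\<And>p. \<omega> p \<in> conf_maps A C p"
  shows "triv_spin \<omega> \<in> spin_bundles A C"
proof -
  have lin: "tangent_linear A p (\<omega> p)" and inj: "inj_on (\<omega> p) (TS p)" for p using \<omega>(2) unfolding conf_maps_def by auto
  have "\<forall>p. \<exists>r>0. \<forall>X\<in>TS p. \<forall>Y\<in>TS p. \<omega> p X \<bullet> \<omega> p Y = r * g p X Y" using \<omega>(2) g_in_C unfolding conf_maps_def by blast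
  then obtain r where r: "\<And>p. r p > 0" "\<And>p X Y. X \<in> TS p \<Longrightarrow> Y \<in> TS p \<Longrightarrow> \<omega> p X \<bullet> \<omega> p Y = r p * g p X Y" by metis
  have rs: "msmooth A (\<lambda>_. r) 0 p" for p
  proof -
    obtain c where c: "c \<in> A" "p \<in> fst c" by (rule chart_exists)
    have "msmooth A (\<lambda>_ q. \<omega> q (fr1 c q) \<bullet> \<omega> q (fr1 c q)) 0 p" by (intro msmooth_inner msmooth_form_frame \<omega>(1) lin c)
    then show ?thesis
      by (rule msmooth_cong[of _ _ _ UNIV "fst c"])
        (use c chart_open[OF c(1)] r(2)[OF frame_tangent(1)[OF c(1)] frame_tangent(1)[OF c(1)]] frame_orthonormal[OF c(1)] in auto)
  qed
  have q: "quaternionic_line_bundle A (triv_spin \<omega>)"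
    unfolding quaternionic_line_bundle_def
  proof (intro conjI allI)
    show "right_quaternionic_space (fibre (triv_spin \<omega>) p) (bzero (triv_spin \<omega>) p) (badd (triv_spin \<omega>)) (bscale (triv_spin \<omega>))" for p
      unfolding right_quaternionic_space_def
    proof (intro conjI ballI allI)
      fix u assume "u \<in> fibre (triv_spin \<omega>) p"
      then show "\<exists>v\<in>fibre (triv_spin \<omega>) p. badd (triv_spin \<omega>) u v = bzero (triv_spin \<omega>) p"
        by (intro bexI[of _ "(p, - snd u)"]) auto
    qed (auto simp: qmult_assoc qm.add_left qm.add_right algebra_simps)
    have "bij_betw snd ({p} \<times> (UNIV::quat set)) UNIV" for p :: 'm
      by (rule bij_betwI[of _ _ _ "\<lambda>q. (p, q)"]) auto
    then show "\<forall>(U, \<Phi>)\<in>btrivs (triv_spin \<omega>). open U \<and> (\<forall>p\<in>U. bij_betw \<Phi> (fibre (triv_spin \<omega>) p) UNIV \<and>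
          (\<forall>\<psi>\<in>fibre (triv_spin \<omega>) p. \<forall>\<phi>\<in>fibre (triv_spin \<omega>) p. \<Phi> (badd (triv_spin \<omega>) \<psi> \<phi>) = \<Phi> \<psi> + \<Phi> \<phi>) \<and>
          (\<forall>\<psi>\<in>fibre (triv_spin \<omega>) p. \<forall>a. \<Phi> (bscale (triv_spin \<omega>) \<psi> a) = \<Phi> \<psi> *\<^sub>q a))" by simp
    have "smooth_fun_on A UNIV (\<lambda>_. qone)" unfolding smooth_fun_iff by (intro allI msmooth_const)
    then show "\<forall>(U, \<Phi>)\<in>btrivs (triv_spin \<omega>). \<forall>(V, \<Psi>)\<in>btrivs (triv_spin \<omega>). \<exists>\<tau>::'m \<Rightarrow> quat. smooth_fun_on A (U \<inter> V) \<tau> \<and>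
          (\<forall>p\<in>U \<inter> V. \<forall>\<psi>\<in>fibre (triv_spin \<omega>) p. \<Psi> \<psi> = \<tau> p *\<^sub>q \<Phi> \<psi>)" by (auto intro!: exI[of _ "\<lambda>_. qone"])
  qed auto
  have sp: "spin_bundle A (triv_spin \<omega>)"
    unfolding spin_bundle_def
  proof (intro conjI q allI ballI impI)
    fix p \<psi> \<phi> assume \<psi>: "\<psi> \<in> fibre (triv_spin \<omega>) p" and "\<phi> \<in> fibre (triv_spin \<omega>) p"
    then have f: "fst \<psi> = p" "fst \<phi> = p" by auto
    show "tangent_linear A p (pairing (triv_spin \<omega>) \<psi> \<phi>)"
      using lin[of p] unfolding tangent_linear_def
      by (simp add: f qm.add_left qm.add_right qm.scaleR_left qm.scaleR_right)
    fix X assume X: "X \<in> TS p"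
    { fix \<xi> assume "\<xi> \<in> fibre (triv_spin \<omega>) p"
      then have "fst \<xi> = p" by auto
      then show "pairing (triv_spin \<omega>) (badd (triv_spin \<omega>) \<psi> \<xi>) \<phi> X = pairing (triv_spin \<omega>) \<psi> \<phi> X + pairing (triv_spin \<omega>) \<xi> \<phi> X"
        "pairing (triv_spin \<omega>) \<psi> (badd (triv_spin \<omega>) \<phi> \<xi>) X = pairing (triv_spin \<omega>) \<psi> \<phi> X + pairing (triv_spin \<omega>) \<psi> \<xi> X"
        using f by (simp_all add: qconj_add qm.add_left qm.add_right) }
    show "pairing (triv_spin \<omega>) (bscale (triv_spin \<omega>) \<psi> a) (bscale (triv_spin \<omega>) \<phi> b) X
      = qconj a *\<^sub>q pairing (triv_spin \<omega>) \<psi> \<phi> X *\<^sub>q b" for a b by (simp add: qconj_mult qmult_assoc)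
    show "qconj (pairing (triv_spin \<omega>) \<psi> \<phi> X) = - pairing (triv_spin \<omega>) \<phi> \<psi> X"
      by (simp add: f qconj_mult qconj_qim qm.minus_left qm.minus_right qmult_assoc)
    assume "X \<noteq> tzero" "\<psi> \<noteq> bzero (triv_spin \<omega>) p"
    moreover have "\<omega> p X \<noteq> 0" if "X \<noteq> tzero" using r(2)[OF X X] r(1)[of p] metric_pos[OF X that] by auto
    moreover have "snd \<psi> \<noteq> 0" if "\<psi> \<noteq> (p, 0)" using that f by (metis prod.collapse)
    ultimately show "pairing (triv_spin \<omega>) \<psi> \<psi> X \<noteq> 0"
      using f by (auto simp: qmult_eq_0_iff)
  next
    fix W s t assume W: "open W" and st: "smooth_section A (triv_spin \<omega>) W s" "smooth_section A (triv_spin \<omega>) W t"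
    show "smooth_form_on A W (\<lambda>p. pairing (triv_spin \<omega>) (s p) (t p))"
      unfolding smooth_form_on_def
    proof (intro ballI allI)
      fix c v assume c: "c \<in> A"
      have op: "open (fst c \<inter> W)" using chart_open[OF c] W by blast
      show "smooth_fun_on A (fst c \<inter> W) (\<lambda>p. pairing (triv_spin \<omega>) (s p) (t p) (cv c v p))"
        unfolding smooth_fun_on_iff[OF op, where t = 0]
      proof
        fix p assume p: "p \<in> fst c \<inter> W"
        have "msmooth A (\<lambda>_ p. qconj (snd (s p)) *\<^sub>q qim (\<omega> p (cv c v p)) *\<^sub>q snd (t p)) 0 p"
          using st p unfolding triv_spin_section_iff smooth_fun_on_iff[OF W, where t = 0]
          by (intro msmooth_qmult msmooth_qconj msmooth_qim form_smoothD[OF \<omega>(1) c]) auto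
        then show "msmooth A (\<lambda>_ p. pairing (triv_spin \<omega>) (s p) (t p) (cv c v p)) 0 p"
          by (rule msmooth_cong[of _ _ _ UNIV "fst c \<inter> W"]) (use op p st in \<open>auto simp: triv_spin_section_iff\<close>)
      qed
    qed
  qed
  have sm: "section_metric (triv_spin \<omega>) s p X Y = (norm (snd (s p)))\<^sup>2 * (norm (snd (s p)))\<^sup>2 * (r p * g p X Y)"
    if "fst (s p) = p" "X \<in> TS p" "Y \<in> TS p" for s p X Y
    by (simp add: section_metric_def that inner_qmult r(2))
  have "induced_conformal_structure A (triv_spin \<omega>) = C"
  proof (intro equalityI subsetI)
    fix g' assume "g' \<in> induced_conformal_structure A (triv_spin \<omega>)"
    then obtain s \<rho> where g': "riemannian_metric A g'" and s: "smooth_section A (triv_spin \<omega>) UNIV s" "\<And>p. s p \<noteq> (p, 0)"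
      and \<rho>: "smooth_fun_on A UNIV \<rho>" "\<And>p. \<rho> p > 0" "\<And>p X Y. X \<in> TS p \<Longrightarrow> Y \<in> TS p \<Longrightarrow> g' p X Y = \<rho> p * section_metric (triv_spin \<omega>) s p X Y"
      unfolding induced_conformal_structure_def conformally_equivalent_def by auto
    have ss: "fst (s p) = p" "msmooth A (\<lambda>_ p. snd (s p)) 0 p" for p
      using s(1) unfolding triv_spin_section_iff smooth_fun_iff by auto
    have nz: "snd (s p) \<noteq> 0" for p using s(2)[of p] ss(1)[of p] by (metis prod.collapse)
    have "conformally_equivalent A g g'"
      unfolding conformally_equivalent_def
    proof (intro exI[of _ "\<lambda>p. \<rho> p * ((norm (snd (s p)))\<^sup>2 * (norm (snd (s p)))\<^sup>2 * r p)"] conjI allI ballI)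
      show "smooth_fun_on A UNIV (\<lambda>p. \<rho> p * ((norm (snd (s p)))\<^sup>2 * (norm (snd (s p)))\<^sup>2 * r p))"
        using \<rho>(1) unfolding smooth_fun_iff power2_eq_square by (auto intro!: msmooth_mult msmooth_norm ss rs nz)
      show "\<rho> p * ((norm (snd (s p)))\<^sup>2 * (norm (snd (s p)))\<^sup>2 * r p) > 0" for p using \<rho>(2) r(1) nz by simp
      show "g' p X Y = \<rho> p * ((norm (snd (s p)))\<^sup>2 * (norm (snd (s p)))\<^sup>2 * r p) * g p X Y" if "X \<in> TS p" "Y \<in> TS p" for p X Y
        using \<rho>(3)[OF that] sm[of s p X Y, OF ss(1) that] by simp
    qed
    then show "g' \<in> C" unfolding C_eq using g' by blast
  next
    fix g' assume "g' \<in> C"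
    then obtain \<rho> where g': "riemannian_metric A g'" and \<rho>: "smooth_fun_on A UNIV \<rho>" "\<And>p. \<rho> p > 0"
      "\<And>p X Y. X \<in> TS p \<Longrightarrow> Y \<in> TS p \<Longrightarrow> g' p X Y = \<rho> p * g p X Y"
      unfolding C_eq conformally_equivalent_def by blast
    have "conformally_equivalent A (section_metric (triv_spin \<omega>) (\<lambda>p. (p, qone))) g'"
      unfolding conformally_equivalent_def
    proof (intro exI[of _ "\<lambda>p. \<rho> p / r p"] conjI allI ballI)
      show "smooth_fun_on A UNIV (\<lambda>p. \<rho> p / r p)"
        using \<rho>(1) r(1) unfolding smooth_fun_iff by (auto intro!: msmooth_divide rs simp: less_imp_neq[symmetric])
      show "\<rho> p / r p > 0" for p using \<rho>(2) r(1) by simp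
      show "g' p X Y = \<rho> p / r p * section_metric (triv_spin \<omega>) (\<lambda>p. (p, qone)) p X Y" if "X \<in> TS p" "Y \<in> TS p" for p X Y
        using \<rho>(3)[OF that] sm[of "\<lambda>p. (p, qone)" p X Y] that r(1)[of p] by simp
    qed
    then show "g' \<in> induced_conformal_structure A (triv_spin \<omega>)"
      unfolding induced_conformal_structure_def using g' triv_spin_section(1,2) by blast
  qed
  then show ?thesis unfolding spin_bundles_def using sp by blast
qed

end

section \<open>Regular homotopy classes and spin bundles\<close>

context conformal_surface begin

lemma immersions_iff: "f \<in> immersions A \<longleftrightarrow> (\<forall>t p. msmooth A (\<lambda>_. f) t p) \<and> (\<forall>p. inj_on (differential f) (TS p))"
  unfolding immersions_def using smooth_fun_on_iff[OF open_UNIV, of f] by auto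

lemma cpart_cong: "(\<And>X. X \<in> TS p \<Longrightarrow> \<alpha> X = \<beta> X) \<Longrightarrow> cpart p \<alpha> = cpart p \<beta>"
  unfolding cpart_def cform_def[abs_def] using frame_tangent[OF chart_at] by simp

lemma inj_on_form_kernel:
  assumes "tangent_linear A p \<alpha>" "\<And>X. X \<in> TS p \<Longrightarrow> \<alpha> X = 0 \<Longrightarrow> X = tzero"
  shows "inj_on \<alpha> (TS p)"
proof (rule inj_onI)
  fix X Y assume XY: "X \<in> TS p" "Y \<in> TS p" "\<alpha> X = \<alpha> Y"
  have "\<alpha> (tcomb 1 X (-1) Y) = 1 *\<^sub>R \<alpha> X + (-1) *\<^sub>R \<alpha> Y" using assms(1) XY unfolding tangent_linear_def by blast
  then have "tcomb 1 X (-1) Y = tzero" using assms(2)[OF tcomb_tangent[OF XY(1,2)]] XY(3) by simp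
  then show "X = Y" by (auto simp: tcomb_def tzero_def fun_eq_iff)
qed

lemma conf_maps_kernel: "\<omega> \<in> conf_maps A C p \<Longrightarrow> X \<in> TS p \<Longrightarrow> \<omega> X = 0 \<Longrightarrow> X = tzero"
proof -
  assume \<omega>: "\<omega> \<in> conf_maps A C p" and X: "X \<in> TS p" "\<omega> X = 0"
  obtain r where "r > 0" "\<forall>X\<in>TS p. \<forall>Y\<in>TS p. \<omega> X \<bullet> \<omega> Y = r * g p X Y" using \<omega> g_in_C unfolding conf_maps_def by blast
  then have "g p X X = 0" using X by force
  then show "X = tzero" using metric_pos[OF X(1)] by force
qed

text \<open>Writing \<open>\<alpha>\<close> as its conformal part after a positive \<open>B\<close>,
  the segment is the conformal part after \<open>(1 - s) B + s\<close>, which is again positive and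
  so has no kernel.\<close>

lemma polar_interpolation_inj:
  assumes \<alpha>: "tangent_linear A p \<alpha>" "inj_on \<alpha> (TS p)" and s: "0 \<le> s" "s \<le> 1"
  shows "inj_on (\<lambda>X. (1 - s) *\<^sub>R \<alpha> X + s *\<^sub>R cpart p \<alpha> X) (TS p)"
proof (rule inj_on_form_kernel)
  note P = polar_cpart[OF \<alpha>]
  let ?B = "bform (chart_at p) p \<alpha>"
  have \<omega>: "cpart p \<alpha> \<in> conf_maps A C p" by (rule cpart_conf[OF \<alpha>])
  then have lin: "tangent_linear A p (cpart p \<alpha>)" unfolding conf_maps_def by blast
  show "tangent_linear A p (\<lambda>X. (1 - s) *\<^sub>R \<alpha> X + s *\<^sub>R cpart p \<alpha> X)"
    by (intro tangent_linear_add tangent_linear_scaleR \<alpha> lin)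
  fix X assume X: "X \<in> TS p" and 0: "(1 - s) *\<^sub>R \<alpha> X + s *\<^sub>R cpart p \<alpha> X = 0"
  have BX: "?B X \<in> TS p" and aX: "\<alpha> X = cpart p \<alpha> (?B X)" and pos: "X \<noteq> tzero \<Longrightarrow> g p (?B X) X > 0"
    using P X g_in_C unfolding polar_def tangent_endo_def by auto
  have "cpart p \<alpha> (tcomb (1 - s) (?B X) s X) = (1 - s) *\<^sub>R cpart p \<alpha> (?B X) + s *\<^sub>R cpart p \<alpha> X"
    using lin BX X unfolding tangent_linear_def by blast
  then have "tcomb (1 - s) (?B X) s X = tzero"
    using conf_maps_kernel[OF \<omega> tcomb_tangent[OF BX X]] 0 aX by simp
  moreover have "g p tzero X = 0" using metric_comb_left[OF X X X, of 0 0] by (simp add: tcomb_def tzero_def)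
  ultimately have "(1 - s) * g p (?B X) X + s * g p X X = 0" using metric_comb_left[OF X BX X, of "1 - s" s] by simp
  moreover have "(1 - s) * g p (?B X) X + s * g p X X > 0" if "X \<noteq> tzero"
  proof (cases "s = 0")
    case False
    then have "s * g p X X > 0" using s metric_pos[OF X that] by simp
    moreover have "(1 - s) * g p (?B X) X \<ge> 0" using s pos[OF that] by simp
    ultimately show ?thesis by linarith
  qed (use pos[OF that] in simp)
  ultimately show "X = tzero" by force
qed

lemma immersion_cpart:
  assumes "f \<in> immersions A"
  shows "form_smooth (\<lambda>_. conformal_part A C f)" "conformal_part A C f p \<in> conf_maps A C p"
    "conformal_part A C f p = cpart p (differential f)"
proof -
  note f = assms[unfolded immersions_iff]
  show e: "conformal_part A C f p = cpart p (differential f)" using conformal_part_eq[OF assms] by simp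
  show "conformal_part A C f p \<in> conf_maps A C p"
    unfolding e by (rule cpart_conf[OF tangent_linear_differential]) (use f in blast)
  show "form_smooth (\<lambda>_. conformal_part A C f)"
    unfolding conformal_part_eq[OF assms]
    by (rule form_smooth_cpart[OF _ tangent_linear_differential]) (use f form_smooth_differential[of "\<lambda>_. f"] in blast)+
qed

lemma regularly_homotopic_imp_speq:
  assumes f: "f \<in> immersions A" "f' \<in> immersions A" and h: "regularly_homotopic A f f'"
  shows "speq (conformal_part A C f) (conformal_part A C f')"
proof -
  obtain F :: "real \<Rightarrow> 'm \<Rightarrow> real^3" where F0: "\<forall>(U, x)\<in>A. smooth_on ({0..1} \<times> x ` U) (\<lambda>(t, y). F t (inv_into U x y))"
    "\<forall>t\<in>{0..1}. F t \<in> immersions A" "F 0 = f" "F 1 = f'"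
    using h unfolding regularly_homotopic_def by blast
  have F: "\<And>c. c \<in> A \<Longrightarrow> smooth_on ({0..1} \<times> snd c ` fst c) (\<lambda>(t, y). F t (cinv c y))"
    "\<And>t. t \<in> {0..1} \<Longrightarrow> F t \<in> immersions A" "F 0 = f" "F 1 = f'"
    using F0 by (auto simp: case_prod_beta)
  have Fs: "smooth_fun_on A UNIV (F t)" if "t \<in> {0..1}" for t using F(2)[OF that] unfolding immersions_def by blast
  have "speq (\<lambda>p. cpart p (differential (F 0))) (\<lambda>p. cpart p (differential (F 1)))"
  proof (rule formal_homotopy_speq[where \<Phi> = "\<lambda>t p. differential (F t)"])
    show "tangent_linear A p (differential (F t))" for t p by (rule tangent_linear_differential)
    show "inj_on (differential (F t)) (TS p)" if "t \<in> {0..1}" for t p using F(2)[OF that] unfolding immersions_def by blast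
    show "form_smooth (\<lambda>_ p. differential (F t))" if "t \<in> {0..1}" for t
      by (rule form_smooth_differential[of "\<lambda>_. F t"]) (use F(2)[OF that] immersions_iff in blast)
    fix c i assume c: "c \<in> A"
    let ?S = "{0..1::real} \<times> snd c ` fst c"
    define D where "D z = differential (F (fst z)) (cv c (axis i 1) (cinv c (snd z)))" for z
    have "continuous (at z within ?S) D" if z: "z \<in> ?S" for z
    proof -
      obtain U k where U: "open U" "z \<in> U" "\<forall>n. Ck_on n k U" "\<forall>y\<in>?S \<inter> U. k y = (case y of (t, y) \<Rightarrow> F t (cinv c y))"
        using F(1)[OF c] z unfolding smooth_on_def by blast
      have ks: "smooth_at k w" if "w \<in> U" for w using U that unfolding smooth_at_def by blast
      \<comment> \<open>\<open>k\<close> is a smooth local extension of \<open>F\<close>, possibly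
        beyond the time interval. At each admissible time it agrees with \<open>F\<close> on an open
        piece of the space slice, so the spatial derivatives agree, also at times 0 and 1.\<close>
      have D: "D w = frechet_derivative k (at w) (0, axis i 1)" if w: "w \<in> ?S \<inter> U" for w
      proof -
        obtain t y where ty: "w = (t, y)" "t \<in> {0..1}" "y \<in> snd c ` fst c" using w by blast
        have "open ((\<lambda>y'. (t, y')) -` U)" by (rule open_vimage[OF U(1)]) (intro continuous_intros)
        then have op: "open (snd c ` fst c \<inter> (\<lambda>y'. (t, y')) -` U)" using chart_image_open[OF c] by blast
        have "D w = frechet_derivative (F t \<circ> cinv c) (at y) (axis i 1)"
          using differential_coord_vector[OF Fs[OF ty(2)] c cinv_in[OF ty(3)]] chart_cinv[OF ty(3)] ty(1) by (simp add: D_def)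
        also have "frechet_derivative (F t \<circ> cinv c) (at y) = frechet_derivative (\<lambda>y. k (t, y)) (at y)"
        proof (rule frechet_derivative_cong_open[OF op])
          show "y \<in> snd c ` fst c \<inter> (\<lambda>y'. (t, y')) -` U" using w ty by auto
          show "(F t \<circ> cinv c) y' = k (t, y')" if "y' \<in> snd c ` fst c \<inter> (\<lambda>y'. (t, y')) -` U" for y'
            using U(4) that ty(2) by auto
        qed
        also have "\<dots> (axis i 1) = frechet_derivative k (at (t, y)) (0, axis i 1)"
          by (rule slice_derivative[OF ks]) (use w ty(1) in auto)
        finally show ?thesis using ty(1) by simp
      qed
      have "isCont (\<lambda>w. frechet_derivative k (at w) (0, axis i 1)) z"
        by (rule smooth_at_isCont[OF smooth_at_frechet_derivative[OF ks[OF U(2)]]])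
      then have "continuous (at z within ?S) (\<lambda>w. frechet_derivative k (at w) (0, axis i 1))"
        by (rule continuous_at_imp_continuous_at_within)
      then show ?thesis
        unfolding continuous_within D[OF IntI[OF z U(2)]]
      proof (rule Lim_transform_eventually)
        show "\<forall>\<^sub>F w in at z within ?S. frechet_derivative k (at w) (0, axis i 1) = D w"
          unfolding eventually_at_topological using D U(1,2) by (intro exI[of _ U]) auto
      qed
    qed
    then show "continuous_on ?S (\<lambda>(t, y). differential (F t) (cv c (axis i 1) (cinv c y)))"
      unfolding continuous_on_eq_continuous_within by (simp add: D_def[abs_def] case_prod_beta')
  qed
  then show ?thesis using immersion_cpart(3)[OF f(1)] immersion_cpart(3)[OF f(2)] F(3,4) by (auto elim: speq_cong)
qed

lemma form_smooth_reparam: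
  assumes "form_smooth \<Phi>" "\<And>t. smooth_at \<phi> t" shows "form_smooth (\<lambda>t. \<Phi> (\<phi> t))"
  using assms unfolding form_smooth_def
  by (auto intro: msmooth_reparam[where F = "\<lambda>t q. \<Phi> t q (cv c v q)" and \<phi> = \<phi> for c v])

lemma smooth_step_scaled: "smooth_at (\<lambda>t. smooth_step (a * t + b)) t"
  by (intro smooth_intros)

theorem conformal_form_realised:
  assumes \<omega>: "form_smooth (\<lambda>_. \<omega>)" "\<And>p. \<omega> p \<in> conf_maps A C p"
  obtains f where "f \<in> immersions A" "speq \<omega> (conformal_part A C f)"
proof -
  have lin: "tangent_linear A p (\<omega> p)" and inj: "inj_on (\<omega> p) (TS p)" for p using \<omega>(2) unfolding conf_maps_def by auto
  \<comment> \<open>A bump in time that rises on \<open>[1/8, 3/8]\<close> and falls on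
    \<open>[5/8, 7/8]\<close>. At time 1/2 all of \<open>\<omega>\<close> has been removed and the
    injective form that remains is the differential of \<open>G (1/2)\<close>; at time 0 it is still
    \<open>\<omega>\<close>. The first half of the path therefore links the two.\<close>
  define b where "b t = smooth_step (4 * t + (- 1/2)) * smooth_step ((- 4) * t + 7/2)" for t
  have bs: "smooth_at b t" for t unfolding b_def by (intro smooth_at_mult smooth_step_scaled)
  have b0: "b t = 0" if "t \<notin> {1/8..1 - 1/8}" for t using that by (auto simp: b_def smooth_step_0)
  have b1: "b (1/2) = 1" by (simp add: b_def smooth_step_1)
  have \<alpha>s: "form_smooth (\<lambda>t p X. b t *\<^sub>R \<omega> p X)" by (intro form_smooth_scaleR msmooth_time bs \<omega>(1))
  have \<alpha>l: "tangent_linear A p (\<lambda>X. b t *\<^sub>R \<omega> p X)" for t p by (intro tangent_linear_scaleR lin)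
  obtain G where G: "\<And>t p. msmooth A G t p" "\<And>t p. t \<notin> {0<..<1} \<Longrightarrow> G t p = 0"
    "\<And>t p. inj_on (\<lambda>X. \<omega> p X - b t *\<^sub>R \<omega> p X + differential (G t) X) (TS p)"
    by (rule h_principle[where \<Phi> = "\<lambda>_. \<omega>" and \<alpha> = "\<lambda>t p X. b t *\<^sub>R \<omega> p X" and \<delta> = "1/8", OF \<omega>(1) lin inj \<alpha>s \<alpha>l])
      (use b0 in auto)
  define \<Xi> where "\<Xi> t p X = \<omega> p X - b t *\<^sub>R \<omega> p X + differential (G t) X" for t p X
  have \<Xi>l: "tangent_linear A p (\<Xi> t p)" for t p
    unfolding \<Xi>_def[abs_def] by (intro tangent_linear_add tangent_linear_diff lin \<alpha>l tangent_linear_differential)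
  have \<Xi>s: "form_smooth \<Xi>"
    unfolding \<Xi>_def[abs_def] by (intro form_smooth_add form_smooth_diff \<omega>(1) \<alpha>s form_smooth_differential G(1))
  have \<Xi>i: "inj_on (\<Xi> t p) (TS p)" for t p unfolding \<Xi>_def[abs_def] by (rule G(3))
  have half: "form_smooth (\<lambda>t. \<Xi> (t * (1/2)))"
    by (rule form_smooth_reparam[OF \<Xi>s]) (intro smooth_intros)
  have sp: "speq (\<lambda>p. cpart p (\<Xi> (0 * (1/2)) p)) (\<lambda>p. cpart p (\<Xi> (1 * (1/2)) p))"
    by (rule formal_homotopy_speq[where \<Phi> = "\<lambda>t. \<Xi> (t * (1/2))"])
      (use \<Xi>l \<Xi>i form_smooth_slice[OF \<Xi>s] form_smooth_continuous[OF half] in auto)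
  define f where "f = G (1/2)"
  have \<Xi>f: "\<Xi> (1 * (1/2)) p = differential f" for p by (simp add: \<Xi>_def[abs_def] b1 f_def)
  have f: "f \<in> immersions A"
    unfolding immersions_iff
  proof (intro conjI allI)
    show "msmooth A (\<lambda>_. f) t p" for t p unfolding f_def by (rule msmooth_slice[OF G(1)])
    show "inj_on (differential f) (TS p)" for p using \<Xi>i[of "1 * (1/2)" p] unfolding \<Xi>f .
  qed
  have "\<Xi> (0 * (1/2)) p X = \<omega> p X" if X: "X \<in> TS p" for p X
  proof -
    have z: "smooth_fun_on A UNIV (\<lambda>_. 0::real^3)" unfolding smooth_fun_iff by (intro allI msmooth_const)
    have "G 0 = (\<lambda>_. 0)" using G(2) by auto
    then have "differential (G 0) X = 0" using differential_comb[OF X z z, of 0 0] by simp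
    then show ?thesis using b0[of 0] by (simp add: \<Xi>_def)
  qed
  then have \<Xi>0: "cpart p (\<Xi> (0 * (1/2)) p) X = \<omega> p X" if "X \<in> TS p" for p X
    using cpart_cong[of p "\<Xi> (0 * (1/2)) p" "\<omega> p"] cpart_conformal[OF \<omega>(2) that] by simp
  have "speq \<omega> (conformal_part A C f)"
    by (rule speq_cong[OF sp]) (simp_all only: \<Xi>0 \<Xi>f immersion_cpart(3)[OF f])
  then show ?thesis using that f by blast
qed

text \<open>The cone over the image is covered by countably many smooth images of three-dimensional
  sets in four-space.\<close>

lemma negligible_ray_image:
  fixes \<mu> :: "'m \<Rightarrow> quat"
  assumes "\<And>p. msmooth A (\<lambda>_. \<mu>) 0 p"
  shows "negligible {r *\<^sub>R \<mu> p |r p. True}"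
proof -
  obtain c :: "nat \<Rightarrow> 'm chart" and K where c: "\<And>j. c j \<in> A" "\<And>j. K j \<subseteq> fst (c j)" and cover: "\<And>p. \<exists>j. p \<in> interior (K j)"
    by (rule countable_compact_chart_cover) (rule that; assumption)
  define h where "h j z = fst z *\<^sub>R \<mu> (cinv (c j) (snd z))" for j and z :: "real \<times> (real^2)"
  let ?S = "\<lambda>j. UNIV \<times> snd (c j) ` fst (c j) :: (real \<times> (real^2)) set"
  have "negligible (h j ` ?S j)" for j
  proof (rule negligible_differentiable_image_lowdim)
    show "DIM(real \<times> (real^2)) < DIM(quat)" by simp
    show "h j differentiable_on ?S j"
    proof (rule differentiable_at_imp_differentiable_on)
      fix z assume "z \<in> ?S j"
      then obtain p where p: "p \<in> fst (c j)" "snd z = snd (c j) p" by auto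
      have "smooth_at (\<lambda>y. \<mu> (cinv (c j) y)) (snd z)"
        using assms[of p] msmooth_slice_iff[OF c(1) p(1), of \<mu> 0] p(2) by (simp add: o_def)
      then have "smooth_at (h j) z" unfolding h_def
        by (intro smooth_at_scaleR smooth_at_fst smooth_at_id smooth_at_compose_snd)
      then show "h j differentiable (at z)" by (rule smooth_at_differentiable)
    qed
  qed
  then have "negligible (\<Union>j. h j ` ?S j)" by (intro negligible_countable_Union) auto
  then show ?thesis
  proof (rule negligible_subset)
    show "{r *\<^sub>R \<mu> p |r p. True} \<subseteq> (\<Union>j. h j ` ?S j)"
    proof
      fix x assume "x \<in> {r *\<^sub>R \<mu> p |r p. True}"
      then obtain r p where x: "x = r *\<^sub>R \<mu> p" by blast
      obtain j where "p \<in> interior (K j)" using cover by blast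
      then have p: "p \<in> fst (c j)" using interior_subset c(2) by blast
      then have "r *\<^sub>R \<mu> p = h j (r, snd (c j) p)" by (simp add: h_def cinv_chart[OF c(1)])
      then show "x \<in> (\<Union>j. h j ` ?S j)" using p x by blast
    qed
  qed
qed

text \<open>Missing all real multiples of the values of \<open>\<mu>\<close> keeps the segments from
  \<open>\<mu> p\<close> to \<open>q\<close> away from 0. Being off the real axis does the same for
  the segment from \<open>q\<close> to 1, which is why the axis is removed as well.\<close>

lemma avoided_direction:
  fixes \<mu> :: "'m \<Rightarrow> quat"
  assumes "\<And>p. msmooth A (\<lambda>_. \<mu>) 0 p"
  obtains q where "q \<noteq> 0" "\<And>r p. q \<noteq> r *\<^sub>R \<mu> p" "\<And>r. q \<noteq> r *\<^sub>R qone"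
proof -
  have "negligible (range (\<lambda>r. r *\<^sub>R qone))"
    by (rule negligible_differentiable_image_lowdim) (auto intro!: derivative_intros)
  then have "negligible ({r *\<^sub>R \<mu> p |r p. True} \<union> range (\<lambda>r. r *\<^sub>R qone))"
    using negligible_ray_image[OF assms] by (intro negligible_Un)
  then have "{r *\<^sub>R \<mu> p |r p. True} \<union> range (\<lambda>r. r *\<^sub>R qone) \<noteq> UNIV" using non_negligible_UNIV by metis
  then obtain q where q: "q \<notin> {r *\<^sub>R \<mu> p |r p. True}" "q \<notin> range (\<lambda>r. r *\<^sub>R qone)" by blast
  have 2: "q \<noteq> r *\<^sub>R qone" for r using q(2) by blast
  show ?thesis by (rule that[of q]) (use q(1) 2[of 0] 2 in auto)
qed

theorem speq_imp_regularly_homotopic: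
  assumes f: "f \<in> immersions A" "f' \<in> immersions A" and sp: "speq (conformal_part A C f) (conformal_part A C f')"
  shows "regularly_homotopic A f f'"
proof -
  define \<omega> \<omega>' where "\<omega> = conformal_part A C f" and "\<omega>' = conformal_part A C f'"
  obtain \<mu> where \<mu>s: "smooth_fun_on A UNIV \<mu>" and \<mu>0: "\<And>p. \<mu> p \<noteq> 0"
    and \<mu>: "\<And>p X. X \<in> TS p \<Longrightarrow> qim (\<omega> p X) = qconj (\<mu> p) *\<^sub>q qim (\<omega>' p X) *\<^sub>q \<mu> p"
    using sp unfolding speq_def \<omega>_def \<omega>'_def by blast
  have \<mu>m: "msmooth A (\<lambda>_. \<mu>) t p" for t p using \<mu>s smooth_fun_on_iff[OF open_UNIV, of \<mu> t] by blast
  obtain q where q: "q \<noteq> 0" "\<And>r p. q \<noteq> r *\<^sub>R \<mu> p" "\<And>r. q \<noteq> r *\<^sub>R qone"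
    by (rule avoided_direction[OF \<mu>m]) (assumption | rule that)+
  have \<omega>: "form_smooth (\<lambda>_. \<omega>)" "\<And>p. \<omega> p \<in> conf_maps A C p" "\<And>p. \<omega> p = cpart p (differential f)"
    and \<omega>': "form_smooth (\<lambda>_. \<omega>')" "\<And>p. \<omega>' p \<in> conf_maps A C p" "\<And>p. \<omega>' p = cpart p (differential f')"
    unfolding \<omega>_def \<omega>'_def by (intro immersion_cpart f)+
  have fm: "msmooth A (\<lambda>_. f) t p" "msmooth A (\<lambda>_. f') t p" and fi: "inj_on (differential f) (TS p)" "inj_on (differential f') (TS p)" for t p
    using f unfolding immersions_iff by blast+
  have df: "form_smooth (\<lambda>_ _. differential f)" "form_smooth (\<lambda>_ _. differential f')"
    using form_smooth_differential[of "\<lambda>_. f"] form_smooth_differential[of "\<lambda>_. f'"] fm by blast+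
  have lin': "tangent_linear A p (\<omega>' p)" and inj': "inj_on (\<omega>' p) (TS p)" for p using \<omega>'(2) unfolding conf_maps_def by auto
  \<comment> \<open>\<open>\<sigma> k\<close> rises on the interval from \<open>k/6\<close> to
    \<open>(k+1)/6\<close>. In turn, \<open>\<sigma> 1\<close> leads from \<open>df\<close> to its
    conformal part, \<open>\<sigma> 2\<close> from \<open>\<mu>\<close> to \<open>q\<close>,
    \<open>\<sigma> 3\<close> from \<open>q\<close> to 1, and \<open>\<sigma> 4\<close> from the
    conformal part of \<open>f'\<close> to \<open>df'\<close>. The first and last sixth stay
    constant, as the end conditions of \<open>h_principle\<close> require.\<close>
  define \<sigma> where "\<sigma> k t = smooth_step (6 * t + (- real k))" for k :: nat and t
  have \<sigma>s: "smooth_at (\<sigma> k) t" for k t unfolding \<sigma>_def by (rule smooth_step_scaled)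
  have \<sigma>m: "msmooth A (\<lambda>t p. \<sigma> k t) t p" for k t p by (rule msmooth_time[OF \<sigma>s])
  have \<sigma>0: "\<sigma> k t = 0" if "t \<le> real k / 6" for k t using that by (simp add: \<sigma>_def smooth_step_0)
  have \<sigma>1: "\<sigma> k t = 1" if "t \<ge> (real k + 1) / 6" for k t using that by (simp add: \<sigma>_def smooth_step_1)
  have \<sigma>b: "0 \<le> \<sigma> k t" "\<sigma> k t \<le> 1" for k t by (simp_all add: \<sigma>_def smooth_step_nonneg smooth_step_le_1)
  have seg: "(1 - s) *\<^sub>R x + s *\<^sub>R y \<noteq> 0" if s: "0 \<le> s" "s \<le> 1" and x: "x \<noteq> 0" "\<And>r. y \<noteq> r *\<^sub>R x" for s and x y :: quat
  proof
    assume 0: "(1 - s) *\<^sub>R x + s *\<^sub>R y = 0"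
    show False
    proof (cases "s = 0")
      case False
      have "s *\<^sub>R y = (s - 1) *\<^sub>R x" using 0 by (simp add: algebra_simps eq_neg_iff_add_eq_0)
      then have "inverse s *\<^sub>R (s *\<^sub>R y) = (inverse s * (s - 1)) *\<^sub>R x" by simp
      then have "y = (inverse s * (s - 1)) *\<^sub>R x" using False by simp
      then show False using x(2) by blast
    qed (use 0 x(1) in simp)
  qed
  define \<nu> where "\<nu> t p = (1 - \<sigma> 3 t) *\<^sub>R ((1 - \<sigma> 2 t) *\<^sub>R \<mu> p + \<sigma> 2 t *\<^sub>R q) + \<sigma> 3 t *\<^sub>R qone" for t p
  have \<nu>0: "\<nu> t p \<noteq> 0" for t p
  proof (cases "t \<le> 3/6")
    case True
    then have "\<nu> t p = (1 - \<sigma> 2 t) *\<^sub>R \<mu> p + \<sigma> 2 t *\<^sub>R q" using \<sigma>0[of t 3] by (simp add: \<nu>_def)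
    then show ?thesis using seg[OF \<sigma>b \<mu>0 q(2)] by simp
  next
    case False
    then have e: "\<nu> t p = (1 - \<sigma> 3 t) *\<^sub>R q + \<sigma> 3 t *\<^sub>R qone" using \<sigma>1[of 2 t] by (simp add: \<nu>_def)
    have "qone \<noteq> r *\<^sub>R q" for r
    proof
      assume r: "qone = r *\<^sub>R q"
      then have "r \<noteq> 0" by (metis norm_qone norm_zero scaleR_zero_left zero_neq_one)
      then have "inverse r *\<^sub>R qone = q" unfolding r by simp
      then show False using q(3) by metis
    qed
    then show ?thesis unfolding e by (intro seg \<sigma>b q(1))
  qed
  have \<nu>m: "msmooth A \<nu> t p" for t p
    unfolding \<nu>_def by (intro msmooth_add msmooth_scaleR msmooth_diff msmooth_const \<sigma>m \<mu>m)
  define M where "M t p X = snd (qconj (\<nu> t p) *\<^sub>q qim (\<omega>' p X) *\<^sub>q \<nu> t p)" for t p X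
  have qM: "qim (M t p X) = qconj (\<nu> t p) *\<^sub>q qim (\<omega>' p X) *\<^sub>q \<nu> t p" for t p X
    unfolding M_def by (rule sandwich_imaginary)
  have Ml: "tangent_linear A p (M t p)" for t p
    unfolding M_def[abs_def]
    by (rule tangent_linear_linear[OF _ lin']) (simp add: linear_iff qm.add_left qm.add_right qm.scaleR_left qm.scaleR_right)
  have Ms: "form_smooth M"
    unfolding form_smooth_def M_def
    by (intro allI ballI impI msmooth_linear[OF bounded_linear_snd] msmooth_qmult msmooth_qconj msmooth_qim \<nu>m form_smoothD[OF \<omega>'(1)])
  have Mi: "inj_on (M t p) (TS p)" for t p
  proof (rule inj_on_form_kernel[OF Ml])
    fix X assume X: "X \<in> TS p" "M t p X = 0"
    then have "qconj (\<nu> t p) *\<^sub>q qim (\<omega>' p X) *\<^sub>q \<nu> t p = 0" using qM[of t p X] by simp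
    then have "\<omega>' p X = 0" using \<nu>0 by (simp add: qmult_eq_0_iff)
    then show "X = tzero" using conf_maps_kernel[OF \<omega>'(2) X(1)] by blast
  qed
  have M1: "M t p X = \<omega> p X" if "t \<le> 2/6" "X \<in> TS p" for t p X
  proof -
    have "\<nu> t p = \<mu> p" using \<sigma>0[of t 2] \<sigma>0[of t 3] that(1) by (simp add: \<nu>_def)
    then have "qim (M t p X) = qim (\<omega> p X)" using qM \<mu>[OF that(2)] by simp
    then show ?thesis by simp
  qed
  have M2: "M t p X = \<omega>' p X" if "t \<ge> 4/6" for t p X
  proof -
    have "\<nu> t p = qone" using \<sigma>1[of 3 t] that by (simp add: \<nu>_def)
    then have "qim (M t p X) = qim (\<omega>' p X)" using qM[of t p X] by simp
    then show ?thesis by simp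
  qed
  define \<Phi> where "\<Phi> t p X = (1 - \<sigma> 1 t) *\<^sub>R differential f X + \<sigma> 1 t *\<^sub>R ((1 - \<sigma> 4 t) *\<^sub>R M t p X + \<sigma> 4 t *\<^sub>R differential f' X)" for t p X
  have \<Phi>l: "tangent_linear A p (\<Phi> t p)" for t p
    unfolding \<Phi>_def[abs_def] by (intro tangent_linear_add tangent_linear_scaleR tangent_linear_differential Ml)
  have \<Phi>s: "form_smooth \<Phi>"
    unfolding \<Phi>_def by (intro form_smooth_add form_smooth_scaleR msmooth_diff msmooth_const \<sigma>m df Ms)
  have \<Phi>i: "inj_on (\<Phi> t p) (TS p)" for t p
  proof -
    consider "t \<le> 2/6" | "2/6 \<le> t" "t \<le> 4/6" | "4/6 \<le> t" by linarith
    then show ?thesis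
    proof cases
      case 1
      have "\<Phi> t p X = (1 - \<sigma> 1 t) *\<^sub>R differential f X + \<sigma> 1 t *\<^sub>R cpart p (differential f) X" if "X \<in> TS p" for X
        using \<sigma>0[of t 4] 1 M1[OF 1 that] by (simp add: \<Phi>_def \<omega>(3))
      then show ?thesis
        using polar_interpolation_inj[OF tangent_linear_differential fi(1) \<sigma>b] by (simp add: inj_on_def)
    next
      case 2
      then have "\<Phi> t p X = M t p X" for X using \<sigma>1[of 1 t] \<sigma>0[of t 4] by (simp add: \<Phi>_def)
      then show ?thesis using Mi[of t p] by (simp add: inj_on_def)
    next
      case 3
      have "\<Phi> t p X = (1 - (1 - \<sigma> 4 t)) *\<^sub>R differential f' X + (1 - \<sigma> 4 t) *\<^sub>R cpart p (differential f') X" for X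
        using \<sigma>1[of 1 t] 3 M2[OF 3] by (simp add: \<Phi>_def \<omega>'(3))
      then show ?thesis
        using polar_interpolation_inj[OF tangent_linear_differential fi(2), of "1 - \<sigma> 4 t"] \<sigma>b[of 4 t] by (simp add: inj_on_def)
    qed
  qed
  \<comment> \<open>A path of maps that need not be immersions. With \<open>\<alpha>\<close> the
    difference between the formal path and its differential, \<open>\<Phi> - \<alpha>\<close> is the
    differential of \<open>ft t\<close>, so the h-principle makes \<open>ft + G\<close> a path of
    immersions. In the first and last sixth of the time interval both are equal to \<open>df\<close>
    or to \<open>df'\<close>, so \<open>\<alpha>\<close> vanishes there.\<close>
  define ft where "ft t p = (1 - \<sigma> 2 t) *\<^sub>R f p + \<sigma> 2 t *\<^sub>R f' p" for t p
  have ftm: "msmooth A ft t p" for t p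
    unfolding ft_def by (intro msmooth_add msmooth_scaleR msmooth_diff msmooth_const \<sigma>m fm)
  define \<alpha> where "\<alpha> t p X = \<Phi> t p X - differential (ft t) X" for t p X
  have \<alpha>s: "form_smooth \<alpha>" unfolding \<alpha>_def by (intro form_smooth_diff \<Phi>s form_smooth_differential ftm)
  have \<alpha>l: "tangent_linear A p (\<alpha> t p)" for t p
    unfolding \<alpha>_def[abs_def] by (intro tangent_linear_diff \<Phi>l tangent_linear_differential)
  have ft0: "ft t = f" if "t \<le> 2/6" for t using \<sigma>0[of t 2] that by (auto simp: ft_def)
  have ft1: "ft t = f'" if "t \<ge> 3/6" for t using \<sigma>1[of 2 t] that by (auto simp: ft_def)
  have \<alpha>0: "\<alpha> t p X = 0" if "X \<in> TS p" "t \<notin> {1/6..1 - 1/6}" for t p X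
  proof (cases "t \<le> 1/6")
    case True
    then show ?thesis using \<sigma>0[of t 1] ft0[of t] by (simp add: \<alpha>_def \<Phi>_def)
  next
    case False
    then have t: "t \<ge> 5/6" using that(2) by auto
    then show ?thesis using \<sigma>1[of 1 t] \<sigma>1[of 4 t] ft1[of t] by (simp add: \<alpha>_def \<Phi>_def)
  qed
  obtain G where G: "\<And>t p. msmooth A G t p" "\<And>t p. t \<notin> {0<..<1} \<Longrightarrow> G t p = 0"
    "\<And>t p. inj_on (\<lambda>X. \<Phi> t p X - \<alpha> t p X + differential (G t) X) (TS p)"
    by (rule h_principle[where \<Phi> = \<Phi> and \<alpha> = \<alpha> and \<delta> = "1/6", OF \<Phi>s \<Phi>l \<Phi>i \<alpha>s \<alpha>l _ \<alpha>0]) auto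
  define F where "F t p = ft t p + G t p" for t p
  have Fm: "msmooth A F t p" for t p unfolding F_def by (intro msmooth_add ftm G(1))
  have "F t \<in> immersions A" for t
    unfolding immersions_iff
  proof (intro conjI allI)
    show "msmooth A (\<lambda>_. F t) s p" for s p by (rule msmooth_slice[OF Fm])
    fix p
    have "differential (F t) X = \<Phi> t p X - \<alpha> t p X + differential (G t) X" if "X \<in> TS p" for X
      using differential_add[OF that msmooth_imp_smooth_fun[OF ftm] msmooth_imp_smooth_fun[OF G(1)], of t t]
      by (simp add: F_def[abs_def] \<alpha>_def)
    then show "inj_on (differential (F t)) (TS p)" using G(3)[of t p] by (simp add: inj_on_def)
  qed
  moreover have "F 0 = f" "F 1 = f'" using ft0[of 0] ft1[of 1] G(2) by (auto simp: F_def)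
  moreover have "smooth_on ({0..1} \<times> x ` U) (\<lambda>(t, y). F t (inv_into U x y))" if "(U, x) \<in> A" for U x
    by (rule smooth_on_of_msmooth[OF Fm that])
  ultimately show ?thesis unfolding regularly_homotopic_def by (intro exI[of _ F]) auto
qed

section \<open>Passage to classes\<close>

lemma induced_spin_bundle_in: "f \<in> immersions A \<Longrightarrow> induced_spin_bundle A C f \<in> spin_bundles A C"
  unfolding induced_spin_bundle_eq by (intro triv_spin_in_spin_bundles immersion_cpart)

lemma spin_isomorphic_speq:
  assumes "L \<in> spin_bundles A C" "L' \<in> spin_bundles A C" "smooth_section A L UNIV s" "\<And>p. s p \<noteq> bzero L p"
    "smooth_section A L' UNIV s'" "\<And>p. s' p \<noteq> bzero L' p"
  shows "spin_isomorphic A L L' \<longleftrightarrow> speq (section_form L s) (section_form L' s')"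
  using spin_isomorphic_iff_speq[of L s L' s'] assms unfolding spin_bundles_def by blast

text \<open>Choosing a section for every bundle turns isomorphism into \<open>speq\<close>, so
  inverses and composites of bundle maps need not be formed.\<close>

lemma spin_iso_rel_equiv: "equiv (spin_bundles A C) (spin_iso_rel A C :: (('m, 'e) spin \<times> ('m, 'e) spin) set)"
proof (rule equivI)
  have "\<forall>L :: ('m, 'e) spin. \<exists>s. L \<in> spin_bundles A C \<longrightarrow> smooth_section A L UNIV s \<and> (\<forall>p. s p \<noteq> bzero L p)"
    using spin_bundle_section by metis
  from choice[OF this] obtain s :: "('m, 'e) spin \<Rightarrow> 'm \<Rightarrow> 'e" where s: "\<And>L. L \<in> spin_bundles A C \<Longrightarrow> smooth_section A L UNIV (s L)"
    "\<And>L p. L \<in> spin_bundles A C \<Longrightarrow> s L p \<noteq> bzero L p" by blast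
  have iff: "spin_isomorphic A L L' \<longleftrightarrow> speq (section_form L (s L)) (section_form L' (s L'))"
    if "L \<in> spin_bundles A C" "L' \<in> spin_bundles A C" for L L' :: "('m, 'e) spin"
    by (rule spin_isomorphic_speq[OF that]) (use s that in auto)
  show "spin_iso_rel A C \<subseteq> spin_bundles A C \<times> (spin_bundles A C :: ('m, 'e) spin set)" unfolding spin_iso_rel_def by auto
  show "refl_on (spin_bundles A C) (spin_iso_rel A C :: (('m, 'e) spin \<times> ('m, 'e) spin) set)"
    unfolding refl_on_def spin_iso_rel_def using iff speq_refl by auto
  show "sym (spin_iso_rel A C :: (('m, 'e) spin \<times> ('m, 'e) spin) set)"
    unfolding sym_def spin_iso_rel_def using iff speq_sym by blast
  show "trans (spin_iso_rel A C :: (('m, 'e) spin \<times> ('m, 'e) spin) set)"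
    unfolding trans_def spin_iso_rel_def using iff speq_trans by blast
qed

theorem induced_isomorphic_iff:
  assumes "f \<in> immersions A" "f' \<in> immersions A"
  shows "spin_isomorphic A (induced_spin_bundle A C f) (induced_spin_bundle A C f') \<longleftrightarrow> regularly_homotopic A f f'"
proof -
  have "spin_isomorphic A (induced_spin_bundle A C f) (induced_spin_bundle A C f')
      \<longleftrightarrow> speq (conformal_part A C f) (conformal_part A C f')"
    using spin_isomorphic_speq[OF induced_spin_bundle_in[OF assms(1)] induced_spin_bundle_in[OF assms(2)],
        of "\<lambda>p. (p, qone)" "\<lambda>p. (p, qone)"] triv_spin_section
    unfolding induced_spin_bundle_eq by simp
  then show ?thesis using regularly_homotopic_imp_speq speq_imp_regularly_homotopic assms by blast
qed

theorem spin_bundle_realised: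
  fixes L :: "('m, 'e) spin"
  assumes "L \<in> spin_bundles A C"
  shows "\<exists>f\<in>immersions A. spin_isomorphic A L (induced_spin_bundle A C f)"
proof -
  obtain s where s: "smooth_section A L UNIV s" "\<And>p. s p \<noteq> bzero L p" "form_smooth (\<lambda>_. section_form L s)"
    "\<And>p. section_form L s p \<in> conf_maps A C p" by (rule spin_bundle_section[OF assms]) (rule that; assumption)
  obtain f where f: "f \<in> immersions A" "speq (section_form L s) (conformal_part A C f)"
    by (rule conformal_form_realised[OF s(3,4)])
  have "spin_isomorphic A L (induced_spin_bundle A C f)"
    using spin_isomorphic_speq[OF assms induced_spin_bundle_in[OF f(1)] s(1,2), of "\<lambda>p. (p, qone)"] triv_spin_section f(2)
    unfolding induced_spin_bundle_eq by simp
  then show ?thesis using f(1) by blast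
qed

text \<open>That regular homotopy is an equivalence relation is transported from bundle isomorphism
  through \<open>induced_isomorphic_iff\<close>; this spares the smooth concatenation of
  homotopies.\<close>

theorem induced_bijection:
  "\<exists>\<Theta>. bij_betw \<Theta> (immersions A // reg_homotopy_rel A) ((spin_bundles A C :: ('m, 'm \<times> quat) spin set) // spin_iso_rel A C) \<and>
     (\<forall>f\<in>immersions A. \<Theta> (reg_homotopy_rel A `` {f}) = spin_iso_rel A C `` {induced_spin_bundle A C f})"
proof -
  let ?R = "reg_homotopy_rel A" and ?S = "spin_iso_rel A C :: (('m, 'm \<times> quat) spin \<times> ('m, 'm \<times> quat) spin) set"
  note S = spin_iso_rel_equiv[where 'e = "'m \<times> quat"]
  have RS: "(f, f') \<in> ?R \<longleftrightarrow> (induced_spin_bundle A C f, induced_spin_bundle A C f') \<in> ?S"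
    if "f \<in> immersions A" "f' \<in> immersions A" for f f'
    using induced_isomorphic_iff[OF that] that induced_spin_bundle_in unfolding reg_homotopy_rel_def spin_iso_rel_def by auto
  have "equiv (immersions A) ?R"
  proof (rule equivI)
    show sub: "?R \<subseteq> immersions A \<times> immersions A" unfolding reg_homotopy_rel_def by auto
    show "refl_on (immersions A) ?R"
      unfolding refl_on_def using RS S induced_spin_bundle_in sub by (meson equivE refl_onD)
    show "sym ?R"
    proof (rule symI)
      fix f f' assume ff: "(f, f') \<in> ?R"
      then have "f \<in> immersions A" "f' \<in> immersions A" using sub by auto
      then show "(f', f) \<in> ?R" using ff RS S by (meson equivE symD)
    qed
    show "trans ?R"
    proof (rule transI)
      fix f f' f'' assume ff: "(f, f') \<in> ?R" "(f', f'') \<in> ?R"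
      then have "f \<in> immersions A" "f' \<in> immersions A" "f'' \<in> immersions A" using sub by auto
      then show "(f, f'') \<in> ?R" using ff RS S by (meson equivE transD)
    qed
  qed
  note R = this
  have cls: "?R `` {f} = ?R `` {f'} \<longleftrightarrow> ?S `` {induced_spin_bundle A C f} = ?S `` {induced_spin_bundle A C f'}"
    if "f \<in> immersions A" "f' \<in> immersions A" for f f'
    using eq_equiv_class_iff[OF R that] RS[OF that]
      eq_equiv_class_iff[OF S induced_spin_bundle_in[OF that(1)] induced_spin_bundle_in[OF that(2)]] by simp
  define \<Theta> where "\<Theta> K = ?S `` {induced_spin_bundle A C (SOME f. f \<in> immersions A \<and> K = ?R `` {f})}" for K
  have \<Theta>: "\<Theta> (?R `` {f}) = ?S `` {induced_spin_bundle A C f}" if f: "f \<in> immersions A" for f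
  proof -
    let ?f = "SOME f'. f' \<in> immersions A \<and> ?R `` {f} = ?R `` {f'}"
    have "?f \<in> immersions A \<and> ?R `` {f} = ?R `` {?f}" by (rule someI[of _ f]) (use f in simp)
    then show ?thesis unfolding \<Theta>_def using cls[OF f, of ?f] by simp
  qed
  have "bij_betw \<Theta> (immersions A // ?R) (spin_bundles A C // ?S)"
  proof (rule bij_betw_imageI)
    show "inj_on \<Theta> (immersions A // ?R)"
    proof (rule inj_onI)
      fix K K' assume K: "K \<in> immersions A // ?R" "K' \<in> immersions A // ?R" "\<Theta> K = \<Theta> K'"
      obtain f f' where "f \<in> immersions A" "K = ?R `` {f}" "f' \<in> immersions A" "K' = ?R `` {f'}"
        using K(1,2) by (metis quotientE)
      then show "K = K'" using K(3) \<Theta> cls by metis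
    qed
    show "\<Theta> ` (immersions A // ?R) = spin_bundles A C // ?S"
    proof (intro equalityI subsetI)
      fix K assume "K \<in> \<Theta> ` (immersions A // ?R)"
      then show "K \<in> spin_bundles A C // ?S" by (auto elim!: quotientE simp: \<Theta> intro!: quotientI induced_spin_bundle_in)
    next
      fix K assume "K \<in> spin_bundles A C // ?S"
      then obtain L where L: "L \<in> spin_bundles A C" "K = ?S `` {L}" by (auto elim: quotientE)
      obtain f where f: "f \<in> immersions A" "spin_isomorphic A L (induced_spin_bundle A C f)" using spin_bundle_realised[OF L(1)] by blast
      then have "(L, induced_spin_bundle A C f) \<in> ?S" unfolding spin_iso_rel_def using L(1) induced_spin_bundle_in by auto
      then have "K = ?S `` {induced_spin_bundle A C f}" using equiv_class_eq[OF S] L(2) by blast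
      then show "K \<in> \<Theta> ` (immersions A // ?R)" using \<Theta>[OF f(1)] quotientI[OF f(1), of ?R] by (metis imageI)
    qed
  qed
  then show ?thesis using \<Theta> by blast
qed

end

text \<open>Isomorphism classes need a common type of total spaces, so the bijection is stated for
  the carrier \<open>'m \<times> quat\<close>. The second conjunct shows that bundles over any other
  carrier type are isomorphic to induced ones and contribute no further classes.\<close>

theorem theorem1:
  fixes A :: "('m::{t2_space, second_countable_topology}) chart set"
    and C :: "'m metric set"
  assumes "smooth_atlas A" and "conformal_structure A C"
  shows "(\<exists>\<Theta>. bij_betw \<Theta> (immersions A // reg_homotopy_rel A)
                ((spin_bundles A C :: ('m, 'm \<times> quat) spin set) // spin_iso_rel A C) \<and>
              (\<forall>f\<in>immersions A.
                 \<Theta> (reg_homotopy_rel A `` {f}) = spin_iso_rel A C `` {induced_spin_bundle A C f})) \<and>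
         (\<forall>L \<in> (spin_bundles A C :: ('m, 'e) spin set).
            \<exists>f\<in>immersions A. spin_isomorphic A L (induced_spin_bundle A C f))"
proof -
  obtain g where g: "riemannian_metric A g" "C = {g'. riemannian_metric A g' \<and> conformally_equivalent A g g'}"
    using assms(2) unfolding conformal_structure_def by blast
  interpret conformal_surface A g C by unfold_locales (use assms(1) g in auto)
  show ?thesis using induced_bijection spin_bundle_realised by blast
qed

end
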